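(* Let $(A,b)\in\mathcal B$ (setting $\mathcal B$), let $\gamma:=\frac{\mathrm{tr}(A)}{|A|^2+|b|^2}$, $\tilde A:=\gamma A$, $\tilde b:=\gamma b$, and let $B_1:H^2_{\mathrm{per},0}(Y)\times H^2_{\mathrm{per},0}(Y)\to\mathbb{R}$ be the bilinear form $$B_1(\varphi_1,\varphi_2):=\int_Y\Delta\varphi_1\left(\tilde A:D^2\varphi_2+\tilde b\cdot\nabla\varphi_2\right).$$ Then: (i) For any $c\in\mathbb{R}$ there exists a unique $\psi_c\in H^2_{\mathrm{per},0}(Y)$ such that $$B_1(\psi_c,\varphi)=c\int_Y\left(\tilde A:D^2\varphi+\tilde b\cdot\nabla\varphi\right)\qquad\forall\,\varphi\in H^2_{\mathrm{per},0}(Y),$$ and $\psi_c=c\,\psi_1$. (ii) The function $\tilde r:=1-\Delta\psi_1$ is the unique solution in $L^2_{\mathrm{per}}(Y)$ to $$-D^2:(\tilde A\tilde r)+\nabla\cdot(\tilde b\tilde r)=0\ \text{ in }Y,\qquad\tilde r\text{ is }Y\text{-periodic},\qquad\int_Y\tilde r=1.$$ Further, $\tilde r\ge0$ a.e. in $\mathbb{R}^n$. (iii) The set $\mathbb{L}$ of all solutions $u\in L^2_{\mathrm{per}}(Y)$ to $$-D^2:(Au)+\nabla\cdot(bu)=0\ \text{ in }Y,\qquad u\text{ is }Y\text{-periodic},$$ is given by $\mathbb{L}=\{c\gamma\tilde r: c\in\mathbb{R}\}$.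
   Context: $Y:=(0,1)^n\subset\mathbb{R}^n$. The subscript "per" denotes spaces of $Y$-periodic functions on $\mathbb{R}^n$ with the indicated (local) regularity; $H^k_{\mathrm{per},0}(Y):=\{v\in H^k_{\mathrm{per}}(Y):\int_Y v=0\}$. $|A|:=\sqrt{A:A}$ is the Frobenius norm, $|b|$ the Euclidean norm, $M:N=\sum_{ij}M_{ij}N_{ij}$. Setting $\mathcal B$: $(A,b)\in\mathcal B$ means that $A\in L^\infty_{\mathrm{per}}(Y;\mathbb{R}^{n\times n}_{\mathrm{sym}})$, $b\in L^\infty_{\mathrm{per}}(Y;\mathbb{R}^n)$; $A$ is uniformly elliptic, i.e. there are $\lambda,\Lambda>0$ with $\lambda I_n\le A\le\Lambda I_n$ a.e. in $\mathbb{R}^n$; and the Cordes-type condition holds: there exists $\delta\in\left(\frac{n}{n+\pi^2},1\right]$ such that $\frac{|A|^2+|b|^2}{(\mathrm{tr}(A))^2}\le\frac{1}{n-1+\delta}$ a.e. in $\mathbb{R}^n$. $D^2:(Au):=\sum_{i,j}\partial^2_{ij}(a_{ij}u)$. Solutions $u\in L^2_{\mathrm{per}}(Y)$ of $-D^2:(Au)+\nabla\cdot(bu)=0$ in $Y$, $u$ $Y$-periodic, are understood in the very weak sense: $\int_Y u\,(A:D^2\varphi+b\cdot\nabla\varphi)=0$ for all $\varphi\in H^2_{\mathrm{per}}(Y)$ (and analogously with $(\tilde A,\tilde b)$). *)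

theory Defs
  imports "HOL-Analysis.Analysis"
begin

text \<open>
  Elements of Lebesgue and Sobolev spaces are represented by arbitrary functions on
  \<open>real ^ 'n\<close>; equality of such elements is equality almost everywhere, and all notions
  below are invariant under changes on Lebesgue null sets.
\<close>

definition cellY :: "(real ^ 'n) set" where
  "cellY = {x. \<forall>i. 0 < x $ i \<and> x $ i < 1}"

definition periodic_ae :: "(real ^ 'n \<Rightarrow> 'b) \<Rightarrow> bool" where
  "periodic_ae f \<longleftrightarrow> (\<forall>k. (\<forall>i. k $ i \<in> \<int>) \<longrightarrow> (AE x in lebesgue. f (x + k) = f x))"

definition Linf_per :: "(real ^ 'n \<Rightarrow> 'b::real_normed_vector) set" where
  "Linf_per = {f. f \<in> borel_measurable lebesgue \<and> periodic_ae f \<and>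
     (\<exists>C. AE x in lebesgue. norm (f x) \<le> C)}"

definition L2_per :: "(real ^ 'n \<Rightarrow> real) set" where
  "L2_per = {f. f \<in> borel_measurable lebesgue \<and> periodic_ae f \<and>
     set_integrable lebesgue cellY (\<lambda>x. (f x)\<^sup>2)}"


subsection \<open>Weak derivatives\<close>

definition pderiv_at :: "'n \<Rightarrow> (real ^ 'n \<Rightarrow> real) \<Rightarrow> real ^ 'n \<Rightarrow> real" where
  "pderiv_at i f x = frechet_derivative f (at x) (axis i 1)"

primrec C_diff :: "nat \<Rightarrow> (real ^ 'n \<Rightarrow> real) \<Rightarrow> bool" where
  "C_diff 0 f \<longleftrightarrow> continuous_on UNIV f"
| "C_diff (Suc k) f \<longleftrightarrow> (\<forall>x. f differentiable (at x)) \<and> (\<forall>i. C_diff k (pderiv_at i f))"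

definition test_functions :: "(real ^ 'n \<Rightarrow> real) set" where
  "test_functions = {\<eta>. (\<forall>k. C_diff k \<eta>) \<and> compact (closure {x. \<eta> x \<noteq> 0})}"

definition locally_integrable :: "(real ^ 'n \<Rightarrow> real) \<Rightarrow> bool" where
  "locally_integrable f \<longleftrightarrow> (\<forall>K. compact K \<longrightarrow> set_integrable lebesgue K f)"

definition is_weak_pderiv :: "'n \<Rightarrow> (real ^ 'n \<Rightarrow> real) \<Rightarrow> (real ^ 'n \<Rightarrow> real) \<Rightarrow> bool" where
  "is_weak_pderiv i f g \<longleftrightarrow> locally_integrable f \<and> locally_integrable g \<and>
     (\<forall>\<eta>\<in>test_functions. (LINT x|lebesgue. f x * pderiv_at i \<eta> x) = - (LINT x|lebesgue. g x * \<eta> x))"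

text \<open>
  The weak partial derivative is unique up to null sets; \<open>weak_pderiv i f\<close> is some
  representative of it, and is meaningful only if the weak derivative exists.
\<close>
definition weak_pderiv :: "'n \<Rightarrow> (real ^ 'n \<Rightarrow> real) \<Rightarrow> real ^ 'n \<Rightarrow> real" where
  "weak_pderiv i f = (SOME g. is_weak_pderiv i f g)"

definition weak_grad :: "(real ^ 'n \<Rightarrow> real) \<Rightarrow> real ^ 'n \<Rightarrow> real ^ 'n" where
  "weak_grad f x = (\<chi> i. weak_pderiv i f x)"

definition weak_hess :: "(real ^ 'n \<Rightarrow> real) \<Rightarrow> real ^ 'n \<Rightarrow> real ^ 'n ^ 'n" where
  "weak_hess f x = (\<chi> i j. weak_pderiv i (weak_pderiv j f) x)"

definition weak_laplacian :: "(real ^ 'n \<Rightarrow> real) \<Rightarrow> real ^ 'n \<Rightarrow> real" where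
  "weak_laplacian f x = (\<Sum>i\<in>UNIV. weak_pderiv i (weak_pderiv i f) x)"


subsection \<open>Periodic Sobolev spaces\<close>

text \<open>
  \<open>H_per k\<close> consists of the periodic functions all of whose weak derivatives on the whole space
  of order at most \<open>k\<close> lie in \<open>L2_per\<close>, i.e. of the periodic functions in \<open>H^k_loc\<close>.
\<close>
primrec H_per :: "nat \<Rightarrow> (real ^ 'n \<Rightarrow> real) set" where
  "H_per 0 = L2_per"
| "H_per (Suc k) = {f \<in> L2_per. \<forall>i. \<exists>g\<in>H_per k. is_weak_pderiv i f g}"

definition H_per0 :: "nat \<Rightarrow> (real ^ 'n \<Rightarrow> real) set" where
  "H_per0 k = {v \<in> H_per k. (LINT x:cellY|lebesgue. v x) = 0}"


subsection \<open>Coefficients, bilinear form and very weak solutions\<close>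

text \<open>
  On \<open>real ^ 'n ^ 'n\<close> the inner product \<open>\<bullet>\<close> is the Frobenius product \<open>M : N\<close> and \<open>norm\<close> is the
  Frobenius norm.
\<close>

definition setting_B :: "((real ^ 'n \<Rightarrow> real ^ 'n ^ 'n) \<times> (real ^ 'n \<Rightarrow> real ^ 'n)) set" where
  "setting_B = {(A, b).
     A \<in> Linf_per \<and> (AE x in lebesgue. transpose (A x) = A x) \<and> b \<in> Linf_per \<and>
     (\<exists>l>0. \<exists>L>0. AE x in lebesgue. \<forall>\<xi>.
        l * (\<xi> \<bullet> \<xi>) \<le> \<xi> \<bullet> (A x *v \<xi>) \<and> \<xi> \<bullet> (A x *v \<xi>) \<le> L * (\<xi> \<bullet> \<xi>)) \<and>
     (\<exists>\<delta>. real CARD('n) / (real CARD('n) + pi\<^sup>2) < \<delta> \<and> \<delta> \<le> 1 \<and>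
        (AE x in lebesgue. ((norm (A x))\<^sup>2 + (norm (b x))\<^sup>2) / (trace (A x))\<^sup>2
            \<le> 1 / (real CARD('n) - 1 + \<delta>)))}"

definition nondiv_op ::
  "(real ^ 'n \<Rightarrow> real ^ 'n ^ 'n) \<Rightarrow> (real ^ 'n \<Rightarrow> real ^ 'n) \<Rightarrow> (real ^ 'n \<Rightarrow> real) \<Rightarrow> real ^ 'n \<Rightarrow> real" where
  "nondiv_op A b \<phi> x = A x \<bullet> weak_hess \<phi> x + b x \<bullet> weak_grad \<phi> x"

definition form_B1 ::
  "(real ^ 'n \<Rightarrow> real ^ 'n ^ 'n) \<Rightarrow> (real ^ 'n \<Rightarrow> real ^ 'n) \<Rightarrow>
   (real ^ 'n \<Rightarrow> real) \<Rightarrow> (real ^ 'n \<Rightarrow> real) \<Rightarrow> real" where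
  "form_B1 A b \<phi>\<^sub>1 \<phi>\<^sub>2 = (LINT x:cellY|lebesgue. weak_laplacian \<phi>\<^sub>1 x * nondiv_op A b \<phi>\<^sub>2 x)"

text \<open>
  The set of \<open>u \<in> L2_per\<close> solving \<open>- D^2 : (A u) + div (b u) = 0\<close> in the very weak sense.
\<close>
definition very_weak_solutions ::
  "(real ^ 'n \<Rightarrow> real ^ 'n ^ 'n) \<Rightarrow> (real ^ 'n \<Rightarrow> real ^ 'n) \<Rightarrow> (real ^ 'n \<Rightarrow> real) set" where
  "very_weak_solutions A b = {u \<in> L2_per.
     \<forall>\<phi>\<in>H_per 2. (LINT x:cellY|lebesgue. u x * nondiv_op A b \<phi> x) = 0}"

definition psi_solutions ::
  "(real ^ 'n \<Rightarrow> real ^ 'n ^ 'n) \<Rightarrow> (real ^ 'n \<Rightarrow> real ^ 'n) \<Rightarrow> real \<Rightarrow> (real ^ 'n \<Rightarrow> real) set" where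
  "psi_solutions A b c = {\<psi> \<in> H_per0 2.
     \<forall>\<phi>\<in>H_per0 2. form_B1 A b \<psi> \<phi> = c * (LINT x:cellY|lebesgue. nondiv_op A b \<phi> x)}"

end

theory Submission
  imports Defs
begin

text \<open>
  All periodic problems are treated with Fourier series. A function \<open>\<phi>\<close> in \<open>H_per0 2\<close> is
  determined by \<open>g = \<Delta>\<phi>\<close>, an arbitrary mean-zero function in \<open>L2_per\<close>, and its first and second
  derivatives are Fourier multipliers applied to \<open>g\<close>; Parseval's identity gives
  \<open>\<parallel>D\<^sup>2\<phi>\<parallel>\<^sup>2 + \<parallel>\<nabla>\<phi>\<parallel>\<^sup>2 \<le> (1 + 1/(4\<pi>\<^sup>2)) \<parallel>g\<parallel>\<^sup>2\<close>. The renormalised operator becomes a bounded operator \<open>T\<close>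
  with \<open>\<parallel>T g - g\<parallel> \<le> \<kappa> \<parallel>g\<parallel>\<close>, where \<open>\<kappa> < 1\<close> by the Cordes condition. Hence \<open>T\<close> is coercive on mean-zero
  functions, which gives existence, uniqueness and stability of the invariant density \<open>r\<close>.

  For \<open>r \<ge> 0\<close> the coefficients are approximated by Lipschitz ones with the same Cordes bound;
  by stability the densities converge in \<open>L\<^sup>2\<close>. For Lipschitz coefficients, stability under
  translations shows that \<open>r\<close> is in \<open>H\<^sup>1\<close>. Testing the equation in divergence form with
  \<open>s = r / sqrt (\<epsilon>\<^sup>2 + r\<^sup>2)\<close> gives \<open>\<parallel>\<nabla>s\<parallel>\<^sup>2 \<le> C \<integral> \<epsilon> r\<^sup>2 / (\<epsilon>\<^sup>2 + r\<^sup>2)\<^bsup>3/2\<^esup>\<close>, which tends to \<open>0\<close> with \<open>\<epsilon>\<close>. By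
  Poincare's inequality \<open>sgn r\<close> is constant, and it is \<open>1\<close> because \<open>r\<close> has mean \<open>1\<close>.
\<close>

subsection \<open>Periodic functions and the unit cell\<close>

text \<open>Written through f = Delta psi and g = Delta phi, the form \<open>form_B1\<close> is the
  L2 pairing of f with T g, so all claims concern orthogonality to the range of T. Coefficients are
  pairs (M, v) with squared norm |M|^2 + |v|^2; the Cordes condition puts the renormalised pair
  within sqrt (1 - \<delta>) of (I, 0), the pair of the Laplacian. The drift costs the extra 1/(4
  pi^2), because the shortest nonzero frequency has length 2 pi. Values of T need not have mean
  zero, so solvability goes through the adjoint, whose values do. The obstacle to r \<ge> 0 is that
  r is a priori only in L2 while both derivatives fall on the test function, so r cannot be tested
  with its own sign. Lipschitz coefficients remove it: a translate of r is the density of the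
  translated coefficients, hence stability bounds difference quotients of r without differentiating
  the equation. Bounded coefficients are limits of Lipschitz ones only in L2 or almost everywhere,
  and r may be unbounded; therefore stability carries the weighted error |w - v| s.\<close>

definition Zn :: "(real ^ 'n) set" where
  "Zn = {k. \<forall>i. k $ i \<in> \<int>}"

abbreviation Q :: "(real ^ 'n) measure" where
  "Q \<equiv> lebesgue_on cellY"

lemma Zn_add [simp]: "k \<in> Zn \<Longrightarrow> l \<in> Zn \<Longrightarrow> k + l \<in> Zn"
  and Zn_diff [simp]: "k \<in> Zn \<Longrightarrow> l \<in> Zn \<Longrightarrow> k - l \<in> Zn"
  and Zn_minus [simp]: "k \<in> Zn \<Longrightarrow> - k \<in> Zn"
  and Zn_0 [simp]: "0 \<in> Zn"
  by (auto simp: Zn_def)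

lemma countable_Zn: "countable (Zn :: (real ^ 'n) set)"
proof -
  have "Zn \<subseteq> range (\<lambda>v :: int ^ 'n. \<chi> i. real_of_int (v $ i))"
  proof
    fix k :: "real ^ 'n" assume "k \<in> Zn"
    then have "k = (\<chi> i. real_of_int ((\<chi> i. \<lfloor>k $ i\<rfloor>) $ i))"
      by (auto simp: Zn_def vec_eq_iff elim: Ints_cases)
    then show "k \<in> range (\<lambda>v :: int ^ 'n. \<chi> i. real_of_int (v $ i))"
      by blast
  qed
  then show ?thesis
    by (rule countable_subset) simp
qed

lemma finite_Zn_bounded: "finite {k \<in> (Zn :: (real ^ 'n) set). \<forall>i. \<bar>k $ i\<bar> \<le> N}"
proof -
  define P where "P = {x \<in> \<int>. \<bar>x :: real\<bar> \<le> N}"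
  have "finite ((\<lambda>f :: 'n \<Rightarrow> real. \<chi> i. f i) ` (UNIV \<rightarrow>\<^sub>E P))"
    by (intro finite_imageI finite_PiE) (auto simp: P_def finite_abs_int_segment)
  moreover have "{k \<in> (Zn :: (real ^ 'n) set). \<forall>i. \<bar>k $ i\<bar> \<le> N} \<subseteq> (\<lambda>f :: 'n \<Rightarrow> real. \<chi> i. f i) ` (UNIV \<rightarrow>\<^sub>E P)"
    by (auto simp: image_iff PiE_def P_def Zn_def intro!: bexI[of _ "\<lambda>i. _ $ i"])
  ultimately show ?thesis
    by (rule rev_finite_subset)
qed

lemma cellY_eq_box: "cellY = box 0 (1 :: real ^ 'n)"
  by (auto simp: cellY_def mem_box_cart)

lemma cellY_sets [measurable, simp]: "(cellY :: (real ^ 'n) set) \<in> sets lebesgue"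
  by (simp add: cellY_eq_box)

lemma emeasure_cellY: "emeasure lebesgue (cellY :: (real ^ 'n) set) = 1"
proof -
  have "emeasure lborel (box 0 (1 :: real ^ 'n)) = (\<Prod>b\<in>Basis. (1 - 0 :: real ^ 'n) \<bullet> b)"
    by (intro emeasure_lborel_box) (auto simp: Basis_vec_def inner_axis)
  also have "(\<Prod>b\<in>Basis. (1 - 0 :: real ^ 'n) \<bullet> b) = 1"
    by (intro prod.neutral) (auto simp: Basis_vec_def inner_axis)
  finally show ?thesis
    by (simp add: cellY_eq_box)
qed

interpretation Q: finite_measure Q
  by standard (simp add: emeasure_restrict_space emeasure_cellY)

lemma measure_Q [simp]: "measure Q cellY = 1"
  by (simp add: measure_def emeasure_restrict_space emeasure_cellY)

lemma set_lebesgue_integral_Q: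
  fixes f :: "real ^ 'n \<Rightarrow> 'b :: {banach, second_countable_topology}"
  shows "(LINT x:cellY|lebesgue. f x) = (LINT x|Q. f x)"
  by (simp add: integral_restrict_space set_lebesgue_integral_def)

lemma set_integrable_Q:
  fixes f :: "real ^ 'n \<Rightarrow> 'b :: {banach, second_countable_topology}"
  shows "set_integrable lebesgue cellY f \<longleftrightarrow> integrable Q f"
  by (simp add: integrable_restrict_space set_integrable_def)

lemma AE_Q: "(AE x in Q. P x) \<longleftrightarrow> (AE x in lebesgue. x \<in> cellY \<longrightarrow> P x)"
  by (simp add: AE_restrict_space_iff)

lemma measurable_Q [measurable (raw)]:
  "f \<in> borel_measurable lebesgue \<Longrightarrow> f \<in> borel_measurable Q"
  by (simp add: measurable_restrict_space1)

lemma AE_lebesgue_Q: "(AE x in lebesgue. P x) \<Longrightarrow> (AE x in Q. P x)"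
  by (auto simp: AE_Q)

subsection \<open>Translations\<close>

lemma measurable_shift_lebesgue [measurable, simp]:
  "(\<lambda>x :: 'a :: euclidean_space. x + a) \<in> lebesgue \<rightarrow>\<^sub>M lebesgue"
  using lebesgue_affine_measurable[of "\<lambda>_. 1" a]
  by (simp add: euclidean_representation add.commute)

lemma lebesgue_shift: "distr lebesgue lebesgue (\<lambda>x :: 'a :: euclidean_space. x + a) = lebesgue"
  using lebesgue_affine_euclidean[of "\<lambda>_. 1" a]
  by (simp add: euclidean_representation add.commute density_1)

lemma borel_measurable_shift:
  "f \<in> borel_measurable lebesgue \<Longrightarrow> (\<lambda>x :: 'a :: euclidean_space. f (x + a)) \<in> borel_measurable lebesgue"
  by (rule measurable_compose[OF measurable_shift_lebesgue])

lemma AE_shift: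
  assumes "AE x :: 'a :: euclidean_space in lebesgue. P x"
  shows "AE x in lebesgue. P (x + a)"
proof -
  have "AE x in distr lebesgue lebesgue (\<lambda>x. x + a). P x"
    using assms by (simp only: lebesgue_shift)
  then show ?thesis
    by (rule AE_distrD[rotated]) simp
qed

lemma integrable_shift:
  fixes f :: "'a :: euclidean_space \<Rightarrow> 'b :: {banach, second_countable_topology}"
  assumes "integrable lebesgue f"
  shows "integrable lebesgue (\<lambda>x. f (x + a))"
  using assms integrable_distr[OF measurable_shift_lebesgue, of a f]
  by (simp add: lebesgue_shift)

lemma integral_shift:
  fixes f :: "'a :: euclidean_space \<Rightarrow> 'b :: {banach, second_countable_topology}"
  assumes "f \<in> borel_measurable lebesgue"
  shows "(LINT x|lebesgue. f (x + a)) = (LINT x|lebesgue. f x)"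
  using assms integral_distr[OF measurable_shift_lebesgue, of f a]
  by (simp add: lebesgue_shift)

text \<open>The open cube misses its faces, so its lattice translates cover exactly the points
  without an integer coordinate; the rest is a countable union of hyperplanes.\<close>

lemma AE_in_translated_cell: "AE x in lebesgue. \<exists>m\<in>Zn. x - m \<in> (cellY :: (real ^ 'n) set)"
proof -
  have "negligible (\<Union>i::'n. \<Union>z\<in>\<int>. {x :: real ^ 'n. x $ i = z})"
  proof (intro negligible_countable_Union countable_image countable_int, safe)
    fix i :: 'n
    show "negligible (\<Union>z\<in>\<int>. {x :: real ^ 'n. x $ i = z})"
    proof (intro negligible_countable_Union countable_image countable_int, safe)
      fix z :: real
      show "negligible {x :: real ^ 'n. x $ i = z}"
        using negligible_standard_hyperplane[of "axis i 1 :: real ^ 'n" z] by (simp add: inner_axis)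
    qed
  qed auto
  then have "AE x in lebesgue. x \<notin> (\<Union>i::'n. \<Union>z\<in>\<int>. {x :: real ^ 'n. x $ i = z})"
    unfolding negligible_iff_null_sets by (rule AE_not_in)
  then show ?thesis
  proof eventually_elim
    case (elim x)
    have "x - (\<chi> i. of_int \<lfloor>x $ i\<rfloor>) \<in> cellY"
      unfolding cellY_def
    proof (clarsimp)
      fix i
      have "x $ i \<notin> \<int>"
        using elim by auto
      then have "of_int \<lfloor>x $ i\<rfloor> \<noteq> x $ i"
        by (metis Ints_of_int)
      then show "of_int \<lfloor>x $ i\<rfloor> < x $ i \<and> x $ i - of_int \<lfloor>x $ i\<rfloor> < 1"
        by linarith
    qed
    moreover have "(\<chi> i. of_int \<lfloor>x $ i\<rfloor>) \<in> (Zn :: (real ^ 'n) set)"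
      by (simp add: Zn_def)
    ultimately show ?case
      by blast
  qed
qed

lemma translated_cell_unique:
  assumes "m \<in> Zn" "m' \<in> Zn" "x - m \<in> cellY" "x - m' \<in> cellY"
  shows "m = m'"
proof -
  have "m $ i = m' $ i" for i
  proof -
    obtain a b where "m $ i = of_int a" "m' $ i = of_int b"
      using assms by (auto simp: Zn_def elim!: Ints_cases) (meson Ints_cases)
    moreover have "0 < x $ i - m $ i" "x $ i - m $ i < 1" "0 < x $ i - m' $ i" "x $ i - m' $ i < 1"
      using assms by (auto simp: cellY_def)
    ultimately have "\<bar>real_of_int a - of_int b\<bar> < 1"
      by linarith
    then have "a = b"
      by linarith
    with \<open>m $ i = _\<close> \<open>m' $ i = _\<close> show ?thesis
      by simp
  qed
  then show ?thesis
    by (simp add: vec_eq_iff)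
qed

lemma periodic_aeD: "periodic_ae f \<Longrightarrow> k \<in> Zn \<Longrightarrow> AE x in lebesgue. f (x + k) = f x"
  by (auto simp: periodic_ae_def Zn_def)

lemma periodic_aeI: "(\<And>k. k \<in> Zn \<Longrightarrow> AE x in lebesgue. f (x + k) = f x) \<Longrightarrow> periodic_ae f"
  by (auto simp: periodic_ae_def Zn_def)

text \<open>Periodicity is known only almost everywhere and separately for each lattice vector.
  \<open>Zn\<close> is countable, so the exceptional sets unite to one null set, outside of which a
  property passes from the cell to all its translates.\<close>

lemma AE_periodic_extend:
  fixes P :: "real ^ 'n \<Rightarrow> bool"
  assumes per: "\<And>m. m \<in> Zn \<Longrightarrow> AE x in lebesgue. P (x + m) \<longleftrightarrow> P x"
    and cell: "AE x in Q. P x"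
  shows "AE x in lebesgue. P x"
proof -
  have "AE x in lebesgue. \<forall>m\<in>Zn. P x \<longleftrightarrow> P (x - m)"
    unfolding AE_ball_countable[OF countable_Zn]
  proof
    fix m :: "real ^ 'n" assume "m \<in> Zn"
    then show "AE x in lebesgue. P x \<longleftrightarrow> P (x - m)"
      using AE_shift[OF per[of m], of "- m"] by simp
  qed
  moreover have "AE x in lebesgue. \<forall>m\<in>Zn. x - m \<in> cellY \<longrightarrow> P (x - m)"
    unfolding AE_ball_countable[OF countable_Zn]
  proof
    fix m :: "real ^ 'n"
    show "AE x in lebesgue. x - m \<in> cellY \<longrightarrow> P (x - m)"
      using AE_shift[OF cell[unfolded AE_Q], of "- m"] by simp
  qed
  ultimately show ?thesis
    using AE_in_translated_cell by eventually_elim blast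
qed

lemma periodic_ae_shift: "periodic_ae f \<Longrightarrow> periodic_ae (\<lambda>x. f (x + z))"
  unfolding periodic_ae_def using AE_shift[of "\<lambda>x. f (x + _) = f x" z] by (simp add: add.assoc add.commute[of z])

lemma AE_eq_periodic_extend:
  assumes "periodic_ae f" "periodic_ae g" "AE x in Q. f x = g x"
  shows "AE x in lebesgue. f x = g x"
proof (rule AE_periodic_extend[OF _ assms(3)])
  fix m :: "real ^ 'a" assume m: "m \<in> Zn"
  show "AE x in lebesgue. (f (x + m) = g (x + m)) \<longleftrightarrow> (f x = g x)"
    using periodic_aeD[OF assms(1) m] periodic_aeD[OF assms(2) m] by eventually_elim simp
qed

text \<open>Unfolding: the integral over the whole space is cut into the cells m +
  \<open>cellY\<close>, and each piece is moved back to \<open>cellY\<close>, where periodicity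
  restores f and only w is left to sum. The margin N + 1 in \<open>M\<close> is right because a cell
  that meets the support has its corner within 1 of it in every coordinate.\<close>

lemma
  fixes f :: "real ^ 'n \<Rightarrow> 'b :: {banach, second_countable_topology}" and w :: "real ^ 'n \<Rightarrow> real"
  assumes f: "periodic_ae f" "f \<in> borel_measurable lebesgue" "integrable Q f"
    and w: "w \<in> borel_measurable lebesgue" "\<And>x. \<bar>w x\<bar> \<le> B"
    and supp: "\<And>x i. w x \<noteq> 0 \<Longrightarrow> \<bar>x $ i\<bar> \<le> N"
  defines "M \<equiv> {m \<in> Zn. \<forall>i. \<bar>m $ i\<bar> \<le> N + 1}"
  shows integrable_periodic_mult: "integrable lebesgue (\<lambda>x. w x *\<^sub>R f x)"
    and integral_unfold: "(LINT x|lebesgue. w x *\<^sub>R f x) = (LINT x|Q. (\<Sum>m\<in>M. w (x + m)) *\<^sub>R f x)"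
proof -
  have fin: "finite M"
    unfolding M_def by (rule finite_Zn_bounded)
  note [measurable] = f(2) w(1) borel_measurable_shift[OF w(1)]
  have cellint: "integrable lebesgue (\<lambda>x. indicator cellY x *\<^sub>R f x)"
    using f(3) by (simp add: integrable_restrict_space)
  \<comment> \<open>Up to periodicity of f, \<open>G m\<close> is the piece of the integrand over m
    + \<open>cellY\<close>, already moved back to \<open>cellY\<close>.\<close>
  define G where "G m x = indicator cellY x *\<^sub>R (w (x + m) *\<^sub>R f x)" for m x
  have G_int: "integrable lebesgue (G m)" for m
  proof (rule Bochner_Integration.integrable_bound[OF integrable_scaleR_right[OF cellint, of B]])
    show "G m \<in> borel_measurable lebesgue"
      unfolding G_def by measurable
    show "AE x in lebesgue. norm (G m x) \<le> norm (B *\<^sub>R indicator cellY x *\<^sub>R f x)"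
      using w(2) by (intro AE_I2) (auto simp: G_def indicator_def intro!: mult_right_mono order_trans[OF w(2)])
  qed
  have G_int': "integrable lebesgue (\<lambda>x. G m (x - m))" for m
    using integrable_shift[OF G_int[of m], of "- m"] by simp
  have ae: "AE x in lebesgue. w x *\<^sub>R f x = (\<Sum>m\<in>M. G m (x - m))"
  proof -
    have "AE x in lebesgue. \<forall>m\<in>Zn. f (x - m) = f x"
      unfolding AE_ball_countable[OF countable_Zn]
      using periodic_aeD[OF f(1) Zn_minus] by simp
    then show ?thesis
      using AE_in_translated_cell
    proof eventually_elim
      case (elim x)
      then obtain m where m: "m \<in> Zn" "x - m \<in> cellY"
        by blast
      have *: "G m' (x - m') = (if m' = m then w x *\<^sub>R f x else 0)" if "m' \<in> M" for m'
      proof (cases "m' = m")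
        case True
        then show ?thesis
          using m elim by (simp add: G_def)
      next
        case False
        then have "x - m' \<notin> cellY"
          using translated_cell_unique[of m m' x] m that by (auto simp: M_def)
        then show ?thesis
          using False by (simp add: G_def)
      qed
      have "m \<in> M" if "w x \<noteq> 0"
      proof -
        have "\<bar>m $ i\<bar> \<le> N + 1" for i
          using supp[OF that, of i] m(2) unfolding cellY_def by (simp add: abs_le_iff) (smt (verit))
        then show ?thesis
          using m by (auto simp: M_def)
      qed
      then show ?case
        using fin by (cases "w x = 0") (auto simp: * cong: sum.cong)
    qed
  qed
  have meas: "(\<lambda>x. w x *\<^sub>R f x) \<in> borel_measurable lebesgue"
    by measurable
  have sum_int: "integrable lebesgue (\<lambda>x. \<Sum>m\<in>M. G m (x - m))"
    by (intro Bochner_Integration.integrable_sum G_int')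
  show "integrable lebesgue (\<lambda>x. w x *\<^sub>R f x)"
    using integrable_cong_AE[OF meas borel_measurable_integrable[OF sum_int] ae] sum_int by blast
  have "(LINT x|lebesgue. w x *\<^sub>R f x) = (LINT x|lebesgue. (\<Sum>m\<in>M. G m (x - m)))"
    using sum_int by (intro integral_cong_AE meas ae) auto
  also have "\<dots> = (\<Sum>m\<in>M. LINT x|lebesgue. G m (x - m))"
    by (intro Bochner_Integration.integral_sum G_int')
  also have "\<dots> = (\<Sum>m\<in>M. LINT x|lebesgue. G m x)"
    using integral_shift[of "G m" "- m" for m] G_int by (auto intro!: sum.cong)
  also have "\<dots> = (LINT x|lebesgue. (\<Sum>m\<in>M. G m x))"
    by (intro Bochner_Integration.integral_sum[symmetric] G_int)
  also have "\<dots> = (LINT x|Q. (\<Sum>m\<in>M. w (x + m)) *\<^sub>R f x)"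
    by (simp add: integral_restrict_space G_def scaleR_sum_left scaleR_sum_right)
  finally show "(LINT x|lebesgue. w x *\<^sub>R f x) = (LINT x|Q. (\<Sum>m\<in>M. w (x + m)) *\<^sub>R f x)" .
qed

text \<open>Unfolding with w the indicator of z + \<open>cellY\<close>: its lattice translates tile
  the space, so they sum to 1 almost everywhere.\<close>

lemma
  fixes f :: "real ^ 'n \<Rightarrow> 'b :: {banach, second_countable_topology}"
  assumes f: "periodic_ae f" "f \<in> borel_measurable lebesgue" "integrable Q f"
  shows integrable_Q_shift: "integrable Q (\<lambda>x. f (x + z))"
    and integral_Q_shift: "(LINT x|Q. f (x + z)) = (LINT x|Q. f x)"
proof -
  define w where "w x = indicat_real cellY (x - z)" for x
  define N where "N = norm z + 1"
  have wm: "w \<in> borel_measurable lebesgue"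
    unfolding w_def using borel_measurable_shift[of "indicat_real cellY" "- z"] by simp
  have wB: "\<bar>w x\<bar> \<le> 1" for x
    by (simp add: w_def indicator_def)
  have wN: "\<bar>x $ i\<bar> \<le> N" if "w x \<noteq> 0" for x i
  proof -
    have "x - z \<in> cellY"
      using that by (simp add: w_def indicator_def split: if_splits)
    then have "0 < x $ i - z $ i" "x $ i - z $ i < 1"
      by (auto simp: cellY_def)
    moreover have "\<bar>z $ i\<bar> \<le> norm z"
      by (rule component_le_norm_cart)
    ultimately show ?thesis
      unfolding N_def by linarith
  qed
  define M where "M = {m \<in> Zn :: (real ^ 'n) set. \<forall>i. \<bar>m $ i\<bar> \<le> N + 1}"
  have fin: "finite M"
    unfolding M_def by (rule finite_Zn_bounded)
  note un = integrable_periodic_mult[OF f wm wB wN] integral_unfold[OF f wm wB wN, folded M_def]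
  have eq: "indicator cellY x *\<^sub>R f (x + z) = w (x + z) *\<^sub>R f (x + z)" for x
    by (simp add: w_def indicator_def)
  show "integrable Q (\<lambda>x. f (x + z))"
    using integrable_shift[OF un(1), of z] by (simp add: integrable_restrict_space eq)
  have "(LINT x|Q. f (x + z)) = (LINT x|lebesgue. w (x + z) *\<^sub>R f (x + z))"
    by (simp add: integral_restrict_space eq)
  also have "\<dots> = (LINT x|lebesgue. w x *\<^sub>R f x)"
    using un(1) by (intro integral_shift) auto
  also have "\<dots> = (LINT x|Q. (\<Sum>m\<in>M. w (x + m)) *\<^sub>R f x)"
    by (rule un(2))
  also have "\<dots> = (LINT x|Q. f x)"
  proof (rule integral_cong_AE)
    note [measurable] = f(2) borel_measurable_shift[OF wm]
    show "(\<lambda>x. (\<Sum>m\<in>M. w (x + m)) *\<^sub>R f x) \<in> borel_measurable Q" "f \<in> borel_measurable Q"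
      by measurable
    show "AE x in Q. (\<Sum>m\<in>M. w (x + m)) *\<^sub>R f x = f x"
      unfolding AE_Q using AE_shift[OF AE_in_translated_cell, of "- z"]
    proof (eventually_elim, intro impI)
      fix x :: "real ^ 'n"
      assume elim: "\<exists>m\<in>Zn. x + - z - m \<in> cellY" "x \<in> cellY"
      from elim(1) have "\<exists>m\<in>Zn. x - z - m \<in> cellY"
        by simp
      then obtain m where m: "m \<in> Zn" "x - z - m \<in> cellY"
        by blast
      have "w (x + m') = (if m' = - m then 1 else 0)" if "m' \<in> M" for m'
      proof -
        have "x - z - - m' \<in> cellY \<longleftrightarrow> - m' = m"
          using translated_cell_unique[of m "- m'" "x - z"] m that by (auto simp: M_def)
        moreover have "x + m' - z = x - z - - m'"
          by simp
        ultimately show ?thesis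
          unfolding w_def by (metis add.inverse_inverse indicator_simps)
      qed
      moreover have "- m \<in> M"
      proof -
        have eq': "x + (- m) - z = x - z - m"
          by (simp add: diff_diff_eq add.commute)
        have "w (x + (- m)) \<noteq> 0"
          unfolding w_def eq' using m(2) by simp
        from wN[OF this] have bd: "\<bar>x $ i - m $ i\<bar> \<le> N" for i
          by simp
        have "\<bar>m $ i\<bar> \<le> N + 1" for i
        proof -
          have "\<bar>x $ i - m $ i\<bar> \<le> N" "0 < x $ i" "x $ i < 1"
            using bd elim(2) by (auto simp: cellY_def)
          then show ?thesis
            by arith
        qed
        then show ?thesis
          using m by (auto simp: M_def)
      qed
      ultimately show "(\<Sum>m\<in>M. w (x + m)) *\<^sub>R f x = f x"
        using fin by (simp cong: sum.cong)
    qed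
  qed
  finally show "(LINT x|Q. f (x + z)) = (LINT x|Q. f x)" .
qed

subsection \<open>Exponentials\<close>

definition ek :: "real ^ 'n \<Rightarrow> real ^ 'n \<Rightarrow> complex" where
  "ek k x = cis (2 * pi * (k \<bullet> x))"

definition fc :: "(real ^ 'n \<Rightarrow> complex) \<Rightarrow> real ^ 'n \<Rightarrow> complex" where
  "fc f k = (LINT x|Q. f x * cnj (ek k x))"

lemma ek_0 [simp]: "ek 0 x = 1"
  by (simp add: ek_def)

lemma ek_add: "ek (k + l) x = ek k x * ek l x"
  by (simp add: ek_def cis_mult inner_add_left algebra_simps)

lemma ek_minus: "ek (- k) x = cnj (ek k x)"
  by (simp add: ek_def cis_cnj)

lemma ek_shift: "ek k (x + z) = ek k x * ek k z"
  by (simp add: ek_def cis_mult inner_add_right algebra_simps)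

lemma norm_ek [simp]: "norm (ek k x) = 1"
  by (simp add: ek_def)

lemma ek_cnj_self [simp]: "ek k x * cnj (ek k x) = 1" "cnj (ek k x) * ek k x = 1"
  by (simp_all add: ek_def cis_cnj cis_mult)

lemma Zn_inner_Ints:
  assumes "k \<in> Zn" "m \<in> Zn"
  shows "k \<bullet> m \<in> \<int>"
  using assms by (auto simp: inner_vec_def Zn_def intro!: Ints_sum Ints_mult)

lemma ek_Zn [simp]: "k \<in> Zn \<Longrightarrow> m \<in> Zn \<Longrightarrow> ek k m = 1"
  using Zn_inner_Ints[of k m] by (auto simp: ek_def elim!: Ints_cases)

lemma ek_periodic: "k \<in> Zn \<Longrightarrow> periodic_ae (ek k)"
  by (intro periodic_aeI AE_I2) (simp add: ek_shift)

lemma continuous_ek [continuous_intros]: "continuous_on S (ek k)"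
  unfolding ek_def by (intro continuous_intros)

lemma continuous_imp_lebesgue:
  fixes f :: "'a :: euclidean_space \<Rightarrow> 'b :: topological_space"
  shows "continuous_on UNIV f \<Longrightarrow> f \<in> borel_measurable lebesgue"
  using measurable_completion[of f lborel borel] borel_measurable_continuous_onI[of f] by simp

lemma measurable_ek [measurable, simp]: "ek k \<in> borel_measurable lebesgue"
  by (intro continuous_imp_lebesgue continuous_ek)

lemma integrable_Q_bounded:
  fixes f :: "real ^ 'n \<Rightarrow> 'b :: {banach, second_countable_topology}"
  assumes "f \<in> borel_measurable lebesgue" "AE x in lebesgue. norm (f x) \<le> B"
  shows "integrable Q f"
  by (rule Q.integrable_const_bound[of _ B]) (use assms AE_lebesgue_Q in auto)

lemma integrable_mult_bounded:
  fixes f g :: "'a \<Rightarrow> 'b :: {banach, second_countable_topology, real_normed_algebra}"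
  assumes "integrable M f" "g \<in> borel_measurable M" "AE x in M. norm (g x) \<le> B"
  shows "integrable M (\<lambda>x. f x * g x)"
proof (rule Bochner_Integration.integrable_bound)
  show "integrable M (\<lambda>x. B *\<^sub>R f x)"
    using assms by simp
  show "AE x in M. norm (f x * g x) \<le> norm (B *\<^sub>R f x)"
    using assms(3)
  proof eventually_elim
    case (elim x)
    have "norm (f x * g x) \<le> norm (f x) * norm (g x)"
      by (rule norm_mult_ineq)
    also have "\<dots> \<le> norm (f x) * \<bar>B\<bar>"
      using elim by (intro mult_left_mono) auto
    finally show ?case
      by (simp add: mult.commute)
  qed
qed (use assms in auto)

lemma integrable_Q_ek [simp]: "integrable Q (ek k)"
  by (rule integrable_Q_bounded[of _ 1]) auto

text \<open>A shift by \<open>h\<close>, half a wavelength along a coordinate with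
  \<open>k $ i\<close> nonzero, multiplies \<open>ek k\<close> by -1 and leaves the integral
  unchanged; so the integral is its own negative.\<close>

lemma integral_Q_ek:
  assumes "k \<in> Zn"
  shows "(LINT x|Q. ek k x) = (if k = 0 then 1 else 0)"
proof (cases "k = 0")
  case False
  then obtain i where i: "k $ i \<noteq> 0"
    by (auto simp: vec_eq_iff)
  define h :: "real ^ 'a" where "h = axis i (1 / (2 * k $ i))"
  have "2 * pi * (k \<bullet> h) = pi"
    using i by (simp add: h_def inner_axis)
  then have h: "ek k h = - 1"
    unfolding ek_def by (simp only: cis_pi)
  have "(LINT x|Q. ek k x) = (LINT x|Q. ek k (x + h))"
    using assms by (intro integral_Q_shift[symmetric] ek_periodic) auto
  also have "\<dots> = - (LINT x|Q. ek k x)"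
    by (simp add: ek_shift h)
  finally have "(LINT x|Q. ek k x) = 0"
    by (metis add.right_inverse add_cancel_right_left mult_2 mult_eq_0_iff zero_neq_numeral)
  with False show ?thesis
    by simp
qed simp

lemma fc_ek:
  assumes "k \<in> Zn" "l \<in> Zn"
  shows "fc (ek l) k = (if k = l then 1 else 0)"
proof -
  have "ek (l - k) x = ek l x * cnj (ek k x)" for x
    using ek_add[of l "- k" x] by (simp add: ek_minus)
  then show ?thesis
    using integral_Q_ek[of "l - k"] assms by (auto simp: fc_def simp del: ek_cnj_self)
qed

lemma integrable_fc:
  "integrable Q f \<Longrightarrow> integrable Q (\<lambda>x. f x * cnj (ek k x))"
  using measurable_ek[of "- k"] unfolding ek_minus
  by (intro integrable_mult_bounded[of _ _ _ 1] measurable_Q) auto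

subsection \<open>Completeness of the exponentials\<close>

inductive_set trigpoly :: "(real ^ 'n \<Rightarrow> complex) set" where
  trigpoly_ek: "k \<in> Zn \<Longrightarrow> (\<lambda>x. c * ek k x) \<in> trigpoly"
| trigpoly_add: "f \<in> trigpoly \<Longrightarrow> g \<in> trigpoly \<Longrightarrow> (\<lambda>x. f x + g x) \<in> trigpoly"

lemma trigpoly_const: "(\<lambda>x. c) \<in> trigpoly"
  using trigpoly_ek[of 0 c] by simp

lemma trigpoly_mult_ek: "f \<in> trigpoly \<Longrightarrow> k \<in> Zn \<Longrightarrow> (\<lambda>x. f x * (c * ek k x)) \<in> trigpoly"
proof (induction rule: trigpoly.induct)
  case (trigpoly_ek l d)
  then show ?case
    using trigpoly.trigpoly_ek[of "l + k" "d * c"] by (simp add: ek_add mult_ac)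
next
  case (trigpoly_add f g)
  then show ?case
    using trigpoly.trigpoly_add by (simp add: distrib_right)
qed

lemma trigpoly_mult: "g \<in> trigpoly \<Longrightarrow> f \<in> trigpoly \<Longrightarrow> (\<lambda>x. f x * g x) \<in> trigpoly"
proof (induction rule: trigpoly.induct)
  case (trigpoly_ek k c)
  then show ?case
    by (intro trigpoly_mult_ek)
next
  case (trigpoly_add g h)
  then show ?case
    using trigpoly.trigpoly_add by (simp add: distrib_left)
qed

lemma trigpoly_cmult: "f \<in> trigpoly \<Longrightarrow> (\<lambda>x. c * f x) \<in> trigpoly"
  using trigpoly_mult[of f "\<lambda>_. c"] trigpoly_const[of c] by simp

lemma trigpoly_sum: "(\<And>i. i \<in> I \<Longrightarrow> f i \<in> trigpoly) \<Longrightarrow> (\<lambda>x. \<Sum>i\<in>I. f i x) \<in> trigpoly"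
  by (induction I rule: infinite_finite_induct) (auto intro: trigpoly_const trigpoly_add)

text \<open>The torus as a compact subset of Euclidean space, each coordinate wrapped around a
  circle. Ordinary polynomials in the image point are trigonometric polynomials in x, which makes
  the Stone-Weierstrass theorem for polynomials applicable.\<close>

definition torus_map :: "real ^ 'n \<Rightarrow> (real ^ 'n) \<times> (real ^ 'n)" where
  "torus_map x = ((\<chi> i. cos (2 * pi * x $ i)), (\<chi> i. sin (2 * pi * x $ i)))"

lemma axis_Zn: "axis i 1 \<in> Zn"
  by (simp add: Zn_def axis_def)

lemma trigpoly_cos: "(\<lambda>x. complex_of_real (cos (2 * pi * x $ i))) \<in> trigpoly"
  and trigpoly_sin: "(\<lambda>x. complex_of_real (sin (2 * pi * x $ i))) \<in> trigpoly"
proof -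
  have *: "(\<lambda>x. c * ek (axis i 1) x + d * ek (- axis i 1) x) \<in> trigpoly" for c d
    by (intro trigpoly_add trigpoly_ek) (simp_all add: axis_Zn)
  have "(\<lambda>x. 1/2 * ek (axis i 1) x + 1/2 * ek (- axis i 1) x) = (\<lambda>x. complex_of_real (cos (2 * pi * x $ i)))"
    by (auto simp: ek_def inner_axis' complex_eq_iff)
  with *[of "1/2" "1/2"] show "(\<lambda>x. complex_of_real (cos (2 * pi * x $ i))) \<in> trigpoly"
    by simp
  have "(\<lambda>x. (-\<i>/2) * ek (axis i 1) x + (\<i>/2) * ek (- axis i 1) x) = (\<lambda>x. complex_of_real (sin (2 * pi * x $ i)))"
    by (auto simp: ek_def inner_axis' complex_eq_iff)
  with *[of "-\<i>/2" "\<i>/2"] show "(\<lambda>x. complex_of_real (sin (2 * pi * x $ i))) \<in> trigpoly"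
    by simp
qed

lemma trigpoly_torus_polynomial:
  "real_polynomial_function p \<Longrightarrow> (\<lambda>x. complex_of_real (p (torus_map x))) \<in> trigpoly"
proof (induction rule: real_polynomial_function.induct)
  case (linear f)
  then interpret bounded_linear f .
  have "f (torus_map x) = (\<Sum>i\<in>UNIV. f (axis i 1, 0) * cos (2 * pi * x $ i))
      + (\<Sum>i\<in>UNIV. f (0, axis i 1) * sin (2 * pi * x $ i))" for x
  proof -
    have "torus_map x = (\<Sum>i\<in>UNIV. cos (2 * pi * x $ i) *\<^sub>R (axis i 1, 0)) + (\<Sum>i\<in>UNIV. sin (2 * pi * x $ i) *\<^sub>R (0, axis i 1))"
      by (simp add: torus_map_def prod_eq_iff fst_sum snd_sum vec_eq_iff axis_def if_distrib cong: if_cong)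
    then show ?thesis
      by (simp add: add sum scaleR mult.commute del: scaleR_Pair)
  qed
  then show ?case
    by (auto simp: intro!: trigpoly_add trigpoly_sum trigpoly_cmult trigpoly_cos trigpoly_sin)
qed (auto intro: trigpoly_const trigpoly_add trigpoly_mult)

text \<open>For a compact K in the open cell, the distance to the image of K must not vanish at cell
  points outside K.\<close>

lemma inj_torus_map: "inj_on torus_map (cellY :: (real ^ 'n) set)"
proof (rule inj_onI)
  fix x y :: "real ^ 'n" assume xy: "x \<in> cellY" "y \<in> cellY" "torus_map x = torus_map y"
  have "x $ i = y $ i" for i
  proof -
    have "sin (2 * pi * x $ i) = sin (2 * pi * y $ i) \<and> cos (2 * pi * x $ i) = cos (2 * pi * y $ i)"
      using xy(3) by (auto simp: torus_map_def vec_eq_iff)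
    then obtain n :: int where "2 * pi * x $ i = 2 * pi * y $ i + 2 * pi * of_int n"
      unfolding sin_cos_eq_iff by auto
    then have "2 * pi * (x $ i - y $ i - of_int n) = 0"
      by (simp add: algebra_simps)
    then have n: "x $ i - y $ i = of_int n"
      by simp
    moreover have "0 < x $ i" "x $ i < 1" "0 < y $ i" "y $ i < 1"
      using xy by (auto simp: cellY_def)
    ultimately have "\<bar>real_of_int n\<bar> < 1"
      by linarith
    then have "n = 0"
      by linarith
    with n show ?thesis
      by simp
  qed
  then show "x = y"
    by (simp add: vec_eq_iff)
qed

lemma continuous_torus_map: "continuous_on S torus_map"
  unfolding torus_map_def by (intro continuous_intros)

lemma integral_trigpoly_eq_0:
  assumes f: "integrable Q f" and fc: "\<And>k. k \<in> Zn \<Longrightarrow> fc f k = 0"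
  shows "g \<in> trigpoly \<Longrightarrow> integrable Q (\<lambda>x. f x * g x) \<and> (LINT x|Q. f x * g x) = 0"
proof (induction rule: trigpoly.induct)
  case (trigpoly_ek k c)
  have "integrable Q (\<lambda>x. c * (f x * ek k x))"
    using integrable_fc[OF f, of "- k"] by (simp add: ek_minus)
  moreover have "(LINT x|Q. c * (f x * ek k x)) = 0"
    using fc[of "- k"] trigpoly_ek by (simp add: fc_def ek_minus)
  moreover have "(\<lambda>x. f x * (c * ek k x)) = (\<lambda>x. c * (f x * ek k x))"
    by (simp add: mult_ac)
  ultimately show ?case
    by (simp only:)
qed (simp add: distrib_left)

text \<open>On the cell, the indicator of K is a pointwise limit of tent functions of the distance
  to the image of K on the torus. Each tent is within 1/(j + 1) of a polynomial there, hence of a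
  trigonometric polynomial in x, and dominated convergence transfers the vanishing of the
  integrals.\<close>

lemma trigpoly_dense_compact:
  assumes f: "integrable Q f" and fc: "\<And>k. k \<in> Zn \<Longrightarrow> fc f k = 0"
    and K: "compact K" "K \<subseteq> cellY"
  shows "(LINT x|Q. f x * indicator K x) = 0"
proof -
  define T where "T = torus_map ` cbox 0 (1 :: real ^ 'a)"
  have T: "compact T"
    unfolding T_def by (intro compact_continuous_image continuous_torus_map compact_cbox)
  \<comment> \<open>\<open>infdist\<close> to the empty set is 0 by convention, which would make the
    tent identically 1; the case distinction gives the indicator of the empty set instead.\<close>
  define G :: "nat \<Rightarrow> _ \<Rightarrow> real" where "G j p = (if K = {} then 0 else max 0 (1 - real j * infdist p (torus_map ` K)))" for j p
  have G_cont: "continuous_on T (G j)" for j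
    unfolding G_def by (cases "K = {}") (auto intro!: continuous_intros)
  have "\<exists>p. real_polynomial_function p \<and> (\<forall>x\<in>T. \<bar>G j x - p x\<bar> < 1 / Suc j)" for j
    by (rule Stone_Weierstrass_real_polynomial_function[OF T G_cont, of "1 / Suc j" j]) auto
  then obtain p where p: "\<And>j. real_polynomial_function (p j)" "\<And>j x. x \<in> T \<Longrightarrow> \<bar>G j x - p j x\<bar> < 1 / Suc j"
    by metis
  have sub: "torus_map x \<in> T" if "x \<in> cellY" for x
    using that unfolding T_def cellY_eq_box by (intro imageI) (auto simp: mem_box_cart less_imp_le)
  have lim: "(\<lambda>j. p j (torus_map x)) \<longlonglongrightarrow> indicator K x" if x: "x \<in> cellY" for x
  proof -
    have 1: "(\<lambda>j. G j (torus_map x) - p j (torus_map x)) \<longlonglongrightarrow> 0"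
    proof (rule Lim_null_comparison)
      show "\<forall>\<^sub>F j in sequentially. norm (G j (torus_map x) - p j (torus_map x)) \<le> inverse (real (Suc j))"
        using p(2)[OF sub[OF x]] by (intro always_eventually) (simp add: less_imp_le inverse_eq_divide)
      show "(\<lambda>j. inverse (real (Suc j))) \<longlonglongrightarrow> 0"
        by (rule LIMSEQ_inverse_real_of_nat)
    qed
    have 2: "(\<lambda>j. G j (torus_map x)) \<longlonglongrightarrow> indicator K x"
    proof (cases "x \<in> K")
      case True
      then have "G j (torus_map x) = 1" for j
        by (auto simp: G_def)
      with True show ?thesis
        by simp
    next
      case False
      show ?thesis
      proof (cases "K = {}")
        case False
        define d where "d = infdist (torus_map x) (torus_map ` K)"
        have "torus_map x \<notin> torus_map ` K"
          using \<open>x \<notin> K\<close> x K(2) inj_torus_map by (auto dest: inj_onD)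
        moreover have "closed (torus_map ` K)"
          by (intro compact_imp_closed compact_continuous_image continuous_torus_map K)
        ultimately have "d > 0"
          unfolding d_def using False infdist_pos_not_in_closed[of "torus_map ` K" "torus_map x"] by auto
        then obtain N :: nat where N: "1 < real N * d"
          using reals_Archimedean3 by blast
        have "\<forall>\<^sub>F j in sequentially. G j (torus_map x) = 0"
          using eventually_ge_at_top[of N]
        proof eventually_elim
          case (elim j)
          have "real N * d \<le> real j * d"
            using elim \<open>d > 0\<close> by (intro mult_right_mono) auto
          with N False show ?case
            by (simp add: G_def d_def)
        qed
        with \<open>x \<notin> K\<close> show ?thesis
          by (simp add: tendsto_eventually)
      qed (simp add: G_def)
    qed
    from tendsto_diff[OF 2 1] show ?thesis
      by simp
  qed
  have bound: "\<bar>p j (torus_map x)\<bar> \<le> 2" if "x \<in> cellY" for x j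
  proof -
    have "\<bar>G j (torus_map x)\<bar> \<le> 1"
      by (auto simp: G_def infdist_nonneg)
    moreover have "1 / real (Suc j) \<le> 1"
      by simp
    ultimately show ?thesis
      using p(2)[OF sub[OF that], of j] by linarith
  qed
  have Kmeas: "K \<in> sets lebesgue"
    using K(1) by (simp add: borel_compact)
  have tp: "integrable Q (\<lambda>x. f x * complex_of_real (p j (torus_map x)))"
    "(LINT x|Q. f x * complex_of_real (p j (torus_map x))) = 0" for j
    using integral_trigpoly_eq_0[OF f fc trigpoly_torus_polynomial[OF p(1)]] by simp_all
  have "(\<lambda>j. LINT x|Q. f x * complex_of_real (p j (torus_map x))) \<longlonglongrightarrow> (LINT x|Q. f x * complex_of_real (indicator K x))"
  proof (rule integral_dominated_convergence[where w = "\<lambda>x. 2 * norm (f x)"])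
    show "(\<lambda>x. f x * complex_of_real (indicator K x)) \<in> borel_measurable Q"
      using Kmeas borel_measurable_integrable[OF f] by measurable
    show "(\<lambda>x. f x * complex_of_real (p j (torus_map x))) \<in> borel_measurable Q" for j
      using tp(1) by (rule borel_measurable_integrable)
    show "integrable Q (\<lambda>x. 2 * norm (f x))"
      using f by simp
    show "AE x in Q. (\<lambda>j. f x * complex_of_real (p j (torus_map x))) \<longlonglongrightarrow> f x * complex_of_real (indicator K x)"
      using lim by (intro AE_I2 tendsto_intros) auto
    show "AE x in Q. norm (f x * complex_of_real (p j (torus_map x))) \<le> 2 * norm (f x)" for j
      using bound by (intro AE_I2) (auto simp: norm_mult mult.commute[of 2] intro!: mult_left_mono)
  qed
  then have "(LINT x|Q. f x * complex_of_real (indicator K x)) = 0"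
    by (simp add: tp LIMSEQ_const_iff)
  moreover have "complex_of_real (indicator K x) = indicator K x" for x
    by (simp add: indicator_def)
  ultimately show ?thesis
    by simp
qed

text \<open>Inner regularity: the set where u > 0 is exhausted up to measure e by a compact subset
  T. The integral of u over T vanishes while u is positive there, so T is null and the whole set has
  measure at most e.\<close>

lemma AE_le_0_if_compact_integral_0:
  fixes u :: "real ^ 'n \<Rightarrow> real"
  assumes u: "integrable Q u" and K: "\<And>K. compact K \<Longrightarrow> K \<subseteq> cellY \<Longrightarrow> (LINT x|Q. u x * indicator K x) = 0"
  shows "AE x in Q. u x \<le> 0"
proof -
  define S where "S = {x \<in> space Q. u x > 0}"
  have "S \<in> sets Q"
    unfolding S_def using borel_measurable_integrable[OF u] by measurable
  then have S: "S \<in> sets lebesgue" "S \<subseteq> cellY"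
    by (auto simp: sets_restrict_space_iff)
  have "emeasure lebesgue S \<le> ennreal e" if "e > 0" for e
  proof -
    obtain T where T: "closed T" "T \<subseteq> S" "emeasure lebesgue (S - T) < ennreal e"
      using sets_lebesgue_inner_closed[OF S(1) \<open>e > 0\<close>] by metis
    have "bounded (cellY :: (real ^ 'n) set)"
      by (simp add: cellY_eq_box)
    then have "compact T"
      using T S by (meson bounded_subset compact_eq_bounded_closed)
    then have Tm: "T \<in> sets lebesgue"
      by (simp add: borel_compact)
    have "(LINT x|Q. u x * indicator T x) = 0"
      using K \<open>compact T\<close> T S by blast
    moreover have "integrable Q (\<lambda>x. u x * indicator T x)"
      by (rule integrable_mult_bounded[OF u, of _ 1])
        (use Tm in \<open>auto simp: indicator_def intro!: measurable_Q\<close>)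
    moreover have "AE x in Q. 0 \<le> u x * indicator T x"
      using T by (intro AE_I2) (auto simp: S_def indicator_def)
    ultimately have "AE x in Q. u x * indicator T x = 0"
      by (simp add: integral_nonneg_eq_0_iff_AE)
    then have "AE x in lebesgue. x \<notin> T"
      unfolding AE_Q using T S by (auto elim!: eventually_mono simp: S_def)
    then have "T \<in> null_sets lebesgue"
      using Tm AE_iff_null_sets by blast
    have "emeasure lebesgue S \<le> emeasure lebesgue T + emeasure lebesgue (S - T)"
      using S Tm T by (metis emeasure_Diff_null_set emeasure_mono eq_iff le_iff_add add.commute \<open>T \<in> null_sets lebesgue\<close> null_setsD1 add_0)
    then show ?thesis
      using T(3) \<open>T \<in> null_sets lebesgue\<close> by (simp add: null_setsD1)
  qed
  then have "emeasure lebesgue S = 0"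
    by (metis ennreal_le_epsilon ennreal_0 add_0 le_zero_eq)
  then have "AE x in lebesgue. x \<notin> S"
    using S(1) by (intro AE_not_in) (simp add: null_sets_def)
  then show ?thesis
    unfolding AE_Q by eventually_elim (auto simp: S_def not_less)
qed

lemma AE_eq_0_if_compact_integral_0:
  fixes u :: "real ^ 'n \<Rightarrow> real"
  assumes u: "integrable Q u" and K: "\<And>K. compact K \<Longrightarrow> K \<subseteq> cellY \<Longrightarrow> (LINT x|Q. u x * indicator K x) = 0"
  shows "AE x in Q. u x = 0"
proof -
  have "AE x in Q. - u x \<le> 0"
    using u K by (intro AE_le_0_if_compact_integral_0) auto
  moreover have "AE x in Q. u x \<le> 0"
    using u K by (rule AE_le_0_if_compact_integral_0)
  ultimately show ?thesis
    by eventually_elim simp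
qed

text \<open>Stated for integrable and not only square-integrable f, because the fundamental lemma
  for weak derivatives applies it to a locally integrable function times a bump.\<close>

theorem fc_eq_0_imp_AE_0:
  assumes f: "integrable Q f" and fc: "\<And>k. k \<in> Zn \<Longrightarrow> fc f k = 0"
  shows "AE x in Q. f x = 0"
proof -
  have *: "(LINT x|Q. Re (f x) * indicator K x) = 0 \<and> (LINT x|Q. Im (f x) * indicator K x) = 0"
    if K: "compact K" "K \<subseteq> cellY" for K
  proof -
    have int: "integrable Q (\<lambda>x. f x * indicator K x)"
    proof (rule integrable_mult_bounded[OF f, of _ 1])
      have "K \<in> sets lebesgue"
        using K(1) by (simp add: borel_compact)
      then show "(indicator K :: _ \<Rightarrow> complex) \<in> borel_measurable Q"
        by (intro measurable_Q) simp
    qed (simp add: indicator_def)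
    have "Re (LINT x|Q. f x * indicator K x) = 0" "Im (LINT x|Q. f x * indicator K x) = 0"
      using trigpoly_dense_compact[OF f fc K] by simp_all
    moreover have "Re (f x * indicator K x) = Re (f x) * indicator K x" "Im (f x * indicator K x) = Im (f x) * indicator K x" for x
      by (auto simp: indicator_def)
    ultimately show ?thesis
      using int by (simp add: integral_Re[symmetric] integral_Im[symmetric] del: integral_Re integral_Im)
  qed
  have "AE x in Q. Re (f x) = 0" "AE x in Q. Im (f x) = 0"
    using f * by (auto intro!: AE_eq_0_if_compact_integral_0)
  then show ?thesis
    by eventually_elim (simp add: complex_eq_iff)
qed

subsection \<open>Square-integrable periodic functions\<close>

text \<open>Values in an arbitrary Euclidean space let one set of lemmas serve real functions and
  complex Fourier sums.\<close>

definition L2p :: "(real ^ 'n \<Rightarrow> 'b :: euclidean_space) set" where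
  "L2p = {f. f \<in> borel_measurable lebesgue \<and> periodic_ae f \<and> integrable Q (\<lambda>x. (norm (f x))\<^sup>2)}"

definition nrm :: "(real ^ 'n \<Rightarrow> 'b :: euclidean_space) \<Rightarrow> real" where
  "nrm f = sqrt (LINT x|Q. (norm (f x))\<^sup>2)"

lemma L2_per_eq: "L2_per = L2p"
  by (simp add: L2_per_def L2p_def set_integrable_Q)

lemma L2pD:
  assumes "f \<in> L2p"
  shows "f \<in> borel_measurable lebesgue" "periodic_ae f" "integrable Q (\<lambda>x. (norm (f x))\<^sup>2)" "f \<in> borel_measurable Q"
  using assms by (auto simp: L2p_def)

lemma nrm_nonneg [simp]: "0 \<le> nrm f"
  by (simp add: nrm_def)

lemma nrm_power2: "(nrm f)\<^sup>2 = (LINT x|Q. (norm (f x))\<^sup>2)"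
  by (simp add: nrm_def)

lemma periodic_ae_comp: "periodic_ae f \<Longrightarrow> periodic_ae (\<lambda>x. h (f x))"
  unfolding periodic_ae_def by (auto elim: eventually_mono)

lemma periodic_ae_comp2:
  assumes "periodic_ae f" "periodic_ae g"
  shows "periodic_ae (\<lambda>x. h (f x) (g x))"
  unfolding periodic_ae_def
proof (intro allI impI)
  fix k :: "real ^ 'a" assume "\<forall>i. k $ i \<in> \<int>"
  then have "AE x in lebesgue. f (x + k) = f x" "AE x in lebesgue. g (x + k) = g x"
    using assms by (auto simp: periodic_ae_def)
  then show "AE x in lebesgue. h (f (x + k)) (g (x + k)) = h (f x) (g x)"
    by eventually_elim simp
qed

lemma periodic_ae_cong_AE:
  assumes "periodic_ae f" "AE x in lebesgue. f x = g x"
  shows "periodic_ae g"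
  unfolding periodic_ae_def
proof (intro allI impI)
  fix k :: "real ^ 'a" assume "\<forall>i. k $ i \<in> \<int>"
  then have "AE x in lebesgue. f (x + k) = f x"
    using assms by (auto simp: periodic_ae_def)
  then show "AE x in lebesgue. g (x + k) = g x"
    using assms(2) AE_shift[OF assms(2), of k] by eventually_elim simp
qed

lemma L2p_bound:
  fixes f :: "real ^ 'n \<Rightarrow> 'b :: euclidean_space" and g :: "real ^ 'n \<Rightarrow> 'c :: euclidean_space"
  assumes f: "f \<in> L2p" and g: "g \<in> borel_measurable lebesgue" "periodic_ae g"
    and le: "AE x in lebesgue. norm (g x) \<le> C * norm (f x)"
  shows "g \<in> L2p" "(nrm g)\<^sup>2 \<le> C\<^sup>2 * (nrm f)\<^sup>2"
proof -
  have le2: "AE x in Q. (norm (g x))\<^sup>2 \<le> C\<^sup>2 * (norm (f x))\<^sup>2"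
    using AE_lebesgue_Q[OF le]
  proof eventually_elim
    case (elim x)
    then have "(norm (g x))\<^sup>2 \<le> (C * norm (f x))\<^sup>2"
      by (intro power_mono) auto
    then show ?case
      by (simp add: power_mult_distrib)
  qed
  have "integrable Q (\<lambda>x. (norm (g x))\<^sup>2)"
  proof (rule Bochner_Integration.integrable_bound)
    show "integrable Q (\<lambda>x. C\<^sup>2 * (norm (f x))\<^sup>2)"
      using L2pD[OF f] by simp
  qed (use le2 g(1) in \<open>auto elim: eventually_mono intro!: measurable_Q\<close>)
  then show "g \<in> L2p"
    using g by (simp add: L2p_def)
  have "(nrm g)\<^sup>2 \<le> (LINT x|Q. C\<^sup>2 * (norm (f x))\<^sup>2)"
    unfolding nrm_power2 using L2pD[OF f] le2 \<open>integrable Q (\<lambda>x. (norm (g x))\<^sup>2)\<close>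
    by (intro integral_mono_AE) auto
  then show "(nrm g)\<^sup>2 \<le> C\<^sup>2 * (nrm f)\<^sup>2"
    by (simp add: nrm_power2)
qed

lemma nrm_bound:
  fixes f :: "real ^ 'n \<Rightarrow> 'b :: euclidean_space" and g :: "real ^ 'n \<Rightarrow> 'c :: euclidean_space"
  assumes "f \<in> L2p" "g \<in> borel_measurable lebesgue" "periodic_ae g"
    and "AE x in lebesgue. norm (g x) \<le> C * norm (f x)" "C \<ge> 0"
  shows "nrm g \<le> C * nrm f"
  using L2p_bound(2)[OF assms(1-4)] assms(5)
  by (metis nrm_nonneg mult_nonneg_nonneg power2_le_imp_le power_mult_distrib)

lemma nrm_cong_AE:
  assumes "AE x in lebesgue. f x = g x" "f \<in> borel_measurable lebesgue" "g \<in> borel_measurable lebesgue"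
  shows "nrm f = nrm g"
proof -
  have "(LINT x|Q. (norm (f x))\<^sup>2) = (LINT x|Q. (norm (g x))\<^sup>2)"
    using AE_lebesgue_Q[OF assms(1)] assms(2,3)
    by (intro integral_cong_AE) (auto elim: eventually_mono intro!: measurable_Q)
  then show ?thesis
    by (simp add: nrm_def)
qed

text \<open>Completeness of Lebesgue measure: whatever g does on the exceptional null set, the
  affected part of a preimage is measurable.\<close>

lemma borel_measurable_cong_AE_lebesgue:
  fixes f g :: "real ^ 'n \<Rightarrow> 'b :: euclidean_space"
  assumes f: "f \<in> borel_measurable lebesgue" and ae: "AE x in lebesgue. f x = g x"
  shows "g \<in> borel_measurable lebesgue"
proof (rule measurableI)
  fix A :: "'b set" assume A: "A \<in> sets borel"
  let ?N = "{x. f x \<noteq> g x}"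
  from ae obtain N where "{x \<in> space lebesgue. f x \<noteq> g x} \<subseteq> N" "N \<in> null_sets lebesgue"
    by (auto elim!: AE_E simp: null_sets_def)
  then have N: "?N \<subseteq> N" "N \<in> null_sets lebesgue"
    by auto
  then have "?N \<in> null_sets lebesgue"
    by (blast intro: null_sets_completion_subset)
  have "f -` A \<in> sets lebesgue"
    using measurable_sets[OF f A] by simp
  then have "(f -` A - ?N) \<union> (g -` A \<inter> ?N) \<in> sets lebesgue"
    using \<open>?N \<in> null_sets lebesgue\<close>
    by (intro sets.Un sets.Diff) (auto intro: null_setsD2 null_sets_completion_subset[of "_ \<inter> ?N" ?N])
  moreover have "(f -` A - ?N) \<union> (g -` A \<inter> ?N) = g -` A"
    by auto
  ultimately show "g -` A \<inter> space lebesgue \<in> sets lebesgue"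
    by simp
qed simp

lemma L2p_cong_AE:
  fixes f g :: "real ^ 'n \<Rightarrow> 'b :: euclidean_space"
  assumes "f \<in> L2p" "AE x in lebesgue. f x = g x"
  shows "g \<in> L2p"
  by (rule L2p_bound(1)[OF assms(1), of _ 1])
    (use assms in \<open>auto intro: borel_measurable_cong_AE_lebesgue[of f] periodic_ae_cong_AE[of f] L2pD elim: eventually_mono\<close>)

lemma L2p_const [simp]: "(\<lambda>x. c) \<in> L2p"
  by (simp add: L2p_def periodic_ae_def)

lemma L2p_bounded:
  assumes "g \<in> borel_measurable lebesgue" "periodic_ae g" "AE x in lebesgue. norm (g x) \<le> C"
  shows "g \<in> L2p"
  by (rule L2p_bound(1)[OF L2p_const[of "1::real"], of _ C]) (use assms in auto)

lemma L2p_scaleR: "f \<in> L2p \<Longrightarrow> (\<lambda>x. c *\<^sub>R f x) \<in> L2p"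
  by (rule L2p_bound(1)[of f _ "\<bar>c\<bar>"]) (auto intro: L2pD periodic_ae_comp dest: L2pD(1))

lemma L2p_minus: "f \<in> L2p \<Longrightarrow> (\<lambda>x. - f x) \<in> L2p"
  using L2p_scaleR[of f "-1"] by simp

lemma L2p_add:
  fixes f g :: "real ^ 'n \<Rightarrow> 'b :: euclidean_space"
  assumes "f \<in> L2p" "g \<in> L2p"
  shows "(\<lambda>x. f x + g x) \<in> L2p"
proof -
  note [measurable] = L2pD(4)[OF assms(1)] L2pD(4)[OF assms(2)]
  have "integrable Q (\<lambda>x. (norm (f x + g x))\<^sup>2)"
  proof (rule Bochner_Integration.integrable_bound)
    show "integrable Q (\<lambda>x. 2 * (norm (f x))\<^sup>2 + 2 * (norm (g x))\<^sup>2)"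
      using L2pD(3)[OF assms(1)] L2pD(3)[OF assms(2)] by simp
    show "AE x in Q. norm ((norm (f x + g x))\<^sup>2) \<le> norm (2 * (norm (f x))\<^sup>2 + 2 * (norm (g x))\<^sup>2)"
    proof (intro AE_I2)
      fix x
      have "(norm (f x + g x))\<^sup>2 \<le> (norm (f x) + norm (g x))\<^sup>2"
        by (intro power_mono norm_triangle_ineq) auto
      also have "\<dots> \<le> 2 * (norm (f x))\<^sup>2 + 2 * (norm (g x))\<^sup>2"
        using sum_squares_bound[of "norm (f x)" "norm (g x)"] by (simp add: power2_sum)
      finally show "norm ((norm (f x + g x))\<^sup>2) \<le> norm (2 * (norm (f x))\<^sup>2 + 2 * (norm (g x))\<^sup>2)"
        by simp
    qed
  qed measurable
  then show ?thesis
    using assms unfolding L2p_def by (auto intro: periodic_ae_comp2)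
qed

lemma L2p_diff:
  fixes f g :: "real ^ 'n \<Rightarrow> 'b :: euclidean_space"
  shows "f \<in> L2p \<Longrightarrow> g \<in> L2p \<Longrightarrow> (\<lambda>x. f x - g x) \<in> L2p"
  using L2p_add[of f "\<lambda>x. - g x"] L2p_minus[of g] by simp

lemma L2p_sum:
  fixes f :: "'i \<Rightarrow> real ^ 'n \<Rightarrow> 'b :: euclidean_space"
  shows "(\<And>i. i \<in> I \<Longrightarrow> f i \<in> L2p) \<Longrightarrow> (\<lambda>x. \<Sum>i\<in>I. f i x) \<in> L2p"
  by (induction I rule: infinite_finite_induct) (auto intro: L2p_add)

lemma L2p_cmult: "f \<in> L2p \<Longrightarrow> (\<lambda>x. (c::real) * f x) \<in> L2p"
  using L2p_scaleR[of f c] by simp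

lemma L2p_mult_bounded:
  fixes f a :: "real ^ 'n \<Rightarrow> real"
  assumes f: "f \<in> L2p" and a: "a \<in> borel_measurable lebesgue" "periodic_ae a" "AE x in lebesgue. \<bar>a x\<bar> \<le> C"
  shows "(\<lambda>x. a x * f x) \<in> L2p"
proof (rule L2p_bound(1)[OF f, of _ C])
  show "(\<lambda>x. a x * f x) \<in> borel_measurable lebesgue"
    using L2pD(1)[OF f] a(1) by measurable
  show "periodic_ae (\<lambda>x. a x * f x)"
    using L2pD(2)[OF f] a(2) by (rule periodic_ae_comp2[rotated])
  show "AE x in lebesgue. norm (a x * f x) \<le> C * norm (f x)"
    using a(3) by eventually_elim (simp add: abs_mult mult_right_mono)
qed

lemma L2p_shift:
  fixes f :: "real ^ 'n \<Rightarrow> 'b :: euclidean_space"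
  assumes "f \<in> L2p"
  shows "(\<lambda>x. f (x + h)) \<in> L2p" "nrm (\<lambda>x. f (x + h)) = nrm f"
proof -
  have *: "periodic_ae (\<lambda>x. (norm (f x))\<^sup>2)" "(\<lambda>x. (norm (f x))\<^sup>2) \<in> borel_measurable lebesgue"
    using L2pD[OF assms] by (auto intro: periodic_ae_comp)
  show "(\<lambda>x. f (x + h)) \<in> L2p"
    using L2pD[OF assms] integrable_Q_shift[OF * L2pD(3)[OF assms]]
    by (auto simp: L2p_def intro: periodic_ae_shift borel_measurable_shift)
  show "nrm (\<lambda>x. f (x + h)) = nrm f"
    unfolding nrm_def using integral_Q_shift[OF * L2pD(3)[OF assms]] by simp
qed

lemma integrable_norm_mult:
  fixes f :: "real ^ 'n \<Rightarrow> 'b :: euclidean_space" and g :: "real ^ 'n \<Rightarrow> 'c :: euclidean_space"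
  assumes "f \<in> L2p" "g \<in> L2p"
  shows "integrable Q (\<lambda>x. norm (f x) * norm (g x))"
proof (rule Bochner_Integration.integrable_bound)
  show "integrable Q (\<lambda>x. (norm (f x))\<^sup>2 + (norm (g x))\<^sup>2)"
    using L2pD(3)[OF assms(1)] L2pD(3)[OF assms(2)] by simp
  show "(\<lambda>x. norm (f x) * norm (g x)) \<in> borel_measurable Q"
    using L2pD(4)[OF assms(1)] L2pD(4)[OF assms(2)] by measurable
  have "norm (f x) * norm (g x) \<le> (norm (f x))\<^sup>2 + (norm (g x))\<^sup>2" for x
    using sum_squares_bound[of "norm (f x)" "norm (g x)"] mult_nonneg_nonneg[OF norm_ge_zero norm_ge_zero, of "f x" "g x"]
    by linarith
  then show "AE x in Q. norm (norm (f x) * norm (g x)) \<le> norm ((norm (f x))\<^sup>2 + (norm (g x))\<^sup>2)"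
    by (intro AE_I2) simp
qed

lemma integrable_inner:
  fixes f g :: "real ^ 'n \<Rightarrow> 'b :: euclidean_space"
  assumes "f \<in> L2p" "g \<in> L2p"
  shows "integrable Q (\<lambda>x. f x \<bullet> g x)"
proof (rule Bochner_Integration.integrable_bound[OF integrable_norm_mult[OF assms]])
  show "(\<lambda>x. f x \<bullet> g x) \<in> borel_measurable Q"
    using L2pD(4)[OF assms(1)] L2pD(4)[OF assms(2)] by measurable
qed (intro AE_I2, simp add: Cauchy_Schwarz_ineq2)

lemma L2p_integrable:
  fixes f :: "real ^ 'n \<Rightarrow> 'b :: euclidean_space"
  assumes "f \<in> L2p"
  shows "integrable Q f"
  using integrable_norm_mult[OF assms L2p_const[of "1::real"]] L2pD(4)[OF assms]
  by (simp add: integrable_norm_iff)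

lemma nrm_eq_0_iff:
  fixes f :: "real ^ 'n \<Rightarrow> 'b :: euclidean_space"
  assumes "f \<in> L2p"
  shows "nrm f = 0 \<longleftrightarrow> (AE x in lebesgue. f x = 0)"
proof -
  have "nrm f = 0 \<longleftrightarrow> (LINT x|Q. (norm (f x))\<^sup>2) = 0"
    by (simp add: nrm_def)
  also have "\<dots> \<longleftrightarrow> (AE x in Q. f x = 0)"
    using L2pD[OF assms] by (subst integral_nonneg_eq_0_iff_AE) auto
  also have "\<dots> \<longleftrightarrow> (AE x in lebesgue. f x = 0)"
    using AE_eq_periodic_extend[OF L2pD(2)[OF assms], of "\<lambda>_. 0"] AE_lebesgue_Q
    by (auto simp: periodic_ae_def)
  finally show ?thesis .
qed

lemma integral_norm_mult_le:
  fixes f :: "real ^ 'n \<Rightarrow> 'b :: euclidean_space" and g :: "real ^ 'n \<Rightarrow> 'c :: euclidean_space"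
  assumes f: "f \<in> L2p" and g: "g \<in> L2p"
  shows "(LINT x|Q. norm (f x) * norm (g x)) \<le> nrm f * nrm g"
proof -
  note [measurable] = L2pD(4)[OF assms(1)] L2pD(4)[OF assms(2)]
  note int = integrable_norm_mult[OF assms]
  \<comment> \<open>Crossed weights: with a the norm of g and b the norm of f, both squares in the
    expansion of (a |f| - b |g|)^2 integrate to a^2 b^2, and division by a b leaves the
    Cauchy-Schwarz inequality.\<close>
  define a b where "a = nrm g" and "b = nrm f"
  have a2: "(LINT x|Q. (norm (g x))\<^sup>2) = a\<^sup>2" and b2: "(LINT x|Q. (norm (f x))\<^sup>2) = b\<^sup>2"
    by (simp_all add: a_def b_def nrm_power2)
  show "(LINT x|Q. norm (f x) * norm (g x)) \<le> nrm f * nrm g"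
  proof (cases "a = 0 \<or> b = 0")
    case True
    then have "AE x in lebesgue. norm (f x) * norm (g x) = 0"
      using nrm_eq_0_iff[OF f] nrm_eq_0_iff[OF g] by (auto simp: a_def b_def elim: eventually_mono)
    then have ae: "AE x in Q. norm (f x) * norm (g x) = 0"
      by (rule AE_lebesgue_Q)
    have "(LINT x|Q. norm (f x) * norm (g x)) = (LINT x|(Q :: (real ^ 'n) measure). 0)"
    proof (rule integral_cong_AE[OF _ _ ae])
      show "(\<lambda>x. norm (f x) * norm (g x)) \<in> borel_measurable Q"
        by measurable
    qed simp
    then show ?thesis
      by simp
  next
    case False
    then have ab: "a * b > 0"
      using nrm_nonneg[of f] nrm_nonneg[of g] by (auto simp: a_def b_def zero_less_mult_iff order.order_iff_strict)
    have "0 \<le> (LINT x|Q. (a * norm (f x) - b * norm (g x))\<^sup>2)"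
      by (intro Bochner_Integration.integral_nonneg) simp
    also have "\<dots> = (LINT x|Q. a\<^sup>2 * (norm (f x))\<^sup>2 + b\<^sup>2 * (norm (g x))\<^sup>2 - (2 * (a * b)) * (norm (f x) * norm (g x)))"
      by (intro Bochner_Integration.integral_cong) (auto simp: power2_diff power_mult_distrib algebra_simps)
    also have "\<dots> = a\<^sup>2 * b\<^sup>2 + b\<^sup>2 * a\<^sup>2 - (2 * (a * b)) * (LINT x|Q. norm (f x) * norm (g x))"
      using int L2pD(3)[OF f] L2pD(3)[OF g] by (simp add: a2 b2)
    finally have "(a * b) * (LINT x|Q. norm (f x) * norm (g x)) \<le> (a * b) * (a * b)"
      by (simp add: power2_eq_square algebra_simps)
    then have "(LINT x|Q. norm (f x) * norm (g x)) \<le> a * b"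
      using ab by (simp only: mult_le_cancel_left_pos)
    then show ?thesis
      by (simp add: a_def b_def mult.commute)
  qed
qed

lemma integral_inner_le:
  fixes f g :: "real ^ 'n \<Rightarrow> 'b :: euclidean_space"
  assumes "f \<in> L2p" "g \<in> L2p"
  shows "\<bar>LINT x|Q. f x \<bullet> g x\<bar> \<le> nrm f * nrm g"
proof -
  have "\<bar>LINT x|Q. f x \<bullet> g x\<bar> \<le> (LINT x|Q. norm (f x) * norm (g x))"
    using Bochner_Integration.integral_norm_bound_integral[OF integrable_inner[OF assms] integrable_norm_mult[OF assms]]
    by (simp add: Cauchy_Schwarz_ineq2)
  with integral_norm_mult_le[OF assms] show ?thesis
    by simp
qed

lemma nrm_add_power2:
  fixes f g :: "real ^ 'n \<Rightarrow> 'b :: euclidean_space"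
  assumes "f \<in> L2p" "g \<in> L2p"
  shows "(nrm (\<lambda>x. f x + g x))\<^sup>2 = (nrm f)\<^sup>2 + (nrm g)\<^sup>2 + 2 * (LINT x|Q. f x \<bullet> g x)"
proof -
  have "(norm (f x + g x))\<^sup>2 = (norm (f x))\<^sup>2 + (norm (g x))\<^sup>2 + 2 * (f x \<bullet> g x)" for x
    by (simp add: power2_norm_eq_inner inner_add_left inner_add_right inner_commute)
  then show ?thesis
    using L2pD(3)[OF assms(1)] L2pD(3)[OF assms(2)] integrable_inner[OF assms] by (simp add: nrm_power2)
qed

lemma nrm_triangle:
  fixes f g :: "real ^ 'n \<Rightarrow> 'b :: euclidean_space"
  assumes "f \<in> L2p" "g \<in> L2p"
  shows "nrm (\<lambda>x. f x + g x) \<le> nrm f + nrm g"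
proof (rule power2_le_imp_le)
  show "(nrm (\<lambda>x. f x + g x))\<^sup>2 \<le> (nrm f + nrm g)\<^sup>2"
    using integral_inner_le[OF assms] by (simp add: nrm_add_power2[OF assms] power2_sum)
qed simp

lemma nrm_scaleR: "nrm (\<lambda>x. c *\<^sub>R f x) = \<bar>c\<bar> * nrm f"
  by (simp add: nrm_def power_mult_distrib real_sqrt_mult)

lemma nrm_minus_commute: "nrm (\<lambda>x. f x - g x) = nrm (\<lambda>x. g x - f x)"
  by (simp add: nrm_def norm_minus_commute)

lemma nrm_triangle_diff:
  fixes f g h :: "real ^ 'n \<Rightarrow> 'b :: euclidean_space"
  assumes "f \<in> L2p" "g \<in> L2p" "h \<in> L2p"
  shows "nrm (\<lambda>x. f x - h x) \<le> nrm (\<lambda>x. f x - g x) + nrm (\<lambda>x. g x - h x)"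
  using nrm_triangle[OF L2p_diff[OF assms(1,2)] L2p_diff[OF assms(2,3)]] by simp

lemma nrm_sum:
  fixes f :: "'i \<Rightarrow> real ^ 'n \<Rightarrow> 'b :: euclidean_space"
  shows "(\<And>i. i \<in> I \<Longrightarrow> f i \<in> L2p) \<Longrightarrow> nrm (\<lambda>x. \<Sum>i\<in>I. f i x) \<le> (\<Sum>i\<in>I. nrm (f i))"
proof (induction I rule: infinite_finite_induct)
  case (insert i I)
  then have "nrm (\<lambda>x. \<Sum>i\<in>insert i I. f i x) \<le> nrm (f i) + nrm (\<lambda>x. \<Sum>i\<in>I. f i x)"
    by (simp add: nrm_triangle L2p_sum)
  with insert show ?case
    by fastforce
qed (simp_all add: nrm_def)

lemma integral_norm_le_nrm:
  fixes f :: "real ^ 'n \<Rightarrow> 'b :: euclidean_space"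
  assumes "f \<in> L2p"
  shows "(LINT x|Q. norm (f x)) \<le> nrm f"
  using integral_norm_mult_le[OF assms L2p_const[of "1::real"]] by (simp add: nrm_def[of "\<lambda>_. 1"])

text \<open>Fatou's lemma. It turns Cauchy estimates for f n - f m into estimates for f n - g once f
  m converges to g almost everywhere, and gives square-integrability of the limit at the same
  time.\<close>

lemma fatou_L2:
  fixes h :: "nat \<Rightarrow> real ^ 'n \<Rightarrow> 'b :: euclidean_space"
  assumes h: "\<And>j. h j \<in> L2p" and ae: "AE x in lebesgue. (\<lambda>j. h j x) \<longlonglongrightarrow> g x"
    and g: "g \<in> borel_measurable lebesgue" "periodic_ae g"
    and C: "\<forall>\<^sub>F j in sequentially. nrm (h j) \<le> C"
  shows "g \<in> L2p" "nrm g \<le> C"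
proof -
  note [measurable] = L2pD(4)[OF h] measurable_Q[OF g(1)]
  have C0: "C \<ge> 0"
    using eventually_happens[OF C] nrm_nonneg order_trans by (metis sequentially_bot)
  have nn: "(\<integral>\<^sup>+x. ennreal ((norm (h j x))\<^sup>2) \<partial>Q) = ennreal ((nrm (h j))\<^sup>2)" for j
    unfolding nrm_power2 using L2pD(3)[OF h] by (intro nn_integral_eq_integral) auto
  have "(\<integral>\<^sup>+x. ennreal ((norm (g x))\<^sup>2) \<partial>Q) = (\<integral>\<^sup>+x. liminf (\<lambda>j. ennreal ((norm (h j x))\<^sup>2)) \<partial>Q)"
  proof (rule nn_integral_cong_AE)
    show "AE x in Q. ennreal ((norm (g x))\<^sup>2) = liminf (\<lambda>j. ennreal ((norm (h j x))\<^sup>2))"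
      using AE_lebesgue_Q[OF ae]
    proof eventually_elim
      case (elim x)
      then have "(\<lambda>j. ennreal ((norm (h j x))\<^sup>2)) \<longlonglongrightarrow> ennreal ((norm (g x))\<^sup>2)"
        by (intro tendsto_intros)
      then show ?case
        by (intro lim_imp_Liminf[symmetric]) auto
    qed
  qed
  also have "\<dots> \<le> liminf (\<lambda>j. \<integral>\<^sup>+x. ennreal ((norm (h j x))\<^sup>2) \<partial>Q)"
    by (intro nn_integral_liminf) measurable
  also have "\<dots> \<le> ennreal (C\<^sup>2)"
  proof -
    have "liminf (\<lambda>j. ennreal ((nrm (h j))\<^sup>2)) \<le> limsup (\<lambda>j. ennreal ((nrm (h j))\<^sup>2))"
      by (rule Liminf_le_Limsup) simp
    also have "\<dots> \<le> ennreal (C\<^sup>2)"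
      by (rule Limsup_bounded, use C in eventually_elim) (auto intro!: ennreal_leI power_mono)
    finally show ?thesis
      by (simp add: nn)
  qed
  finally have le: "(\<integral>\<^sup>+x. ennreal ((norm (g x))\<^sup>2) \<partial>Q) \<le> ennreal (C\<^sup>2)" .
  then have int: "integrable Q (\<lambda>x. (norm (g x))\<^sup>2)"
    by (intro integrableI_bounded) (auto intro: le_less_trans)
  then show "g \<in> L2p"
    using g by (simp add: L2p_def)
  have "ennreal ((nrm g)\<^sup>2) \<le> ennreal (C\<^sup>2)"
    using le int by (simp add: nrm_power2 nn_integral_eq_integral)
  then have "(nrm g)\<^sup>2 \<le> C\<^sup>2"
    by simp
  then show "nrm g \<le> C"
    using C0 by (rule power2_le_imp_le)
qed

text \<open>The cell has measure 1, so the L1 norm is at most the L2 norm. Monotone convergence then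
  gives the sum of \<open>norm (u j x)\<close> a finite integral, hence finite values almost
  everywhere.\<close>

lemma summable_nrm_AE_convergent:
  fixes u :: "nat \<Rightarrow> real ^ 'n \<Rightarrow> 'b :: euclidean_space"
  assumes u: "\<And>j. u j \<in> L2p" and sm: "summable (\<lambda>j. nrm (u j))"
  shows "AE x in Q. summable (\<lambda>j. norm (u j x))"
proof -
  note [measurable] = L2pD(4)[OF u]
  have "(\<integral>\<^sup>+x. (\<Sum>j. ennreal (norm (u j x))) \<partial>Q) = (\<Sum>j. \<integral>\<^sup>+x. ennreal (norm (u j x)) \<partial>Q)"
    by (intro nn_integral_suminf) measurable
  also have "\<dots> = (\<Sum>j. ennreal (LINT x|Q. norm (u j x)))"
    using L2p_integrable[OF u] by (subst nn_integral_eq_integral) auto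
  also have "\<dots> \<le> (\<Sum>j. ennreal (nrm (u j)))"
    by (intro suminf_le ennreal_leI integral_norm_le_nrm u) auto
  also have "\<dots> < \<infinity>"
    using sm by (simp add: suminf_ennreal2)
  finally have "AE x in Q. (\<Sum>j. ennreal (norm (u j x))) \<noteq> \<infinity>"
    by (intro nn_integral_PInf_AE) auto
  then show ?thesis
    by eventually_elim (auto intro!: summable_suminf_not_top)
qed

text \<open>Riesz's proof: a subsequence with geometrically decreasing gaps converges almost
  everywhere, and Fatou's lemma turns its pointwise limit into a limit in norm.\<close>

theorem L2p_complete:
  fixes f :: "nat \<Rightarrow> real ^ 'n \<Rightarrow> 'b :: euclidean_space"
  assumes f: "\<And>n. f n \<in> L2p"
    and cauchy: "\<And>e. e > 0 \<Longrightarrow> \<exists>N. \<forall>m\<ge>N. \<forall>n\<ge>N. nrm (\<lambda>x. f m x - f n x) \<le> e"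
  obtains g where "g \<in> L2p" "(\<lambda>n. nrm (\<lambda>x. f n x - g x)) \<longlonglongrightarrow> 0"
proof -
  obtain N where N: "\<And>k m n. m \<ge> N k \<Longrightarrow> n \<ge> N k \<Longrightarrow> nrm (\<lambda>x. f m x - f n x) \<le> (1/2) ^ k"
    using cauchy[of "(1/2) ^ _"] by (metis zero_less_power half_gt_zero_iff zero_less_one)
  \<comment> \<open>Summing the thresholds makes \<open>s\<close> monotone and keeps it above every
    \<open>N k\<close>.\<close>
  define s where "s k = (\<Sum>i\<le>k. N i)" for k
  have s: "s k \<ge> N k" "s (Suc k) \<ge> s k" for k
    by (auto simp: s_def intro!: member_le_sum)
  have s_mono: "s j \<ge> N k" if "j \<ge> k" for j k
    using s(1)[of k] lift_Suc_mono_le[of s k j] s(2) that by (meson order_trans)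
  \<comment> \<open>Where the subsequence diverges, \<open>lim\<close> has some default value, but
    one that depends only on the sequence of values; so g inherits periodicity without a case
    distinction.\<close>
  define g where "g x = lim (\<lambda>k. f (s k) x)" for x
  have conv: "AE x in Q. (\<lambda>k. f (s k) x) \<longlonglongrightarrow> g x"
  proof -
    have "AE x in Q. summable (\<lambda>j. norm (f (s (Suc j)) x - f (s j) x))"
    proof (rule summable_nrm_AE_convergent[OF L2p_diff[OF f f]])
      have "nrm (\<lambda>x. f (s (Suc j)) x - f (s j) x) \<le> (1/2) ^ j" for j
        using s_mono[of j j] s_mono[of j "Suc j"] by (intro N) auto
      then have *: "norm (nrm (\<lambda>x. f (s (Suc j)) x - f (s j) x)) \<le> (1/2) ^ j" for j
        unfolding real_norm_def abs_of_nonneg[OF nrm_nonneg] .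
      have "summable (\<lambda>j. (1/2::real) ^ j)"
        by (rule summable_geometric) simp
      then show "summable (\<lambda>j. nrm (\<lambda>x. f (s (Suc j)) x - f (s j) x))"
        by (rule summable_comparison_test'[OF _ *])
    qed
    then show ?thesis
    proof eventually_elim
      case (elim x)
      then have "summable (\<lambda>j. f (s (Suc j)) x - f (s j) x)"
        by (rule summable_norm_cancel)
      then have "convergent (\<lambda>k. f (s k) x)"
        unfolding summable_iff_convergent sum_lessThan_telescope[of "\<lambda>k. f (s k) x"]
        by (simp add: convergent_diff_const_right_iff)
      then show ?case
        by (simp add: g_def convergent_LIMSEQ_iff)
    qed
  qed
  have gper: "periodic_ae g"
  proof (rule periodic_aeI)
    fix m :: "real ^ 'n" assume "m \<in> Zn"
    then have "AE x in lebesgue. \<forall>k. f (s k) (x + m) = f (s k) x"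
      by (simp add: AE_all_countable periodic_aeD L2pD(2)[OF f])
    then show "AE x in lebesgue. g (x + m) = g x"
      by eventually_elim (simp add: g_def)
  qed
  have gmeas: "g \<in> borel_measurable lebesgue"
    unfolding g_def by (intro borel_measurable_lim_metric L2pD f)
  have conv': "AE x in lebesgue. (\<lambda>k. f (s k) x) \<longlonglongrightarrow> g x"
  proof (rule AE_periodic_extend[OF _ conv])
    fix m :: "real ^ 'n" assume m: "m \<in> Zn"
    then have "AE x in lebesgue. \<forall>k. f (s k) (x + m) = f (s k) x"
      by (simp add: AE_all_countable periodic_aeD L2pD(2)[OF f])
    then show "AE x in lebesgue. ((\<lambda>k. f (s k) (x + m)) \<longlonglongrightarrow> g (x + m)) \<longleftrightarrow> (\<lambda>k. f (s k) x) \<longlonglongrightarrow> g x"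
      using periodic_aeD[OF gper m] by eventually_elim simp
  qed
  have fg: "(\<lambda>x. f n x - g x) \<in> L2p" "n \<ge> N k \<Longrightarrow> nrm (\<lambda>x. f n x - g x) \<le> (1/2) ^ k" for n k
  proof -
    have meas: "(\<lambda>x. f n x - g x) \<in> borel_measurable lebesgue" "periodic_ae (\<lambda>x. f n x - g x)"
      using L2pD[OF f] gmeas gper by (auto intro: periodic_ae_comp2)
    have ae: "AE x in lebesgue. (\<lambda>j. f n x - f (s j) x) \<longlonglongrightarrow> f n x - g x"
      using conv' by eventually_elim (intro tendsto_intros)
    have *: "\<forall>\<^sub>F j in sequentially. nrm (\<lambda>x. f n x - f (s j) x) \<le> (1/2) ^ k" if "n \<ge> N k" for n k
      using eventually_ge_at_top[of k] by eventually_elim (use that in \<open>intro N s_mono\<close>)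
    show "nrm (\<lambda>x. f n x - g x) \<le> (1/2) ^ k" if "n \<ge> N k"
      by (rule fatou_L2(2)[OF L2p_diff[OF f f] ae meas *[OF that]])
    have "(\<lambda>x. f (N 0) x - g x) \<in> L2p"
    proof (rule fatou_L2(1)[OF L2p_diff[OF f f] _ _ _ *[of 0, OF order.refl]])
      show "AE x in lebesgue. (\<lambda>j. f (N 0) x - f (s j) x) \<longlonglongrightarrow> f (N 0) x - g x"
        using conv' by eventually_elim (intro tendsto_intros)
      show "(\<lambda>x. f (N 0) x - g x) \<in> borel_measurable lebesgue" "periodic_ae (\<lambda>x. f (N 0) x - g x)"
        using L2pD[OF f] gmeas gper by (auto intro: periodic_ae_comp2)
    qed
    from L2p_add[OF L2p_diff[OF f[of n] f[of "N 0"]] this] show "(\<lambda>x. f n x - g x) \<in> L2p"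
      by simp
  qed
  show thesis
  proof
    show "g \<in> L2p"
      using L2p_diff[OF f[of 0] fg(1)[of 0]] by simp
    show "(\<lambda>n. nrm (\<lambda>x. f n x - g x)) \<longlonglongrightarrow> 0"
    proof (rule LIMSEQ_I)
      fix r :: real assume "r > 0"
      then obtain k where "(1/2::real) ^ k < r"
        using real_arch_pow_inv[of r "1/2"] by auto
      then show "\<exists>no. \<forall>n\<ge>no. norm (nrm (\<lambda>x. f n x - g x) - 0) < r"
        using fg(2) by (intro exI[of _ "N k"]) (auto intro: le_less_trans)
    qed
  qed
qed

subsection \<open>The Riesz--Fischer theorem and Parseval's identity\<close>

lemma ek_L2p: "k \<in> Zn \<Longrightarrow> ek k \<in> L2p"
  by (rule L2p_bounded[of _ 1]) (auto simp: ek_periodic)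

lemma ek_minus_eq: "ek (- k) = (\<lambda>x. cnj (ek k x))"
  by (simp add: fun_eq_iff ek_minus)

lemma borel_measurable_cnj: "f \<in> borel_measurable M \<Longrightarrow> (\<lambda>x. cnj (f x)) \<in> borel_measurable M"
  by (rule measurable_compose[OF _ borel_measurable_continuous_onI]) (auto intro: continuous_intros)

lemma L2p_cmult_complex:
  fixes c :: complex
  assumes "f \<in> L2p"
  shows "(\<lambda>x. c * f x) \<in> L2p"
  using L2pD[OF assms]
  by (intro L2p_bound(1)[OF assms, of _ "cmod c"]) (auto intro: periodic_ae_comp simp: norm_mult)

lemma L2p_ek_sum: "F \<subseteq> Zn \<Longrightarrow> (\<lambda>x. \<Sum>k\<in>F. a k * ek k x) \<in> L2p"
  by (intro L2p_sum L2p_cmult_complex ek_L2p) auto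

lemma fc_add: "integrable Q f \<Longrightarrow> integrable Q g \<Longrightarrow> fc (\<lambda>x. f x + g x) k = fc f k + fc g k"
  by (simp add: fc_def distrib_right integrable_fc)

lemma fc_diff: "integrable Q f \<Longrightarrow> integrable Q g \<Longrightarrow> fc (\<lambda>x. f x - g x) k = fc f k - fc g k"
  by (simp add: fc_def left_diff_distrib integrable_fc)

lemma fc_cmult: "fc (\<lambda>x. c * f x) k = c * fc f k"
  by (simp add: fc_def mult.assoc)

lemma fc_cong_AE:
  assumes "AE x in lebesgue. f x = g x" "f \<in> borel_measurable lebesgue" "g \<in> borel_measurable lebesgue"
  shows "fc f k = fc g k"
proof -
  have "(\<lambda>x. cnj (ek k x)) \<in> borel_measurable lebesgue"
    by (intro borel_measurable_cnj) simp
  then show ?thesis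
    unfolding fc_def using assms AE_lebesgue_Q[OF assms(1)]
    by (intro integral_cong_AE borel_measurable_times measurable_Q) (auto elim: eventually_mono)
qed

lemma norm_fc_le:
  assumes "f \<in> L2p"
  shows "norm (fc f k) \<le> nrm f"
proof -
  have "norm (fc f k) \<le> (LINT x|Q. norm (f x * cnj (ek k x)))"
    unfolding fc_def by (rule integral_norm_bound)
  also have "\<dots> = (LINT x|Q. norm (f x))"
    by (simp add: norm_mult)
  finally show ?thesis
    using integral_norm_le_nrm[OF assms] by simp
qed

lemma fc_ek_sum:
  assumes "finite F" "F \<subseteq> Zn" "k \<in> Zn"
  shows "fc (\<lambda>x. \<Sum>l\<in>F. a l * ek l x) k = (if k \<in> F then a k else 0)"
  using assms(1,2)
proof (induction F rule: finite_induct)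
  case empty
  then show ?case by (simp add: fc_def)
next
  case (insert l F)
  have "integrable Q (\<lambda>x. a l * ek l x)" "integrable Q (\<lambda>x. \<Sum>l\<in>F. a l * ek l x)"
    by auto
  then have "fc (\<lambda>x. a l * ek l x + (\<Sum>l\<in>F. a l * ek l x)) k = a l * fc (ek l) k + fc (\<lambda>x. \<Sum>l\<in>F. a l * ek l x) k"
    by (simp only: fc_add fc_cmult)
  with insert show ?case
    using assms(3) by (auto simp: fc_ek)
qed

lemma integral_inner_ek_sum:
  assumes "finite F" "F \<subseteq> Zn" "f \<in> L2p"
  shows "(LINT x|Q. f x \<bullet> (\<Sum>k\<in>F. a k * ek k x)) = (\<Sum>k\<in>F. Re (fc f k * cnj (a k)))"
proof -
  have int: "integrable Q (\<lambda>x. f x * cnj (ek k x) * cnj (a k))" for k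
    using integrable_fc[OF L2p_integrable[OF assms(3)]] by simp
  have "f x \<bullet> (\<Sum>k\<in>F. a k * ek k x) = Re (\<Sum>k\<in>F. f x * cnj (ek k x) * cnj (a k))" for x
    unfolding inner_sum_right Re_sum by (intro sum.cong) (auto simp: inner_complex_def algebra_simps)
  then have "(LINT x|Q. f x \<bullet> (\<Sum>k\<in>F. a k * ek k x)) = (LINT x|Q. Re (\<Sum>k\<in>F. f x * cnj (ek k x) * cnj (a k)))"
    by simp
  also have "\<dots> = Re (LINT x|Q. (\<Sum>k\<in>F. f x * cnj (ek k x) * cnj (a k)))"
    using int by (intro integral_Re) auto
  also have "\<dots> = (\<Sum>k\<in>F. Re (fc f k * cnj (a k)))"
    using int by (simp add: fc_def)
  finally show ?thesis .
qed

lemma nrm_ek_sum: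
  assumes "finite F" "F \<subseteq> Zn"
  shows "(nrm (\<lambda>x. \<Sum>k\<in>F. a k * ek k x))\<^sup>2 = (\<Sum>k\<in>F. (cmod (a k))\<^sup>2)"
proof -
  have "(nrm (\<lambda>x. \<Sum>k\<in>F. a k * ek k x))\<^sup>2 = (LINT x|Q. (\<Sum>k\<in>F. a k * ek k x) \<bullet> (\<Sum>k\<in>F. a k * ek k x))"
    by (simp add: nrm_power2 power2_norm_eq_inner)
  also have "\<dots> = (\<Sum>k\<in>F. (cmod (a k))\<^sup>2)"
    using assms by (subst integral_inner_ek_sum)
      (auto simp: L2p_ek_sum fc_ek_sum subset_iff complex_mult_cnj cmod_power2 intro!: sum.cong)
  finally show ?thesis .
qed

text \<open>Pythagoras: the cross term contributes -2 times the sum of the squared coefficients, the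
  projection itself contributes that sum once.\<close>

lemma nrm_minus_projection:
  assumes "finite F" "F \<subseteq> Zn" "f \<in> L2p"
  shows "(nrm (\<lambda>x. f x - (\<Sum>k\<in>F. fc f k * ek k x)))\<^sup>2 = (nrm f)\<^sup>2 - (\<Sum>k\<in>F. (cmod (fc f k))\<^sup>2)"
proof -
  let ?p = "\<lambda>x. \<Sum>k\<in>F. (- fc f k) * ek k x"
  have "(nrm (\<lambda>x. f x + ?p x))\<^sup>2 = (nrm f)\<^sup>2 + (nrm ?p)\<^sup>2 + 2 * (LINT x|Q. f x \<bullet> ?p x)"
    using assms by (intro nrm_add_power2 L2p_ek_sum)
  also have "\<dots> = (nrm f)\<^sup>2 - (\<Sum>k\<in>F. (cmod (fc f k))\<^sup>2)"
  proof -
    have "Re (fc f k * cnj (- fc f k)) = - (cmod (fc f k))\<^sup>2" for k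
      by (simp add: cmod_power2) (simp add: power2_eq_square)
    then show ?thesis
      unfolding nrm_ek_sum[OF assms(1,2)] integral_inner_ek_sum[OF assms] by (simp add: sum_negf)
  qed
  finally show ?thesis
    by (simp add: sum_negf)
qed

lemma bessel:
  assumes "finite F" "F \<subseteq> Zn" "f \<in> L2p"
  shows "(\<Sum>k\<in>F. (cmod (fc f k))\<^sup>2) \<le> (nrm f)\<^sup>2"
proof -
  have "0 \<le> (nrm f)\<^sup>2 - (\<Sum>k\<in>F. (cmod (fc f k))\<^sup>2)"
    unfolding nrm_minus_projection[OF assms, symmetric] by simp
  then show ?thesis
    by simp
qed

text \<open>\<open>has_sum\<close> over \<open>Zn\<close> is convergence along finite subsets. An
  increasing sequence of cubes that absorbs every finite subset turns it into convergence of a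
  sequence, as \<open>L2p_complete\<close> requires.\<close>

lemma exhaust_Zn:
  obtains F :: "nat \<Rightarrow> (real ^ 'n) set" where
    "\<And>n. finite (F n)" "\<And>n. F n \<subseteq> Zn" "\<And>m n. m \<le> n \<Longrightarrow> F m \<subseteq> F n"
    "\<And>G. finite G \<Longrightarrow> G \<subseteq> Zn \<Longrightarrow> \<exists>N. \<forall>n\<ge>N. G \<subseteq> F n"
proof -
  define F where "F n = {k \<in> (Zn :: (real ^ 'n) set). \<forall>i. \<bar>k $ i\<bar> \<le> real n}" for n
  show thesis
  proof
    show "finite (F n)" for n
      unfolding F_def by (rule finite_Zn_bounded)
    show "F m \<subseteq> F n" if "m \<le> n" for m n
      using that by (auto simp: F_def intro: order_trans)
    show "\<exists>N. \<forall>n\<ge>N. G \<subseteq> F n" if G: "finite G" "G \<subseteq> Zn" for G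
    proof (intro exI[of _ "nat \<lceil>\<Sum>k\<in>G. norm k\<rceil>"] allI impI subsetI)
      fix n k assume n: "n \<ge> nat \<lceil>\<Sum>k\<in>G. norm k\<rceil>" and k: "k \<in> G"
      have "\<bar>k $ i\<bar> \<le> n" for i
      proof -
        have "\<bar>k $ i\<bar> \<le> norm k"
          by (rule component_le_norm_cart)
        also have "\<dots> \<le> (\<Sum>k\<in>G. norm k)"
          using k G by (intro member_le_sum) auto
        also have "\<dots> \<le> n"
          using n by linarith
        finally show ?thesis .
      qed
      then show "k \<in> F n"
        using k G by (auto simp: F_def)
    qed
  qed (auto simp: F_def)
qed

text \<open>The partial sums over cubes are Cauchy, since the squared norm of a difference is a
  piece of the tail of the sum. Coefficients and norm are continuous in L2 and pass to the
  limit.\<close>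

lemma riesz_fischer:
  fixes a :: "real ^ 'n \<Rightarrow> complex"
  assumes a: "(\<lambda>k. (cmod (a k))\<^sup>2) summable_on Zn"
  obtains f where "f \<in> L2p" "\<And>k. k \<in> Zn \<Longrightarrow> fc f k = a k"
    "((\<lambda>k. (cmod (a k))\<^sup>2) has_sum (nrm f)\<^sup>2) Zn"
proof -
  obtain F :: "nat \<Rightarrow> (real ^ 'n) set" where F: "\<And>n. finite (F n)" "\<And>n. F n \<subseteq> Zn" "\<And>m n. m \<le> n \<Longrightarrow> F m \<subseteq> F n"
    "\<And>G. finite G \<Longrightarrow> G \<subseteq> Zn \<Longrightarrow> \<exists>N. \<forall>n\<ge>N. G \<subseteq> F n"
    by (rule exhaust_Zn) blast
  define S where "S = infsum (\<lambda>k. (cmod (a k))\<^sup>2) Zn"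
  have S: "((\<lambda>k. (cmod (a k))\<^sup>2) has_sum S) Zn"
    unfolding S_def using a by (rule has_sum_infsum)
  have Flim: "filterlim F (finite_subsets_at_top Zn) sequentially"
    unfolding filterlim_finite_subsets_at_top
  proof (intro allI impI)
    fix G :: "(real ^ 'n) set" assume "finite G \<and> G \<subseteq> Zn"
    then obtain N where "\<forall>n\<ge>N. G \<subseteq> F n"
      using F(4) by blast
    then show "\<forall>\<^sub>F n in sequentially. finite (F n) \<and> G \<subseteq> F n \<and> F n \<subseteq> Zn"
      using F(1,2) by (auto simp: eventually_sequentially)
  qed
  have lim: "(\<lambda>n. \<Sum>k\<in>F n. (cmod (a k))\<^sup>2) \<longlonglongrightarrow> S"
    using S Flim unfolding has_sum_def by (rule filterlim_compose)
  have le: "(\<Sum>k\<in>F n. (cmod (a k))\<^sup>2) \<le> S" for n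
    by (rule finite_sum_le_has_sum[OF S F(1,2)]) auto
  define p where "p n x = (\<Sum>k\<in>F n. a k * ek k x)" for n x
  have p: "p n \<in> L2p" for n
    unfolding p_def by (rule L2p_ek_sum[OF F(2)])
  have diff: "(nrm (\<lambda>x. p n x - p m x))\<^sup>2 \<le> S - (\<Sum>k\<in>F m. (cmod (a k))\<^sup>2)" if "m \<le> n" for m n
  proof -
    have "p n x - p m x = (\<Sum>k\<in>F n - F m. a k * ek k x)" for x
      unfolding p_def using sum_diff[OF F(1) F(3)[OF that], of "\<lambda>k. a k * ek k x"] by simp
    then have "(nrm (\<lambda>x. p n x - p m x))\<^sup>2 = (\<Sum>k\<in>F n - F m. (cmod (a k))\<^sup>2)"
      using F(1,2) by (simp add: nrm_ek_sum Diff_subset[THEN subset_trans])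
    also have "\<dots> = (\<Sum>k\<in>F n. (cmod (a k))\<^sup>2) - (\<Sum>k\<in>F m. (cmod (a k))\<^sup>2)"
      by (rule sum_diff[OF F(1) F(3)[OF that]])
    finally show ?thesis
      using le[of n] by simp
  qed
  obtain f where f: "f \<in> L2p" "(\<lambda>n. nrm (\<lambda>x. p n x - f x)) \<longlonglongrightarrow> 0"
  proof (rule L2p_complete[OF p])
    fix e :: real assume "e > 0"
    then have "e\<^sup>2 > 0" by simp
    from LIMSEQ_D[OF lim this] obtain N where N: "\<And>n. n \<ge> N \<Longrightarrow> \<bar>(\<Sum>k\<in>F n. (cmod (a k))\<^sup>2) - S\<bar> < e\<^sup>2"
      by auto
    have *: "nrm (\<lambda>x. p n x - p m x) \<le> e" if "N \<le> m" "m \<le> n" for m n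
    proof (rule power2_le_imp_le)
      show "(nrm (\<lambda>x. p n x - p m x))\<^sup>2 \<le> e\<^sup>2"
        using diff[OF that(2)] N[OF that(1)] by linarith
    qed (use \<open>e > 0\<close> in simp)
    show "\<exists>N. \<forall>m\<ge>N. \<forall>n\<ge>N. nrm (\<lambda>x. p m x - p n x) \<le> e"
    proof (intro exI[of _ N] allI impI)
      fix m n assume "m \<ge> N" "n \<ge> N"
      then show "nrm (\<lambda>x. p m x - p n x) \<le> e"
        using *[of n m] *[of m n] nrm_minus_commute[of "p m" "p n"] by (cases "m \<le> n") auto
    qed
  qed
  have fcf: "fc f k = a k" if k: "k \<in> Zn" for k
  proof -
    obtain N where N: "\<forall>n\<ge>N. {k} \<subseteq> F n"
      using F(4)[of "{k}"] k by auto
    have "(\<lambda>n. fc (p n) k - fc f k) \<longlonglongrightarrow> 0"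
    proof (rule Lim_null_comparison[OF _ f(2)])
      show "\<forall>\<^sub>F n in sequentially. norm (fc (p n) k - fc f k) \<le> nrm (\<lambda>x. p n x - f x)"
        using norm_fc_le[OF L2p_diff[OF p f(1)]] fc_diff[OF L2p_integrable[OF p] L2p_integrable[OF f(1)]]
        by (intro always_eventually) simp
    qed
    moreover have "\<forall>\<^sub>F n in sequentially. fc (p n) k - fc f k = a k - fc f k"
      using eventually_ge_at_top[of N]
      by eventually_elim (use N F k in \<open>auto simp: p_def[abs_def] fc_ek_sum\<close>)
    ultimately have "(\<lambda>n. a k - fc f k) \<longlonglongrightarrow> 0"
      by (rule Lim_transform_eventually)
    then show ?thesis
      by (simp add: LIMSEQ_const_iff)
  qed
  have "(\<lambda>n. nrm (p n) - nrm f) \<longlonglongrightarrow> 0"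
  proof (rule Lim_null_comparison[OF _ f(2)])
    show "\<forall>\<^sub>F n in sequentially. norm (nrm (p n) - nrm f) \<le> nrm (\<lambda>x. p n x - f x)"
    proof (intro always_eventually allI)
      fix n
      show "norm (nrm (p n) - nrm f) \<le> nrm (\<lambda>x. p n x - f x)"
        using nrm_triangle[OF L2p_diff[OF p f(1)] f(1), of n] nrm_triangle[OF L2p_diff[OF f(1) p] p, of n n]
          nrm_minus_commute[of "p n" f] by (simp add: abs_le_iff)
    qed
  qed
  then have "(\<lambda>n. nrm (p n)) \<longlonglongrightarrow> nrm f"
    by (simp add: LIM_zero_iff)
  then have "(\<lambda>n. (nrm (p n))\<^sup>2) \<longlonglongrightarrow> (nrm f)\<^sup>2"
    by (intro tendsto_intros)
  moreover have "(nrm (p n))\<^sup>2 = (\<Sum>k\<in>F n. (cmod (a k))\<^sup>2)" for n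
    unfolding p_def by (rule nrm_ek_sum[OF F(1,2)])
  ultimately have "S = (nrm f)\<^sup>2"
    using lim LIMSEQ_unique by force
  with f(1) fcf S that show thesis
    by blast
qed

lemma fc_inject:
  assumes "f \<in> L2p" "g \<in> L2p" "\<And>k. k \<in> Zn \<Longrightarrow> fc f k = fc g k"
  shows "AE x in lebesgue. f x = g x"
proof (rule AE_eq_periodic_extend)
  have "AE x in Q. f x - g x = 0"
    using assms by (intro fc_eq_0_imp_AE_0) (auto simp: L2p_integrable fc_diff)
  then show "AE x in Q. f x = g x"
    by eventually_elim simp
qed (use assms in \<open>auto dest: L2pD\<close>)

text \<open>Bessel's inequality makes the coefficients square-summable, Riesz-Fischer provides a
  function with these coefficients and the right norm, and completeness of the exponentials
  identifies it with f.\<close>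

theorem parseval:
  assumes f: "f \<in> L2p"
  shows "((\<lambda>k. (cmod (fc f k))\<^sup>2) has_sum (nrm f)\<^sup>2) Zn"
proof -
  have "(\<lambda>k. (cmod (fc f k))\<^sup>2) summable_on Zn"
  proof (rule nonneg_bdd_above_summable_on)
    show "bdd_above (sum (\<lambda>k. (cmod (fc f k))\<^sup>2) ` {F. F \<subseteq> Zn \<and> finite F})"
      using bessel[OF _ _ f] by (intro bdd_aboveI2[of _ _ "(nrm f)\<^sup>2"]) auto
  qed simp
  then obtain g where g: "g \<in> L2p" "\<And>k. k \<in> Zn \<Longrightarrow> fc g k = fc f k"
      "((\<lambda>k. (cmod (fc f k))\<^sup>2) has_sum (nrm g)\<^sup>2) Zn"
    by (rule riesz_fischer) blast
  have "nrm f = nrm g"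
    using fc_inject[OF f g(1)] g(2) f g(1) by (intro nrm_cong_AE) (auto dest: L2pD)
  with g(3) show ?thesis
    by simp
qed

text \<open>Polarisation. The inner product on the complex numbers is the real one, hence the real
  part.\<close>

theorem parseval_inner:
  assumes f: "f \<in> L2p" and g: "g \<in> L2p"
  shows "((\<lambda>k. Re (fc f k * cnj (fc g k))) has_sum (LINT x|Q. f x \<bullet> g x)) Zn"
proof -
  have "((\<lambda>k. 1/2 * ((cmod (fc (\<lambda>x. f x + g x) k))\<^sup>2 + - (cmod (fc f k))\<^sup>2 + - (cmod (fc g k))\<^sup>2)) has_sum
     1/2 * ((nrm (\<lambda>x. f x + g x))\<^sup>2 + - (nrm f)\<^sup>2 + - (nrm g)\<^sup>2)) Zn"
    using f g by (intro has_sum_cmult_right has_sum_add parseval L2p_add) (simp_all add: has_sum_uminus parseval)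
  also have "(\<lambda>k. 1/2 * ((cmod (fc (\<lambda>x. f x + g x) k))\<^sup>2 + - (cmod (fc f k))\<^sup>2 + - (cmod (fc g k))\<^sup>2)) = (\<lambda>k. Re (fc f k * cnj (fc g k)))"
    using f g by (auto simp: fc_add L2p_integrable cmod_power2 power2_sum)
  also have "1/2 * ((nrm (\<lambda>x. f x + g x))\<^sup>2 + - (nrm f)\<^sup>2 + - (nrm g)\<^sup>2) = (LINT x|Q. f x \<bullet> g x)"
    using nrm_add_power2[OF f g] by simp
  finally show ?thesis .
qed

subsection \<open>Fourier coefficients of real functions\<close>

definition rc :: "(real ^ 'n \<Rightarrow> real) \<Rightarrow> real ^ 'n \<Rightarrow> complex" where
  "rc f = fc (\<lambda>x. complex_of_real (f x))"

lemma L2p_of_real: "f \<in> L2p \<Longrightarrow> (\<lambda>x. complex_of_real (f x)) \<in> L2p"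
  by (rule L2p_bound(1)[of f _ 1]) (auto intro: periodic_ae_comp dest: L2pD)

lemma nrm_of_real: "nrm (\<lambda>x. complex_of_real (f x)) = nrm f"
  by (simp add: nrm_def)

lemma rc_minus: "rc f (- k) = cnj (rc f k)"
  unfolding rc_def fc_def by (subst Bochner_Integration.integral_cnj[symmetric]) (simp add: ek_minus)

lemma rc_0: "f \<in> L2p \<Longrightarrow> rc f 0 = complex_of_real (LINT x|Q. f x)"
  by (simp add: rc_def fc_def)

lemma rc_add: "f \<in> L2p \<Longrightarrow> g \<in> L2p \<Longrightarrow> rc (\<lambda>x. f x + g x) k = rc f k + rc g k"
  by (simp add: rc_def fc_add L2p_integrable)

lemma rc_diff: "f \<in> L2p \<Longrightarrow> g \<in> L2p \<Longrightarrow> rc (\<lambda>x. f x - g x) k = rc f k - rc g k"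
  by (simp add: rc_def fc_diff L2p_integrable)

lemma rc_cmult: "rc (\<lambda>x. c * f x) k = complex_of_real c * rc f k"
  by (simp add: rc_def fc_cmult)

lemma rc_sum:
  "(\<And>i. i \<in> I \<Longrightarrow> f i \<in> L2p) \<Longrightarrow> rc (\<lambda>x. \<Sum>i\<in>I. f i x) k = (\<Sum>i\<in>I. rc (f i) k)"
proof (induction I rule: infinite_finite_induct)
  case (insert i I)
  then show ?case
    by (simp add: rc_add L2p_sum)
qed (simp_all add: rc_def fc_def)

lemma rc_const: "k \<in> Zn \<Longrightarrow> rc (\<lambda>x. c) k = (if k = 0 then complex_of_real c else 0)"
  using fc_cmult[of "complex_of_real c" "\<lambda>_. 1" k] fc_ek[of k 0] by (simp add: rc_def ek_0[abs_def] cong: if_cong)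

lemma rc_cong_AE:
  "AE x in lebesgue. f x = g x \<Longrightarrow> f \<in> borel_measurable lebesgue \<Longrightarrow> g \<in> borel_measurable lebesgue \<Longrightarrow> rc f k = rc g k"
  unfolding rc_def by (intro fc_cong_AE) (auto elim: eventually_mono)

lemma rc_inject:
  assumes "f \<in> L2p" "g \<in> L2p" "\<And>k. k \<in> Zn \<Longrightarrow> rc f k = rc g k"
  shows "AE x in lebesgue. f x = g x"
  using fc_inject[OF L2p_of_real[OF assms(1)] L2p_of_real[OF assms(2)]] assms(3) by (simp add: rc_def)

lemma parseval_real: "f \<in> L2p \<Longrightarrow> ((\<lambda>k. (cmod (rc f k))\<^sup>2) has_sum (nrm f)\<^sup>2) Zn"
  unfolding rc_def using parseval[OF L2p_of_real, of f] by (simp add: nrm_of_real)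

lemma parseval_real_inner:
  "f \<in> L2p \<Longrightarrow> g \<in> L2p \<Longrightarrow> ((\<lambda>k. Re (rc f k * cnj (rc g k))) has_sum (LINT x|Q. f x * g x)) Zn"
  unfolding rc_def using parseval_inner[OF L2p_of_real L2p_of_real, of f g] by (simp add: inner_complex_def)

lemma rc_shift:
  assumes f: "f \<in> L2p" and k: "k \<in> Zn"
  shows "rc (\<lambda>x. f (x + h)) k = ek k h * rc f k"
proof -
  let ?g = "\<lambda>x. complex_of_real (f x) * cnj (ek k x)"
  have "(\<lambda>x. cnj (ek k x)) \<in> borel_measurable lebesgue" "periodic_ae (\<lambda>x. cnj (ek k x))"
    using measurable_ek[of "- k"] ek_periodic[of "- k"] k by (simp_all add: ek_minus_eq)
  then have g: "periodic_ae ?g" "?g \<in> borel_measurable lebesgue" "integrable Q ?g"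
    using L2pD[OF L2p_of_real[OF f]] integrable_fc[OF L2p_integrable[OF L2p_of_real[OF f]]]
    by (auto intro: periodic_ae_comp2)
  have "complex_of_real (f (x + h)) * cnj (ek k x) = ?g (x + h) * ek k h" for x
    by (simp add: ek_shift mult.assoc)
  then have "rc (\<lambda>x. f (x + h)) k = (LINT x|Q. ?g (x + h) * ek k h)"
    by (simp only: rc_def fc_def)
  also have "\<dots> = (LINT x|Q. ?g x) * ek k h"
    using integral_Q_shift[OF g, of h] by simp
  finally show ?thesis
    by (simp add: rc_def fc_def)
qed

text \<open>The symmetry of \<open>a\<close> says that the conjugate of the Riesz-Fischer function
  has the same coefficients. So that function is real almost everywhere, and its real part is the
  answer.\<close>

theorem riesz_fischer_real:
  fixes a :: "real ^ 'n \<Rightarrow> complex"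
  assumes a: "(\<lambda>k. (cmod (a k))\<^sup>2) summable_on Zn" and sym: "\<And>k. k \<in> Zn \<Longrightarrow> a (- k) = cnj (a k)"
  obtains f where "f \<in> L2p" "\<And>k. k \<in> Zn \<Longrightarrow> rc f k = a k"
proof -
  obtain g where g: "g \<in> L2p" "\<And>k. k \<in> Zn \<Longrightarrow> fc g k = a k"
    using riesz_fischer[OF a] by blast
  have cg: "(\<lambda>x. cnj (g x)) \<in> L2p"
    using L2pD[OF g(1)] by (intro L2p_bound(1)[OF g(1), of _ 1]) (auto intro: periodic_ae_comp borel_measurable_cnj)
  have "fc (\<lambda>x. cnj (g x)) k = fc g k" if k: "k \<in> Zn" for k
  proof -
    have "fc (\<lambda>x. cnj (g x)) k = cnj (fc g (- k))"
      unfolding fc_def by (subst Bochner_Integration.integral_cnj[symmetric]) (simp add: ek_minus)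
    then show ?thesis
      using k by (simp add: g sym)
  qed
  then have "AE x in lebesgue. cnj (g x) = g x"
    using fc_inject[OF cg g(1)] by blast
  then have re: "AE x in lebesgue. complex_of_real (Re (g x)) = g x"
    by eventually_elim (simp add: complex_eq_iff)
  have Re: "(\<lambda>x. Re (g x)) \<in> L2p"
    using L2pD[OF g(1)] by (intro L2p_bound(1)[OF g(1), of _ 1]) (auto intro: periodic_ae_comp simp: abs_Re_le_cmod)
  have "rc (\<lambda>x. Re (g x)) k = a k" if "k \<in> Zn" for k
    unfolding rc_def using fc_cong_AE[OF re] L2pD[OF L2p_of_real[OF Re]] L2pD[OF g(1)] g(2)[OF that] by simp
  with Re that show thesis
    by blast
qed

subsection \<open>Smooth functions\<close>

definition smooth :: "(real ^ 'n \<Rightarrow> real) \<Rightarrow> bool" where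
  "smooth f \<longleftrightarrow> (\<forall>k. C_diff k f)"

lemma pderiv_at_eq: "(f has_derivative f') (at x) \<Longrightarrow> pderiv_at i f x = f' (axis i 1)"
  unfolding pderiv_at_def by (simp add: frechet_derivative_at[symmetric])

lemma pderiv_at_has_derivative:
  "f differentiable (at x) \<Longrightarrow> (f has_derivative frechet_derivative f (at x)) (at x)"
  by (simp add: frechet_derivative_works)

text \<open>Replaces the computation of higher derivatives: it is enough to exhibit a family of
  differentiable functions that is closed under partial derivatives.\<close>

lemma smooth_coinduct:
  assumes "f \<in> S"
    and S: "\<And>f. f \<in> S \<Longrightarrow> (\<forall>x. f differentiable (at x)) \<and> (\<forall>i. pderiv_at i f \<in> S)"
  shows "smooth f"
proof -
  have "\<forall>f\<in>S. C_diff k f" for k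
  proof (induction k)
    case 0
    then show ?case
      using S by (auto intro!: differentiable_imp_continuous_on simp: differentiable_on_def)
  next
    case (Suc k)
    then show ?case
      using S by auto
  qed
  with assms(1) show ?thesis
    by (auto simp: smooth_def)
qed

lemma smoothD:
  assumes "smooth f"
  shows "f differentiable (at x)" "smooth (pderiv_at i f)" "continuous_on S f"
proof -
  have "C_diff (Suc k) f" for k
    using assms by (simp add: smooth_def)
  then show "f differentiable (at x)" "smooth (pderiv_at i f)"
    by (auto simp: smooth_def)
  have "C_diff 0 f"
    using assms unfolding smooth_def by blast
  then show "continuous_on S f"
    by (auto intro: continuous_on_subset)
qed

lemma pderiv_at_add:
  assumes "f differentiable (at x)" "g differentiable (at x)"
  shows "pderiv_at i (\<lambda>x. f x + g x) x = pderiv_at i f x + pderiv_at i g x"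
  using has_derivative_add[OF assms[THEN pderiv_at_has_derivative]]
  by (simp add: pderiv_at_eq) (simp add: pderiv_at_def)

lemma pderiv_at_mult:
  assumes "f differentiable (at x)" "g differentiable (at x)"
  shows "pderiv_at i (\<lambda>x. f x * g x) x = f x * pderiv_at i g x + pderiv_at i f x * g x"
  using has_derivative_mult[OF assms[THEN pderiv_at_has_derivative]]
  by (simp add: pderiv_at_eq) (simp add: pderiv_at_def)

lemma C_diff_add: "C_diff k f \<Longrightarrow> C_diff k g \<Longrightarrow> C_diff k (\<lambda>x. f x + g x)"
proof (induction k arbitrary: f g)
  case 0
  then show ?case by (auto intro: continuous_intros)
next
  case (Suc k)
  then have "pderiv_at i (\<lambda>x. f x + g x) = (\<lambda>x. pderiv_at i f x + pderiv_at i g x)" for i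
    by (auto simp: fun_eq_iff pderiv_at_add)
  with Suc show ?case
    by (auto intro: differentiable_add)
qed

lemma smooth_add: "smooth f \<Longrightarrow> smooth g \<Longrightarrow> smooth (\<lambda>x. f x + g x)"
  by (simp add: smooth_def C_diff_add)

lemma smooth_mult:
  fixes f g :: "real ^ 'n \<Rightarrow> real"
  assumes "smooth f" "smooth g"
  shows "smooth (\<lambda>x. f x * g x)"
proof -
  \<comment> \<open>Both factors stay general in the induction on the order, since the product rule
    replaces either of them by a derivative.\<close>
  have "smooth f \<Longrightarrow> smooth g \<Longrightarrow> C_diff k (\<lambda>x. f x * g x)" for k and f g :: "real ^ 'n \<Rightarrow> real"
  proof (induction k arbitrary: f g)
    case 0
    then show ?case by (simp add: continuous_on_mult smoothD(3))
  next
    case (Suc k)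
    have "pderiv_at i (\<lambda>x. f x * g x) = (\<lambda>x. f x * pderiv_at i g x + pderiv_at i f x * g x)" for i
      using Suc.prems by (auto simp: fun_eq_iff pderiv_at_mult smoothD)
    moreover have "(\<lambda>x. f x * g x) differentiable (at x)" for x
      using Suc.prems by (intro differentiable_mult smoothD(1))
    moreover have "C_diff k (\<lambda>x. f x * pderiv_at i g x + pderiv_at i f x * g x)" for i
      using Suc.prems by (intro C_diff_add Suc.IH) (auto intro: smoothD(2))
    ultimately show ?case
      by simp
  qed
  with assms show ?thesis
    by (subst smooth_def) blast
qed

text \<open>\<open>d\<close> lists the successive derivatives of a function of one variable.
  Composed with an affine function they form, up to constant factors, a family closed under partial
  derivatives.\<close>

lemma smooth_1d:
  fixes d :: "nat \<Rightarrow> real \<Rightarrow> real"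
  assumes d: "\<And>k t. (d k has_real_derivative d (Suc k) t) (at t)"
  shows "smooth (\<lambda>x. d k (a \<bullet> x + b))"
    and "pderiv_at i (\<lambda>x. d k (a \<bullet> x + b)) x = a $ i * d (Suc k) (a \<bullet> x + b)"
proof -
  have der: "((\<lambda>x. c * d k (a \<bullet> x + b)) has_derivative (\<lambda>h. c * (d (Suc k) (a \<bullet> x + b) * (a \<bullet> h)))) (at x)" for c k x
  proof -
    have "((\<lambda>x. a \<bullet> x + b) has_derivative (\<lambda>h. a \<bullet> h)) (at x)"
      by (auto intro!: derivative_eq_intros)
    from has_derivative_compose[OF this d[of k "a \<bullet> x + b", unfolded has_field_derivative_def]]
    show ?thesis
      by (intro has_derivative_mult_right) simp
  qed
  have eq: "pderiv_at i (\<lambda>x. c * d k (a \<bullet> x + b)) = (\<lambda>x. (c * a $ i) * d (Suc k) (a \<bullet> x + b))" for c i k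
    using pderiv_at_eq[OF der] by (auto simp: fun_eq_iff inner_axis)
  show "smooth (\<lambda>x. d k (a \<bullet> x + b))"
  proof (rule smooth_coinduct)
    show "(\<lambda>x. d k (a \<bullet> x + b)) \<in> {\<lambda>x. c * d k (a \<bullet> x + b) |c k. True}"
      by (auto intro!: exI[of _ 1] exI[of _ k])
    fix f assume "f \<in> {\<lambda>x. c * d k (a \<bullet> x + b) |c k. True}"
    then obtain c k where f: "f = (\<lambda>x. c * d k (a \<bullet> x + b))"
      by blast
    show "(\<forall>x. f differentiable (at x)) \<and> (\<forall>i. pderiv_at i f \<in> {\<lambda>x. c * d k (a \<bullet> x + b) |c k. True})"
      unfolding f eq using der by (blast intro: differentiableI)
  qed
  show "pderiv_at i (\<lambda>x. d k (a \<bullet> x + b)) x = a $ i * d (Suc k) (a \<bullet> x + b)"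
    using eq[of i 1 k] by simp
qed

lemma smooth_const: "smooth (\<lambda>x. c)"
  using smooth_1d(1)[of "\<lambda>k t. if k = 0 then c else 0" 0 0 0] by simp

lemma smooth_prod:
  "(\<And>i. i \<in> I \<Longrightarrow> smooth (f i)) \<Longrightarrow> smooth (\<lambda>x. \<Prod>i\<in>I. f i x)"
  by (induction I rule: infinite_finite_induct) (auto intro: smooth_const smooth_mult)

lemma smooth_cos: "smooth (\<lambda>x. cos (a \<bullet> x + b))"
  and smooth_sin: "smooth (\<lambda>x. sin (a \<bullet> x + b))"
  and pderiv_at_cos: "pderiv_at i (\<lambda>x. cos (a \<bullet> x)) = (\<lambda>x. - a $ i * sin (a \<bullet> x))"
  and pderiv_at_sin: "pderiv_at i (\<lambda>x. sin (a \<bullet> x)) = (\<lambda>x. a $ i * cos (a \<bullet> x))"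
proof -
  \<comment> \<open>All derivatives in closed form: each differentiation shifts the phase by
    pi/2.\<close>
  have s: "((\<lambda>t. sin (t + of_nat k * (pi / 2))) has_real_derivative sin (t + of_nat (Suc k) * (pi / 2))) (at t)" for k t
  proof -
    have *: "t + of_nat (Suc k) * (pi / 2) = t + of_nat k * (pi / 2) + pi / 2"
      by (simp add: algebra_simps)
    show ?thesis
      unfolding * sin_add[of _ "pi / 2"] by (auto intro!: derivative_eq_intros)
  qed
  have c: "((\<lambda>t. cos (t + of_nat k * (pi / 2))) has_real_derivative cos (t + of_nat (Suc k) * (pi / 2))) (at t)" for k t
  proof -
    have *: "t + of_nat (Suc k) * (pi / 2) = t + of_nat k * (pi / 2) + pi / 2"
      by (simp add: algebra_simps)
    show ?thesis
      unfolding * cos_add[of _ "pi / 2"] by (auto intro!: derivative_eq_intros)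
  qed
  show "smooth (\<lambda>x. cos (a \<bullet> x + b))"
    using smooth_1d(1)[of "\<lambda>k t. cos (t + of_nat k * (pi / 2))" 0, OF c] by simp
  show "smooth (\<lambda>x. sin (a \<bullet> x + b))"
    using smooth_1d(1)[of "\<lambda>k t. sin (t + of_nat k * (pi / 2))" 0, OF s] by simp
  show "pderiv_at i (\<lambda>x. cos (a \<bullet> x)) = (\<lambda>x. - a $ i * sin (a \<bullet> x))"
    using smooth_1d(2)[of "\<lambda>k t. cos (t + of_nat k * (pi / 2))" i 0 a 0, OF c] by (auto simp: cos_add)
  show "pderiv_at i (\<lambda>x. sin (a \<bullet> x)) = (\<lambda>x. a $ i * cos (a \<bullet> x))"
    using smooth_1d(2)[of "\<lambda>k t. sin (t + of_nat k * (pi / 2))" i 0 a 0, OF s] by (auto simp: sin_add)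
qed

subsection \<open>Test functions\<close>

text \<open>The classical exp(-1/t), extended by 0. The polynomial factor in 1/t makes the family
  closed under differentiation: p is replaced by X^2 (p - p').\<close>

definition flat :: "real poly \<Rightarrow> real \<Rightarrow> real" where
  "flat p t = (if t > 0 then poly p (1 / t) * exp (- (1 / t)) else 0)"

lemma tendsto_poly_exp: "((\<lambda>s. poly p s * exp (- s)) \<longlongrightarrow> 0) at_top" for p :: "real poly"
proof -
  have "((\<lambda>s. \<Sum>i\<le>degree p. coeff p i * (s ^ i / exp s)) \<longlongrightarrow> (\<Sum>i\<le>degree p. coeff p i * 0)) at_top"
    by (intro tendsto_sum tendsto_mult_left tendsto_power_div_exp_0)
  then show ?thesis
    by (simp add: poly_altdef exp_minus field_simps sum_divide_distrib)
qed

lemma flat_tendsto_0: "(flat p \<longlongrightarrow> 0) (at 0)"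
proof -
  have "((\<lambda>t. poly p (inverse t) * exp (- inverse t)) \<longlongrightarrow> 0) (at_right 0)"
    using filterlim_compose[OF tendsto_poly_exp filterlim_inverse_at_top_right] .
  then have "(flat p \<longlongrightarrow> 0) (at_right 0)"
    by (rule Lim_transform_eventually)
      (auto simp: eventually_at_right_field flat_def inverse_eq_divide intro!: exI[of _ 1])
  moreover have "(flat p \<longlongrightarrow> 0) (at_left 0)"
    by (rule tendsto_eventually) (auto simp: eventually_at_left_field flat_def intro!: exI[of _ "-1"])
  ultimately show ?thesis
    using filterlim_split_at by blast
qed

lemma flat_derivative:
  "(flat p has_real_derivative flat (monom 1 2 * (p - pderiv p)) t) (at t)"
proof -
  consider "t > 0" | "t < 0" | "t = 0" by linarith
  then show ?thesis
  proof cases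
    case 1
    have "((\<lambda>t. poly p (1 / t) * exp (- (1 / t))) has_real_derivative flat (monom 1 2 * (p - pderiv p)) t) (at t)"
      using 1 by (auto intro!: derivative_eq_intros DERIV_chain2[OF poly_DERIV] simp: flat_def poly_monom field_simps power2_eq_square)
    moreover have "\<forall>\<^sub>F s in nhds t. flat p s = poly p (1 / s) * exp (- (1 / s))"
      using eventually_nhds_in_open[of "{0<..}" t] 1 by (auto simp: flat_def elim!: eventually_mono)
    ultimately show ?thesis
      by (subst DERIV_cong_ev[OF refl _ refl])
  next
    case 2
    have "((\<lambda>t. 0) has_real_derivative flat (monom 1 2 * (p - pderiv p)) t) (at t)"
      using 2 by (auto simp: flat_def)
    moreover have "\<forall>\<^sub>F s in nhds t. flat p s = 0"
      using eventually_nhds_in_open[of "{..<0}" t] 2 by (auto simp: flat_def elim!: eventually_mono)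
    ultimately show ?thesis
      by (subst DERIV_cong_ev[OF refl _ refl])
  next
    case 3
    have "((\<lambda>h. (flat p (0 + h) - flat p 0) / h) \<longlongrightarrow> 0) (at 0)"
      \<comment> \<open>Division by h multiplies the polynomial by its variable 1/h, so the
        difference quotient at 0 is again of the form \<open>flat\<close>.\<close>
      using flat_tendsto_0[of "[:0, 1:] * p"]
      by (rule Lim_transform_eventually) (auto simp: flat_def eventually_at_filter)
    then show ?thesis
      using 3 by (simp add: DERIV_def flat_def)
  qed
qed

lemma smooth_flat: "smooth (\<lambda>x. flat p (a \<bullet> x + b))"
  using smooth_1d(1)[of "\<lambda>k. flat (((\<lambda>p. monom 1 2 * (p - pderiv p)) ^^ k) p)" 0 a b] flat_derivative by simp

definition bump :: "real \<Rightarrow> real" where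
  "bump t = flat 1 t * flat 1 (1 - t)"

lemma bump_pos_iff: "bump t > 0 \<longleftrightarrow> 0 < t \<and> t < 1"
  by (auto simp: bump_def flat_def)

lemma bump_eq_0: "t \<le> 0 \<or> 1 \<le> t \<Longrightarrow> bump t = 0"
  by (auto simp: bump_def flat_def)

lemma smooth_bump: "smooth (\<lambda>x. bump (a \<bullet> x + b))"
  using smooth_mult[OF smooth_flat[of 1 a b] smooth_flat[of 1 "- a" "1 - b"]]
  by (simp add: bump_def algebra_simps)

lemma isCont_bump: "isCont bump t"
proof -
  have f: "isCont (flat 1) s" for s
    using flat_derivative by (rule DERIV_isCont)
  have "isCont (\<lambda>t. flat 1 (1 - t)) t"
    by (rule isCont_o2[OF _ f]) (intro continuous_intros)
  with f show ?thesis
    unfolding bump_def[abs_def] by (intro continuous_intros)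
qed

text \<open>With \<open>B\<close> an antiderivative of \<open>bump\<close> and c its total increase,
  the hat is (B (t + 1) - B t) / c, the bump averaged over a unit window. Two neighbouring hats
  telescope to (B (t + 1) - B (t - 1)) / c, which is 1 on (0, 1) because \<open>B\<close> is
  constant on either side of that interval.\<close>

lemma smooth_hat:
  obtains \<theta> :: "real \<Rightarrow> real" where
    "\<And>a b. smooth (\<lambda>x :: real ^ 'n. \<theta> (a \<bullet> x + b))" "\<And>t. \<theta> t \<noteq> 0 \<Longrightarrow> \<bar>t\<bar> \<le> 1"
    "\<And>t. 0 < t \<Longrightarrow> t < 1 \<Longrightarrow> \<theta> t + \<theta> (t - 1) = 1"
proof -
  obtain B :: "real \<Rightarrow> real" where B: "\<And>t. (B has_real_derivative bump t) (at t)"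
    using einterval_antiderivative[of "-\<infinity>" "\<infinity>" bump] isCont_bump
    by (auto simp: has_real_derivative_iff_has_vector_derivative)
  have B_const: "B t = B s" if "bump ` {s..t} \<subseteq> {0}" "s \<le> t" for s t
  proof (cases "s = t")
    case False
    then have "s < t" using that by simp
    have "\<exists>z. s < z \<and> z < t \<and> B t - B s = (t - s) * bump z"
      by (rule MVT2[OF \<open>s < t\<close>]) (use B in blast)
    then obtain z where z: "s < z" "z < t" "B t - B s = (t - s) * bump z"
      by blast
    moreover have "bump z = 0"
    proof -
      have "bump z \<in> bump ` {s..t}"
        using z by (intro imageI) auto
      with that(1) show ?thesis
        by blast
    qed
    ultimately show ?thesis by simp
  qed simp
  have B0: "B t = B 0" if "t \<le> 0" for t
    using B_const[of t 0] that by (fastforce simp: bump_eq_0)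
  have B1: "B t = B 1" if "t \<ge> 1" for t
    using B_const[of 1 t] that by (fastforce simp: bump_eq_0)
  define c where "c = B 1 - B 0"
  have "\<exists>z. 0 < z \<and> z < 1 \<and> B 1 - B 0 = (1 - 0) * bump z"
    by (rule MVT2) (use B in auto)
  then have "c > 0"
    unfolding c_def using bump_pos_iff by (metis diff_zero mult_1)
  define \<theta> where "\<theta> t = (B (t + 1) - B t) / c" for t
  show thesis
  proof
    fix a :: "real ^ 'n" and b
    have der: "((\<lambda>x. \<theta> (a \<bullet> x + b)) has_derivative (\<lambda>h. (bump (a \<bullet> x + (b + 1)) - bump (a \<bullet> x + b)) / c * (a \<bullet> h))) (at x)" for x
    proof -
      have 1: "((\<lambda>x. a \<bullet> x + b) has_derivative (\<lambda>h. a \<bullet> h)) (at x)" for b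
        by (auto intro!: derivative_eq_intros)
      have 2: "((\<lambda>x. B (a \<bullet> x + b)) has_derivative (\<lambda>h. bump (a \<bullet> x + b) * (a \<bullet> h))) (at x)" for b
        using has_derivative_compose[OF 1 B[unfolded has_field_derivative_def]] .
      have 3: "((\<lambda>x. (B (a \<bullet> x + (b + 1)) - B (a \<bullet> x + b)) * (1 / c)) has_derivative
          (\<lambda>h. (bump (a \<bullet> x + (b + 1)) * (a \<bullet> h) - bump (a \<bullet> x + b) * (a \<bullet> h)) * (1 / c))) (at x)"
        by (intro has_derivative_mult_left has_derivative_diff 2)
      then show ?thesis
        by (simp add: \<theta>_def algebra_simps diff_divide_distrib)
    qed
    have eq: "pderiv_at i (\<lambda>x. \<theta> (a \<bullet> x + b)) = (\<lambda>x. (bump (a \<bullet> x + (b + 1)) + (-1) * bump (a \<bullet> x + b)) * (a $ i / c))" for i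
      using pderiv_at_eq[OF der] by (auto simp: fun_eq_iff inner_axis)
    show "smooth (\<lambda>x :: real ^ 'n. \<theta> (a \<bullet> x + b))"
    \<comment> \<open>One derivative of the hat is a difference of bumps, already known to be
      smooth; so the closed family is the hat together with all smooth functions.\<close>
    proof (rule smooth_coinduct)
      fix f :: "real ^ 'n \<Rightarrow> real" assume f: "f \<in> insert (\<lambda>x. \<theta> (a \<bullet> x + b)) {f. smooth f}"
      show "(\<forall>x. f differentiable (at x)) \<and> (\<forall>i. pderiv_at i f \<in> insert (\<lambda>x. \<theta> (a \<bullet> x + b)) {f. smooth f})"
      proof (cases "smooth f")
        case True
        then show ?thesis by (auto intro: smoothD)
      next
        case False
        with f have f: "f = (\<lambda>x. \<theta> (a \<bullet> x + b))" by auto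
        have "smooth (pderiv_at i f)" for i
          unfolding f eq by (intro smooth_mult smooth_add smooth_bump smooth_const)
        then show ?thesis
          using der unfolding f by (auto intro: differentiableI)
      qed
    qed simp
  next
    fix t assume "\<theta> t \<noteq> 0"
    then have "B (t + 1) \<noteq> B t"
      by (auto simp: \<theta>_def)
    then show "\<bar>t\<bar> \<le> 1"
      using B0[of t] B0[of "t + 1"] B1[of t] B1[of "t + 1"] by (auto simp: abs_le_iff) linarith+
  next
    fix t :: real assume "0 < t" "t < 1"
    then show "\<theta> t + \<theta> (t - 1) = 1"
      using B0[of "t - 1"] B1[of "t + 1"] \<open>c > 0\<close>
      by (simp add: \<theta>_def c_def flip: add_divide_distrib)
  qed
qed

text \<open>All lattice vectors m for which m + \<open>cellY\<close> can meet the cube of half-width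
  N; the margin 1 is that of \<open>integral_unfold\<close>.\<close>

definition lat :: "real \<Rightarrow> (real ^ 'n) set" where
  "lat N = {m \<in> Zn. \<forall>i. \<bar>m $ i\<bar> \<le> N + 1}"

definition supp_in :: "real \<Rightarrow> (real ^ 'n \<Rightarrow> real) \<Rightarrow> bool" where
  "supp_in N \<eta> \<longleftrightarrow> (\<forall>x. \<eta> x \<noteq> 0 \<longrightarrow> (\<forall>i. \<bar>x $ i\<bar> \<le> N))"

lemma supp_inD: "supp_in N \<eta> \<Longrightarrow> \<eta> x \<noteq> 0 \<Longrightarrow> \<bar>x $ i\<bar> \<le> N"
  by (auto simp: supp_in_def)

lemma supp_inI: "(\<And>x i. \<eta> x \<noteq> 0 \<Longrightarrow> \<bar>x $ i\<bar> \<le> N) \<Longrightarrow> supp_in N \<eta>"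
  by (auto simp: supp_in_def)

lemma test_functions_iff: "\<eta> \<in> test_functions \<longleftrightarrow> smooth \<eta> \<and> bounded {x. \<eta> x \<noteq> 0}"
  by (simp add: test_functions_def smooth_def compact_closure)

lemma test_function_support:
  assumes "\<eta> \<in> test_functions"
  obtains N where "supp_in N \<eta>"
proof -
  obtain N where "\<And>x. \<eta> x \<noteq> 0 \<Longrightarrow> norm x \<le> N"
    using assms unfolding test_functions_iff bounded_iff by auto
  then have "\<bar>x $ i\<bar> \<le> N" if "\<eta> x \<noteq> 0" for x i
    using that component_le_norm_cart[of x i] order_trans by blast
  then show thesis
    by (intro that[of N] supp_inI)
qed

lemma mem_cube: "(\<And>i. \<bar>x $ i\<bar> \<le> N) \<Longrightarrow> x \<in> cbox (- (\<chi> i. N)) (\<chi> i. (N :: real))"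
  unfolding mem_box_cart by (simp add: abs_le_iff) (metis minus_le_iff)

lemma bounded_box_support:
  assumes "supp_in N \<eta>"
  shows "bounded {x :: real ^ 'n. \<eta> x \<noteq> (0 :: real)}"
proof (rule bounded_subset)
  show "bounded (cbox (- (\<chi> i. N)) (\<chi> i. N) :: (real ^ 'n) set)"
    by simp
  show "{x. \<eta> x \<noteq> 0} \<subseteq> cbox (- (\<chi> i. N)) (\<chi> i. N)"
    using assms by (auto intro!: mem_cube supp_inD)
qed

lemma test_functionI:
  assumes "smooth \<eta>" "supp_in N \<eta>"
  shows "\<eta> \<in> test_functions"
  using assms bounded_box_support[OF assms(2)] by (auto simp: test_functions_iff)

lemma test_function_mult:
  assumes "\<eta> \<in> test_functions" "smooth e"
  shows "(\<lambda>x. \<eta> x * e x) \<in> test_functions"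
  using assms bounded_subset[of "{x. \<eta> x \<noteq> 0}" "{x. \<eta> x * e x \<noteq> 0}"]
  by (auto simp: test_functions_iff smooth_mult)

lemma pderiv_at_support:
  fixes \<eta> :: "real ^ 'n \<Rightarrow> real"
  assumes "supp_in N \<eta>"
  shows "supp_in N (pderiv_at j \<eta>)"
proof (rule supp_inI, rule ccontr)
  fix x i assume nz: "pderiv_at j \<eta> x \<noteq> 0" and *: "\<not> \<bar>x $ i\<bar> \<le> N"
  have op: "open {x :: real ^ 'n. N < \<bar>x $ i\<bar>}"
    by (intro open_Collect_less continuous_intros)
  have "(\<eta> has_derivative (\<lambda>_. 0)) (at x)"
  proof (rule has_derivative_transform_within_open[OF _ op])
    show "((\<lambda>_. 0) has_derivative (\<lambda>_. 0)) (at x)"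
      by simp
    show "0 = \<eta> y" if "y \<in> {x :: real ^ 'n. N < \<bar>x $ i\<bar>}" for y
      using supp_inD[OF assms, of y i] that by force
  qed (use * in auto)
  with nz show False
    by (simp add: pderiv_at_eq)
qed

lemma test_function_pderiv:
  assumes "\<eta> \<in> test_functions"
  shows "pderiv_at j \<eta> \<in> test_functions"
proof -
  obtain N where N: "supp_in N \<eta>"
    using test_function_support[OF assms] by blast
  show ?thesis
    by (rule test_functionI[of _ N])
      (use assms pderiv_at_support[OF N] in \<open>auto simp: test_functions_iff intro: smoothD\<close>)
qed

lemma smooth_shift:
  assumes "smooth f"
  shows "smooth (\<lambda>x. f (x + m))"
proof (rule smooth_coinduct)
  show "(\<lambda>x. f (x + m)) \<in> {\<lambda>x. f (x + m) |f. smooth f}"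
    using assms by blast
  fix h :: "real ^ 'a \<Rightarrow> real" assume "h \<in> {\<lambda>x. f (x + m) |f. smooth f}"
  then obtain f where f: "h = (\<lambda>x. f (x + m))" "smooth f"
    by blast
  have der: "(h has_derivative frechet_derivative f (at (x + m))) (at x)" for x
  proof -
    have "((\<lambda>x. x + m) has_derivative (\<lambda>h. h)) (at x)"
      by (auto intro!: derivative_eq_intros)
    from has_derivative_compose[OF this pderiv_at_has_derivative[OF smoothD(1)[OF f(2)]]]
    show ?thesis
      by (simp add: f(1))
  qed
  have "pderiv_at i h = (\<lambda>x. pderiv_at i f (x + m))" for i
    using pderiv_at_eq[OF der] by (auto simp: fun_eq_iff pderiv_at_def[of i f])
  with der f show "(\<forall>x. h differentiable (at x)) \<and> (\<forall>i. pderiv_at i h \<in> {\<lambda>x. f (x + m) |f. smooth f})"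
    by (auto intro: differentiableI smoothD)
qed

lemma smooth_measurable: "smooth f \<Longrightarrow> f \<in> borel_measurable lebesgue" "smooth f \<Longrightarrow> f \<in> borel_measurable borel"
  by (auto intro!: continuous_imp_lebesgue borel_measurable_continuous_onI smoothD(3))

lemma test_function_bounded:
  assumes "\<eta> \<in> test_functions"
  obtains B where "\<And>x. \<bar>\<eta> x\<bar> \<le> B" "B \<ge> 0"
proof -
  let ?S = "closure {x. \<eta> x \<noteq> 0}"
  have "compact ?S" "continuous_on ?S \<eta>"
    using assms by (auto simp: test_functions_iff compact_closure intro: smoothD)
  then have "bounded (\<eta> ` ?S)"
    by (intro compact_imp_bounded compact_continuous_image)
  then obtain B where B: "\<And>x. x \<in> ?S \<Longrightarrow> \<bar>\<eta> x\<bar> \<le> B"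
    by (auto simp: bounded_iff)
  have "\<bar>\<eta> x\<bar> \<le> max B 0" for x
    using B[of x] closure_subset[of "{x. \<eta> x \<noteq> 0}"] by (cases "\<eta> x = 0") auto
  then show thesis
    by (intro that[of "max B 0"]) auto
qed

lemma integrable_bounded_support:
  fixes f :: "real ^ 'n \<Rightarrow> real"
  assumes "f \<in> borel_measurable lebesgue" "\<And>x. \<bar>f x\<bar> \<le> B" "supp_in N f"
  shows "integrable lebesgue f"
proof -
  have "periodic_ae (\<lambda>_ :: real ^ 'n. 1 :: real)"
    by (simp add: periodic_ae_def)
  then have "integrable lebesgue (\<lambda>x. f x *\<^sub>R (1 :: real))"
  proof (rule integrable_periodic_mult)
    show "\<bar>f x\<bar> \<le> B" for x
      by (rule assms)
    show "\<bar>x $ i\<bar> \<le> N" if "f x \<noteq> 0" for x i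
      using assms(3) that by (rule supp_inD)
  qed (use assms(1) in simp_all)
  then show ?thesis
    by simp
qed

lemma test_function_integrable:
  assumes "\<eta> \<in> test_functions"
  shows "integrable lebesgue \<eta>"
proof -
  obtain N where N: "supp_in N \<eta>"
    using test_function_support[OF assms] by blast
  obtain B where B: "\<And>x. \<bar>\<eta> x\<bar> \<le> B"
    using test_function_bounded[OF assms] by blast
  show ?thesis
    using assms by (intro integrable_bounded_support[OF _ B N] smooth_measurable) (auto simp: test_functions_iff)
qed

text \<open>No iterated integrals: the difference quotients in direction i have integral 0 by
  translation invariance, and they converge boundedly within a common compact set.\<close>

lemma integral_pderiv_test_function:
  fixes \<eta> :: "real ^ 'n \<Rightarrow> real"
  assumes \<eta>: "\<eta> \<in> test_functions"
  shows "(LINT x|lebesgue. pderiv_at i \<eta> x) = 0"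
proof -
  obtain N where N: "supp_in N \<eta>"
    using test_function_support[OF \<eta>] by blast
  obtain B where B: "\<And>x. \<bar>pderiv_at i \<eta> x\<bar> \<le> B" "B \<ge> 0"
    using test_function_bounded[OF test_function_pderiv[OF \<eta>]] by blast
  have sm: "smooth \<eta>"
    using \<eta> by (simp add: test_functions_iff)
  define e :: "real ^ 'n" where "e = axis i 1"
  define u where "u n x = (\<eta> (x + inverse (real (Suc n)) *\<^sub>R e) - \<eta> x) / inverse (real (Suc n))" for n x
  have der: "((\<lambda>s. \<eta> (x + s *\<^sub>R e)) has_real_derivative pderiv_at i \<eta> (x + s *\<^sub>R e)) (at s)" for x s
  proof -
    have "((\<lambda>s. x + s *\<^sub>R e) has_derivative (\<lambda>h. h *\<^sub>R e)) (at s)"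
      by (auto intro!: derivative_eq_intros)
    from has_derivative_compose[OF this pderiv_at_has_derivative[OF smoothD(1)[OF sm]]]
    have "((\<lambda>s. \<eta> (x + s *\<^sub>R e)) has_derivative (\<lambda>h. frechet_derivative \<eta> (at (x + s *\<^sub>R e)) (h *\<^sub>R e))) (at s)" .
    moreover have "frechet_derivative \<eta> (at (x + s *\<^sub>R e)) (h *\<^sub>R e) = pderiv_at i \<eta> (x + s *\<^sub>R e) * h" for h
      using linear_frechet_derivative[OF smoothD(1)[OF sm]] by (simp add: linear_scale pderiv_at_def e_def)
    ultimately show ?thesis
      by (simp add: has_field_derivative_def)
  qed
  have um: "u n \<in> borel_measurable lebesgue" for n
    unfolding u_def using smooth_measurable(1)[OF sm] smooth_measurable(1)[OF smooth_shift[OF sm]] by measurable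
  have uB: "\<bar>u n x\<bar> \<le> B" for n x
  proof -
    let ?h = "inverse (real (Suc n))"
    obtain z where z: "\<eta> (x + ?h *\<^sub>R e) - \<eta> (x + 0 *\<^sub>R e) = (?h - 0) * pderiv_at i \<eta> (x + z *\<^sub>R e)"
      using MVT2[of 0 ?h "\<lambda>s. \<eta> (x + s *\<^sub>R e)" "\<lambda>s. pderiv_at i \<eta> (x + s *\<^sub>R e)"] der by auto
    then have "u n x = pderiv_at i \<eta> (x + z *\<^sub>R e)"
      by (simp add: u_def field_simps)
    then show ?thesis
      using B by simp
  qed
  have uN: "\<bar>x $ j\<bar> \<le> N + 1" if "u n x \<noteq> 0" for n x j
  proof -
    have "\<eta> (x + inverse (real (Suc n)) *\<^sub>R e) \<noteq> 0 \<or> \<eta> x \<noteq> 0"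
      using that by (auto simp: u_def)
    then have "\<bar>x $ j + inverse (real (Suc n)) * e $ j\<bar> \<le> N \<or> \<bar>x $ j\<bar> \<le> N"
      using supp_inD[OF N, of "x + inverse (real (Suc n)) *\<^sub>R e" j] supp_inD[OF N, of x j] by auto
    moreover have "\<bar>inverse (real (Suc n)) * e $ j\<bar> \<le> 1"
      by (auto simp: e_def axis_def inverse_eq_divide)
    ultimately show ?thesis
      by linarith
  qed
  \<comment> \<open>The increments are at most 1, so all difference quotients vanish outside the
    cube of half-width N + 1.\<close>
  define w where "w x = B * indicator (cbox (- (\<chi> i. N + 1)) (\<chi> i. N + 1)) x" for x :: "real ^ 'n"
  have "(\<lambda>n. LINT x|lebesgue. u n x) \<longlonglongrightarrow> (LINT x|lebesgue. pderiv_at i \<eta> x)"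
  proof (rule integral_dominated_convergence[where w = w])
    show "pderiv_at i \<eta> \<in> borel_measurable lebesgue"
      by (intro smooth_measurable smoothD sm)
    have "emeasure lborel (cbox (- (\<chi> i. N + 1)) (\<chi> i. N + 1) :: (real ^ 'n) set) < \<infinity>"
      by (intro emeasure_bounded_finite bounded_cbox)
    then show "integrable lebesgue w"
      unfolding w_def by (intro integrable_mult_right integrable_real_indicator) simp_all
    show "AE x in lebesgue. norm (u n x) \<le> w x" for n
    proof (intro AE_I2)
      fix x
      show "norm (u n x) \<le> w x"
      proof (cases "u n x = 0")
        case False
        then have "x \<in> cbox (- (\<chi> i. N + 1)) (\<chi> i. N + 1)"
          by (intro mem_cube uN[OF False])
        then show ?thesis
          using uB by (simp add: w_def)
      qed (use B in \<open>auto simp: w_def\<close>)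
    qed
    show "AE x in lebesgue. (\<lambda>n. u n x) \<longlonglongrightarrow> pderiv_at i \<eta> x"
    proof (intro AE_I2)
      fix x
      have "((\<lambda>h. (\<eta> (x + h *\<^sub>R e) - \<eta> x) / h) \<longlongrightarrow> pderiv_at i \<eta> x) (at 0)"
        using der[of x 0] by (simp add: DERIV_def)
      moreover have "filterlim (\<lambda>n. inverse (real (Suc n))) (at 0) sequentially"
        using LIMSEQ_inverse_real_of_nat by (auto simp: filterlim_at)
      ultimately show "(\<lambda>n. u n x) \<longlonglongrightarrow> pderiv_at i \<eta> x"
        unfolding u_def by (rule filterlim_compose)
    qed
  qed (rule um)
  moreover have "(LINT x|lebesgue. u n x) = 0" for n
  proof -
    have "(LINT x|lebesgue. u n x) = ((LINT x|lebesgue. \<eta> (x + inverse (real (Suc n)) *\<^sub>R e)) - (LINT x|lebesgue. \<eta> x)) / inverse (real (Suc n))"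
      unfolding u_def using test_function_integrable[OF \<eta>] integrable_shift[OF test_function_integrable[OF \<eta>]]
      by (simp del: of_nat_Suc)
    then show ?thesis
      using integral_shift[OF smooth_measurable(1)[OF sm]] by simp
  qed
  ultimately show ?thesis
    by (simp add: LIMSEQ_const_iff)
qed

lemma integration_by_parts:
  assumes \<eta>: "\<eta> \<in> test_functions" and e: "smooth e"
  shows "(LINT x|lebesgue. pderiv_at i \<eta> x * e x) = - (LINT x|lebesgue. \<eta> x * pderiv_at i e x)"
proof -
  have sm: "smooth \<eta>"
    using \<eta> by (simp add: test_functions_iff)
  have "integrable lebesgue (\<lambda>x. pderiv_at i \<eta> x * e x)" "integrable lebesgue (\<lambda>x. \<eta> x * pderiv_at i e x)"
    using \<eta> e by (auto intro!: test_function_integrable test_function_mult test_function_pderiv smoothD)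
  moreover have "(LINT x|lebesgue. pderiv_at i (\<lambda>x. \<eta> x * e x) x) = 0"
    by (intro integral_pderiv_test_function test_function_mult \<eta> e)
  ultimately show ?thesis
    by (simp add: pderiv_at_mult smoothD sm e)
qed

subsection \<open>A smooth periodic partition of unity\<close>

text \<open>A product of one-dimensional hats. The lattice sum factors into one-dimensional sums,
  each of which has only the terms 0 and -1 when the coordinate lies in (0, 1). Multiplication by
  \<open>\<eta>\<close> turns a smooth periodic function into a test function that unfolds to the
  original on the cell.\<close>

lemma partition_of_unity:
  obtains \<eta> :: "real ^ 'n \<Rightarrow> real" where "\<eta> \<in> test_functions" "supp_in 1 \<eta>"
    "\<And>x. x \<in> cellY \<Longrightarrow> (\<Sum>m\<in>lat 1. \<eta> (x + m)) = 1"
proof -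
  obtain \<theta> :: "real \<Rightarrow> real" where
    \<theta>: "\<And>a b. smooth (\<lambda>x :: real ^ 'n. \<theta> (a \<bullet> x + b))" "\<And>t. \<theta> t \<noteq> 0 \<Longrightarrow> \<bar>t\<bar> \<le> 1"
    "\<And>t. 0 < t \<Longrightarrow> t < 1 \<Longrightarrow> \<theta> t + \<theta> (t - 1) = 1"
    using smooth_hat[where 'n = 'n] by blast
  define \<eta> where "\<eta> x = (\<Prod>i\<in>UNIV. \<theta> (x $ i))" for x :: "real ^ 'n"
  have "smooth (\<lambda>x :: real ^ 'n. \<theta> (x $ i))" for i
    using \<theta>(1)[of "axis i 1" 0] by (simp add: inner_axis')
  then have sm: "smooth \<eta>"
    unfolding \<eta>_def by (intro smooth_prod)
  have supp: "supp_in 1 \<eta>"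
    using \<theta>(2) by (auto simp: \<eta>_def intro!: supp_inI)
  define P where "P = {z \<in> \<int>. \<bar>z :: real\<bar> \<le> 1 + 1}"
  have fin: "finite P"
    unfolding P_def by (rule finite_abs_int_segment)
  have M: "lat 1 = (\<lambda>f :: 'n \<Rightarrow> real. \<chi> i. f i) ` (UNIV \<rightarrow>\<^sub>E P)"
    by (auto simp: lat_def image_iff PiE_def P_def Zn_def intro!: bexI[of _ "\<lambda>i. _ $ i"])
  have one: "(\<Sum>z\<in>P. \<theta> (t + z)) = 1" if t: "0 < t" "t < 1" for t
  proof -
    have "(\<Sum>z\<in>P. \<theta> (t + z)) = (\<Sum>z\<in>{0, -1}. \<theta> (t + z))"
    proof (rule sum.mono_neutral_right[OF fin])
      show "{0, -1} \<subseteq> P"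
        by (auto simp: P_def)
      show "\<forall>z\<in>P - {0, - 1}. \<theta> (t + z) = 0"
      proof
        fix z assume z: "z \<in> P - {0, -1}"
        then obtain j :: int where j: "z = of_int j" "j \<noteq> 0" "j \<noteq> - 1"
          by (auto simp: P_def elim!: Ints_cases)
        then have "1 \<le> j \<or> j \<le> -2"
          by linarith
        then have "1 \<le> z \<or> z \<le> -2"
          using j(1) by linarith
        then have "\<not> \<bar>t + z\<bar> \<le> 1"
          using t by linarith
        then show "\<theta> (t + z) = 0"
          using \<theta>(2) by blast
      qed
    qed
    with \<theta>(3)[OF t] show ?thesis
      by simp
  qed
  have "(\<Sum>m\<in>lat 1. \<eta> (x + m)) = 1" if x: "x \<in> cellY" for x
  proof -
    have "(\<Sum>m\<in>lat 1. \<eta> (x + m)) = (\<Sum>f\<in>UNIV \<rightarrow>\<^sub>E P. \<eta> (x + (\<chi> i. f i)))"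
      unfolding M by (subst sum.reindex) (auto simp: inj_on_def vec_eq_iff)
    also have "\<dots> = (\<Sum>f\<in>UNIV \<rightarrow>\<^sub>E P. \<Prod>i\<in>UNIV. \<theta> (x $ i + f i))"
      by (simp add: \<eta>_def)
    also have "\<dots> = (\<Prod>i\<in>UNIV. \<Sum>z\<in>P. \<theta> (x $ i + z))"
      using fin by (subst prod_sum_PiE) auto
    also have "\<dots> = 1"
      using x by (intro prod.neutral) (auto simp: cellY_def one)
    finally show ?thesis .
  qed
  moreover have "\<eta> \<in> test_functions"
    using sm supp by (rule test_functionI)
  ultimately show thesis
    using supp that by blast
qed

subsection \<open>Weak derivatives and Fourier coefficients\<close>

definition wv :: "real ^ 'n \<Rightarrow> real ^ 'n" where
  "wv k = (2 * pi) *\<^sub>R k"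

lemma ek_Complex: "ek k x = Complex (cos (wv k \<bullet> x)) (sin (wv k \<bullet> x))"
  by (simp add: ek_def wv_def complex_eq_iff)

lemma trig_periodic:
  assumes "k \<in> Zn" "m \<in> Zn"
  shows "cos (wv k \<bullet> (x + m)) = cos (wv k \<bullet> x)" "sin (wv k \<bullet> (x + m)) = sin (wv k \<bullet> x)"
proof -
  have "ek k (x + m) = ek k x"
    using assms by (simp add: ek_shift)
  then show "cos (wv k \<bullet> (x + m)) = cos (wv k \<bullet> x)" "sin (wv k \<bullet> (x + m)) = sin (wv k \<bullet> x)"
    unfolding ek_Complex by simp_all
qed

lemma smooth_trig: "smooth (\<lambda>x. cos (wv k \<bullet> x))" "smooth (\<lambda>x. sin (wv k \<bullet> x))"
  using smooth_cos[of "wv k" 0] smooth_sin[of "wv k" 0] by simp_all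

lemma trig_L2p:
  assumes "k \<in> Zn"
  shows "(\<lambda>x. cos (wv k \<bullet> x)) \<in> L2p" "(\<lambda>x. sin (wv k \<bullet> x)) \<in> L2p"
  using assms by (auto intro!: L2p_bounded[of _ 1] smooth_measurable smooth_trig periodic_aeI simp: trig_periodic)

lemma rc_eq_trig:
  assumes f: "f \<in> L2p" and k: "k \<in> Zn"
  shows "rc f k = Complex (LINT x|Q. f x * cos (wv k \<bullet> x)) (- (LINT x|Q. f x * sin (wv k \<bullet> x)))"
proof -
  have int: "integrable Q (\<lambda>x. complex_of_real (f x) * cnj (ek k x))"
    using integrable_fc[OF L2p_integrable[OF L2p_of_real[OF f]]] .
  have "Re (rc f k) = (LINT x|Q. f x * cos (wv k \<bullet> x))"
    unfolding rc_def fc_def by (subst integral_Re[OF int, symmetric]) (simp add: ek_Complex)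
  moreover have "Im (rc f k) = - (LINT x|Q. f x * sin (wv k \<bullet> x))"
    unfolding rc_def fc_def by (subst integral_Im[OF int, symmetric]) (simp add: ek_Complex)
  ultimately show ?thesis
    by (simp add: complex_eq_iff)
qed

lemma L2p_mult_integrable:
  fixes f g :: "real ^ 'n \<Rightarrow> real"
  assumes "f \<in> L2p" "g \<in> L2p"
  shows "periodic_ae (\<lambda>x. f x * g x)" "(\<lambda>x. f x * g x) \<in> borel_measurable lebesgue" "integrable Q (\<lambda>x. f x * g x)"
  using integrable_inner[OF assms] periodic_ae_comp2[OF L2pD(2)[OF assms(1)] L2pD(2)[OF assms(2)]]
    borel_measurable_times[OF L2pD(1)[OF assms(1)] L2pD(1)[OF assms(2)]] by simp_all

lemma unfold_test_function:
  fixes f \<eta> :: "real ^ 'n \<Rightarrow> real"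
  assumes f: "periodic_ae f" "f \<in> borel_measurable lebesgue" "integrable Q f"
    and \<eta>: "\<eta> \<in> test_functions" "supp_in N \<eta>"
  shows "integrable lebesgue (\<lambda>x. f x * \<eta> x)"
    "(LINT x|lebesgue. f x * \<eta> x) = (LINT x|Q. f x * (\<Sum>m\<in>lat N. \<eta> (x + m)))"
proof -
  obtain B where B: "\<And>x. \<bar>\<eta> x\<bar> \<le> B"
    using test_function_bounded[OF \<eta>(1)] by blast
  have m: "\<eta> \<in> borel_measurable lebesgue"
    using \<eta>(1) by (auto simp: test_functions_iff smooth_measurable)
  show "integrable lebesgue (\<lambda>x. f x * \<eta> x)"
    using integrable_periodic_mult[OF f m B supp_inD[OF \<eta>(2)]] by (simp add: mult.commute lat_def)
  show "(LINT x|lebesgue. f x * \<eta> x) = (LINT x|Q. f x * (\<Sum>m\<in>lat N. \<eta> (x + m)))"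
    using integral_unfold[OF f m B supp_inD[OF \<eta>(2)]] by (simp add: mult.commute lat_def)
qed

lemma sum_pderiv_partition:
  fixes \<eta> :: "real ^ 'n \<Rightarrow> real"
  assumes \<eta>: "smooth \<eta>" "\<And>x. x \<in> cellY \<Longrightarrow> (\<Sum>m\<in>M. \<eta> (x + m)) = 1" and x: "x \<in> cellY"
  shows "(\<Sum>m\<in>M. pderiv_at i \<eta> (x + m)) = 0"
proof -
  have "((\<lambda>x. \<eta> (x + m)) has_derivative frechet_derivative \<eta> (at (x + m))) (at x)" for m
  proof -
    have "((\<lambda>x. x + m) has_derivative (\<lambda>h. h)) (at x)"
      by (auto intro!: derivative_eq_intros)
    from has_derivative_compose[OF this pderiv_at_has_derivative[OF smoothD(1)[OF \<eta>(1)]]]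
    show ?thesis .
  qed
  then have "((\<lambda>x. \<Sum>m\<in>M. \<eta> (x + m)) has_derivative (\<lambda>h. \<Sum>m\<in>M. frechet_derivative \<eta> (at (x + m)) h)) (at x)"
    by (intro has_derivative_sum)
  from pderiv_at_eq[OF this, of i]
  have 1: "pderiv_at i (\<lambda>x. \<Sum>m\<in>M. \<eta> (x + m)) x = (\<Sum>m\<in>M. pderiv_at i \<eta> (x + m))"
    by (simp add: pderiv_at_def[of i \<eta>])
  have "((\<lambda>x. \<Sum>m\<in>M. \<eta> (x + m)) has_derivative (\<lambda>_. 0)) (at x)"
  proof (rule has_derivative_transform_within_open[of "\<lambda>_. 1" _ x UNIV cellY])
    show "open (cellY :: (real ^ 'n) set)"
      unfolding cellY_eq_box by (rule open_box)
  qed (use x \<eta>(2) in auto)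
  from pderiv_at_eq[OF this, of i] 1 show ?thesis
    by simp
qed

text \<open>Testing with \<open>\<eta>\<close> times e and unfolding: the translates of
  \<open>\<eta>\<close> sum to 1 on the cell, and those of its derivative to the derivative of 1,
  which is 0.\<close>

lemma weak_pderiv_periodic_test:
  assumes w: "is_weak_pderiv i f g" and f: "f \<in> L2p" and g: "g \<in> L2p"
    and e: "smooth e" "e \<in> L2p" "pderiv_at i e \<in> L2p"
  shows "(LINT x|Q. g x * e x) = - (LINT x|Q. f x * pderiv_at i e x)"
proof -
  obtain \<eta> :: "real ^ 'a \<Rightarrow> real" where \<eta>: "\<eta> \<in> test_functions" "supp_in 1 \<eta>"
    "\<And>x. x \<in> cellY \<Longrightarrow> (\<Sum>m\<in>lat 1. \<eta> (x + m)) = 1"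
    by (rule partition_of_unity) blast
  have sm: "smooth \<eta>"
    using \<eta>(1) by (simp add: test_functions_iff)
  have \<eta>': "pderiv_at i \<eta> \<in> test_functions" "supp_in 1 (pderiv_at i \<eta>)"
    using \<eta>(1) pderiv_at_support[OF \<eta>(2)] by (auto intro: test_function_pderiv)
  note ge = L2p_mult_integrable[OF g e(2)]
  note fe = L2p_mult_integrable[OF f e(2)]
  note fe' = L2p_mult_integrable[OF f e(3)]
  have "(LINT x|lebesgue. g x * (\<eta> x * e x)) = (LINT x|lebesgue. (g x * e x) * \<eta> x)"
    by (simp add: mult_ac)
  also have "\<dots> = (LINT x|Q. g x * e x)"
    unfolding unfold_test_function(2)[OF ge \<eta>(1,2)]
    by (intro Bochner_Integration.integral_cong) (simp_all add: \<eta>(3))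
  finally have 1: "(LINT x|lebesgue. g x * (\<eta> x * e x)) = (LINT x|Q. g x * e x)" .
  have "(LINT x|lebesgue. f x * pderiv_at i (\<lambda>x. \<eta> x * e x) x) =
      (LINT x|lebesgue. (f x * pderiv_at i e x) * \<eta> x + (f x * e x) * pderiv_at i \<eta> x)"
    by (simp add: pderiv_at_mult smoothD sm e(1) algebra_simps)
  also have "\<dots> = (LINT x|lebesgue. (f x * pderiv_at i e x) * \<eta> x) + (LINT x|lebesgue. (f x * e x) * pderiv_at i \<eta> x)"
    by (intro Bochner_Integration.integral_add unfold_test_function(1)[OF fe' \<eta>(1,2)] unfold_test_function(1)[OF fe \<eta>'])
  also have "(LINT x|lebesgue. (f x * pderiv_at i e x) * \<eta> x) = (LINT x|Q. f x * pderiv_at i e x)"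
    unfolding unfold_test_function(2)[OF fe' \<eta>(1,2)]
    by (intro Bochner_Integration.integral_cong) (simp_all add: \<eta>(3))
  also have "(LINT x|lebesgue. (f x * e x) * pderiv_at i \<eta> x) = (LINT x|(Q :: (real ^ 'a) measure). 0)"
    unfolding unfold_test_function(2)[OF fe \<eta>']
    by (intro Bochner_Integration.integral_cong) (simp_all add: sum_pderiv_partition[OF sm \<eta>(3)])
  finally have 2: "(LINT x|lebesgue. f x * pderiv_at i (\<lambda>x. \<eta> x * e x) x) = (LINT x|Q. f x * pderiv_at i e x)"
    by simp
  have "(LINT x|lebesgue. f x * pderiv_at i (\<lambda>x. \<eta> x * e x) x) = - (LINT x|lebesgue. g x * (\<eta> x * e x))"
    using w test_function_mult[OF \<eta>(1) e(1)] unfolding is_weak_pderiv_def by blast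
  with 1 2 show ?thesis
    by simp
qed

text \<open>The symbol of the i-th partial derivative. For functions in \<open>L2p\<close>, weak
  differentiation is exactly multiplication of the coefficients by it, by the next theorem and
  \<open>rc_imp_weak_pderiv\<close>.\<close>

abbreviation dm :: "'n \<Rightarrow> real ^ 'n \<Rightarrow> complex" where
  "dm i k \<equiv> \<i> * complex_of_real (2 * pi * k $ i)"

theorem weak_pderiv_imp_rc:
  assumes w: "is_weak_pderiv i f g" and f: "f \<in> L2p" and g: "g \<in> L2p" and k: "k \<in> Zn"
  shows "rc g k = dm i k * rc f k"
proof -
  have p: "pderiv_at i (\<lambda>x. cos (wv k \<bullet> x)) = (\<lambda>x. (- 2 * pi * k $ i) * sin (wv k \<bullet> x))"
    "pderiv_at i (\<lambda>x. sin (wv k \<bullet> x)) = (\<lambda>x. (2 * pi * k $ i) * cos (wv k \<bullet> x))"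
    unfolding pderiv_at_cos pderiv_at_sin by (simp_all add: wv_def)
  have "(LINT x|Q. g x * cos (wv k \<bullet> x)) = - (LINT x|Q. f x * pderiv_at i (\<lambda>x. cos (wv k \<bullet> x)) x)"
    "(LINT x|Q. g x * sin (wv k \<bullet> x)) = - (LINT x|Q. f x * pderiv_at i (\<lambda>x. sin (wv k \<bullet> x)) x)"
    by (intro weak_pderiv_periodic_test[OF w f g] smooth_trig trig_L2p[OF k]; unfold p; intro L2p_cmult trig_L2p[OF k])+
  then have "(LINT x|Q. g x * cos (wv k \<bullet> x)) = (2 * pi * k $ i) * (LINT x|Q. f x * sin (wv k \<bullet> x))"
    "(LINT x|Q. g x * sin (wv k \<bullet> x)) = - (2 * pi * k $ i) * (LINT x|Q. f x * cos (wv k \<bullet> x))"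
    unfolding p mult.left_commute[of "f _"] by simp_all
  then show ?thesis
    by (simp add: rc_eq_trig[OF f k] rc_eq_trig[OF g k] complex_eq_iff)
qed

text \<open>Pairings with a test function over the whole space become pairings with H on the cell,
  to which Parseval's identity applies.\<close>

lemma periodization:
  fixes \<eta> :: "real ^ 'n \<Rightarrow> real"
  assumes \<eta>: "\<eta> \<in> test_functions" "supp_in N \<eta>"
  obtains H where "H \<in> L2p" "\<And>f. f \<in> L2p \<Longrightarrow> (LINT x|lebesgue. f x * \<eta> x) = (LINT x|Q. f x * H x)"
proof -
  define M where "M = (lat N :: (real ^ 'n) set)"
  \<comment> \<open>The finite sum over \<open>lat N\<close> is the full lattice sum only for points
    of the cell; taking fractional parts first extends it to a periodic Borel function.\<close>
  define fr where "fr x = (\<chi> i. frac (x $ i))" for x :: "real ^ 'n"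
  define H where "H x = (\<Sum>m\<in>M. \<eta> (fr x + m))" for x
  obtain B where B: "\<And>x. \<bar>\<eta> x\<bar> \<le> B" "B \<ge> 0"
    using test_function_bounded[OF \<eta>(1)] by blast
  have [measurable]: "\<eta> \<in> borel_measurable borel"
    using \<eta>(1) by (simp add: test_functions_iff smooth_measurable)
  have [measurable]: "fr \<in> borel_measurable borel"
  proof (subst borel_measurable_euclidean_space, rule ballI)
    fix b :: "real ^ 'n" assume "b \<in> Basis"
    then obtain i where i: "b = axis i 1"
      by (auto simp: Basis_vec_def)
    have [measurable]: "(\<lambda>x :: real ^ 'n. x $ i) \<in> borel_measurable borel"
      by (intro borel_measurable_continuous_onI continuous_intros)
    have "(\<lambda>x. fr x \<bullet> b) = (\<lambda>x. x $ i - of_int \<lfloor>x $ i\<rfloor>)"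
      by (simp add: fr_def i inner_axis frac_def)
    then show "(\<lambda>x. fr x \<bullet> b) \<in> borel_measurable borel"
      by simp
  qed
  have "H \<in> borel_measurable borel"
    unfolding H_def by measurable
  then have Hm: "H \<in> borel_measurable lebesgue"
    by (intro measurable_completion) (simp only: measurable_cong_sets[OF sets_lborel refl])
  have frZ: "fr (x + k) = fr x" if "k \<in> Zn" for x k
  proof -
    have "frac (x $ i + k $ i) = frac (x $ i)" for i
    proof -
      have "k $ i \<in> \<int>"
        using that by (simp add: Zn_def)
      then obtain j :: int where j: "k $ i = of_int j"
        by (auto elim: Ints_cases)
      have "\<lfloor>x $ i + of_int j\<rfloor> = \<lfloor>x $ i\<rfloor> + j"
        by linarith
      then show ?thesis
        by (simp add: frac_def j)
    qed
    then show ?thesis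
      by (simp add: fr_def vec_eq_iff)
  qed
  have fr_cell: "fr x = x" if "x \<in> cellY" for x
    using that by (simp add: fr_def cellY_def vec_eq_iff frac_eq less_imp_le)
  have "H \<in> L2p"
  proof (rule L2p_bounded[OF Hm])
    show "periodic_ae H"
      by (intro periodic_aeI AE_I2) (simp add: H_def frZ)
    show "AE x in lebesgue. norm (H x) \<le> (\<Sum>m\<in>M. B)"
      unfolding H_def by (intro AE_I2 sum_norm_le) (simp add: B)
  qed
  moreover have "(LINT x|lebesgue. f x * \<eta> x) = (LINT x|Q. f x * H x)" if f: "f \<in> L2p" for f
    unfolding unfold_test_function(2)[OF L2pD(2)[OF f] L2pD(1)[OF f] L2p_integrable[OF f] \<eta>]
    by (intro Bochner_Integration.integral_cong) (simp_all add: H_def fr_cell M_def)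
  ultimately show thesis
    by (rule that)
qed

text \<open>Integration by parts over the whole space against cosines and sines; H and H' enter only
  through the functionals that they represent.\<close>

lemma periodization_rc:
  assumes \<eta>: "\<eta> \<in> test_functions" and H: "H \<in> L2p" "\<And>f. f \<in> L2p \<Longrightarrow> (LINT x|lebesgue. f x * \<eta> x) = (LINT x|Q. f x * H x)"
    and H': "H' \<in> L2p" "\<And>f. f \<in> L2p \<Longrightarrow> (LINT x|lebesgue. f x * pderiv_at i \<eta> x) = (LINT x|Q. f x * H' x)"
    and k: "k \<in> Zn"
  shows "rc H' k = dm i k * rc H k"
proof -
  have p: "pderiv_at i (\<lambda>x. cos (wv k \<bullet> x)) = (\<lambda>x. (- 2 * pi * k $ i) * sin (wv k \<bullet> x))"
    "pderiv_at i (\<lambda>x. sin (wv k \<bullet> x)) = (\<lambda>x. (2 * pi * k $ i) * cos (wv k \<bullet> x))"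
    unfolding pderiv_at_cos pderiv_at_sin by (simp_all add: wv_def)
  have "(LINT x|Q. H' x * cos (wv k \<bullet> x)) = (LINT x|lebesgue. pderiv_at i \<eta> x * cos (wv k \<bullet> x))"
    using H'(2)[OF trig_L2p(1)[OF k]] by (simp add: mult.commute)
  also have "\<dots> = (2 * pi * k $ i) * (LINT x|lebesgue. sin (wv k \<bullet> x) * \<eta> x)"
    unfolding integration_by_parts[OF \<eta> smooth_trig(1)] p mult.left_commute[of "\<eta> _"] by (simp add: mult.commute[of "\<eta> _"])
  also have "\<dots> = (2 * pi * k $ i) * (LINT x|Q. H x * sin (wv k \<bullet> x))"
    using H(2)[OF trig_L2p(2)[OF k]] by (simp add: mult.commute)
  finally have 1: "(LINT x|Q. H' x * cos (wv k \<bullet> x)) = (2 * pi * k $ i) * (LINT x|Q. H x * sin (wv k \<bullet> x))" .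
  have "(LINT x|Q. H' x * sin (wv k \<bullet> x)) = (LINT x|lebesgue. pderiv_at i \<eta> x * sin (wv k \<bullet> x))"
    using H'(2)[OF trig_L2p(2)[OF k]] by (simp add: mult.commute)
  also have "\<dots> = - (2 * pi * k $ i) * (LINT x|lebesgue. cos (wv k \<bullet> x) * \<eta> x)"
    unfolding integration_by_parts[OF \<eta> smooth_trig(2)] p mult.left_commute[of "\<eta> _"] by (simp add: mult.commute[of "\<eta> _"])
  also have "\<dots> = - (2 * pi * k $ i) * (LINT x|Q. H x * cos (wv k \<bullet> x))"
    using H(2)[OF trig_L2p(1)[OF k]] by (simp add: mult.commute)
  finally show ?thesis
    using 1 by (simp add: rc_eq_trig[OF H(1) k] rc_eq_trig[OF H'(1) k] complex_eq_iff)
qed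

lemma L2p_locally_integrable:
  fixes f :: "real ^ 'n \<Rightarrow> real"
  assumes f: "f \<in> L2p"
  shows "locally_integrable f"
  unfolding locally_integrable_def set_integrable_def
proof (intro allI impI)
  fix K :: "(real ^ 'n) set" assume K: "compact K"
  then obtain N where N: "\<And>x. x \<in> K \<Longrightarrow> norm x \<le> N"
    using compact_imp_bounded[OF K] by (auto simp: bounded_iff)
  show "integrable lebesgue (\<lambda>x. indicat_real K x *\<^sub>R f x)"
  proof (rule integrable_periodic_mult[OF L2pD(2)[OF f] L2pD(1)[OF f] L2p_integrable[OF f], of _ 1 N])
    show "indicat_real K \<in> borel_measurable lebesgue"
      using K by (intro borel_measurable_indicator) (simp add: borel_compact)
    show "\<bar>x $ i\<bar> \<le> N" if "indicat_real K x \<noteq> 0" for x i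
      using N[of x] that component_le_norm_cart[of x i] by (auto simp: indicator_def split: if_splits)
  qed (simp add: indicator_def)
qed

text \<open>Both pairings become sums over \<open>Zn\<close> by Parseval. The symbol is imaginary,
  so moving it from the periodised test function to f changes the sign, term by term.\<close>

theorem rc_imp_weak_pderiv:
  assumes f: "f \<in> L2p" and g: "g \<in> L2p" and rc: "\<And>k. k \<in> Zn \<Longrightarrow> rc g k = dm i k * rc f k"
  shows "is_weak_pderiv i f g"
  unfolding is_weak_pderiv_def
proof (intro conjI ballI)
  fix \<eta> :: "real ^ 'a \<Rightarrow> real" assume \<eta>: "\<eta> \<in> test_functions"
  obtain N where N: "supp_in N \<eta>"
    using test_function_support[OF \<eta>] by blast
  obtain H where H: "H \<in> L2p" "\<And>f. f \<in> L2p \<Longrightarrow> (LINT x|lebesgue. f x * \<eta> x) = (LINT x|Q. f x * H x)"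
    using periodization[OF \<eta> N] by blast
  obtain H' where H': "H' \<in> L2p" "\<And>f. f \<in> L2p \<Longrightarrow> (LINT x|lebesgue. f x * pderiv_at i \<eta> x) = (LINT x|Q. f x * H' x)"
    using periodization[OF test_function_pderiv[OF \<eta>] pderiv_at_support[OF N]] by blast
  have "((\<lambda>k. Re (rc f k * cnj (rc H' k))) has_sum (LINT x|Q. f x * H' x)) Zn"
    by (rule parseval_real_inner[OF f H'(1)])
  moreover have "((\<lambda>k. - Re (rc g k * cnj (rc H k))) has_sum - (LINT x|Q. g x * H x)) Zn"
    unfolding has_sum_uminus minus_minus by (rule parseval_real_inner[OF g H(1)])
  moreover have "Re (rc f k * cnj (rc H' k)) = - Re (rc g k * cnj (rc H k))" if k: "k \<in> Zn" for k
  proof -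
    have "rc H' k = dm i k * rc H k"
      using periodization_rc[OF \<eta> H(1) H(2) H'(1) H'(2) k] by blast
    then show ?thesis
      by (simp add: rc[OF k] algebra_simps)
  qed
  ultimately have "(LINT x|Q. f x * H' x) = - (LINT x|Q. g x * H x)"
    using has_sum_unique has_sum_cong by (metis (no_types, lifting))
  then show "(LINT x|lebesgue. f x * pderiv_at i \<eta> x) = - (LINT x|lebesgue. g x * \<eta> x)"
    by (simp add: H H' f g)
qed (use f g in \<open>auto intro: L2p_locally_integrable\<close>)

text \<open>The fundamental lemma of the calculus of variations, by way of Fourier series. The bump
  \<open>\<omega>\<close> is positive exactly on the cell, so on each translated cell u times a
  translate of \<open>\<omega>\<close> is integrable with vanishing Fourier coefficients. The cells
  are treated one by one because u need not be periodic: it will be a difference of arbitrary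
  representatives of weak derivatives.\<close>

lemma AE_eq_0_if_integral_test_functions_0:
  fixes u :: "real ^ 'n \<Rightarrow> real"
  assumes u: "locally_integrable u" and orth: "\<And>\<eta>. \<eta> \<in> test_functions \<Longrightarrow> (LINT x|lebesgue. u x * \<eta> x) = 0"
  shows "AE x in lebesgue. u x = 0"
proof -
  define \<omega> where "\<omega> x = (\<Prod>i\<in>UNIV. bump (x $ i))" for x :: "real ^ 'n"
  have \<omega>_pos: "\<omega> x > 0 \<longleftrightarrow> x \<in> cellY" and \<omega>_0: "x \<notin> cellY \<Longrightarrow> \<omega> x = 0" for x
  proof -
    show "\<omega> x = 0" if "x \<notin> cellY"
      using that by (auto simp: \<omega>_def cellY_def not_less intro: bump_eq_0)
    moreover have "\<omega> x > 0" if "x \<in> cellY"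
      unfolding \<omega>_def using that by (intro prod_pos) (simp add: cellY_def bump_pos_iff)
    ultimately show "\<omega> x > 0 \<longleftrightarrow> x \<in> cellY"
      by force
  qed
  have "smooth (\<lambda>x :: real ^ 'n. bump (x $ i))" for i
    using smooth_bump[of "axis i 1" 0] by (simp add: inner_axis')
  then have \<omega>_smooth: "smooth \<omega>"
    unfolding \<omega>_def by (intro smooth_prod)
  have "\<omega> \<in> test_functions"
  proof (intro test_functionI[OF \<omega>_smooth, of 1] supp_inI)
    fix x i assume "\<omega> x \<noteq> 0"
    then have "x \<in> cellY"
      using \<omega>_0 by blast
    then show "\<bar>x $ i\<bar> \<le> 1"
      by (auto simp: cellY_def abs_le_iff less_imp_le intro: order_trans[of _ 0])
  qed
  then obtain B where B: "\<And>x. \<bar>\<omega> x\<bar> \<le> B"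
    using test_function_bounded by blast
  have main: "AE x in lebesgue. x \<in> cellY \<longrightarrow> u (x + m) = 0" if m: "m \<in> Zn" for m :: "real ^ 'n"
  proof -
    have shift_test: "(\<lambda>x. \<omega> (x + - m) * e x) \<in> test_functions" if "smooth e" for e
    proof (intro test_functionI[of _ "1 + norm m"] supp_inI)
      show "smooth (\<lambda>x. \<omega> (x + - m) * e x)"
        by (intro smooth_mult smooth_shift \<omega>_smooth that)
      fix x i assume "\<omega> (x + - m) * e x \<noteq> 0"
      then have "x - m \<in> cellY"
        using \<omega>_0[of "x + - m"] by auto
      then have "0 < x $ i - m $ i" "x $ i - m $ i < 1"
        by (auto simp: cellY_def)
      then show "\<bar>x $ i\<bar> \<le> 1 + norm m"
        using component_le_norm_cart[of m i] by linarith
    qed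
    have int: "integrable lebesgue (\<lambda>x. u (x + m) * \<omega> x)"
    proof -
      have "compact (cbox m (m + 1))"
        by simp
      then have "integrable lebesgue (\<lambda>x. indicat_real (cbox m (m + 1)) x *\<^sub>R u x)"
        using u unfolding locally_integrable_def set_integrable_def by blast
      from integrable_shift[OF this, of m]
      have i1: "integrable lebesgue (\<lambda>x. indicat_real (cbox m (m + 1)) (x + m) * u (x + m))"
        by simp
      have "integrable lebesgue (\<lambda>x. (indicat_real (cbox m (m + 1)) (x + m) * u (x + m)) * \<omega> x)"
        by (rule integrable_mult_bounded[OF i1, of _ B]) (auto simp: B smooth_measurable \<omega>_smooth)
      moreover have "(indicat_real (cbox m (m + 1)) (x + m) * u (x + m)) * \<omega> x = u (x + m) * \<omega> x" for x
      proof (cases "x \<in> cellY")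
        case True
        then have "x + m \<in> cbox m (m + 1)"
          by (auto simp: mem_box_cart cellY_def less_imp_le)
        then show ?thesis by simp
      qed (simp add: \<omega>_0)
      ultimately show ?thesis
        by simp
    qed
    define v where "v x = u (x + m) * \<omega> x" for x
    \<comment> \<open>A shift carries the bump to the cell m + \<open>cellY\<close> and does not
      affect e, which has period m; the shifted bump times e is a test function.\<close>
    have v0: "(LINT x|lebesgue. v x * e x) = 0" if e: "smooth e" "\<And>x. e (x + m) = e x" for e
    proof -
      have meas: "(\<lambda>x. v x * e x) \<in> borel_measurable lebesgue"
        using borel_measurable_integrable[OF int] smooth_measurable(1)[OF e(1)] unfolding v_def[abs_def, symmetric] by measurable
      have ee: "e (x + - m) = e x" for x
        using e(2)[of "x + - m"] by simp
      have "(LINT x|lebesgue. v x * e x) = (LINT x|lebesgue. v (x + - m) * e (x + - m))"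
        using integral_shift[OF meas, of "- m"] by simp
      also have "\<dots> = (LINT x|lebesgue. u x * (\<omega> (x + - m) * e x))"
        unfolding ee v_def by (simp add: mult.assoc)
      also have "\<dots> = 0"
        by (intro orth shift_test e)
      finally show ?thesis .
    qed
    have vQ: "(LINT x|Q. v x * e x) = (LINT x|lebesgue. v x * e x)" for e
      unfolding integral_restrict_space[of cellY lebesgue, simplified]
      by (intro Bochner_Integration.integral_cong) (auto simp: indicator_def v_def \<omega>_0)
    have "indicator cellY x *\<^sub>R v x = u (x + m) * \<omega> x" for x
      by (cases "x \<in> cellY") (simp_all add: v_def \<omega>_0)
    with int have "integrable lebesgue (\<lambda>x. indicator cellY x *\<^sub>R v x)"
      by simp
    then have vint: "integrable Q v"
      by (simp add: integrable_restrict_space)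
    have "AE x in Q. complex_of_real (v x) = 0"
    proof (rule fc_eq_0_imp_AE_0)
      show "integrable Q (\<lambda>x. complex_of_real (v x))"
        using vint by simp
      fix k :: "real ^ 'n" assume k: "k \<in> Zn"
      have int': "integrable Q (\<lambda>x. complex_of_real (v x) * cnj (ek k x))"
        using vint by (intro integrable_fc) simp
      have "Re (fc (\<lambda>x. complex_of_real (v x)) k) = (LINT x|Q. v x * cos (wv k \<bullet> x))"
        unfolding fc_def by (subst integral_Re[OF int', symmetric]) (simp add: ek_Complex)
      moreover have "Im (fc (\<lambda>x. complex_of_real (v x)) k) = - (LINT x|Q. v x * sin (wv k \<bullet> x))"
        unfolding fc_def by (subst integral_Im[OF int', symmetric]) (simp add: ek_Complex)
      moreover have "(LINT x|Q. v x * cos (wv k \<bullet> x)) = 0" "(LINT x|Q. v x * sin (wv k \<bullet> x)) = 0"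
        unfolding vQ using v0[OF smooth_trig(1)] v0[OF smooth_trig(2)] k m by (simp_all add: trig_periodic)
      ultimately show "fc (\<lambda>x. complex_of_real (v x)) k = 0"
        by (simp add: complex_eq_iff)
    qed
    then show ?thesis
      unfolding AE_Q
    proof eventually_elim
      case (elim x)
      then show ?case
        using \<omega>_pos[of x] by (auto simp: v_def)
    qed
  qed
  have "AE x in lebesgue. \<forall>m\<in>Zn. x - m \<in> cellY \<longrightarrow> u x = 0"
    unfolding AE_ball_countable[OF countable_Zn]
  proof
    fix m :: "real ^ 'n" assume "m \<in> Zn"
    from AE_shift[OF main[OF this], of "- m"]
    show "AE x in lebesgue. x - m \<in> cellY \<longrightarrow> u x = 0"
      by simp
  qed
  with AE_in_translated_cell show ?thesis
    by eventually_elim blast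
qed

lemma locally_integrable_diff:
  assumes "locally_integrable f" "locally_integrable g"
  shows "locally_integrable (\<lambda>x. f x - g x)"
  using assms by (auto simp: locally_integrable_def)

lemma locally_integrable_test:
  assumes f: "locally_integrable f" and \<eta>: "\<eta> \<in> test_functions"
  shows "integrable lebesgue (\<lambda>x. f x * \<eta> x)"
proof -
  let ?K = "closure {x. \<eta> x \<noteq> 0}"
  have "compact ?K"
    using \<eta> by (simp add: test_functions_def)
  then have i: "integrable lebesgue (\<lambda>x. indicat_real ?K x * f x)"
    using f by (simp add: locally_integrable_def set_integrable_def)
  obtain B where B: "\<And>x. \<bar>\<eta> x\<bar> \<le> B"
    using test_function_bounded[OF \<eta>] by blast
  have "integrable lebesgue (\<lambda>x. (indicat_real ?K x * f x) * \<eta> x)"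
    by (rule integrable_mult_bounded[OF i, of _ B])
      (use \<eta> in \<open>auto simp: B smooth_measurable test_functions_iff\<close>)
  moreover have "(indicat_real ?K x * f x) * \<eta> x = f x * \<eta> x" for x
    using closure_subset[of "{x. \<eta> x \<noteq> 0}"] by (auto simp: indicator_def)
  ultimately show ?thesis
    by simp
qed

lemma is_weak_pderiv_unique:
  assumes "is_weak_pderiv i f g" "is_weak_pderiv i f h"
  shows "AE x in lebesgue. g x = h x"
proof -
  have "AE x in lebesgue. g x - h x = 0"
  proof (rule AE_eq_0_if_integral_test_functions_0)
    show "locally_integrable (\<lambda>x. g x - h x)"
      using assms by (auto simp: is_weak_pderiv_def intro: locally_integrable_diff)
    fix \<eta> :: "real ^ 'a \<Rightarrow> real" assume \<eta>: "\<eta> \<in> test_functions"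
    have "integrable lebesgue (\<lambda>x. g x * \<eta> x)" "integrable lebesgue (\<lambda>x. h x * \<eta> x)"
      using assms \<eta> by (auto simp: is_weak_pderiv_def intro: locally_integrable_test)
    moreover have "(LINT x|lebesgue. g x * \<eta> x) = (LINT x|lebesgue. h x * \<eta> x)"
      using assms \<eta> unfolding is_weak_pderiv_def by force
    ultimately show "(LINT x|lebesgue. (g x - h x) * \<eta> x) = 0"
      by (simp add: left_diff_distrib)
  qed
  then show ?thesis
    by eventually_elim simp
qed

text \<open>\<open>weak_pderiv\<close> is a choice among all weak derivatives, and its definition
  promises neither periodicity nor square-integrability. Uniqueness makes it equal almost everywhere
  to any weak derivative in \<open>L2p\<close>, from which it inherits both.\<close>

lemma weak_pderiv_L2p:
  assumes f: "f \<in> L2p" and w: "is_weak_pderiv i f g" and g: "g \<in> L2p"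
  shows "weak_pderiv i f \<in> L2p" "AE x in lebesgue. weak_pderiv i f x = g x"
    "is_weak_pderiv i f (weak_pderiv i f)" "k \<in> Zn \<Longrightarrow> rc (weak_pderiv i f) k = dm i k * rc f k"
proof -
  show 1: "is_weak_pderiv i f (weak_pderiv i f)"
    unfolding weak_pderiv_def by (rule someI[of _ g]) (rule w)
  show 2: "AE x in lebesgue. weak_pderiv i f x = g x"
    by (rule is_weak_pderiv_unique[OF 1 w])
  show 3: "weak_pderiv i f \<in> L2p"
    by (rule L2p_cong_AE[OF g]) (use 2 in \<open>auto elim: eventually_mono\<close>)
  show "rc (weak_pderiv i f) k = dm i k * rc f k" if "k \<in> Zn"
    by (rule weak_pderiv_imp_rc[OF 1 f 3 that])
qed

subsection \<open>Fourier multipliers\<close>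

text \<open>The first condition makes the image of a real function real, the second keeps its
  coefficients square-summable.\<close>

definition is_multiplier :: "(real ^ 'n \<Rightarrow> complex) \<Rightarrow> bool" where
  "is_multiplier m \<longleftrightarrow> (\<forall>k\<in>Zn. m (- k) = cnj (m k)) \<and> (\<exists>C. \<forall>k\<in>Zn. cmod (m k) \<le> C)"

text \<open>A choice among representatives. The condition involves f only through the products
  \<open>m k * rc f k\<close>, so equal products give literally the same function, not merely one
  equal almost everywhere.\<close>

definition mop :: "(real ^ 'n \<Rightarrow> complex) \<Rightarrow> (real ^ 'n \<Rightarrow> real) \<Rightarrow> real ^ 'n \<Rightarrow> real" where
  "mop m f = (SOME g. g \<in> L2p \<and> (\<forall>k\<in>Zn. rc g k = m k * rc f k))"

lemma mop:
  assumes m: "is_multiplier m" and f: "f \<in> L2p"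
  shows "mop m f \<in> L2p" "k \<in> Zn \<Longrightarrow> rc (mop m f) k = m k * rc f k"
proof -
  obtain C where C: "\<And>k. k \<in> Zn \<Longrightarrow> cmod (m k) \<le> C"
    using m by (auto simp: is_multiplier_def)
  have s1: "(\<lambda>k. (cmod (m k * rc f k))\<^sup>2) summable_on Zn"
  proof (rule summable_on_comparison_test)
    show "(\<lambda>k. C\<^sup>2 * (cmod (rc f k))\<^sup>2) summable_on Zn"
      using parseval_real[OF f] by (intro summable_on_cmult_right) (rule has_sum_imp_summable)
    fix k :: "real ^ 'a" assume "k \<in> Zn"
    then show "(cmod (m k * rc f k))\<^sup>2 \<le> C\<^sup>2 * (cmod (rc f k))\<^sup>2"
      using C[of k] by (simp add: norm_mult power_mult_distrib mult_right_mono power_mono)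
  qed simp
  have s2: "m (- k) * rc f (- k) = cnj (m k * rc f k)" if "k \<in> Zn" for k
    using m that by (simp add: is_multiplier_def rc_minus)
  obtain g where "g \<in> L2p" "\<And>k. k \<in> Zn \<Longrightarrow> rc g k = m k * rc f k"
    by (rule riesz_fischer_real[OF s1 s2]) auto
  then have "g \<in> L2p \<and> (\<forall>k\<in>Zn. rc g k = m k * rc f k)"
    by blast
  from someI[of "\<lambda>g. g \<in> L2p \<and> (\<forall>k\<in>Zn. rc g k = m k * rc f k)", OF this]
  show "mop m f \<in> L2p" "k \<in> Zn \<Longrightarrow> rc (mop m f) k = m k * rc f k"
    unfolding mop_def by blast+
qed

text \<open>The multipliers of \<open>\<partial>\<^sub>i\<partial>\<^sub>j\<Delta>\<^sup>-\<^sup>1\<close>, \<open>\<partial>\<^sub>i\<Delta>\<^sup>-\<^sup>1\<close> and \<open>\<Delta>\<^sup>-\<^sup>1\<close>. At \<open>k = 0\<close> the division by zero gives \<open>0\<close>, so they annihilate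
  constants and map into mean-zero functions.\<close>

definition Rm :: "'n \<Rightarrow> 'n \<Rightarrow> real ^ 'n \<Rightarrow> complex" where
  "Rm i j k = complex_of_real (k $ i * k $ j / (k \<bullet> k))"

definition Sm :: "'n \<Rightarrow> real ^ 'n \<Rightarrow> complex" where
  "Sm i k = - \<i> * complex_of_real (k $ i / (2 * pi * (k \<bullet> k)))"

definition Gm :: "real ^ 'n \<Rightarrow> complex" where
  "Gm k = - complex_of_real (1 / (4 * pi\<^sup>2 * (k \<bullet> k)))"

lemma Zn_norm_ge_1:
  assumes "k \<in> Zn" "k \<noteq> 0"
  shows "1 \<le> k \<bullet> k"
proof -
  obtain i where i: "k $ i \<noteq> 0"
    using assms(2) by (auto simp: vec_eq_iff)
  then obtain z :: int where "k $ i = of_int z" "z \<noteq> 0"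
    using assms(1) by (auto simp: Zn_def elim!: Ints_cases dest!: spec[of _ i])
  then have "1 \<le> \<bar>k $ i\<bar>"
    by simp
  then have "1 \<le> (k $ i)\<^sup>2"
    using one_le_power[of "\<bar>k $ i\<bar>" 2] by simp
  also have "\<dots> \<le> (\<Sum>i\<in>UNIV. (k $ i)\<^sup>2)"
    by (rule member_le_sum[of i UNIV "\<lambda>i. (k $ i)\<^sup>2"]) auto
  finally show ?thesis
    by (simp add: inner_vec_def power2_eq_square)
qed

lemma inner_self_sum: "k \<bullet> k = (\<Sum>i\<in>UNIV. (k $ i)\<^sup>2)" for k :: "real ^ 'n"
  by (simp add: inner_vec_def power2_eq_square)

lemma is_multiplier_Rm: "is_multiplier (Rm i j)" for i j :: "'n :: finite"
  unfolding is_multiplier_def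
proof (intro conjI ballI exI)
  fix k :: "real ^ 'n" assume "k \<in> Zn"
  show "Rm i j (- k) = cnj (Rm i j k)"
    by (simp add: Rm_def)
  have "\<bar>k $ i * k $ j\<bar> \<le> k \<bullet> k"
    using component_le_norm_cart[of k i] component_le_norm_cart[of k j]
    by (simp add: abs_mult dot_square_norm power2_eq_square mult_mono)
  then show "cmod (Rm i j k) \<le> 1"
    by (simp add: Rm_def divide_le_eq_1 del: of_real_mult of_real_divide)
qed

lemma is_multiplier_Sm: "is_multiplier (Sm i)" for i :: "'n :: finite"
  unfolding is_multiplier_def
proof (intro conjI ballI exI)
  fix k :: "real ^ 'n" assume k: "k \<in> Zn"
  show "Sm i (- k) = cnj (Sm i k)"
    by (simp add: Sm_def)
  show "cmod (Sm i k) \<le> 1"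
  proof (cases "k = 0")
    case False
    have 1: "1 \<le> k \<bullet> k"
      by (rule Zn_norm_ge_1[OF k False])
    then have "1 \<le> norm k"
      by (simp add: norm_eq_sqrt_inner)
    have "\<bar>k $ i\<bar> \<le> norm k"
      by (rule component_le_norm_cart)
    also have "\<dots> \<le> norm k * norm k"
      using mult_left_mono[OF \<open>1 \<le> norm k\<close>, of "norm k"] by simp
    also have "\<dots> = k \<bullet> k"
      by (simp add: dot_square_norm power2_eq_square)
    also have "\<dots> \<le> 2 * pi * (k \<bullet> k)"
      using 1 pi_gt3 mult_right_mono[of 1 "2 * pi" "k \<bullet> k"] by simp
    finally have "\<bar>k $ i\<bar> \<le> 2 * pi * (k \<bullet> k)" .
    then have "\<bar>k $ i\<bar> / (2 * pi * (k \<bullet> k)) \<le> 1"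
    proof -
      have "0 < 2 * pi * (k \<bullet> k)"
        using 1 by (intro mult_pos_pos) auto
      then show ?thesis
        using \<open>\<bar>k $ i\<bar> \<le> 2 * pi * (k \<bullet> k)\<close> by (metis divide_le_eq_1_pos)
    qed
    moreover have "cmod (Sm i k) = \<bar>k $ i / (2 * pi * (k \<bullet> k))\<bar>"
      unfolding Sm_def norm_mult norm_of_real by simp
    ultimately show ?thesis
      using 1 by (simp add: abs_mult)
  qed (simp add: Sm_def)
qed

lemma is_multiplier_Gm: "is_multiplier Gm"
  unfolding is_multiplier_def
proof (intro conjI ballI exI)
  fix k :: "real ^ 'n" assume k: "k \<in> Zn"
  show "Gm (- k) = cnj (Gm k)"
    by (simp add: Gm_def)
  show "cmod (Gm k) \<le> 1"
  proof (cases "k = 0")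
    case False
    have "1 \<le> pi\<^sup>2"
      using pi_gt3 by (intro one_le_power) simp
    then have "1 * 1 \<le> (4 * pi\<^sup>2) * (k \<bullet> k)"
      using Zn_norm_ge_1[OF k False] by (intro mult_mono) auto
    moreover have "cmod (Gm k) = \<bar>1 / (4 * pi\<^sup>2 * (k \<bullet> k))\<bar>"
      unfolding Gm_def norm_minus_cancel norm_of_real by simp
    moreover have "\<bar>1 / D\<bar> \<le> 1" if "1 * 1 \<le> D" for D :: real
      using that by simp
    ultimately show ?thesis
      by (simp only:)
  qed (simp add: Gm_def)
qed

lemma is_multiplier_cnj: "is_multiplier m \<Longrightarrow> is_multiplier (\<lambda>k. cnj (m k))"
  by (auto simp: is_multiplier_def)

text \<open>By Parseval, since a symbol changes sides under conjugation.\<close>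

lemma mop_adjoint:
  assumes m: "is_multiplier m" and f: "f \<in> L2p" and g: "g \<in> L2p"
  shows "(LINT x|Q. f x * mop m g x) = (LINT x|Q. mop (\<lambda>k. cnj (m k)) f x * g x)"
proof -
  have "((\<lambda>k. Re (rc f k * cnj (rc (mop m g) k))) has_sum (LINT x|Q. f x * mop m g x)) Zn"
    by (intro parseval_real_inner f mop[OF m g])
  moreover have "((\<lambda>k. Re (rc (mop (\<lambda>k. cnj (m k)) f) k * cnj (rc g k))) has_sum
      (LINT x|Q. mop (\<lambda>k. cnj (m k)) f x * g x)) Zn"
    by (intro parseval_real_inner g mop[OF is_multiplier_cnj[OF m] f])
  moreover have "Re (rc f k * cnj (rc (mop m g) k)) = Re (rc (mop (\<lambda>k. cnj (m k)) f) k * cnj (rc g k))" if "k \<in> Zn" for k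
    using mop(2)[OF m g that] mop(2)[OF is_multiplier_cnj[OF m] f that] by (simp add: mult_ac)
  ultimately show ?thesis
    using has_sum_unique has_sum_cong by (metis (no_types, lifting))
qed

subsection \<open>Second-order periodic Sobolev functions\<close>

lemma H_per_2D:
  fixes \<phi> :: "real ^ 'n \<Rightarrow> real"
  assumes \<phi>: "\<phi> \<in> H_per 2"
  shows "\<phi> \<in> L2p" "weak_pderiv i \<phi> \<in> L2p" "weak_pderiv j (weak_pderiv i \<phi>) \<in> L2p"
    "k \<in> Zn \<Longrightarrow> rc (weak_pderiv i \<phi>) k = dm i k * rc \<phi> k"
    "k \<in> Zn \<Longrightarrow> rc (weak_pderiv j (weak_pderiv i \<phi>)) k = - complex_of_real (4 * pi\<^sup>2 * (k $ i * k $ j)) * rc \<phi> k"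
proof -
  show \<phi>L: "\<phi> \<in> L2p"
    using \<phi> by (simp add: numeral_2_eq_2 L2_per_eq)
  obtain g where g: "g \<in> H_per 1" "is_weak_pderiv i \<phi> g"
    using \<phi> unfolding numeral_2_eq_2 One_nat_def H_per.simps(2)[of "Suc 0"] by blast
  then have gL: "g \<in> L2p"
    by (simp add: L2_per_eq)
  obtain h where h: "h \<in> L2p" "is_weak_pderiv j g h"
    using g(1) by (auto simp: L2_per_eq)
  note wi = weak_pderiv_L2p[OF \<phi>L g(2) gL]
  show w1: "weak_pderiv i \<phi> \<in> L2p"
    by (rule wi(1))
  show w4: "rc (weak_pderiv i \<phi>) k = dm i k * rc \<phi> k" if "k \<in> Zn" for k
    by (rule wi(4)[OF that])
  \<comment> \<open>The second derivative \<open>h\<close> belongs to \<open>g\<close>, the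
    derivative supplied by \<open>H_per\<close>, and not to the representative chosen by
    \<open>weak_pderiv\<close>. Both have the same coefficients, and these decide weak
    differentiability.\<close>
  have "is_weak_pderiv j (weak_pderiv i \<phi>) h"
  proof (rule rc_imp_weak_pderiv[OF w1 h(1)])
    fix k :: "real ^ 'n" assume k: "k \<in> Zn"
    have "rc (weak_pderiv i \<phi>) k = rc g k"
      by (rule rc_cong_AE[OF wi(2) L2pD(1)[OF w1] L2pD(1)[OF gL]])
    then show "rc h k = dm j k * rc (weak_pderiv i \<phi>) k"
      using weak_pderiv_imp_rc[OF h(2) gL h(1) k] by simp
  qed
  note wj = weak_pderiv_L2p[OF w1 this h(1)]
  show "weak_pderiv j (weak_pderiv i \<phi>) \<in> L2p"
    by (rule wj(1))
  show "rc (weak_pderiv j (weak_pderiv i \<phi>)) k = - complex_of_real (4 * pi\<^sup>2 * (k $ i * k $ j)) * rc \<phi> k" if "k \<in> Zn" for k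
    unfolding wj(4)[OF that] w4[OF that] by (simp add: power2_eq_square)
qed

lemma weak_laplacian_L2p:
  assumes \<phi>: "\<phi> \<in> H_per 2"
  shows "weak_laplacian \<phi> \<in> L2p"
    "k \<in> Zn \<Longrightarrow> rc (weak_laplacian \<phi>) k = - complex_of_real (4 * pi\<^sup>2 * (k \<bullet> k)) * rc \<phi> k"
proof -
  have eq: "weak_laplacian \<phi> = (\<lambda>x. \<Sum>i\<in>UNIV. weak_pderiv i (weak_pderiv i \<phi>) x)"
    by (simp add: fun_eq_iff weak_laplacian_def)
  show "weak_laplacian \<phi> \<in> L2p"
    unfolding eq by (intro L2p_sum H_per_2D[OF \<phi>])
  assume k: "k \<in> Zn"
  have "rc (weak_laplacian \<phi>) k = (\<Sum>i\<in>UNIV. - complex_of_real (4 * pi\<^sup>2 * (k $ i * k $ i)) * rc \<phi> k)"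
    unfolding eq by (simp only: rc_sum H_per_2D[OF \<phi>] k)
  also have "\<dots> = - complex_of_real (4 * pi\<^sup>2 * (k \<bullet> k)) * rc \<phi> k"
    unfolding inner_vec_def inner_real_def by (simp add: sum_distrib_left sum_distrib_right sum_negf mult.assoc)
  finally show "rc (weak_laplacian \<phi>) k = - complex_of_real (4 * pi\<^sup>2 * (k \<bullet> k)) * rc \<phi> k" .
qed

text \<open>Up to null sets the range of the Laplacian on \<open>H_per 2\<close>: the mean is the
  coefficient at 0, where the symbol of the Laplacian vanishes.\<close>

definition L0 :: "(real ^ 'n \<Rightarrow> real) set" where
  "L0 = {f \<in> L2p. (LINT x|Q. f x) = 0}"

lemma L0D: "f \<in> L0 \<Longrightarrow> f \<in> L2p" "f \<in> L0 \<Longrightarrow> rc f 0 = 0" "f \<in> L0 \<Longrightarrow> (LINT x|Q. f x) = 0"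
  by (auto simp: L0_def rc_0)

lemma L0I: "f \<in> L2p \<Longrightarrow> rc f 0 = 0 \<Longrightarrow> f \<in> L0"
  by (auto simp: L0_def rc_0)

lemma L0_diff: "f \<in> L0 \<Longrightarrow> g \<in> L0 \<Longrightarrow> (\<lambda>x. f x - g x) \<in> L0"
  by (auto intro!: L0I L2p_diff simp: L0D rc_diff)

lemma weak_laplacian_L0: "\<phi> \<in> H_per 2 \<Longrightarrow> weak_laplacian \<phi> \<in> L0"
  by (intro L0I) (simp_all add: weak_laplacian_L2p)

lemma H_per_2_via_laplacian:
  assumes \<phi>: "\<phi> \<in> H_per 2"
  shows "AE x in lebesgue. weak_pderiv i \<phi> x = mop (Sm i) (weak_laplacian \<phi>) x"
    "AE x in lebesgue. weak_pderiv i (weak_pderiv j \<phi>) x = mop (Rm i j) (weak_laplacian \<phi>) x"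
proof -
  note L = weak_laplacian_L2p[OF \<phi>]
  show "AE x in lebesgue. weak_pderiv i \<phi> x = mop (Sm i) (weak_laplacian \<phi>) x"
  proof (rule rc_inject[OF H_per_2D(2)[OF \<phi>] mop(1)[OF is_multiplier_Sm L(1)]])
    fix k :: "real ^ 'a" assume k: "k \<in> Zn"
    show "rc (weak_pderiv i \<phi>) k = rc (mop (Sm i) (weak_laplacian \<phi>)) k"
      unfolding H_per_2D(4)[OF \<phi> k] mop(2)[OF is_multiplier_Sm L(1) k] L(2)[OF k]
      by (cases "k = 0") (simp_all add: Sm_def field_simps power2_eq_square)
  qed
  show "AE x in lebesgue. weak_pderiv i (weak_pderiv j \<phi>) x = mop (Rm i j) (weak_laplacian \<phi>) x"
  proof (rule rc_inject[OF H_per_2D(3)[OF \<phi>] mop(1)[OF is_multiplier_Rm L(1)]])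
    fix k :: "real ^ 'a" assume k: "k \<in> Zn"
    show "rc (weak_pderiv i (weak_pderiv j \<phi>)) k = rc (mop (Rm i j) (weak_laplacian \<phi>)) k"
      unfolding H_per_2D(5)[OF \<phi> k] mop(2)[OF is_multiplier_Rm L(1) k] L(2)[OF k]
      by (cases "k = 0") (simp_all add: Rm_def field_simps power2_eq_square)
  qed
qed

lemma poisson:
  fixes g :: "real ^ 'n \<Rightarrow> real"
  assumes g: "g \<in> L0"
  shows "mop Gm g \<in> H_per0 2" "AE x in lebesgue. weak_laplacian (mop Gm g) x = g x"
proof -
  let ?\<phi> = "mop Gm g"
  note G = mop[OF is_multiplier_Gm L0D(1)[OF g]] and S = mop[OF is_multiplier_Sm L0D(1)[OF g]]
    and R = mop[OF is_multiplier_Rm L0D(1)[OF g]]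
  have "is_weak_pderiv i ?\<phi> (mop (Sm i) g)" for i
  proof (rule rc_imp_weak_pderiv[OF G(1) S(1)])
    fix k :: "real ^ 'n" assume k: "k \<in> Zn"
    show "rc (mop (Sm i) g) k = dm i k * rc ?\<phi> k"
      unfolding S(2)[OF k] G(2)[OF k]
      by (cases "k = 0") (simp_all add: Sm_def Gm_def field_simps power2_eq_square)
  qed
  moreover have "is_weak_pderiv j (mop (Sm i) g) (mop (Rm i j) g)" for i j
  proof (rule rc_imp_weak_pderiv[OF S(1) R(1)])
    fix k :: "real ^ 'n" assume k: "k \<in> Zn"
    show "rc (mop (Rm i j) g) k = dm j k * rc (mop (Sm i) g) k"
      unfolding S(2)[OF k] R(2)[OF k]
      by (cases "k = 0") (simp_all add: Sm_def Rm_def field_simps power2_eq_square)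
  qed
  ultimately have H: "?\<phi> \<in> H_per 2"
    using G(1) S(1) R(1) unfolding numeral_2_eq_2 H_per.simps L2_per_eq by blast
  moreover have "(LINT x|Q. ?\<phi> x) = 0"
  proof -
    have "complex_of_real (LINT x|Q. ?\<phi> x) = 0"
      using G(2)[of 0] L0D(2)[OF g] rc_0[OF G(1)] by simp
    then show ?thesis
      by simp
  qed
  ultimately show "?\<phi> \<in> H_per0 2"
    by (simp add: H_per0_def set_lebesgue_integral_Q)
  show "AE x in lebesgue. weak_laplacian ?\<phi> x = g x"
  proof (rule rc_inject[OF weak_laplacian_L2p(1)[OF H] L0D(1)[OF g]])
    fix k :: "real ^ 'n" assume k: "k \<in> Zn"
    show "rc (weak_laplacian ?\<phi>) k = rc g k"
      unfolding weak_laplacian_L2p(2)[OF H k] G(2)[OF k]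
      by (cases "k = 0") (simp_all add: Gm_def L0D(2)[OF g])
  qed
qed

text \<open>The symbol of the Laplacian cancels except at 0, where both coefficients vanish because
  the functions have mean zero. The factor c serves the scaling of psi with c.\<close>

lemma weak_laplacian_inject:
  assumes \<phi>: "\<phi> \<in> H_per0 2" and \<psi>: "\<psi> \<in> H_per0 2"
    and eq: "AE x in lebesgue. weak_laplacian \<phi> x = c * weak_laplacian \<psi> x"
  shows "AE x in lebesgue. \<phi> x = c * \<psi> x"
proof -
  have H: "\<phi> \<in> H_per 2" "\<psi> \<in> H_per 2" and m: "(LINT x|Q. \<phi> x) = 0" "(LINT x|Q. \<psi> x) = 0"
    using \<phi> \<psi> by (auto simp: H_per0_def set_lebesgue_integral_Q)
  note L = weak_laplacian_L2p[OF H(1)] and L' = weak_laplacian_L2p[OF H(2)]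
  show ?thesis
  proof (rule rc_inject[OF H_per_2D(1)[OF H(1)] L2p_cmult[OF H_per_2D(1)[OF H(2)]]])
    fix k :: "real ^ 'a" assume k: "k \<in> Zn"
    have "rc (weak_laplacian \<phi>) k = rc (\<lambda>x. c * weak_laplacian \<psi> x) k"
      using L(1) L'(1) by (intro rc_cong_AE[OF eq]) (auto intro: L2p_cmult dest: L2pD)
    then have "complex_of_real (4 * pi\<^sup>2 * (k \<bullet> k)) * rc \<phi> k = complex_of_real (4 * pi\<^sup>2 * (k \<bullet> k)) * (c * rc \<psi> k)"
      unfolding rc_cmult L(2)[OF k] L'(2)[OF k] by simp
    then show "rc \<phi> k = rc (\<lambda>x. c * \<psi> x) k"
      using m rc_0[OF H_per_2D(1)[OF H(1)]] rc_0[OF H_per_2D(1)[OF H(2)]]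
      by (cases "k = 0") (simp_all add: rc_cmult)
  qed
qed

lemma nrm_power2_real: "(nrm f)\<^sup>2 = (LINT x|Q. f x * f x)" for f :: "real ^ 'n \<Rightarrow> real"
  unfolding nrm_power2 by (simp add: power2_eq_square)

subsection \<open>The operator in terms of the Laplacian\<close>

text \<open>On pairs the squared norm is |M|^2 + |v|^2, the numerator of the Cordes quotient, so one
  Cauchy-Schwarz inequality treats the second-order and the drift term together.\<close>

type_synonym 'n coeff = "(real ^ 'n ^ 'n) \<times> (real ^ 'n)"

text \<open>For mean-zero f, the Hessian and the gradient of the solution of Delta phi = f.\<close>

definition DD :: "(real ^ 'n \<Rightarrow> real) \<Rightarrow> real ^ 'n \<Rightarrow> 'n coeff" where
  "DD f x = ((\<chi> i j. mop (Rm i j) f x), (\<chi> i. mop (Sm i) f x))"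

text \<open>The coefficients of the Laplacian.\<close>

definition w0 :: "('n :: finite) coeff" where
  "w0 = (mat 1, 0)"

lemma inner_DD:
  "v \<bullet> DD f x = (\<Sum>i\<in>UNIV. \<Sum>j\<in>UNIV. fst v $ i $ j * mop (Rm i j) f x) + (\<Sum>i\<in>UNIV. snd v $ i * mop (Sm i) f x)"
  by (simp add: DD_def inner_prod_def inner_vec_def)

lemma norm_DD:
  "(norm (DD f x))\<^sup>2 = (\<Sum>i\<in>UNIV. \<Sum>j\<in>UNIV. (mop (Rm i j) f x)\<^sup>2) + (\<Sum>i\<in>UNIV. (mop (Sm i) f x)\<^sup>2)"
  unfolding power2_norm_eq_inner inner_DD by (simp add: DD_def power2_eq_square)

lemma has_sum_finite_sum:
  fixes f :: "'i \<Rightarrow> 'k \<Rightarrow> real"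
  assumes "\<And>i. i \<in> I \<Longrightarrow> (f i has_sum s i) A"
  shows "((\<lambda>k. \<Sum>i\<in>I. f i k) has_sum (\<Sum>i\<in>I. s i)) A"
  using assms by (induction I rule: infinite_finite_induct) (auto intro: has_sum_add)

text \<open>Off the origin the second-order part is |k|^4 / |k|^4 = 1. The gradient part is 1 / (4
  pi^2 |k|^2), at most 1 / (4 pi^2) since |k| \<ge> 1 on the lattice.\<close>

lemma multiplier_square_sum:
  fixes k :: "real ^ 'n"
  assumes k: "k \<in> Zn"
  shows "(\<Sum>i\<in>UNIV. \<Sum>j\<in>UNIV. (cmod (Rm i j k))\<^sup>2) + (\<Sum>i\<in>UNIV. (cmod (Sm i k))\<^sup>2) \<le> 1 + 1 / (4 * pi\<^sup>2)"
proof (cases "k = 0")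
  case False
  define N where "N = k \<bullet> k"
  have N: "1 \<le> N" "(\<Sum>i\<in>UNIV. (k $ i)\<^sup>2) = N"
    using Zn_norm_ge_1[OF k False] by (simp_all add: N_def inner_self_sum)
  have "(\<Sum>i\<in>UNIV. \<Sum>j\<in>UNIV. (cmod (Rm i j k))\<^sup>2) = (\<Sum>i\<in>UNIV. \<Sum>j\<in>UNIV. (k $ i)\<^sup>2 * (k $ j)\<^sup>2 / N\<^sup>2)"
    unfolding Rm_def norm_of_real by (simp add: N_def power_divide power_mult_distrib)
  also have "\<dots> = (\<Sum>i\<in>UNIV. (k $ i)\<^sup>2) * (\<Sum>j\<in>UNIV. (k $ j)\<^sup>2) / N\<^sup>2"
    by (simp add: sum_product sum_divide_distrib)
  also have "\<dots> = 1"
    using N by (simp add: power2_eq_square)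
  finally have 1: "(\<Sum>i\<in>UNIV. \<Sum>j\<in>UNIV. (cmod (Rm i j k))\<^sup>2) = 1" .
  have "(cmod (Sm i k))\<^sup>2 = (k $ i)\<^sup>2 / (4 * pi\<^sup>2 * N\<^sup>2)" for i
    unfolding Sm_def norm_mult norm_of_real by (simp add: N_def power_divide power_mult_distrib)
  then have "(\<Sum>i\<in>UNIV. (cmod (Sm i k))\<^sup>2) = N / (4 * pi\<^sup>2 * N\<^sup>2)"
    using N(2) by (simp flip: sum_divide_distrib)
  also have "\<dots> = 1 / (4 * pi\<^sup>2) * (1 / N)"
    using N(1) by (simp add: power2_eq_square)
  also have "\<dots> \<le> 1 / (4 * pi\<^sup>2) * 1"
    using N(1) by (intro mult_left_mono) auto
  finally show ?thesis
    using 1 by simp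
qed (simp add: Rm_def Sm_def)

lemma periodic_ae_sum:
  "(\<And>i. i \<in> I \<Longrightarrow> periodic_ae (f i)) \<Longrightarrow> periodic_ae (\<lambda>x. \<Sum>i\<in>I. f i x :: real)"
proof (induction I rule: infinite_finite_induct)
  case (insert i I)
  then have "periodic_ae (\<lambda>x. f i x + (\<Sum>i\<in>I. f i x))"
    by (intro periodic_ae_comp2[of _ _ "(+)"]) auto
  with insert show ?case by simp
qed (simp_all add: periodic_ae_def)

text \<open>Parseval for every component; the squared symbols are then added frequency by frequency,
  so no constant is lost in putting the components together.\<close>

lemma norm_DD_L2p:
  fixes f :: "real ^ 'n \<Rightarrow> real"
  assumes f: "f \<in> L2p"
  shows "(\<lambda>x. norm (DD f x)) \<in> L2p"
    "(nrm (\<lambda>x. norm (DD f x)))\<^sup>2 \<le> (1 + 1 / (4 * pi\<^sup>2)) * (nrm f)\<^sup>2"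
proof -
  note R = mop[OF is_multiplier_Rm f] and S = mop[OF is_multiplier_Sm f]
  have eq: "norm (DD f x) = sqrt ((\<Sum>i\<in>UNIV. \<Sum>j\<in>UNIV. (mop (Rm i j) f x)\<^sup>2) + (\<Sum>i\<in>UNIV. (mop (Sm i) f x)\<^sup>2))" for x
    unfolding norm_DD[symmetric] by simp
  have int: "integrable Q (\<lambda>x. (mop (Rm i j) f x)\<^sup>2)" "integrable Q (\<lambda>x. (mop (Sm i) f x)\<^sup>2)" for i j
    using L2pD(3)[OF R(1)] L2pD(3)[OF S(1)] by simp_all
  have "(\<lambda>x. norm (DD f x)) \<in> borel_measurable lebesgue"
    unfolding eq using L2pD(1)[OF R(1)] L2pD(1)[OF S(1)] by measurable
  moreover have "periodic_ae (\<lambda>x. norm (DD f x))"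
    unfolding eq
    by (intro periodic_ae_comp[of _ sqrt] periodic_ae_comp2[of _ _ "(+)"] periodic_ae_sum
        periodic_ae_comp[of _ "\<lambda>t. t\<^sup>2"] L2pD(2)[OF R(1)] L2pD(2)[OF S(1)])
  moreover have "integrable Q (\<lambda>x. (norm (DD f x))\<^sup>2)"
    unfolding norm_DD using int by (intro Bochner_Integration.integrable_add Bochner_Integration.integrable_sum)
  ultimately show "(\<lambda>x. norm (DD f x)) \<in> L2p"
    by (simp add: L2p_def)
  define s where "s = (\<Sum>i\<in>UNIV. \<Sum>j\<in>UNIV. (nrm (mop (Rm i j) f))\<^sup>2) + (\<Sum>i\<in>UNIV. (nrm (mop (Sm i) f))\<^sup>2)"
  define t where "t k = (\<Sum>i\<in>UNIV. \<Sum>j\<in>UNIV. (cmod (rc (mop (Rm i j) f) k))\<^sup>2) + (\<Sum>i\<in>UNIV. (cmod (rc (mop (Sm i) f) k))\<^sup>2)" for k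
  have e: "(nrm (\<lambda>x. norm (DD f x)))\<^sup>2 = s"
    unfolding s_def nrm_power2 real_norm_def abs_norm_cancel norm_DD using int by simp
  have t_sum: "(t has_sum s) Zn"
    unfolding t_def[abs_def] s_def by (intro has_sum_add has_sum_finite_sum parseval_real R(1) S(1))
  have f_sum: "((\<lambda>k. (1 + 1 / (4 * pi\<^sup>2)) * (cmod (rc f k))\<^sup>2) has_sum (1 + 1 / (4 * pi\<^sup>2)) * (nrm f)\<^sup>2) Zn"
    by (intro has_sum_cmult_right parseval_real f)
  have "t k \<le> (1 + 1 / (4 * pi\<^sup>2)) * (cmod (rc f k))\<^sup>2" if k: "k \<in> Zn" for k
  proof -
    have "t k = ((\<Sum>i\<in>UNIV. \<Sum>j\<in>UNIV. (cmod (Rm i j k))\<^sup>2) + (\<Sum>i\<in>UNIV. (cmod (Sm i k))\<^sup>2)) * (cmod (rc f k))\<^sup>2"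
      unfolding t_def R(2)[OF k] S(2)[OF k] norm_mult power_mult_distrib distrib_right sum_distrib_right ..
    then show ?thesis
      using mult_right_mono[OF multiplier_square_sum[OF k], of "(cmod (rc f k))\<^sup>2"] by simp
  qed
  then show "(nrm (\<lambda>x. norm (DD f x)))\<^sup>2 \<le> (1 + 1 / (4 * pi\<^sup>2)) * (nrm f)\<^sup>2"
    unfolding e by (rule has_sum_mono[OF t_sum f_sum])
qed

text \<open>The diagonal symbols k_i^2 / |k|^2 add up to 1 except at 0, where f has no
  coefficient.\<close>

lemma inner_w0_DD:
  fixes f :: "real ^ 'n \<Rightarrow> real"
  assumes f: "f \<in> L0"
  shows "AE x in lebesgue. w0 \<bullet> DD f x = f x"
proof -
  have eq: "w0 \<bullet> DD f x = (\<Sum>i\<in>UNIV. mop (Rm i i) f x)" for x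
    unfolding inner_DD w0_def by (simp add: mat_def if_distrib[of "\<lambda>a. a * _"] cong: if_cong)
  note R = mop[OF is_multiplier_Rm L0D(1)[OF f]]
  show ?thesis
    unfolding eq
  proof (rule rc_inject[OF L2p_sum[OF R(1)] L0D(1)[OF f]])
    fix k :: "real ^ 'n" assume k: "k \<in> Zn"
    have "rc (\<lambda>x. \<Sum>i\<in>UNIV. mop (Rm i i) f x) k = (\<Sum>i\<in>UNIV. Rm i i k * rc f k)"
      by (simp add: rc_sum R k)
    also have "\<dots> = complex_of_real ((\<Sum>i\<in>UNIV. k $ i * k $ i) / (k \<bullet> k)) * rc f k"
      by (simp only: Rm_def of_real_divide of_real_sum sum_divide_distrib sum_distrib_right)
    also have "\<dots> = rc f k"
      using L0D(2)[OF f] by (cases "k = 0") (simp_all add: inner_vec_def[of k k, symmetric, unfolded inner_real_def])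
    finally show "rc (\<lambda>x. \<Sum>i\<in>UNIV. mop (Rm i i) f x) k = rc f k" .
  qed
qed

text \<open>The operator T: for f = Delta phi it is the non-divergence operator with coefficients w,
  applied to phi.\<close>

definition Tw :: "(real ^ 'n \<Rightarrow> 'n coeff) \<Rightarrow> (real ^ 'n \<Rightarrow> real) \<Rightarrow> real ^ 'n \<Rightarrow> real" where
  "Tw w f x = w x \<bullet> DD f x"

text \<open>The Cordes condition as it is used: distance at most \<rho> from the coefficients of the
  Laplacian. The factor 1 + 1/(4 pi^2) bounds the squared norm of \<open>DD\<close>, so the last
  assumption makes T differ from the identity on \<open>L0\<close> by a strict contraction.\<close>

locale cordes =
  fixes w :: "real ^ 'n \<Rightarrow> 'n coeff" and \<rho> :: real
  assumes w_meas: "w \<in> borel_measurable lebesgue"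
    and w_per: "periodic_ae w"
    and w_near: "AE x in lebesgue. norm (w x - w0) \<le> \<rho>"
    and rho: "0 \<le> \<rho>" "\<rho>\<^sup>2 * (1 + 1 / (4 * pi\<^sup>2)) < 1"
begin

definition \<kappa> :: real where "\<kappa> = sqrt (\<rho>\<^sup>2 * (1 + 1 / (4 * pi\<^sup>2)))"

lemma kappa: "0 \<le> \<kappa>" "\<kappa> < 1" "\<kappa>\<^sup>2 = \<rho>\<^sup>2 * (1 + 1 / (4 * pi\<^sup>2))"
  using rho by (simp_all add: \<kappa>_def)

lemma w_components:
  shows "(\<lambda>x. fst (w x) $ i $ j) \<in> borel_measurable lebesgue" "(\<lambda>x. snd (w x) $ i) \<in> borel_measurable lebesgue"
    "periodic_ae (\<lambda>x. fst (w x) $ i $ j)" "periodic_ae (\<lambda>x. snd (w x) $ i)"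
    "AE x in lebesgue. \<bar>fst (w x) $ i $ j\<bar> \<le> norm (w0 :: 'n coeff) + \<rho>"
    "AE x in lebesgue. \<bar>snd (w x) $ i\<bar> \<le> norm (w0 :: 'n coeff) + \<rho>"
proof -
  show "(\<lambda>x. fst (w x) $ i $ j) \<in> borel_measurable lebesgue" "(\<lambda>x. snd (w x) $ i) \<in> borel_measurable lebesgue"
    by (intro measurable_compose[OF w_meas] borel_measurable_continuous_onI continuous_intros)+
  show "periodic_ae (\<lambda>x. fst (w x) $ i $ j)" "periodic_ae (\<lambda>x. snd (w x) $ i)"
    by (rule periodic_ae_comp[OF w_per])+
  have b: "norm v \<le> norm (w0 :: 'n coeff) + \<rho>" if "norm (v - w0) \<le> \<rho>" for v :: "'n coeff"
    using norm_triangle_ineq[of "v - w0" w0] that by simp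
  have c: "\<bar>fst v $ i $ j\<bar> \<le> norm v" "\<bar>snd v $ i\<bar> \<le> norm v" for v :: "'n coeff"
    using Finite_Cartesian_Product.norm_nth_le[of "fst v $ i" j] Finite_Cartesian_Product.norm_nth_le[of "fst v" i] norm_fst_le[of "fst v" "snd v"]
      Finite_Cartesian_Product.norm_nth_le[of "snd v" i] norm_snd_le[of "snd v" "fst v"]
    by (auto intro: order_trans)
  show "AE x in lebesgue. \<bar>fst (w x) $ i $ j\<bar> \<le> norm (w0 :: 'n coeff) + \<rho>"
    "AE x in lebesgue. \<bar>snd (w x) $ i\<bar> \<le> norm (w0 :: 'n coeff) + \<rho>"
    using w_near by (eventually_elim, use b c order_trans in blast)+
qed

lemma w_mult_L2p:
  assumes "f \<in> L2p"
  shows "(\<lambda>x. fst (w x) $ i $ j * f x) \<in> L2p" "(\<lambda>x. snd (w x) $ i * f x) \<in> L2p"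
  by (rule L2p_mult_bounded[OF assms w_components(1,3,5)], rule L2p_mult_bounded[OF assms w_components(2,4,6)])

lemma Tw_L2p:
  assumes "f \<in> L2p"
  shows "Tw w f \<in> L2p"
proof -
  have eq: "Tw w f = (\<lambda>x. (\<Sum>i\<in>UNIV. \<Sum>j\<in>UNIV. fst (w x) $ i $ j * mop (Rm i j) f x) + (\<Sum>i\<in>UNIV. snd (w x) $ i * mop (Sm i) f x))"
    by (simp add: Tw_def fun_eq_iff inner_DD)
  show ?thesis
    unfolding eq by (intro L2p_add L2p_sum w_mult_L2p mop is_multiplier_Rm is_multiplier_Sm assms)
qed

text \<open>\<open>w0\<close> reproduces f, so the difference is the pairing of w -
  \<open>w0\<close> with \<open>DD f\<close>, bounded pointwise by Cauchy-Schwarz.\<close>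

lemma Tw_near:
  assumes f: "f \<in> L0"
  shows "nrm (\<lambda>x. Tw w f x - f x) \<le> \<kappa> * nrm f"
proof (rule power2_le_imp_le)
  have fL: "f \<in> L2p"
    by (rule L0D(1)[OF f])
  have "(nrm (\<lambda>x. Tw w f x - f x))\<^sup>2 \<le> \<rho>\<^sup>2 * (nrm (\<lambda>x. norm (DD f x)))\<^sup>2"
  proof (rule L2p_bound(2)[OF norm_DD_L2p(1)[OF fL]])
    show "(\<lambda>x. Tw w f x - f x) \<in> borel_measurable lebesgue" "periodic_ae (\<lambda>x. Tw w f x - f x)"
      using L2pD[OF L2p_diff[OF Tw_L2p[OF fL] fL]] by blast+
    show "AE x in lebesgue. norm (Tw w f x - f x) \<le> \<rho> * norm (norm (DD f x))"
      using inner_w0_DD[OF f] w_near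
    proof eventually_elim
      case (elim x)
      have "Tw w f x - f x = (w x - w0) \<bullet> DD f x"
        by (simp add: Tw_def inner_diff_left elim)
      then have "norm (Tw w f x - f x) \<le> norm (w x - w0) * norm (DD f x)"
        by (simp add: Cauchy_Schwarz_ineq2)
      also have "\<dots> \<le> \<rho> * norm (DD f x)"
        using elim by (intro mult_right_mono) auto
      finally show ?case by simp
    qed
  qed
  also have "\<dots> \<le> \<rho>\<^sup>2 * ((1 + 1 / (4 * pi\<^sup>2)) * (nrm f)\<^sup>2)"
    by (intro mult_left_mono norm_DD_L2p fL) simp
  also have "\<dots> = (\<kappa> * nrm f)\<^sup>2"
    by (simp add: power_mult_distrib kappa mult.assoc)
  finally show "(nrm (\<lambda>x. Tw w f x - f x))\<^sup>2 \<le> (\<kappa> * nrm f)\<^sup>2" .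
qed (simp add: kappa)

lemma Tw_coercive:
  assumes f: "f \<in> L0"
  shows "(1 - \<kappa>) * (nrm f)\<^sup>2 \<le> (LINT x|Q. f x * Tw w f x)"
proof -
  note fL = L0D(1)[OF f]
  note dL = L2p_diff[OF fL Tw_L2p[OF fL]]
  have i: "integrable Q (\<lambda>x. f x * f x)" "integrable Q (\<lambda>x. f x * (f x - Tw w f x))"
    using integrable_inner[OF fL fL] integrable_inner[OF fL dL] by simp_all
  have "(LINT x|Q. f x * Tw w f x) = (LINT x|Q. f x * f x - f x * (f x - Tw w f x))"
    by (simp add: right_diff_distrib)
  also have "\<dots> = (nrm f)\<^sup>2 - (LINT x|Q. f x * (f x - Tw w f x))"
    using i by (simp add: nrm_power2_real)
  finally have "(LINT x|Q. f x * Tw w f x) = (nrm f)\<^sup>2 - (LINT x|Q. f x * (f x - Tw w f x))" .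
  moreover have "(LINT x|Q. f x * (f x - Tw w f x)) \<le> nrm f * (\<kappa> * nrm f)"
  proof -
    have "(LINT x|Q. f x * (f x - Tw w f x)) \<le> nrm f * nrm (\<lambda>x. f x - Tw w f x)"
      using integral_inner_le[OF fL dL] by simp
    also have "\<dots> \<le> nrm f * (\<kappa> * nrm f)"
      using Tw_near[OF f] nrm_minus_commute[of f "Tw w f"] by (intro mult_left_mono) auto
    finally show ?thesis .
  qed
  ultimately show ?thesis
    by (simp add: power2_eq_square algebra_simps)
qed

lemma Tw_orthogonal_imp_0:
  assumes f: "f \<in> L0" and orth: "\<And>g. g \<in> L0 \<Longrightarrow> (LINT x|Q. f x * Tw w g x) = 0"
  shows "AE x in lebesgue. f x = 0"
proof -
  have "(1 - \<kappa>) * (nrm f)\<^sup>2 \<le> 0"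
    using Tw_coercive[OF f] orth[OF f] by simp
  then have "nrm f = 0"
    using kappa(2) by (simp add: mult_le_0_iff)
  then show ?thesis
    using nrm_eq_0_iff[OF L0D(1)[OF f]] by simp
qed

text \<open>The adjoint of T, explicitly: first multiplication by the coefficients, then the
  conjugate multipliers. These vanish at 0, so its values lie in \<open>L0\<close>, which keeps the
  iteration of \<open>Tw_solvable\<close> inside the mean-zero functions.\<close>

definition Tadj :: "(real ^ 'n \<Rightarrow> real) \<Rightarrow> real ^ 'n \<Rightarrow> real" where
  "Tadj f x = (\<Sum>i\<in>UNIV. \<Sum>j\<in>UNIV. mop (\<lambda>k. cnj (Rm i j k)) (\<lambda>x. fst (w x) $ i $ j * f x) x)
     + (\<Sum>i\<in>UNIV. mop (\<lambda>k. cnj (Sm i k)) (\<lambda>x. snd (w x) $ i * f x) x)"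

lemma Tadj_L0:
  assumes f: "f \<in> L2p"
  shows "Tadj f \<in> L0"
proof -
  note R = mop[OF is_multiplier_cnj[OF is_multiplier_Rm] w_mult_L2p(1)[OF f]]
  note S = mop[OF is_multiplier_cnj[OF is_multiplier_Sm] w_mult_L2p(2)[OF f]]
  show ?thesis
    unfolding Tadj_def[abs_def]
  proof (rule L0I)
    show "rc (\<lambda>x. (\<Sum>i\<in>UNIV. \<Sum>j\<in>UNIV. mop (\<lambda>k. cnj (Rm i j k)) (\<lambda>x. fst (w x) $ i $ j * f x) x)
     + (\<Sum>i\<in>UNIV. mop (\<lambda>k. cnj (Sm i k)) (\<lambda>x. snd (w x) $ i * f x) x)) 0 = 0"
      by (simp add: rc_add rc_sum L2p_sum R S) (simp add: Rm_def Sm_def)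
  qed (intro L2p_add L2p_sum R S)
qed

lemma Tadj:
  assumes f: "f \<in> L2p" and g: "g \<in> L2p"
  shows "(LINT x|Q. f x * Tw w g x) = (LINT x|Q. Tadj f x * g x)"
proof -
  note R = mop(1)[OF is_multiplier_Rm g] and S = mop(1)[OF is_multiplier_Sm g]
  note R' = mop(1)[OF is_multiplier_cnj[OF is_multiplier_Rm] w_mult_L2p(1)[OF f]]
  note S' = mop(1)[OF is_multiplier_cnj[OF is_multiplier_Sm] w_mult_L2p(2)[OF f]]
  note int = L2p_mult_integrable(3)
  have "(LINT x|Q. f x * Tw w g x) = (LINT x|Q. (\<Sum>i\<in>UNIV. \<Sum>j\<in>UNIV. (fst (w x) $ i $ j * f x) * mop (Rm i j) g x)
      + (\<Sum>i\<in>UNIV. (snd (w x) $ i * f x) * mop (Sm i) g x))"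
    by (simp add: Tw_def inner_DD distrib_left sum_distrib_left mult_ac)
  also have "\<dots> = (\<Sum>i\<in>UNIV. \<Sum>j\<in>UNIV. LINT x|Q. (fst (w x) $ i $ j * f x) * mop (Rm i j) g x)
      + (\<Sum>i\<in>UNIV. LINT x|Q. (snd (w x) $ i * f x) * mop (Sm i) g x)"
    using int[OF w_mult_L2p(1)[OF f] R] int[OF w_mult_L2p(2)[OF f] S] by simp
  also have "\<dots> = (\<Sum>i\<in>UNIV. \<Sum>j\<in>UNIV. LINT x|Q. mop (\<lambda>k. cnj (Rm i j k)) (\<lambda>x. fst (w x) $ i $ j * f x) x * g x)
      + (\<Sum>i\<in>UNIV. LINT x|Q. mop (\<lambda>k. cnj (Sm i k)) (\<lambda>x. snd (w x) $ i * f x) x * g x)"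
    by (simp only: mop_adjoint[OF is_multiplier_Rm w_mult_L2p(1)[OF f] g] mop_adjoint[OF is_multiplier_Sm w_mult_L2p(2)[OF f] g])
  also have "\<dots> = (LINT x|Q. (\<Sum>i\<in>UNIV. \<Sum>j\<in>UNIV. mop (\<lambda>k. cnj (Rm i j k)) (\<lambda>x. fst (w x) $ i $ j * f x) x * g x)
      + (\<Sum>i\<in>UNIV. mop (\<lambda>k. cnj (Sm i k)) (\<lambda>x. snd (w x) $ i * f x) x * g x))"
    using int[OF R' g] int[OF S' g] by simp
  also have "\<dots> = (LINT x|Q. Tadj f x * g x)"
    by (simp add: Tadj_def distrib_right sum_distrib_right)
  finally show ?thesis .
qed

text \<open>The defect \<open>I - T\<close> has norm at most \<open>\<kappa> < 1\<close> on mean-zero functions, hence so has the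
  defect of the adjoint, and the fixed-point iteration for \<open>T\<^sup>* f = c T\<^sup>* 1\<close> converges.\<close>

lemma Tw_solvable:
  obtains f where "f \<in> L0" "\<And>g. g \<in> L2p \<Longrightarrow> (LINT x|Q. f x * Tw w g x) = c * (LINT x|Q. Tw w g x)"
proof -
  have c: "(\<lambda>x. c) \<in> L2p"
    by simp
  \<comment> \<open>A fixed point of F satisfies \<open>Tadj\<close> f = \<open>Tadj\<close> c, the
    adjoint form of the equation to be solved.\<close>
  define F where "F f x = f x - Tadj f x + Tadj (\<lambda>_. c) x" for f x
  have F: "F f \<in> L0" if "f \<in> L0" for f
  proof -
    have "(\<lambda>x. (f x - Tadj f x) - (0 - Tadj (\<lambda>_. c) x)) \<in> L0"
      by (intro L0_diff that Tadj_L0 L0D(1)[OF that] c) (simp add: L0_def)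
    then show ?thesis
      by (simp add: F_def[abs_def])
  qed
  have contr: "nrm (\<lambda>x. F f x - F g x) \<le> \<kappa> * nrm (\<lambda>x. f x - g x)" if f: "f \<in> L0" and g: "g \<in> L0" for f g
  proof -
    define d h where "d = (\<lambda>x. f x - g x)" and "h = (\<lambda>x. F f x - F g x)"
    have d: "d \<in> L0" and h: "h \<in> L0"
      unfolding d_def h_def by (intro L0_diff F f g)+
    note L = L0D(1)[OF f] L0D(1)[OF g] L0D(1)[OF d] L0D(1)[OF h]
    note int = L2p_mult_integrable(3)
    have hx: "h x = d x - (Tadj f x - Tadj g x)" for x
      by (simp add: h_def d_def F_def)
    have "h x * h x = d x * h x - (Tadj f x * h x - Tadj g x * h x)" for x
      by (subst (1) hx) (simp add: left_diff_distrib)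
    \<comment> \<open>Duality: pairing h with itself moves \<open>Tadj\<close> over to h, so that
      only the bound for T - I on \<open>L0\<close> is needed.\<close>
    then have "(nrm h)\<^sup>2 = (LINT x|Q. d x * h x - (Tadj f x * h x - Tadj g x * h x))"
      by (simp only: nrm_power2_real)
    also have "\<dots> = (LINT x|Q. d x * h x) - ((LINT x|Q. Tadj f x * h x) - (LINT x|Q. Tadj g x * h x))"
      using int[OF L(3,4)] int[OF L0D(1)[OF Tadj_L0[OF L(1)]] L(4)] int[OF L0D(1)[OF Tadj_L0[OF L(2)]] L(4)] by simp
    also have "\<dots> = (LINT x|Q. d x * h x) - ((LINT x|Q. f x * Tw w h x) - (LINT x|Q. g x * Tw w h x))"
      by (simp add: Tadj L)
    also have "\<dots> = (LINT x|Q. d x * (h x - Tw w h x))"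
      using int[OF L(3,4)] int[OF L(1) Tw_L2p[OF L(4)]] int[OF L(2) Tw_L2p[OF L(4)]]
      by (simp add: d_def right_diff_distrib left_diff_distrib)
    also have "\<dots> \<le> nrm d * nrm (\<lambda>x. h x - Tw w h x)"
      using integral_inner_le[OF L(3) L2p_diff[OF L(4) Tw_L2p[OF L(4)]]] by simp
    also have "\<dots> \<le> nrm d * (\<kappa> * nrm h)"
      using Tw_near[OF h] nrm_minus_commute[of h "Tw w h"] by (intro mult_left_mono) auto
    finally have "nrm h * nrm h \<le> (\<kappa> * nrm d) * nrm h"
      by (simp add: power2_eq_square mult_ac)
    then have "nrm h \<le> \<kappa> * nrm d"
      using kappa(1) nrm_nonneg[of h] nrm_nonneg[of d]
      by (cases "nrm h = 0") (auto simp: mult_le_cancel_right)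
    then show ?thesis
      by (simp add: d_def h_def)
  qed
  define u where "u n = (F ^^ n) (\<lambda>_. 0)" for n
  have u_Suc: "u (Suc n) = F (u n)" for n
    by (simp add: u_def)
  have u: "u n \<in> L0" for n
    by (induction n) (simp_all add: u_Suc F, simp add: u_def L0_def)
  define D where "D = nrm (\<lambda>x. u 1 x - u 0 x)"
  have step: "nrm (\<lambda>x. u (Suc n) x - u n x) \<le> \<kappa> ^ n * D" for n
  proof (induction n)
    case (Suc n)
    have "nrm (\<lambda>x. u (Suc (Suc n)) x - u (Suc n) x) \<le> \<kappa> * nrm (\<lambda>x. u (Suc n) x - u n x)"
      using contr[OF u u, of "Suc n" n] by (simp add: u_Suc)
    also have "\<dots> \<le> \<kappa> * (\<kappa> ^ n * D)"
      using Suc kappa(1) by (rule mult_left_mono)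
    finally show ?case by (simp add: mult.assoc)
  qed (simp add: D_def)
  have far: "nrm (\<lambda>x. u (n + m) x - u n x) \<le> \<kappa> ^ n * D / (1 - \<kappa>)" for n m
  proof -
    have "nrm (\<lambda>x. u (n + m) x - u n x) \<le> (\<Sum>i<m. \<kappa> ^ (n + i) * D)"
    proof (induction m)
      case 0
      then show ?case by (simp add: nrm_def)
    next
      case (Suc m)
      have "nrm (\<lambda>x. u (n + Suc m) x - u n x) \<le> nrm (\<lambda>x. u (Suc (n + m)) x - u (n + m) x) + nrm (\<lambda>x. u (n + m) x - u n x)"
        using nrm_triangle_diff[of "u (Suc (n + m))" "u (n + m)" "u n"] L0D(1)[OF u] by simp
      with step[of "n + m"] Suc show ?case by simp
    qed
    also have "\<dots> = \<kappa> ^ n * D * (\<Sum>i<m. \<kappa> ^ i)"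
      by (simp add: power_add sum_distrib_left mult_ac)
    also have "\<dots> \<le> \<kappa> ^ n * D * (1 / (1 - \<kappa>))"
    proof (intro mult_left_mono)
      have "(\<Sum>i<m. \<kappa> ^ i) \<le> (\<Sum>i. \<kappa> ^ i)"
        using kappa by (intro sum_le_suminf summable_geometric) auto
      then show "(\<Sum>i<m. \<kappa> ^ i) \<le> 1 / (1 - \<kappa>)"
        using kappa by (simp add: suminf_geometric)
      show "0 \<le> \<kappa> ^ n * D"
        using kappa by (simp add: D_def)
    qed
    finally show ?thesis by simp
  qed
  have far0: "(\<lambda>n. \<kappa> ^ n * D / (1 - \<kappa>)) \<longlonglongrightarrow> 0"
    using tendsto_mult[OF LIMSEQ_power_zero[of \<kappa>] tendsto_const[of "D / (1 - \<kappa>)"]] kappa by simp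
  obtain f where f: "f \<in> L2p" "(\<lambda>n. nrm (\<lambda>x. u n x - f x)) \<longlonglongrightarrow> 0"
  proof (rule L2p_complete[of u])
    show "u n \<in> L2p" for n
      by (rule L0D(1)[OF u])
    fix e :: real assume "e > 0"
    then obtain N where N: "\<And>n. n \<ge> N \<Longrightarrow> \<bar>\<kappa> ^ n * D / (1 - \<kappa>)\<bar> < e"
      using LIMSEQ_D[OF far0] by auto
    have *: "nrm (\<lambda>x. u m x - u n x) \<le> e" if "N \<le> n" "n \<le> m" for m n
    proof -
      have "nrm (\<lambda>x. u m x - u n x) \<le> \<kappa> ^ n * D / (1 - \<kappa>)"
        using far[of n "m - n"] that(2) by simp
      also have "\<dots> \<le> e"
        using N[OF that(1)] by linarith
      finally show ?thesis .
    qed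
    show "\<exists>N. \<forall>m\<ge>N. \<forall>n\<ge>N. nrm (\<lambda>x. u m x - u n x) \<le> e"
    proof (intro exI[of _ N] allI impI)
      fix m n assume "N \<le> m" "N \<le> n"
      then show "nrm (\<lambda>x. u m x - u n x) \<le> e"
        using *[of n m] *[of m n] nrm_minus_commute[of "u m" "u n"] by (cases "n \<le> m") auto
    qed
  qed
  have conv: "(\<lambda>n. LINT x|Q. u n x * h x) \<longlonglongrightarrow> (LINT x|Q. f x * h x)" if h: "h \<in> L2p" for h
  proof (rule Lim_transform2[OF tendsto_const])
    have "(\<lambda>n. nrm (\<lambda>x. u n x - f x) * nrm h) \<longlonglongrightarrow> 0"
      using tendsto_mult[OF f(2) tendsto_const[of "nrm h"]] by simp
    then show "(\<lambda>n. (LINT x|Q. f x * h x) - (LINT x|Q. u n x * h x)) \<longlonglongrightarrow> 0"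
    proof (rule Lim_null_comparison[rotated], intro always_eventually allI)
      fix n
      have "(LINT x|Q. u n x * h x) - (LINT x|Q. f x * h x) = (LINT x|Q. (u n x - f x) \<bullet> h x)"
        using L2p_mult_integrable(3)[OF L0D(1)[OF u] h] L2p_mult_integrable(3)[OF f(1) h]
        by (simp add: left_diff_distrib)
      then show "norm ((LINT x|Q. f x * h x) - (LINT x|Q. u n x * h x)) \<le> nrm (\<lambda>x. u n x - f x) * nrm h"
        using integral_inner_le[OF L2p_diff[OF L0D(1)[OF u] f(1)] h, of n] by (simp add: abs_minus_commute)
    qed
  qed
  \<comment> \<open>Convergence of the pairings with the constant 1 preserves mean zero.\<close>
  have "f \<in> L0"
    using conv[of "\<lambda>_. 1"] f(1) by (simp add: L0D(3)[OF u] LIMSEQ_const_iff L0_def)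
  moreover have "(LINT x|Q. f x * Tw w g x) = c * (LINT x|Q. Tw w g x)" if g: "g \<in> L2p" for g
  proof -
    note Tg = Tw_L2p[OF g]
    note int = L2p_mult_integrable(3)
    have "(LINT x|Q. u n x * Tw w g x) - c * (LINT x|Q. Tw w g x) = (LINT x|Q. u n x * g x) - (LINT x|Q. u (Suc n) x * g x)" for n
    proof -
      have "(LINT x|Q. u (Suc n) x * g x) = (LINT x|Q. u n x * g x - Tadj (u n) x * g x + Tadj (\<lambda>_. c) x * g x)"
        by (simp add: u_Suc F_def algebra_simps)
      also have "\<dots> = (LINT x|Q. u n x * g x) - (LINT x|Q. Tadj (u n) x * g x) + (LINT x|Q. Tadj (\<lambda>_. c) x * g x)"
        using int[OF L0D(1)[OF u] g, of n] int[OF L0D(1)[OF Tadj_L0[OF L0D(1)[OF u]]] g, of n]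
          int[OF L0D(1)[OF Tadj_L0[OF c]] g] by simp
      also have "(LINT x|Q. Tadj (u n) x * g x) = (LINT x|Q. u n x * Tw w g x)"
        by (rule Tadj[OF L0D(1)[OF u] g, symmetric])
      also have "(LINT x|Q. Tadj (\<lambda>_. c) x * g x) = c * (LINT x|Q. Tw w g x)"
        using Tadj[OF c g] by simp
      finally show ?thesis by simp
    qed
    moreover have "(\<lambda>n. (LINT x|Q. u n x * g x) - (LINT x|Q. u (Suc n) x * g x)) \<longlonglongrightarrow> (LINT x|Q. f x * g x) - (LINT x|Q. f x * g x)"
      by (intro tendsto_diff conv g LIMSEQ_Suc[OF conv])
    moreover have "(\<lambda>n. (LINT x|Q. u n x * Tw w g x) - c * (LINT x|Q. Tw w g x)) \<longlonglongrightarrow> (LINT x|Q. f x * Tw w g x) - c * (LINT x|Q. Tw w g x)"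
      by (intro tendsto_diff conv Tg tendsto_const)
    ultimately have "(LINT x|Q. f x * Tw w g x) - c * (LINT x|Q. Tw w g x) = 0"
      using LIMSEQ_unique by fastforce
    then show ?thesis by simp
  qed
  ultimately show thesis
    by (rule that)
qed

end

subsection \<open>Derivatives of functions that are Lipschitz in the mean\<close>

text \<open>Dominated convergence for unordered sums: a finite set carries all but e/2 of the
  majorant, and on it termwise convergence is enough.\<close>

lemma has_sum_dominated_tendsto_0:
  fixes f :: "nat \<Rightarrow> 'k \<Rightarrow> real"
  assumes a: "(a has_sum S) A" and f: "\<And>n. (f n has_sum q n) A"
    and bd: "\<And>n k. k \<in> A \<Longrightarrow> 0 \<le> f n k" "\<And>n k. k \<in> A \<Longrightarrow> f n k \<le> a k"
    and lim: "\<And>k. k \<in> A \<Longrightarrow> (\<lambda>n. f n k) \<longlonglongrightarrow> 0"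
  shows "q \<longlonglongrightarrow> 0"
proof (rule LIMSEQ_I)
  fix e :: real assume e: "e > 0"
  obtain F where F: "finite F" "F \<subseteq> A" "dist (sum a F) S \<le> e / 2"
    using has_sum_finite_approximation[OF a, of "e / 2"] e by auto
  have "(\<lambda>n. \<Sum>k\<in>F. f n k) \<longlonglongrightarrow> (\<Sum>k\<in>F. 0)"
    using F(2) by (intro tendsto_sum lim) auto
  from LIMSEQ_D[OF this, of "e / 2"] obtain N where N: "\<And>n. n \<ge> N \<Longrightarrow> \<bar>\<Sum>k\<in>F. f n k\<bar> < e / 2"
    using e by auto
  have "\<bar>q n\<bar> < e" if n: "n \<ge> N" for n
  proof -
    have "q n - (\<Sum>k\<in>F. f n k) \<le> S - sum a F"
    proof (rule has_sum_mono)
      show "(f n has_sum q n - (\<Sum>k\<in>F. f n k)) (A - F)" "(a has_sum S - sum a F) (A - F)"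
        using F by (auto intro!: has_sum_Diff f a has_sum_finite)
    qed (use bd in auto)
    moreover have "0 \<le> q n"
      using f[of n] bd(1) by (rule has_sum_nonneg)
    moreover have "S - sum a F \<le> e / 2"
      using F(3) unfolding dist_real_def by linarith
    ultimately show ?thesis
      using N[OF n] by linarith
  qed
  then show "\<exists>no. \<forall>n\<ge>no. norm (q n - 0) < e"
    by auto
qed

lemma norm_cis_minus_1_le: "cmod (cis a - 1) \<le> \<bar>a\<bar>"
proof (rule power2_le_imp_le)
  have "(cmod (cis a - 1))\<^sup>2 = (cos a - 1)\<^sup>2 + (sin a)\<^sup>2"
    by (simp add: cmod_power2)
  also have "\<dots> = 2 - 2 * cos a"
    using sin_cos_squared_add[of a] by (simp add: power2_diff)
  also have "\<dots> = 4 * (sin (a / 2))\<^sup>2"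
    using cos_double_sin[of "a / 2"] by simp
  also have "\<dots> \<le> 4 * \<bar>a / 2\<bar>\<^sup>2"
    using abs_sin_x_le_abs_x[of "a / 2"] power_mono[of "\<bar>sin (a / 2)\<bar>" "\<bar>a / 2\<bar>" 2] by simp
  also have "\<dots> = \<bar>a\<bar>\<^sup>2"
    by (simp add: power_divide)
  finally show "(cmod (cis a - 1))\<^sup>2 \<le> \<bar>a\<bar>\<^sup>2" .
qed simp

lemma cis_quotient_tendsto:
  fixes t :: "nat \<Rightarrow> real"
  assumes "t \<longlonglongrightarrow> 0" "\<And>n. t n \<noteq> 0"
  shows "(\<lambda>n. (cis (a * t n) - 1) / complex_of_real (t n)) \<longlonglongrightarrow> \<i> * complex_of_real a"
proof -
  have "((\<lambda>z. exp (\<i> * complex_of_real a * z)) has_field_derivative \<i> * complex_of_real a) (at 0)"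
    by (auto intro!: derivative_eq_intros)
  then have "((\<lambda>z. (exp (\<i> * complex_of_real a * z) - 1) / z) \<longlongrightarrow> \<i> * complex_of_real a) (at 0)"
    by (simp add: DERIV_def)
  moreover have "filterlim (\<lambda>n. complex_of_real (t n)) (at 0) sequentially"
    using assms tendsto_of_real[OF assms(1), where 'a = complex] by (auto simp: filterlim_at)
  ultimately have "(\<lambda>n. (exp (\<i> * complex_of_real a * complex_of_real (t n)) - 1) / complex_of_real (t n)) \<longlonglongrightarrow> \<i> * complex_of_real a"
    by (rule filterlim_compose)
  then show ?thesis
    by (simp add: cis_conv_exp mult.assoc)
qed

text \<open>Periodic H^1, characterised by translations: this is the form in which the stability
  estimate delivers regularity. Derivatives are recovered in \<open>H1_derivative\<close>.\<close>

definition H1 :: "(real ^ 'n \<Rightarrow> real) \<Rightarrow> bool" where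
  "H1 u \<longleftrightarrow> u \<in> L2p \<and> (\<exists>C\<ge>0. \<forall>h. nrm (\<lambda>x. u (x + h) - u x) \<le> C * norm h)"

text \<open>The symbol is unbounded, so the choice in \<open>mop\<close> is meaningful only if a
  suitable function exists; \<open>H1_derivative\<close> supplies it.\<close>

definition Dop :: "'n \<Rightarrow> (real ^ 'n \<Rightarrow> real) \<Rightarrow> real ^ 'n \<Rightarrow> real" where
  "Dop i = mop (dm i)"

lemma norm_axis: "norm (axis i t :: real ^ 'n) = \<bar>t\<bar>"
  by (simp add: norm_eq_sqrt_inner inner_axis_axis)

definition quot :: "'n \<Rightarrow> real \<Rightarrow> (real ^ 'n \<Rightarrow> real) \<Rightarrow> real ^ 'n \<Rightarrow> real" where
  "quot i t u x = (1 / t) * (u (x + axis i t) - u x)"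

lemma quot_L2p: "u \<in> L2p \<Longrightarrow> quot i t u \<in> L2p"
  unfolding quot_def by (intro L2p_cmult L2p_diff L2p_shift)

lemma rc_quot:
  assumes "u \<in> L2p" "k \<in> Zn"
  shows "rc (quot i t u) k = (cis (2 * pi * k $ i * t) - 1) / complex_of_real t * rc u k"
proof -
  have "rc (quot i t u) k = complex_of_real (1 / t) * (ek k (axis i t) * rc u k - rc u k)"
    unfolding quot_def[abs_def] rc_cmult using assms by (simp only: rc_diff L2p_shift(1) rc_shift)
  also have "ek k (axis i t) = cis (2 * pi * k $ i * t)"
    by (simp add: ek_def inner_axis mult_ac)
  finally show ?thesis
    by (simp add: left_diff_distrib)
qed

lemma norm_dm: "(cmod (dm i k))\<^sup>2 = (2 * pi * k $ i)\<^sup>2"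
  unfolding norm_mult norm_of_real by simp

text \<open>Bessel's inequality for the difference quotients bounds finite sums of their squared
  coefficients by C^2, uniformly in the step. Letting the step tend to 0 in finite sums shows that
  the coefficients of the derivative are square-summable.\<close>

lemma H1_derivative:
  fixes u :: "real ^ 'n \<Rightarrow> real"
  assumes u: "H1 u"
  shows "Dop i u \<in> L2p" "k \<in> Zn \<Longrightarrow> rc (Dop i u) k = dm i k * rc u k"
proof -
  have uL: "u \<in> L2p"
    using u by (simp add: H1_def)
  obtain C where C: "C \<ge> 0" "\<And>h. nrm (\<lambda>x. u (x + h) - u x) \<le> C * norm h"
    using u by (auto simp: H1_def)
  have qC: "nrm (quot i t u) \<le> C" if "t \<noteq> 0" for t
  proof -
    have "nrm (quot i t u) = \<bar>1 / t\<bar> * nrm (\<lambda>x. u (x + axis i t) - u x)"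
      unfolding quot_def[abs_def] using nrm_scaleR[of "1 / t" "\<lambda>x. u (x + axis i t) - u x"] by simp
    also have "\<dots> \<le> \<bar>1 / t\<bar> * (C * norm (axis i t))"
      by (intro mult_left_mono C) simp
    also have "\<dots> = C"
      using that by (simp add: norm_axis)
    finally show ?thesis .
  qed
  define t where "t n = inverse (real (Suc n))" for n
  have t: "t \<longlonglongrightarrow> 0" "t n \<noteq> 0" for n
    unfolding t_def using LIMSEQ_inverse_real_of_nat by auto
  have fin: "(\<Sum>k\<in>F. (cmod (dm i k * rc u k))\<^sup>2) \<le> C\<^sup>2" if F: "finite F" "F \<subseteq> Zn" for F
  proof (rule LIMSEQ_le_const2)
    have "(\<lambda>n. (cis (2 * pi * k $ i * t n) - 1) / complex_of_real (t n)) \<longlonglongrightarrow> dm i k" for k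
      by (rule cis_quotient_tendsto[OF t])
    then show "(\<lambda>n. \<Sum>k\<in>F. (cmod ((cis (2 * pi * k $ i * t n) - 1) / complex_of_real (t n) * rc u k))\<^sup>2) \<longlonglongrightarrow> (\<Sum>k\<in>F. (cmod (dm i k * rc u k))\<^sup>2)"
      by (intro tendsto_intros)
    have "(\<Sum>k\<in>F. (cmod ((cis (2 * pi * k $ i * t n) - 1) / complex_of_real (t n) * rc u k))\<^sup>2) \<le> C\<^sup>2" for n
    proof -
      have "(\<Sum>k\<in>F. (cmod ((cis (2 * pi * k $ i * t n) - 1) / complex_of_real (t n) * rc u k))\<^sup>2) = (\<Sum>k\<in>F. (cmod (rc (quot i (t n) u) k))\<^sup>2)"
        using F(2) by (intro sum.cong) (auto simp: rc_quot[OF uL])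
      also have "\<dots> \<le> (nrm (quot i (t n) u))\<^sup>2"
        by (rule finite_sum_le_has_sum[OF parseval_real[OF quot_L2p[OF uL]] F]) simp
      also have "\<dots> \<le> C\<^sup>2"
        by (intro power_mono qC t) simp
      finally show ?thesis .
    qed
    then show "\<exists>N. \<forall>n\<ge>N. (\<Sum>k\<in>F. (cmod ((cis (2 * pi * k $ i * t n) - 1) / complex_of_real (t n) * rc u k))\<^sup>2) \<le> C\<^sup>2"
      by blast
  qed
  have s1: "(\<lambda>k. (cmod (dm i k * rc u k))\<^sup>2) summable_on Zn"
  proof (rule nonneg_bdd_above_summable_on)
    show "bdd_above (sum (\<lambda>k. (cmod (dm i k * rc u k))\<^sup>2) ` {F. F \<subseteq> Zn \<and> finite F})"
      by (rule bdd_aboveI2[of _ _ "C\<^sup>2"], rule fin) simp_all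
  qed simp
  have s2: "dm i (- k) * rc u (- k) = cnj (dm i k * rc u k)" for k
    by (simp add: rc_minus)
  obtain g where "g \<in> L2p" "\<And>k. k \<in> Zn \<Longrightarrow> rc g k = dm i k * rc u k"
    by (rule riesz_fischer_real[OF s1 s2]) auto
  then have "g \<in> L2p \<and> (\<forall>k\<in>Zn. rc g k = dm i k * rc u k)"
    by blast
  from someI[of "\<lambda>g. g \<in> L2p \<and> (\<forall>k\<in>Zn. rc g k = dm i k * rc u k)", OF this]
  show "Dop i u \<in> L2p" "k \<in> Zn \<Longrightarrow> rc (Dop i u) k = dm i k * rc u k"
    unfolding Dop_def mop_def by blast+
qed

text \<open>A difference quotient multiplies coefficients by numbers of modulus at most |2 pi k_i|,
  the modulus of the symbol of the derivative. The squared error is therefore dominated by 4 times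
  the squared coefficients of the derivative, and it vanishes termwise.\<close>

lemma quot_tendsto:
  fixes u :: "real ^ 'n \<Rightarrow> real"
  assumes u: "H1 u" and t: "t \<longlonglongrightarrow> 0" "\<And>n. t n \<noteq> 0"
  shows "(\<lambda>n. nrm (\<lambda>x. quot i (t n) u x - Dop i u x)) \<longlonglongrightarrow> 0"
proof -
  have uL: "u \<in> L2p"
    using u by (simp add: H1_def)
  note D = H1_derivative[OF u, where i = i]
  define c where "c n k = (cis (2 * pi * k $ i * t n) - 1) / complex_of_real (t n) - dm i k" for n and k :: "real ^ 'n"
  have "(\<lambda>n. (nrm (\<lambda>x. quot i (t n) u x - Dop i u x))\<^sup>2) \<longlonglongrightarrow> 0"
  proof (rule has_sum_dominated_tendsto_0)
    show "((\<lambda>k. 4 * (cmod (rc (Dop i u) k))\<^sup>2) has_sum 4 * (nrm (Dop i u))\<^sup>2) Zn"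
      by (intro has_sum_cmult_right parseval_real D)
    show "((\<lambda>k. (cmod (rc (\<lambda>x. quot i (t n) u x - Dop i u x) k))\<^sup>2) has_sum (nrm (\<lambda>x. quot i (t n) u x - Dop i u x))\<^sup>2) Zn" for n
      by (intro parseval_real L2p_diff quot_L2p uL D)
  next
    fix k :: "real ^ 'n" assume k: "k \<in> Zn"
    have eq: "rc (\<lambda>x. quot i (t n) u x - Dop i u x) k = c n k * rc u k" for n
      using rc_diff[OF quot_L2p[OF uL] D(1), of i "t n" k] by (simp add: rc_quot[OF uL k] D(2)[OF k] c_def left_diff_distrib)
    show "0 \<le> (cmod (rc (\<lambda>x. quot i (t n) u x - Dop i u x) k))\<^sup>2" for n
      by simp
    show "(cmod (rc (\<lambda>x. quot i (t n) u x - Dop i u x) k))\<^sup>2 \<le> 4 * (cmod (rc (Dop i u) k))\<^sup>2" for n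
    proof -
      have "cmod (c n k) \<le> cmod ((cis (2 * pi * k $ i * t n) - 1) / complex_of_real (t n)) + cmod (dm i k)"
        unfolding c_def by (rule norm_triangle_ineq4)
      also have "cmod ((cis (2 * pi * k $ i * t n) - 1) / complex_of_real (t n)) \<le> \<bar>2 * pi * k $ i * t n\<bar> / \<bar>t n\<bar>"
        unfolding norm_divide norm_of_real by (intro divide_right_mono norm_cis_minus_1_le) simp
      also have "\<dots> = cmod (dm i k)"
        using t(2)[of n] unfolding norm_mult norm_of_real by (simp add: abs_mult)
      finally have "cmod (c n k) \<le> 2 * cmod (dm i k)"
        by simp
      then have "cmod (c n k) * cmod (rc u k) \<le> 2 * cmod (dm i k) * cmod (rc u k)"
        by (rule mult_right_mono) simp
      then have "cmod (c n k * rc u k) \<le> 2 * cmod (dm i k * rc u k)"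
        by (simp only: norm_mult mult.assoc)
      then have "(cmod (c n k * rc u k))\<^sup>2 \<le> (2 * cmod (dm i k * rc u k))\<^sup>2"
        by (intro power_mono) auto
      then show ?thesis
        unfolding eq D(2)[OF k] by (simp add: power_mult_distrib)
    qed
    have "(\<lambda>n. c n k) \<longlonglongrightarrow> dm i k - dm i k"
      unfolding c_def using cis_quotient_tendsto[OF t, of "2 * pi * k $ i"] by (intro tendsto_diff tendsto_const) simp
    then have "(\<lambda>n. (cmod (c n k * rc u k))\<^sup>2) \<longlonglongrightarrow> (cmod (0 * rc u k))\<^sup>2"
      by (intro tendsto_intros) simp
    then show "(\<lambda>n. (cmod (rc (\<lambda>x. quot i (t n) u x - Dop i u x) k))\<^sup>2) \<longlonglongrightarrow> 0"
      unfolding eq by simp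
  qed
  then have "(\<lambda>n. sqrt ((nrm (\<lambda>x. quot i (t n) u x - Dop i u x))\<^sup>2)) \<longlonglongrightarrow> sqrt 0"
    by (rule tendsto_real_sqrt)
  then show ?thesis
    by simp
qed

text \<open>A common sequence of steps for both functions lets an exact relation between their
  difference quotients pass to the derivatives pointwise. Errors of norm at most 2^-n are summable
  and force convergence almost everywhere.\<close>

lemma quot_AE_subsequence:
  fixes u v :: "real ^ 'n \<Rightarrow> real"
  assumes u: "H1 u" and v: "H1 v"
  obtains t :: "nat \<Rightarrow> real" where "t \<longlonglongrightarrow> 0" "\<And>n. t n \<noteq> 0"
    "AE x in Q. (\<lambda>n. quot i (t n) u x) \<longlonglongrightarrow> Dop i u x"
    "AE x in Q. (\<lambda>n. quot i (t n) v x) \<longlonglongrightarrow> Dop i v x"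
proof -
  define t where "t n = inverse (real (Suc n))" for n
  have t: "t \<longlonglongrightarrow> 0" "\<And>n. t n \<noteq> 0"
    unfolding t_def using LIMSEQ_inverse_real_of_nat by auto
  define E where "E w n = nrm (\<lambda>x. quot i (t n) w x - Dop i w x)" for w n
  have lim: "E u \<longlonglongrightarrow> 0" "E v \<longlonglongrightarrow> 0"
    unfolding E_def by (intro quot_tendsto u v t)+
  have "\<exists>m\<ge>n. E u m \<le> (1/2) ^ n \<and> E v m \<le> (1/2) ^ n" for n
  proof -
    have "\<forall>\<^sub>F m in sequentially. E u m < (1/2) ^ n" "\<forall>\<^sub>F m in sequentially. E v m < (1/2) ^ n"
      using lim by (auto intro: order_tendstoD)
    then have "\<forall>\<^sub>F m in sequentially. m \<ge> n \<and> E u m \<le> (1/2) ^ n \<and> E v m \<le> (1/2) ^ n"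
      using eventually_ge_at_top[of n] by eventually_elim auto
    then show ?thesis
      by (auto simp: eventually_sequentially)
  qed
  then obtain s where s: "\<And>n. s n \<ge> n" "\<And>n. E u (s n) \<le> (1/2) ^ n" "\<And>n. E v (s n) \<le> (1/2) ^ n"
    by metis
  have conv: "AE x in Q. (\<lambda>n. quot i (t (s n)) w x) \<longlonglongrightarrow> Dop i w x"
    if w: "H1 w" and b: "\<And>n. E w (s n) \<le> (1/2) ^ n" for w
  proof -
    have wL: "w \<in> L2p"
      using w by (simp add: H1_def)
    have "AE x in Q. summable (\<lambda>n. norm (quot i (t (s n)) w x - Dop i w x))"
    proof (rule summable_nrm_AE_convergent[OF L2p_diff[OF quot_L2p[OF wL] H1_derivative(1)[OF w]]])
      have "summable (\<lambda>j. (1/2::real) ^ j)"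
        by (rule summable_geometric) simp
      then show "summable (\<lambda>n. nrm (\<lambda>x. quot i (t (s n)) w x - Dop i w x))"
        by (rule summable_comparison_test') (use b in \<open>simp add: E_def\<close>)
    qed
    then show ?thesis
    proof eventually_elim
      case (elim x)
      then have "(\<lambda>n. quot i (t (s n)) w x - Dop i w x) \<longlonglongrightarrow> 0"
        by (rule summable_LIMSEQ_zero[OF summable_norm_cancel])
      then show ?case
        by (simp add: LIM_zero_iff)
    qed
  qed
  have "filterlim s at_top sequentially"
    by (rule filterlim_at_top_mono[OF filterlim_ident]) (use s(1) in auto)
  then have "(\<lambda>n. t (s n)) \<longlonglongrightarrow> 0"
    by (rule filterlim_compose[OF t(1)])
  with t(2) conv[OF u s(2)] conv[OF v s(3)] that show thesis
    by blast
qed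

text \<open>The product rule is only needed up to an error \<open>K |u|\<close>, which avoids differentiating the
  Lipschitz factor.\<close>

lemma quot_step:
  assumes "(\<lambda>n. quot i (t n) u x) \<longlonglongrightarrow> d" "t \<longlonglongrightarrow> 0" "\<And>n. t n \<noteq> 0"
  shows "(\<lambda>n. u (x + axis i (t n))) \<longlonglongrightarrow> u x"
proof -
  have "(\<lambda>n. u x + t n * quot i (t n) u x) \<longlonglongrightarrow> u x + 0 * d"
    by (intro tendsto_intros assms)
  then show ?thesis
    using assms(3) by (simp add: quot_def)
qed

lemma H1_product_near:
  fixes a u :: "real ^ 'n \<Rightarrow> real"
  assumes u: "H1 u" and au: "H1 (\<lambda>x. a x * u x)" and lip: "\<And>x y. \<bar>a x - a y\<bar> \<le> K * norm (x - y)"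
  shows "AE x in Q. \<bar>Dop i (\<lambda>x. a x * u x) x - a x * Dop i u x\<bar> \<le> K * \<bar>u x\<bar>"
proof -
  obtain t where t: "t \<longlonglongrightarrow> 0" "\<And>n. t n \<noteq> 0"
    and c: "AE x in Q. (\<lambda>n. quot i (t n) u x) \<longlonglongrightarrow> Dop i u x"
    "AE x in Q. (\<lambda>n. quot i (t n) (\<lambda>x. a x * u x) x) \<longlonglongrightarrow> Dop i (\<lambda>x. a x * u x) x"
    by (rule quot_AE_subsequence[OF u au, where i = i]) blast
  from c show ?thesis
  proof eventually_elim
    case (elim x)
    have ax: "(\<lambda>n. a (x + axis i (t n))) \<longlonglongrightarrow> a x"
    proof -
      have "(\<lambda>n. a (x + axis i (t n)) - a x) \<longlonglongrightarrow> 0"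
      proof (rule Lim_null_comparison)
        show "\<forall>\<^sub>F n in sequentially. norm (a (x + axis i (t n)) - a x) \<le> K * \<bar>t n\<bar>"
          using lip[of "x + axis i (t _)" x] by (intro always_eventually) (simp add: norm_axis)
        show "(\<lambda>n. K * \<bar>t n\<bar>) \<longlonglongrightarrow> 0"
          using tendsto_mult[OF tendsto_const[of K] tendsto_rabs[OF t(1)]] by simp
      qed
      then show ?thesis
        by (simp add: LIM_zero_iff)
    qed
    \<comment> \<open>Discrete Leibniz rule with a taken at the shifted point; what remains is the
      difference quotient of a, at most K in modulus, times \<open>u x\<close>.\<close>
    have "\<bar>quot i (t n) (\<lambda>x. a x * u x) x - a (x + axis i (t n)) * quot i (t n) u x\<bar> \<le> K * \<bar>u x\<bar>" for n
    proof -
      have "quot i (t n) (\<lambda>x. a x * u x) x - a (x + axis i (t n)) * quot i (t n) u x = (a (x + axis i (t n)) - a x) * u x / t n"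
        using t(2)[of n] by (simp add: quot_def field_simps)
      also have "\<bar>\<dots>\<bar> = \<bar>a (x + axis i (t n)) - a x\<bar> * \<bar>u x\<bar> / \<bar>t n\<bar>"
        by (simp add: abs_mult)
      also have "\<dots> \<le> (K * \<bar>t n\<bar>) * \<bar>u x\<bar> / \<bar>t n\<bar>"
        using lip[of "x + axis i (t n)" x] by (intro divide_right_mono mult_right_mono) (auto simp: norm_axis)
      also have "\<dots> = K * \<bar>u x\<bar>"
        using t(2)[of n] by simp
      finally show ?thesis .
    qed
    moreover have "(\<lambda>n. \<bar>quot i (t n) (\<lambda>x. a x * u x) x - a (x + axis i (t n)) * quot i (t n) u x\<bar>)
        \<longlonglongrightarrow> \<bar>Dop i (\<lambda>x. a x * u x) x - a x * Dop i u x\<bar>"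
      by (intro tendsto_intros elim ax)
    ultimately show ?case
      by (intro LIMSEQ_le_const2) auto
  qed
qed

lemma H1_chain:
  fixes u :: "real ^ 'n \<Rightarrow> real"
  assumes u: "H1 u" and su: "H1 (\<lambda>x. s (u x))" and s: "\<And>t. (s has_real_derivative s' t) (at t)"
  shows "AE x in Q. Dop i (\<lambda>x. s (u x)) x = s' (u x) * Dop i u x"
proof -
  obtain t where t: "t \<longlonglongrightarrow> 0" "\<And>n. t n \<noteq> 0"
    and c: "AE x in Q. (\<lambda>n. quot i (t n) u x) \<longlonglongrightarrow> Dop i u x"
    "AE x in Q. (\<lambda>n. quot i (t n) (\<lambda>x. s (u x)) x) \<longlonglongrightarrow> Dop i (\<lambda>x. s (u x)) x"
    by (rule quot_AE_subsequence[OF u su, where i = i]) blast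
  from c show ?thesis
  proof eventually_elim
    case (elim x)
    \<comment> \<open>The slope of s, completed by the derivative at \<open>u x\<close>, is
      continuous there; the product formula for the quotient then also covers steps at which u does
      not change.\<close>
    define g where "g z = (if z = u x then s' (u x) else (s z - s (u x)) / (z - u x))" for z
    have "(g \<longlongrightarrow> g (u x)) (at (u x))"
    proof (rule Lim_transform_eventually)
      show "((\<lambda>z. (s z - s (u x)) / (z - u x)) \<longlongrightarrow> g (u x)) (at (u x))"
        using s[of "u x"] by (simp add: has_field_derivative_iff g_def)
    qed (simp add: g_def eventually_at_filter)
    then have "isCont g (u x)"
      by (simp add: isCont_def)
    then have "(\<lambda>n. g (u (x + axis i (t n)))) \<longlonglongrightarrow> g (u x)"
      by (rule isCont_tendsto_compose) (rule quot_step[OF elim(1) t])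
    then have "(\<lambda>n. g (u (x + axis i (t n))) * quot i (t n) u x) \<longlonglongrightarrow> s' (u x) * Dop i u x"
      using elim(1) by (intro tendsto_mult) (simp_all add: g_def)
    moreover have "g (u (x + axis i (t n))) * quot i (t n) u x = quot i (t n) (\<lambda>x. s (u x)) x" for n
      by (simp add: g_def quot_def)
    ultimately show ?case
      using elim(2) LIMSEQ_unique by simp
  qed
qed

text \<open>Frequency by frequency, since 4 pi^2 |k|^2 is at least 1 off the origin. The constant is
  1 instead of the optimal 1 / (4 pi^2).\<close>

lemma poincare:
  fixes u :: "real ^ 'n \<Rightarrow> real"
  assumes u: "H1 u"
  shows "(nrm (\<lambda>x. u x - (LINT x|Q. u x)))\<^sup>2 \<le> (\<Sum>i\<in>UNIV. (nrm (Dop i u))\<^sup>2)"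
proof -
  have uL: "u \<in> L2p"
    using u by (simp add: H1_def)
  let ?v = "\<lambda>x. u x - (LINT x|Q. u x)"
  have v: "((\<lambda>k. (cmod (rc ?v k))\<^sup>2) has_sum (nrm ?v)\<^sup>2) Zn"
    by (intro parseval_real L2p_diff uL L2p_const)
  have D: "((\<lambda>k. \<Sum>i\<in>UNIV. (cmod (rc (Dop i u) k))\<^sup>2) has_sum (\<Sum>i\<in>UNIV. (nrm (Dop i u))\<^sup>2)) Zn"
    by (intro has_sum_finite_sum parseval_real H1_derivative u)
  show ?thesis
  proof (rule has_sum_mono[OF v D])
    fix k :: "real ^ 'n" assume k: "k \<in> Zn"
    have rcv: "rc ?v k = (if k = 0 then 0 else rc u k)"
      by (simp add: rc_diff[OF uL L2p_const] rc_const[OF k] rc_0[OF uL])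
    show "(cmod (rc ?v k))\<^sup>2 \<le> (\<Sum>i\<in>UNIV. (cmod (rc (Dop i u) k))\<^sup>2)"
    proof (cases "k = 0")
      case False
      have "(\<Sum>i\<in>UNIV. (cmod (rc (Dop i u) k))\<^sup>2) = (\<Sum>i\<in>UNIV. (2 * pi * k $ i)\<^sup>2 * (cmod (rc u k))\<^sup>2)"
        by (simp only: H1_derivative(2)[OF u k] norm_mult[of "dm _ k"] power_mult_distrib[of "cmod (dm _ k)"] norm_dm)
      also have "\<dots> = 4 * pi\<^sup>2 * (k \<bullet> k) * (cmod (rc u k))\<^sup>2"
        by (simp add: inner_self_sum power_mult_distrib sum_distrib_left sum_distrib_right)
      finally have "(\<Sum>i\<in>UNIV. (cmod (rc (Dop i u) k))\<^sup>2) = (4 * pi\<^sup>2) * (k \<bullet> k) * (cmod (rc u k))\<^sup>2" .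
      moreover have "1 \<le> (4 * pi\<^sup>2) * (k \<bullet> k)"
      proof -
        have "1 \<le> pi\<^sup>2"
          using pi_gt3 by (intro one_le_power) simp
        then have "1 * 1 \<le> (4 * pi\<^sup>2) * (k \<bullet> k)"
          using Zn_norm_ge_1[OF k False] by (intro mult_mono) auto
        then show ?thesis by simp
      qed
      ultimately show ?thesis
        using False mult_right_mono[of 1 "(4 * pi\<^sup>2) * (k \<bullet> k)" "(cmod (rc u k))\<^sup>2"] by (simp add: rcv)
    qed (use rcv in \<open>simp add: sum_nonneg\<close>)
  qed
qed

subsection \<open>Invariant densities and their stability\<close>

text \<open>Orthogonality is asked on all of \<open>L2p\<close>; since T annihilates constants, this
  amounts to orthogonality on \<open>L0\<close>, to which the Sobolev formulation
  corresponds.\<close>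

definition inv_density :: "(real ^ 'n \<Rightarrow> 'n coeff) \<Rightarrow> (real ^ 'n \<Rightarrow> real) \<Rightarrow> bool" where
  "inv_density w r \<longleftrightarrow> r \<in> L2p \<and> (LINT x|Q. r x) = 1 \<and> (\<forall>g\<in>L2p. (LINT x|Q. r x * Tw w g x) = 0)"

lemma inv_densityD:
  assumes "inv_density w r"
  shows "r \<in> L2p" "(LINT x|Q. r x) = 1" "g \<in> L2p \<Longrightarrow> (LINT x|Q. r x * Tw w g x) = 0"
  using assms by (auto simp: inv_density_def)

text \<open>r = 1 - f, where f solves the adjoint problem with c = 1; f has mean zero, so r has mean
  1.\<close>

lemma (in cordes) inv_density_exists: "\<exists>r. inv_density w r"
proof -
  obtain f where f: "f \<in> L0" "\<And>g. g \<in> L2p \<Longrightarrow> (LINT x|Q. f x * Tw w g x) = 1 * (LINT x|Q. Tw w g x)"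
    using Tw_solvable by blast
  note fL = L0D(1)[OF f(1)]
  have "inv_density w (\<lambda>x. 1 - f x)"
    unfolding inv_density_def
  proof (intro conjI ballI)
    show "(\<lambda>x. 1 - f x) \<in> L2p"
      by (intro L2p_diff fL L2p_const)
    show "(LINT x|Q. 1 - f x) = 1"
      using L2p_integrable[OF fL] L0D(3)[OF f(1)] by simp
    fix g :: "real ^ 'n \<Rightarrow> real" assume g: "g \<in> L2p"
    have "integrable Q (\<lambda>x. f x * Tw w g x)" "integrable Q (Tw w g)"
      by (intro L2p_mult_integrable fL Tw_L2p g L2p_integrable)+
    then show "(LINT x|Q. (1 - f x) * Tw w g x) = 0"
      using f(2)[OF g] by (simp add: left_diff_distrib)
  qed
  then show ?thesis
    by blast
qed

lemma diff_bounded_mult_L2p: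
  fixes w v :: "real ^ 'n \<Rightarrow> 'n coeff"
  assumes w: "w \<in> borel_measurable lebesgue" "periodic_ae w" and v: "v \<in> borel_measurable lebesgue" "periodic_ae v"
    and b: "AE x in lebesgue. norm (w x - v x) \<le> C" and r: "r \<in> L2p"
  shows "(\<lambda>x. norm (w x - v x) * r x) \<in> L2p"
  by (rule L2p_mult_bounded[OF r, of _ C]) (use w v b in \<open>auto intro: periodic_ae_comp2\<close>)

text \<open>Coercivity is applied to g = r - s. Since r is orthogonal to \<open>Tw w g\<close> and s
  to \<open>Tw v g\<close>, the pairing of g with \<open>Tw w g\<close> is the integral of s times
  the inner product of v - w with \<open>DD g\<close>. The weight s stays with the coefficient
  error, so sup-norm closeness of the coefficients is not asked for. The 2 is a crude bound for sqrt
  (1 + 1/(4 pi^2)).\<close>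

lemma (in cordes) stability:
  assumes v: "cordes v \<rho>'" and r: "inv_density w r" and s: "inv_density v s"
  shows "(1 - \<kappa>) * nrm (\<lambda>x. r x - s x) \<le> 2 * nrm (\<lambda>x. norm (w x - v x) * s x)"
proof -
  interpret v: cordes v \<rho>'
    by (rule v)
  define g where "g = (\<lambda>x. r x - s x)"
  note rD = inv_densityD[OF r] and sD = inv_densityD[OF s]
  have gL: "g \<in> L2p"
    unfolding g_def by (intro L2p_diff rD sD)
  have g0: "g \<in> L0"
    using gL rD(2) sD(2) L2p_integrable[OF rD(1)] L2p_integrable[OF sD(1)] by (simp add: L0_def g_def)
  have "AE x in lebesgue. norm (w x - v x) \<le> \<rho> + \<rho>'"
    using w_near v.w_near
  proof eventually_elim
    case (elim x)
    have "norm (w x - v x) \<le> norm (w x - w0) + norm (v x - w0)"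
      using norm_triangle_ineq4[of "w x - w0" "v x - w0"] by simp
    with elim show ?case by simp
  qed
  then have pL: "(\<lambda>x. norm (w x - v x) * s x) \<in> L2p"
    by (intro diff_bounded_mult_L2p w_meas w_per v.w_meas v.w_per sD(1))
  note DL = norm_DD_L2p[OF gL]
  have int: "integrable Q (\<lambda>x. r x * Tw w g x)" "integrable Q (\<lambda>x. s x * Tw w g x)" "integrable Q (\<lambda>x. s x * Tw v g x)"
    by (intro L2p_mult_integrable rD(1) sD(1) Tw_L2p v.Tw_L2p gL)+
  have D2: "nrm (\<lambda>x. norm (DD g x)) \<le> 2 * nrm g"
  proof (rule power2_le_imp_le)
    have "1 \<le> pi\<^sup>2"
      using pi_gt3 by (intro one_le_power) simp
    then have "1 + 1 / (4 * pi\<^sup>2) \<le> 4"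
      by (simp add: divide_simps)
    then have "(1 + 1 / (4 * pi\<^sup>2)) * (nrm g)\<^sup>2 \<le> 4 * (nrm g)\<^sup>2"
      by (rule mult_right_mono) simp
    with DL(2) show "(nrm (\<lambda>x. norm (DD g x)))\<^sup>2 \<le> (2 * nrm g)\<^sup>2"
      by (simp add: power_mult_distrib)
  qed simp
  have "(1 - \<kappa>) * (nrm g)\<^sup>2 \<le> (LINT x|Q. g x * Tw w g x)"
    by (rule Tw_coercive[OF g0])
  also have "\<dots> = (LINT x|Q. r x * Tw w g x) - (LINT x|Q. s x * Tw w g x)"
    using int by (simp add: g_def left_diff_distrib)
  also have "\<dots> = (LINT x|Q. s x * Tw v g x) - (LINT x|Q. s x * Tw w g x)"
    by (simp add: rD(3) sD(3) gL)
  also have "\<dots> = (LINT x|Q. s x * ((v x - w x) \<bullet> DD g x))"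
    using int by (simp add: Tw_def inner_diff_left right_diff_distrib)
  also have "\<dots> \<le> (LINT x|Q. norm (norm (w x - v x) * s x) * norm (norm (DD g x)))"
  proof (rule integral_mono)
    show "integrable Q (\<lambda>x. s x * ((v x - w x) \<bullet> DD g x))"
      using int(2,3) by (simp add: Tw_def inner_diff_left right_diff_distrib)
    show "integrable Q (\<lambda>x. norm (norm (w x - v x) * s x) * norm (norm (DD g x)))"
      by (rule integrable_norm_mult[OF pL DL(1)])
    fix x
    have "s x * ((v x - w x) \<bullet> DD g x) \<le> \<bar>s x\<bar> * \<bar>(v x - w x) \<bullet> DD g x\<bar>"
      by (metis abs_ge_self abs_mult)
    also have "\<dots> \<le> \<bar>s x\<bar> * (norm (v x - w x) * norm (DD g x))"
      by (intro mult_left_mono Cauchy_Schwarz_ineq2) simp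
    finally show "s x * ((v x - w x) \<bullet> DD g x) \<le> norm (norm (w x - v x) * s x) * norm (norm (DD g x))"
      by (simp add: abs_mult norm_minus_commute mult_ac)
  qed
  also have "\<dots> \<le> nrm (\<lambda>x. norm (w x - v x) * s x) * nrm (\<lambda>x. norm (DD g x))"
    by (rule integral_norm_mult_le[OF pL DL(1)])
  also have "\<dots> \<le> nrm (\<lambda>x. norm (w x - v x) * s x) * (2 * nrm g)"
    by (intro mult_left_mono D2) simp
  finally have "((1 - \<kappa>) * nrm g) * nrm g \<le> (2 * nrm (\<lambda>x. norm (w x - v x) * s x)) * nrm g"
    by (simp add: power2_eq_square mult_ac)
  then have "(1 - \<kappa>) * nrm g \<le> 2 * nrm (\<lambda>x. norm (w x - v x) * s x)"
    using nrm_nonneg[of g] by (cases "nrm g = 0") (auto simp: mult_le_cancel_right)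
  then show ?thesis
    by (simp add: g_def)
qed

text \<open>Translation multiplies each coefficient by \<open>ek k h\<close>, which commutes with
  multiplication by the symbol.\<close>

lemma mop_shift:
  assumes m: "is_multiplier m" and f: "f \<in> L2p"
  shows "AE x in lebesgue. mop m (\<lambda>x. f (x + h)) x = mop m f (x + h)"
proof (rule rc_inject)
  show "mop m (\<lambda>x. f (x + h)) \<in> L2p" "(\<lambda>x. mop m f (x + h)) \<in> L2p"
    by (intro mop m f L2p_shift)+
  fix k :: "real ^ 'a" assume k: "k \<in> Zn"
  show "rc (mop m (\<lambda>x. f (x + h))) k = rc (\<lambda>x. mop m f (x + h)) k"
    using k by (simp add: mop m f L2p_shift rc_shift mult_ac)
qed

lemma DD_shift:
  fixes f :: "real ^ 'n \<Rightarrow> real"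
  assumes f: "f \<in> L2p"
  shows "AE x in lebesgue. DD (\<lambda>x. f (x + h)) x = DD f (x + h)"
proof -
  have "AE x in lebesgue. \<forall>i\<in>UNIV. \<forall>j\<in>UNIV. mop (Rm i j) (\<lambda>x. f (x + h)) x = mop (Rm i j) f (x + h)"
    by (intro AE_finite_allI mop_shift[OF is_multiplier_Rm f]) auto
  moreover have "AE x in lebesgue. \<forall>i\<in>UNIV. mop (Sm i) (\<lambda>x. f (x + h)) x = mop (Sm i) f (x + h)"
    by (intro AE_finite_allI mop_shift[OF is_multiplier_Sm f]) auto
  ultimately show ?thesis
    by eventually_elim (simp add: DD_def)
qed

lemma (in cordes) cordes_shift: "cordes (\<lambda>x. w (x + h)) \<rho>"
proof
  show "(\<lambda>x. w (x + h)) \<in> borel_measurable lebesgue"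
    by (rule borel_measurable_shift[OF w_meas])
  show "periodic_ae (\<lambda>x. w (x + h))"
    by (rule periodic_ae_shift[OF w_per])
  show "AE x in lebesgue. norm (w (x + h) - w0) \<le> \<rho>"
    using AE_shift[OF w_near] .
qed (use rho in auto)

text \<open>The test function is translated back; translation invariance of the integral over the
  cell reduces the claim to r itself.\<close>

lemma (in cordes) inv_density_shift:
  assumes r: "inv_density w r"
  shows "inv_density (\<lambda>x. w (x + h)) (\<lambda>x. r (x + h))"
  unfolding inv_density_def
proof (intro conjI ballI)
  note rD = inv_densityD[OF r]
  show "(\<lambda>x. r (x + h)) \<in> L2p"
    by (intro L2p_shift rD)
  show "(LINT x|Q. r (x + h)) = 1"
    using integral_Q_shift[OF L2pD(2)[OF rD(1)] L2pD(1)[OF rD(1)] L2p_integrable[OF rD(1)], of h] rD(2) by simp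
  fix g :: "real ^ 'n \<Rightarrow> real" assume g: "g \<in> L2p"
  interpret s: cordes "\<lambda>x. w (x + h)" \<rho>
    by (rule cordes_shift)
  define g' where "g' = (\<lambda>x. g (x + - h))"
  have g': "g' \<in> L2p"
    unfolding g'_def by (intro L2p_shift g)
  have gg: "(\<lambda>x. g' (x + h)) = g"
    by (simp add: g'_def)
  note P = L2p_mult_integrable[OF rD(1) Tw_L2p[OF g']]
  have "(LINT x|Q. r (x + h) * Tw (\<lambda>x. w (x + h)) g x) = (LINT x|Q. r (x + h) * Tw w g' (x + h))"
  proof (rule integral_cong_AE)
    show "(\<lambda>x. r (x + h) * Tw (\<lambda>x. w (x + h)) g x) \<in> borel_measurable Q"
      by (intro measurable_Q L2p_mult_integrable(2) L2p_shift rD(1) s.Tw_L2p g)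
    show "(\<lambda>x. r (x + h) * Tw w g' (x + h)) \<in> borel_measurable Q"
      by (intro measurable_Q borel_measurable_shift[OF P(2)])
    show "AE x in Q. r (x + h) * Tw (\<lambda>x. w (x + h)) g x = r (x + h) * Tw w g' (x + h)"
      using AE_lebesgue_Q[OF DD_shift[OF g', of h]] unfolding gg by eventually_elim (simp add: Tw_def)
  qed
  also have "\<dots> = (LINT x|Q. r x * Tw w g' x)"
    by (rule integral_Q_shift[OF P])
  also have "\<dots> = 0"
    by (rule rD(3)[OF g'])
  finally show "(LINT x|Q. r (x + h) * Tw (\<lambda>x. w (x + h)) g x) = 0" .
qed

subsection \<open>Positivity for Lipschitz coefficients\<close>

locale lipschitz_cordes = cordes w \<rho> for w :: "real ^ 'n \<Rightarrow> 'n coeff" and \<rho> +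
  fixes K :: real and r :: "real ^ 'n \<Rightarrow> real"
  assumes lip: "\<And>x y. norm (w x - w y) \<le> K * norm (x - y)"
    and dens: "inv_density w r"
begin

lemma K_nonneg: "0 \<le> K"
  using order_trans[OF norm_ge_zero lip[of "axis undefined 1" 0]] by (simp add: norm_axis)

lemma r_L2p: "r \<in> L2p" and r_mean: "(LINT x|Q. r x) = 1"
  using inv_densityD[OF dens] by auto

text \<open>Stability compares w with its translate, whose densities are r and the translate of r.
  The Lipschitz condition bounds the coefficient error by K |h|, which leaves |h| times the norm of
  r.\<close>

lemma H1_r: "H1 r"
  unfolding H1_def
proof (intro conjI exI allI)
  show "r \<in> L2p"
    by (rule r_L2p)
  show "0 \<le> 2 * K * nrm r / (1 - \<kappa>)"
    using K_nonneg kappa by (intro divide_nonneg_nonneg mult_nonneg_nonneg) auto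
  fix h :: "real ^ 'n"
  have "(1 - \<kappa>) * nrm (\<lambda>x. r x - r (x + h)) \<le> 2 * nrm (\<lambda>x. norm (w x - w (x + h)) * r (x + h))"
    by (rule stability[OF cordes_shift dens inv_density_shift[OF dens]])
  also have "nrm (\<lambda>x. norm (w x - w (x + h)) * r (x + h)) \<le> (K * norm h) * nrm (\<lambda>x. r (x + h))"
  proof (rule nrm_bound[OF L2p_shift(1)[OF r_L2p]])
    have b: "norm (w x - w (x + h)) \<le> K * norm h" for x
      using lip[of x "x + h"] by simp
    have "(\<lambda>x. norm (w x - w (x + h)) * r (x + h)) \<in> L2p"
      by (rule diff_bounded_mult_L2p[where C = "K * norm h"])
        (use b w_meas w_per r_L2p in \<open>auto intro: borel_measurable_shift periodic_ae_shift L2p_shift\<close>)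
    then show "(\<lambda>x. norm (w x - w (x + h)) * r (x + h)) \<in> borel_measurable lebesgue"
      "periodic_ae (\<lambda>x. norm (w x - w (x + h)) * r (x + h))"
      by (auto dest: L2pD)
    show "AE x in lebesgue. norm (norm (w x - w (x + h)) * r (x + h)) \<le> K * norm h * norm (r (x + h))"
      using b by (intro AE_I2) (simp add: abs_mult mult_right_mono)
    show "0 \<le> K * norm h"
      using K_nonneg by simp
  qed
  finally have "(1 - \<kappa>) * nrm (\<lambda>x. r (x + h) - r x) \<le> 2 * (K * norm h * nrm r)"
    using L2p_shift(2)[OF r_L2p, of h] nrm_minus_commute[of r "\<lambda>x. r (x + h)"] by simp
  then show "nrm (\<lambda>x. r (x + h) - r x) \<le> 2 * K * nrm r / (1 - \<kappa>) * norm h"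
    using kappa by (simp add: field_simps)
qed

lemma lip_components:
  "\<bar>fst (w x) $ i $ j - fst (w y) $ i $ j\<bar> \<le> K * norm (x - y)"
proof -
  have "\<bar>fst v $ i $ j\<bar> \<le> norm v" for v :: "'n coeff"
    using Finite_Cartesian_Product.norm_nth_le[of "fst v $ i" j] Finite_Cartesian_Product.norm_nth_le[of "fst v" i]
      norm_fst_le[of "fst v" "snd v"] by (auto intro: order_trans)
  from this[of "w x - w y"] lip[of x y] show ?thesis
    by simp
qed

text \<open>With a the coefficient entry, the increment splits into a (x + h) (r (x + h) - r x),
  where a is bounded, and (a (x + h) - a x) r x, where a is Lipschitz.\<close>

lemma H1_p: "H1 (\<lambda>x. fst (w x) $ i $ j * r x)"
proof -
  let ?a = "\<lambda>x. fst (w x) $ i $ j"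
  obtain C where C: "C \<ge> 0" "\<And>h. nrm (\<lambda>x. r (x + h) - r x) \<le> C * norm h"
    using H1_r by (auto simp: H1_def)
  define B where "B = norm (w0 :: 'n coeff) + \<rho>"
  have B: "B \<ge> 0"
    using rho by (simp add: B_def)
  have "nrm (\<lambda>x. ?a (x + h) * r (x + h) - ?a x * r x) \<le> (B * C + K * nrm r) * norm h" for h
  proof -
    have L: "(\<lambda>x. r (x + h) - r x) \<in> L2p"
      by (intro L2p_diff L2p_shift r_L2p)
    have a_shift: "(\<lambda>x. ?a (x + h)) \<in> borel_measurable lebesgue" "periodic_ae (\<lambda>x. ?a (x + h))"
      "AE x in lebesgue. \<bar>?a (x + h)\<bar> \<le> B"
      using borel_measurable_shift[OF w_components(1)] periodic_ae_shift[OF w_components(3)] AE_shift[OF w_components(5)]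
      by (auto simp: B_def)
    have 1: "(\<lambda>x. ?a (x + h) * (r (x + h) - r x)) \<in> L2p"
      by (rule L2p_mult_bounded[OF L a_shift])
    have d: "(\<lambda>x. ?a (x + h) - ?a x) \<in> borel_measurable lebesgue" "periodic_ae (\<lambda>x. ?a (x + h) - ?a x)"
      "AE x in lebesgue. \<bar>?a (x + h) - ?a x\<bar> \<le> K * norm h"
      using a_shift w_components(1,3)[of i j] lip_components[of "_ + h" i j]
      by (auto intro!: periodic_ae_comp2[of _ _ "(-)"] AE_I2) (metis add_diff_cancel_left')
    have 2: "(\<lambda>x. (?a (x + h) - ?a x) * r x) \<in> L2p"
      by (rule L2p_mult_bounded[OF r_L2p d])
    have "nrm (\<lambda>x. ?a (x + h) * r (x + h) - ?a x * r x) = nrm (\<lambda>x. ?a (x + h) * (r (x + h) - r x) + (?a (x + h) - ?a x) * r x)"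
      by (simp add: algebra_simps)
    also have "\<dots> \<le> nrm (\<lambda>x. ?a (x + h) * (r (x + h) - r x)) + nrm (\<lambda>x. (?a (x + h) - ?a x) * r x)"
      by (rule nrm_triangle[OF 1 2])
    also have "nrm (\<lambda>x. ?a (x + h) * (r (x + h) - r x)) \<le> B * nrm (\<lambda>x. r (x + h) - r x)"
    proof (rule nrm_bound[OF L L2pD(1)[OF 1] L2pD(2)[OF 1] _ B])
      show "AE x in lebesgue. norm (?a (x + h) * (r (x + h) - r x)) \<le> B * norm (r (x + h) - r x)"
        using a_shift(3) by eventually_elim (simp add: abs_mult mult_right_mono)
    qed
    also have "B * nrm (\<lambda>x. r (x + h) - r x) \<le> B * (C * norm h)"
      by (intro mult_left_mono C B)
    also have "nrm (\<lambda>x. (?a (x + h) - ?a x) * r x) \<le> (K * norm h) * nrm r"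
    proof (rule nrm_bound[OF r_L2p L2pD(1)[OF 2] L2pD(2)[OF 2]])
      show "AE x in lebesgue. norm ((?a (x + h) - ?a x) * r x) \<le> K * norm h * norm (r x)"
        using d(3) by eventually_elim (simp add: abs_mult mult_right_mono)
    qed (use K_nonneg in simp)
    finally show ?thesis
      by (simp add: algebra_simps)
  qed
  then show ?thesis
    unfolding H1_def using w_mult_L2p(1)[OF r_L2p] B C(1) K_nonneg
    by (intro conjI exI[of _ "B * C + K * nrm r"]) auto
qed

text \<open>The divergence form of the equation. Orthogonality to the range of T, tested with
  \<open>Tadj r\<close>, gives \<open>Tadj r\<close> = 0 almost everywhere. Multiplying its
  coefficients by 4 pi^2 |k|^2 removes the inverse Laplacian and leaves the equation for r at each
  frequency; Parseval then puts one derivative on s.\<close>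

lemma flux_identity:
  assumes s: "H1 s"
  shows "(\<Sum>i\<in>UNIV. \<Sum>j\<in>UNIV. LINT x|Q. Dop i (\<lambda>x. fst (w x) $ i $ j * r x) x * Dop j s x)
    = (\<Sum>i\<in>UNIV. LINT x|Q. (snd (w x) $ i * r x) * Dop i s x)"
proof -
  let ?p = "\<lambda>i j x. fst (w x) $ i $ j * r x" and ?b = "\<lambda>i x. snd (w x) $ i * r x"
  note p = H1_derivative[OF H1_p] and D = H1_derivative[OF s]
  note pL = w_mult_L2p(1)[OF r_L2p] and bL = w_mult_L2p(2)[OF r_L2p]
  have T: "Tadj r \<in> L2p"
    by (rule L0D(1)[OF Tadj_L0[OF r_L2p]])
  have "(nrm (Tadj r))\<^sup>2 = 0"
    unfolding nrm_power2_real using Tadj[OF r_L2p T] inv_densityD(3)[OF dens T] by simp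
  then have T0: "AE x in lebesgue. Tadj r x = 0"
    using nrm_eq_0_iff[OF T] by simp
  have eq: "(\<Sum>i\<in>UNIV. \<Sum>j\<in>UNIV. dm i k * dm j k * rc (?p i j) k) = (\<Sum>i\<in>UNIV. dm i k * rc (?b i) k)"
    if k: "k \<in> Zn" for k
  proof -
    note R = mop[OF is_multiplier_cnj[OF is_multiplier_Rm] pL] and S = mop[OF is_multiplier_cnj[OF is_multiplier_Sm] bL]
    define c where "c = complex_of_real (4 * pi\<^sup>2 * (k \<bullet> k))"
    have "rc (Tadj r) k = rc (\<lambda>x. 0) k"
      by (rule rc_cong_AE[OF T0 L2pD(1)[OF T]]) simp
    then have "rc (Tadj r) k = 0"
      by (simp add: rc_def fc_def)
    moreover have "rc (Tadj r) k = (\<Sum>i\<in>UNIV. \<Sum>j\<in>UNIV. cnj (Rm i j k) * rc (?p i j) k) + (\<Sum>i\<in>UNIV. cnj (Sm i k) * rc (?b i) k)"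
      unfolding Tadj_def[abs_def] by (simp add: rc_add rc_sum L2p_sum R S k)
    ultimately have "c * ((\<Sum>i\<in>UNIV. \<Sum>j\<in>UNIV. cnj (Rm i j k) * rc (?p i j) k) + (\<Sum>i\<in>UNIV. cnj (Sm i k) * rc (?b i) k)) = 0"
      by simp
    then have "(\<Sum>i\<in>UNIV. \<Sum>j\<in>UNIV. c * cnj (Rm i j k) * rc (?p i j) k) + (\<Sum>i\<in>UNIV. c * cnj (Sm i k) * rc (?b i) k) = 0"
      by (simp only: distrib_left sum_distrib_left mult.assoc)
    moreover have "c * cnj (Rm i j k) = - (dm i k * dm j k)" for i j
      by (cases "k = 0") (simp_all add: c_def Rm_def field_simps power2_eq_square)
    moreover have "c * cnj (Sm i k) = dm i k" for i
      by (cases "k = 0") (simp_all add: c_def Sm_def field_simps power2_eq_square)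
    ultimately show ?thesis
      by (simp only: mult_minus_left sum_negf) (simp only: add.commute[of "- _"] eq_iff_diff_eq_0[symmetric] diff_conv_add_uminus[symmetric] right_minus_eq)
  qed
  have "((\<lambda>k. \<Sum>i\<in>UNIV. \<Sum>j\<in>UNIV. Re (rc (Dop i (?p i j)) k * cnj (rc (Dop j s) k))) has_sum
      (\<Sum>i\<in>UNIV. \<Sum>j\<in>UNIV. LINT x|Q. Dop i (?p i j) x * Dop j s x)) Zn"
    by (intro has_sum_finite_sum parseval_real_inner p(1) D(1))
  moreover have "((\<lambda>k. \<Sum>i\<in>UNIV. Re (rc (?b i) k * cnj (rc (Dop i s) k))) has_sum
      (\<Sum>i\<in>UNIV. LINT x|Q. ?b i x * Dop i s x)) Zn"
    by (intro has_sum_finite_sum parseval_real_inner bL D(1))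
  moreover have "(\<Sum>i\<in>UNIV. \<Sum>j\<in>UNIV. Re (rc (Dop i (?p i j)) k * cnj (rc (Dop j s) k))) = (\<Sum>i\<in>UNIV. Re (rc (?b i) k * cnj (rc (Dop i s) k)))"
    if k: "k \<in> Zn" for k
  proof -
    have c: "cnj (dm i k * rc s k) = - (dm i k) * cnj (rc s k)" for i
      by simp
    have "(\<Sum>i\<in>UNIV. \<Sum>j\<in>UNIV. rc (Dop i (?p i j)) k * cnj (rc (Dop j s) k))
        = (\<Sum>i\<in>UNIV. \<Sum>j\<in>UNIV. dm i k * dm j k * rc (?p i j) k) * - cnj (rc s k)"
      unfolding p(2)[OF k] D(2)[OF k] c sum_distrib_right by (intro sum.cong refl) (simp only: mult_ac mult_minus_left mult_minus_right)
    also have "\<dots> = (\<Sum>i\<in>UNIV. dm i k * rc (?b i) k) * - cnj (rc s k)"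
      by (simp only: eq[OF k])
    also have "\<dots> = (\<Sum>i\<in>UNIV. rc (?b i) k * cnj (rc (Dop i s) k))"
      unfolding D(2)[OF k] c sum_distrib_right by (intro sum.cong refl) (simp only: mult_ac mult_minus_left mult_minus_right)
    finally show ?thesis
      unfolding Re_sum[symmetric] by simp
  qed
  ultimately show ?thesis
    using has_sum_unique has_sum_cong by (metis (no_types, lifting))
qed

end

section \<open>A smooth approximation of the sign function\<close>

definition sg :: "real \<Rightarrow> real \<Rightarrow> real" where
  "sg e t = t / sqrt (e\<^sup>2 + t\<^sup>2)"

text \<open>The derivative of \<open>sg e\<close>. What matters is that
  \<open>sg' e t * t\<^sup>2 / e\<close> stays between 0 and 1 and tends to 0 with e: it is the
  integrand left over by the energy estimate.\<close>

definition sg' :: "real \<Rightarrow> real \<Rightarrow> real" where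
  "sg' e t = e\<^sup>2 / sqrt (e\<^sup>2 + t\<^sup>2) ^ 3"

lemma sg_sqrt:
  assumes "e > 0"
  shows "0 < sqrt (e\<^sup>2 + t\<^sup>2)" "e \<le> sqrt (e\<^sup>2 + t\<^sup>2)" "\<bar>t\<bar> \<le> sqrt (e\<^sup>2 + t\<^sup>2)" "(sqrt (e\<^sup>2 + t\<^sup>2))\<^sup>2 = e\<^sup>2 + t\<^sup>2"
  using assms by (auto intro!: real_le_rsqrt add_pos_nonneg simp: real_sqrt_abs[symmetric] simp del: real_sqrt_abs)

lemma sg_derivative:
  assumes "e > 0"
  shows "(sg e has_real_derivative sg' e t) (at t)"
proof -
  define y where "y = sqrt (e\<^sup>2 + t\<^sup>2)"
  have y: "y > 0" "y\<^sup>2 = e\<^sup>2 + t\<^sup>2"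
    using sg_sqrt[OF assms, of t] by (simp_all add: y_def)
  have p: "0 < e\<^sup>2 + t\<^sup>2"
    using assms by (intro add_pos_nonneg) auto
  have "((\<lambda>t. t / sqrt (e\<^sup>2 + t\<^sup>2)) has_real_derivative (1 * y - t * (t / y)) / (y * y)) (at t)"
    using p y by (auto intro!: derivative_eq_intros simp: y_def field_simps)
  moreover have "(1 * y - t * (t / y)) / (y * y) = sg' e t"
  proof -
    have "(1 * y - t * (t / y)) / (y * y) = (y\<^sup>2 - t\<^sup>2) / y ^ 3"
      using y(1) by (simp add: field_simps power2_eq_square power3_eq_cube)
    then show ?thesis
      using y(2) by (simp add: sg'_def y_def)
  qed
  ultimately show ?thesis
    by (simp add: sg_def[abs_def])
qed

lemma sg'_bounds:
  assumes e: "e > 0"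
  shows "0 \<le> sg' e t" "sg' e t \<le> 1 / e"
proof -
  define y where "y = sqrt (e\<^sup>2 + t\<^sup>2)"
  have y: "y > 0" "e \<le> y"
    using sg_sqrt[OF assms, of t] by (simp_all add: y_def)
  show "0 \<le> sg' e t"
    using y by (simp add: sg'_def flip: y_def)
  have "e ^ 3 \<le> y ^ 3"
    using y e by (intro power_mono) auto
  then have "e\<^sup>2 / y ^ 3 \<le> 1 / e"
    using y e by (simp add: field_simps power2_eq_square power3_eq_cube)
  then show "sg' e t \<le> 1 / e"
    by (simp only: sg'_def y_def)
qed

lemma sg_lipschitz:
  assumes e: "e > 0"
  shows "\<bar>sg e s - sg e t\<bar> \<le> (1 / e) * \<bar>s - t\<bar>"
proof -
  have "norm (sg e s - sg e t) \<le> (1 / e) * norm (s - t)"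
  proof (rule field_differentiable_bound[of UNIV "sg e" "sg' e"])
    show "norm (sg' e z) \<le> 1 / e" for z
      using sg'_bounds[OF e, of z] by simp
  qed (use sg_derivative[OF e] in auto)
  then show ?thesis by simp
qed

lemma sg_bound: "e > 0 \<Longrightarrow> \<bar>sg e t\<bar> \<le> 1"
  using sg_sqrt[of e t] by (simp add: sg_def divide_le_eq_1)

lemma sg_tendsto:
  fixes e :: "nat \<Rightarrow> real"
  assumes "e \<longlonglongrightarrow> 0" "\<And>n. e n > 0"
  shows "(\<lambda>n. sg (e n) t) \<longlonglongrightarrow> sgn t" "(\<lambda>n. sg' (e n) t * t\<^sup>2 / e n) \<longlonglongrightarrow> 0"
proof -
  have r: "(\<lambda>n. sqrt ((e n)\<^sup>2 + t\<^sup>2)) \<longlonglongrightarrow> \<bar>t\<bar>"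
  proof -
    have "(\<lambda>n. sqrt ((e n)\<^sup>2 + t\<^sup>2)) \<longlonglongrightarrow> sqrt (0\<^sup>2 + t\<^sup>2)"
      by (intro tendsto_intros assms)
    then show ?thesis by simp
  qed
  have eq: "sg' (e n) t * t\<^sup>2 / e n = e n * t\<^sup>2 / sqrt ((e n)\<^sup>2 + t\<^sup>2) ^ 3" for n
    using assms(2)[of n] by (simp add: sg'_def power2_eq_square)
  show "(\<lambda>n. sg (e n) t) \<longlonglongrightarrow> sgn t"
  proof (cases "t = 0")
    case False
    then have "(\<lambda>n. t / sqrt ((e n)\<^sup>2 + t\<^sup>2)) \<longlonglongrightarrow> t / \<bar>t\<bar>"
      by (intro tendsto_divide tendsto_const r) simp
    moreover have "t / \<bar>t\<bar> = sgn t"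
      using False by (simp add: sgn_real_def)
    ultimately show ?thesis
      by (simp add: sg_def)
  qed (simp add: sg_def)
  show "(\<lambda>n. sg' (e n) t * t\<^sup>2 / e n) \<longlonglongrightarrow> 0"
  proof (cases "t = 0")
    case False
    then have "(\<lambda>n. e n * t\<^sup>2 / sqrt ((e n)\<^sup>2 + t\<^sup>2) ^ 3) \<longlonglongrightarrow> 0 * t\<^sup>2 / \<bar>t\<bar> ^ 3"
      by (intro tendsto_intros assms r) simp
    then show ?thesis
      by (simp add: eq)
  qed simp
qed

lemma sg'_scaled_bound:
  assumes e: "e > 0"
  shows "0 \<le> sg' e t * t\<^sup>2 / e" "sg' e t * t\<^sup>2 / e \<le> 1"
proof -
  define y where "y = sqrt (e\<^sup>2 + t\<^sup>2)"
  have y: "y > 0" "e \<le> y" "y\<^sup>2 = e\<^sup>2 + t\<^sup>2"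
    using sg_sqrt[OF assms, of t] by (simp_all add: y_def)
  show "0 \<le> sg' e t * t\<^sup>2 / e"
    using sg'_bounds(1)[OF e] e by simp
  have "e * t\<^sup>2 \<le> y * y\<^sup>2"
    using y e by (intro mult_mono) auto
  then have "e * t\<^sup>2 / y ^ 3 \<le> 1"
    using y(1) by (simp add: power2_eq_square power3_eq_cube)
  moreover have "sg' e t * t\<^sup>2 / e = e * t\<^sup>2 / y ^ 3"
    using e by (simp add: sg'_def y_def power2_eq_square)
  ultimately show "sg' e t * t\<^sup>2 / e \<le> 1"
    by simp
qed

lemma sg'_scaled_norm: "e > 0 \<Longrightarrow> norm (sg' e t * t\<^sup>2 / e) \<le> 1"
  unfolding real_norm_def using sg'_scaled_bound[of e t] by (subst abs_of_nonneg) auto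

section \<open>The energy estimate for the regularised sign\<close>

context lipschitz_cordes
begin

lemma rho_less_1: "\<rho> < 1"
proof -
  have "\<rho>\<^sup>2 * 1 \<le> \<rho>\<^sup>2 * (1 + 1 / (4 * pi\<^sup>2))"
    by (intro mult_left_mono) auto
  then have "\<rho>\<^sup>2 < 1\<^sup>2"
    using rho by simp
  then show ?thesis
    by (rule power2_less_imp_less) simp
qed

text \<open>Closeness to \<open>w0\<close> alone yields ellipticity: the pair of the matrix with
  entries xi_i xi_j and the zero vector has norm |xi|^2 and inner product |xi|^2 with
  \<open>w0\<close>, so Cauchy-Schwarz leaves at least (1 - \<rho>) |xi|^2.\<close>

lemma elliptic:
  fixes v :: "'n coeff" and \<xi> :: "'n \<Rightarrow> real"
  assumes v: "norm (v - w0) \<le> \<rho>"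
  shows "(1 - \<rho>) * (\<Sum>i\<in>UNIV. (\<xi> i)\<^sup>2) \<le> (\<Sum>i\<in>UNIV. \<Sum>j\<in>UNIV. fst v $ i $ j * \<xi> i * \<xi> j)"
proof -
  define Z :: "'n coeff" where "Z = ((\<chi> i j. \<xi> i * \<xi> j), 0)"
  define X where "X = (\<Sum>i\<in>UNIV. (\<xi> i)\<^sup>2)"
  have X: "X \<ge> 0"
    by (simp add: X_def sum_nonneg)
  have inner: "u \<bullet> Z = (\<Sum>i\<in>UNIV. \<Sum>j\<in>UNIV. fst u $ i $ j * \<xi> i * \<xi> j)" for u :: "'n coeff"
    by (simp add: Z_def inner_prod_def inner_vec_def mult.assoc)
  have "Z \<bullet> Z = (\<Sum>i\<in>UNIV. \<Sum>j\<in>UNIV. (\<xi> i)\<^sup>2 * (\<xi> j)\<^sup>2)"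
    unfolding inner by (simp add: Z_def power2_eq_square mult_ac)
  also have "\<dots> = X\<^sup>2"
    unfolding X_def power2_eq_square[of "sum _ _"] sum_product ..
  finally have Z: "norm Z = X"
    using X by (simp add: norm_eq_sqrt_inner)
  have "w0 \<bullet> Z = X"
    unfolding inner by (simp add: w0_def mat_def X_def if_distrib[of "\<lambda>a. a * _"] power2_eq_square cong: if_cong)
  moreover have "\<bar>(v - w0) \<bullet> Z\<bar> \<le> \<rho> * X"
    using Cauchy_Schwarz_ineq2[of "v - w0" Z] mult_right_mono[OF v X] unfolding Z by linarith
  moreover have "v \<bullet> Z = w0 \<bullet> Z + (v - w0) \<bullet> Z"
    by (simp add: inner_diff_left)
  ultimately have "(1 - \<rho>) * X \<le> v \<bullet> Z"
    by (simp add: left_diff_distrib)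
  then show ?thesis
    by (simp add: inner X_def)
qed

text \<open>The factor of |t| times the sum of all |xi_j| in the lower-order terms of
  \<open>pointwise_energy\<close>: K once for each row from the product rule error, and a bound of
  the drift.\<close>

definition M :: real where
  "M = real CARD('n) * K + (norm (w0 :: 'n coeff) + \<rho>)"

text \<open>The price of completing the square when half of the ellipticity absorbs the lower-order
  terms.\<close>

definition C :: real where
  "C = M\<^sup>2 * real CARD('n) / (2 * (1 - \<rho>))"

text \<open>To be read with t = r, \<open>\<xi> i\<close> the i-th derivative of r, and
  \<open>P i j\<close> the i-th derivative of r times the (i, j) entry of the coefficients; the
  product rule error is the hypothesis on P. Young's inequality absorbs everything linear in xi into
  half of the elliptic term.\<close>

lemma pointwise_energy:
  fixes v :: "'n coeff" and \<xi> :: "'n \<Rightarrow> real" and P :: "'n \<Rightarrow> 'n \<Rightarrow> real"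
  assumes v: "norm (v - w0) \<le> \<rho>" and P: "\<And>i j. \<bar>P i j - fst v $ i $ j * \<xi> i\<bar> \<le> K * \<bar>t\<bar>"
  shows "(1 - \<rho>) / 2 * (\<Sum>i\<in>UNIV. (\<xi> i)\<^sup>2) - C * t\<^sup>2
    \<le> (\<Sum>i\<in>UNIV. \<Sum>j\<in>UNIV. P i j * \<xi> j) - (\<Sum>i\<in>UNIV. snd v $ i * t * \<xi> i)"
proof -
  define X where "X = (\<Sum>i\<in>UNIV. (\<xi> i)\<^sup>2)"
  define Y where "Y = (\<Sum>i\<in>UNIV. \<bar>\<xi> i\<bar>)"
  define B where "B = norm (w0 :: 'n coeff) + \<rho>"
  define n where "n = real CARD('n)"
  have n: "n > 0"
    by (simp add: n_def)
  have Y2: "Y\<^sup>2 \<le> n * X"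
    using sum_squared_le_sum_of_squares[of "\<lambda>i. \<bar>\<xi> i\<bar>" UNIV] by (simp add: X_def Y_def n_def mult.commute)
  have "(\<Sum>i\<in>UNIV. \<Sum>j\<in>UNIV. fst v $ i $ j * \<xi> i * \<xi> j) - (\<Sum>i\<in>UNIV. \<Sum>j\<in>UNIV. P i j * \<xi> j)
      = (\<Sum>i\<in>UNIV. \<Sum>j\<in>UNIV. (fst v $ i $ j * \<xi> i - P i j) * \<xi> j)"
    by (simp add: left_diff_distrib sum_subtractf)
  also have "\<dots> \<le> (\<Sum>i\<in>(UNIV :: 'n set). \<Sum>j\<in>UNIV. (K * \<bar>t\<bar>) * \<bar>\<xi> j\<bar>)"
  proof (intro sum_mono)
    fix i j
    have "(fst v $ i $ j * \<xi> i - P i j) * \<xi> j \<le> \<bar>fst v $ i $ j * \<xi> i - P i j\<bar> * \<bar>\<xi> j\<bar>"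
      by (metis abs_ge_self abs_mult)
    also have "\<dots> \<le> (K * \<bar>t\<bar>) * \<bar>\<xi> j\<bar>"
      using P[of i j] by (intro mult_right_mono) (auto simp: abs_minus_commute)
    finally show "(fst v $ i $ j * \<xi> i - P i j) * \<xi> j \<le> (K * \<bar>t\<bar>) * \<bar>\<xi> j\<bar>" .
  qed
  also have "\<dots> = n * K * \<bar>t\<bar> * Y"
    by (simp add: n_def Y_def sum_distrib_left mult.assoc)
  finally have 1: "(\<Sum>i\<in>UNIV. \<Sum>j\<in>UNIV. fst v $ i $ j * \<xi> i * \<xi> j) - (\<Sum>i\<in>UNIV. \<Sum>j\<in>UNIV. P i j * \<xi> j) \<le> n * K * \<bar>t\<bar> * Y" .
  have "\<bar>snd v $ i\<bar> \<le> B" for i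
  proof -
    have "\<bar>snd v $ i\<bar> \<le> norm v"
      using Finite_Cartesian_Product.norm_nth_le[of "snd v" i] norm_snd_le[of "snd v" "fst v"] by (auto intro: order_trans)
    also have "\<dots> \<le> B"
      using norm_triangle_ineq[of "v - w0" w0] v by (simp add: B_def)
    finally show ?thesis .
  qed
  note b = this
  have 2: "(\<Sum>i\<in>UNIV. snd v $ i * t * \<xi> i) \<le> (\<Sum>i\<in>UNIV. B * \<bar>t\<bar> * \<bar>\<xi> i\<bar>)"
  proof (intro sum_mono)
    fix i
    have "snd v $ i * t * \<xi> i \<le> \<bar>snd v $ i\<bar> * \<bar>t\<bar> * \<bar>\<xi> i\<bar>"
      by (metis abs_ge_self abs_mult)
    also have "\<dots> \<le> B * \<bar>t\<bar> * \<bar>\<xi> i\<bar>"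
      by (intro mult_right_mono b) auto
    finally show "snd v $ i * t * \<xi> i \<le> B * \<bar>t\<bar> * \<bar>\<xi> i\<bar>" .
  qed
  also have "(\<Sum>i\<in>UNIV. B * \<bar>t\<bar> * \<bar>\<xi> i\<bar>) = B * \<bar>t\<bar> * Y"
    by (simp add: Y_def sum_distrib_left)
  finally have 2: "(\<Sum>i\<in>UNIV. snd v $ i * t * \<xi> i) \<le> B * \<bar>t\<bar> * Y" .
  have 3: "(1 - \<rho>) * X \<le> (\<Sum>i\<in>UNIV. \<Sum>j\<in>UNIV. fst v $ i $ j * \<xi> i * \<xi> j)"
    unfolding X_def by (rule elliptic[OF v])
  \<comment> \<open>Since Y^2 \<le> n X, this choice makes \<delta> Y^2 at most half of the elliptic
    term (1 - \<rho>) X, and M^2 / (4 \<delta>) equal to \<open>C\<close>.\<close>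
  define \<delta> where "\<delta> = (1 - \<rho>) / (2 * n)"
  have \<delta>: "\<delta> > 0"
    using rho_less_1 n by (simp add: \<delta>_def)
  have "0 \<le> (2 * \<delta> * Y - M * \<bar>t\<bar>)\<^sup>2 / (4 * \<delta>)"
    using \<delta> by simp
  also have "\<dots> = \<delta> * Y\<^sup>2 - M * \<bar>t\<bar> * Y + M\<^sup>2 * t\<^sup>2 / (4 * \<delta>)"
    using \<delta> by (simp add: power2_diff power_mult_distrib field_simps) (simp add: power2_eq_square)
  also have "M\<^sup>2 * t\<^sup>2 / (4 * \<delta>) = C * t\<^sup>2"
    using n rho_less_1 by (simp add: C_def \<delta>_def field_simps flip: n_def)
  also have "\<delta> * Y\<^sup>2 \<le> (1 - \<rho>) / 2 * X"
    using mult_left_mono[OF Y2, of \<delta>] \<delta> n by (simp add: \<delta>_def)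
  finally have "M * \<bar>t\<bar> * Y \<le> (1 - \<rho>) / 2 * X + C * t\<^sup>2"
    by simp
  moreover have "M * \<bar>t\<bar> * Y = n * K * \<bar>t\<bar> * Y + B * \<bar>t\<bar> * Y"
    by (simp add: M_def B_def n_def distrib_right)
  moreover have "(1 - \<rho>) * X = (1 - \<rho>) / 2 * X + (1 - \<rho>) / 2 * X"
    by simp
  ultimately show ?thesis
    using 1 2 3 unfolding X_def[symmetric] by linarith
qed

lemma H1_sg:
  assumes e: "e > 0"
  shows "H1 (\<lambda>x. sg e (r x))"
proof -
  have m: "(\<lambda>x. sg e (f x)) \<in> borel_measurable lebesgue" if "f \<in> borel_measurable lebesgue" for f :: "real ^ 'n \<Rightarrow> real"
    unfolding sg_def using that by measurable
  have L: "(\<lambda>x. sg e (r x)) \<in> L2p"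
    by (rule L2p_bounded[of _ 1])
      (use L2pD[OF r_L2p] sg_bound[OF e] in \<open>auto intro: m periodic_ae_comp\<close>)
  obtain C where C: "C \<ge> 0" "\<And>h. nrm (\<lambda>x. r (x + h) - r x) \<le> C * norm h"
    using H1_r by (auto simp: H1_def)
  have "nrm (\<lambda>x. sg e (r (x + h)) - sg e (r x)) \<le> (C / e) * norm h" for h
  proof -
    note d = L2pD[OF L2p_diff[OF L2p_shift(1)[OF L, of h] L]]
    have "nrm (\<lambda>x. sg e (r (x + h)) - sg e (r x)) \<le> (1 / e) * nrm (\<lambda>x. r (x + h) - r x)"
      by (rule nrm_bound[OF L2p_diff[OF L2p_shift(1)[OF r_L2p] r_L2p] d(1,2)])
        (use sg_lipschitz[OF e] e in auto)
    also have "\<dots> \<le> (1 / e) * (C * norm h)"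
      using e by (intro mult_left_mono C) auto
    finally show ?thesis by simp
  qed
  then show ?thesis
    unfolding H1_def using L C(1) e by (intro conjI exI[of _ "C / e"]) auto
qed

text \<open>The divergence form is tested with \<open>sg e\<close> of r, so E has integral 0. By the
  chain rule the derivatives of s are \<sigma> = \<open>sg' e (r x)\<close> times those of r.
  Multiplying \<open>pointwise_energy\<close> by \<sigma> bounds \<sigma> |grad r|^2, and the second
  factor \<sigma> in |grad s|^2 is at most 1/e.\<close>

lemma energy_bound:
  assumes e: "e > 0"
  shows "(\<Sum>i\<in>UNIV. (nrm (Dop i (\<lambda>x. sg e (r x))))\<^sup>2) \<le> 2 * C / (1 - \<rho>) * (LINT x|Q. sg' e (r x) * (r x)\<^sup>2 / e)"
proof -
  define s where "s = (\<lambda>x. sg e (r x))"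
  have s: "H1 s"
    unfolding s_def by (rule H1_sg[OF e])
  let ?p = "\<lambda>i j x. fst (w x) $ i $ j * r x"
  define E where "E x = (\<Sum>i\<in>UNIV. \<Sum>j\<in>UNIV. Dop i (?p i j) x * Dop j s x) - (\<Sum>i\<in>UNIV. (snd (w x) $ i * r x) * Dop i s x)" for x
  note pL = H1_derivative(1)[OF H1_p] and sL = H1_derivative(1)[OF s] and bL = w_mult_L2p(2)[OF r_L2p]
  note int = L2p_mult_integrable(3)
  have Eint: "integrable Q E"
    unfolding E_def by (intro Bochner_Integration.integrable_diff Bochner_Integration.integrable_sum int pL sL bL)
  have E0: "(LINT x|Q. E x) = 0"
    unfolding E_def using int[OF pL sL] int[OF bL sL] flux_identity[OF s] by simp
  define G where "G x = sg' e (r x) * (r x)\<^sup>2 / e" for x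
  have Gm: "G \<in> borel_measurable Q"
    unfolding G_def sg'_def using L2pD(4)[OF r_L2p] by measurable
  have Gint: "integrable Q G"
    unfolding G_def using sg'_scaled_norm[OF e] by (intro Q.integrable_const_bound[OF _ Gm[unfolded G_def], of 1] AE_I2)
  have chain: "AE x in Q. \<forall>i\<in>UNIV. Dop i s x = sg' e (r x) * Dop i r x"
    unfolding s_def by (intro AE_finite_allI H1_chain[OF H1_r H1_sg[OF e] sg_derivative[OF e]]) auto
  have prod: "AE x in Q. \<forall>i\<in>UNIV. \<forall>j\<in>UNIV. \<bar>Dop i (?p i j) x - fst (w x) $ i $ j * Dop i r x\<bar> \<le> K * \<bar>r x\<bar>"
    by (intro AE_finite_allI H1_product_near[OF H1_r H1_p] lip_components) auto
  have "AE x in Q. (\<Sum>i\<in>UNIV. (Dop i s x)\<^sup>2) \<le> 2 / (1 - \<rho>) / e * E x + 2 * C / (1 - \<rho>) * G x"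
    using chain prod AE_lebesgue_Q[OF w_near]
  proof eventually_elim
    case (elim x)
    define \<sigma> where "\<sigma> = sg' e (r x)"
    have \<sigma>: "0 \<le> \<sigma>" "\<sigma> \<le> 1 / e"
      using sg'_bounds[OF e] by (simp_all add: \<sigma>_def)
    define X where "X = (\<Sum>i\<in>UNIV. (Dop i r x)\<^sup>2)"
    have X: "0 \<le> X"
      by (simp add: X_def sum_nonneg)
    have "E x = \<sigma> * ((\<Sum>i\<in>UNIV. \<Sum>j\<in>UNIV. Dop i (?p i j) x * Dop j r x) - (\<Sum>i\<in>UNIV. snd (w x) $ i * r x * Dop i r x))"
      using elim(1) by (simp add: E_def \<sigma>_def right_diff_distrib sum_distrib_left mult_ac)
    moreover have "(1 - \<rho>) / 2 * X - C * (r x)\<^sup>2 \<le> (\<Sum>i\<in>UNIV. \<Sum>j\<in>UNIV. Dop i (?p i j) x * Dop j r x) - (\<Sum>i\<in>UNIV. snd (w x) $ i * r x * Dop i r x)"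
      unfolding X_def using elim(2,3) by (intro pointwise_energy) auto
    ultimately have "\<sigma> * ((1 - \<rho>) / 2 * X - C * (r x)\<^sup>2) \<le> E x"
      using \<sigma>(1) by (simp add: mult_left_mono)
    then have "(1 - \<rho>) / 2 * (\<sigma> * X) \<le> E x + C * (\<sigma> * (r x)\<^sup>2)"
      by (simp add: algebra_simps)
    then have "\<sigma> * X \<le> 2 / (1 - \<rho>) * (E x + C * (\<sigma> * (r x)\<^sup>2))"
      using rho_less_1 by (simp add: field_simps)
    then have *: "1 / e * (\<sigma> * X) \<le> 1 / e * (2 / (1 - \<rho>) * (E x + C * (\<sigma> * (r x)\<^sup>2)))"
      using e by (intro mult_left_mono) auto
    have "(\<Sum>i\<in>UNIV. (Dop i s x)\<^sup>2) = \<sigma> * (\<sigma> * X)"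
      using elim(1) by (simp add: \<sigma>_def X_def sum_distrib_left power2_eq_square mult_ac)
    also have "\<dots> \<le> 1 / e * (\<sigma> * X)"
      using \<sigma> X by (intro mult_right_mono) auto
    also note *
    also have "1 / e * (2 / (1 - \<rho>) * (E x + C * (\<sigma> * (r x)\<^sup>2))) = 2 / (1 - \<rho>) / e * E x + 2 * C / (1 - \<rho>) * G x"
      by (simp add: G_def \<sigma>_def distrib_left add_divide_distrib mult_ac)
    finally show ?case .
  qed
  then have "(LINT x|Q. (\<Sum>i\<in>UNIV. (Dop i s x)\<^sup>2)) \<le> (LINT x|Q. 2 / (1 - \<rho>) / e * E x + 2 * C / (1 - \<rho>) * G x)"
    using L2pD(3)[OF sL] Eint Gint
    by (intro integral_mono_AE Bochner_Integration.integrable_add Bochner_Integration.integrable_sum integrable_mult_right) auto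
  also have "\<dots> = 2 * C / (1 - \<rho>) * (LINT x|Q. G x)"
    using Eint Gint E0 by simp
  also have "(LINT x|Q. (\<Sum>i\<in>UNIV. (Dop i s x)\<^sup>2)) = (\<Sum>i\<in>UNIV. (nrm (Dop i s))\<^sup>2)"
    using L2pD(3)[OF sL] by (simp add: nrm_power2)
  finally show ?thesis
    by (simp add: s_def G_def)
qed

text \<open>sgn r is not known to be in \<open>H1\<close>, so Poincare's inequality is applied to
  the approximations \<open>s n\<close>. Their oscillation tends to 0, and their L2 convergence
  carries this over to sgn r, which thus equals its mean c.\<close>

theorem density_nonneg: "AE x in lebesgue. 0 \<le> r x"
proof -
  define e :: "nat \<Rightarrow> real" where "e n = inverse (real (Suc n))" for n
  have e: "e \<longlonglongrightarrow> 0" "\<And>n. e n > 0"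
    unfolding e_def using LIMSEQ_inverse_real_of_nat by auto
  define s where "s n x = sg (e n) (r x)" for n x
  define g where "g x = sgn (r x)" for x
  define c where "c = (LINT x|Q. g x)"
  have sH: "H1 (s n)" for n
    unfolding s_def[abs_def] by (rule H1_sg[OF e(2)])
  then have sL: "s n \<in> L2p" for n
    by (simp add: H1_def)
  have rm: "r \<in> borel_measurable lebesgue"
    by (rule L2pD(1)[OF r_L2p])
  have gL: "g \<in> L2p"
  proof (rule L2p_bounded[of _ 1])
    show "g \<in> borel_measurable lebesgue"
      unfolding g_def sgn_real_def using rm by measurable
    show "periodic_ae g"
      unfolding g_def[abs_def] by (rule periodic_ae_comp[OF L2pD(2)[OF r_L2p]])
  qed (simp add: g_def sgn_real_def)
  have sg: "(\<lambda>n. nrm (\<lambda>x. s n x - g x)) \<longlonglongrightarrow> 0"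
  proof -
    have "(\<lambda>n. LINT x|Q. (norm (s n x - g x))\<^sup>2) \<longlonglongrightarrow> (LINT x|(Q :: (real ^ 'n) measure). 0)"
    proof (rule integral_dominated_convergence[where w = "\<lambda>_. 4"])
      show "AE x in Q. (\<lambda>n. (norm (s n x - g x))\<^sup>2) \<longlonglongrightarrow> 0"
      proof (intro AE_I2)
        fix x
        have "(\<lambda>n. (norm (s n x - g x))\<^sup>2) \<longlonglongrightarrow> (norm (sgn (r x) - g x))\<^sup>2"
          unfolding s_def by (intro tendsto_intros sg_tendsto e)
        then show "(\<lambda>n. (norm (s n x - g x))\<^sup>2) \<longlonglongrightarrow> 0"
          by (simp add: g_def)
      qed
      show "AE x in Q. norm ((norm (s n x - g x))\<^sup>2) \<le> 4" for n
      proof (intro AE_I2)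
        fix x
        have "\<bar>s n x\<bar> \<le> 1" "\<bar>g x\<bar> \<le> 1"
          using sg_bound[OF e(2)] by (auto simp: s_def g_def sgn_real_def)
        then have "\<bar>s n x - g x\<bar> \<le> 2"
          by linarith
        then have "\<bar>s n x - g x\<bar>\<^sup>2 \<le> 2\<^sup>2"
          by (intro power_mono) auto
        then show "norm ((norm (s n x - g x))\<^sup>2) \<le> 4"
          by simp
      qed
    qed (use L2pD(4)[OF gL] L2pD(4)[OF sL] in measurable)
    then have "(\<lambda>n. sqrt (LINT x|Q. (norm (s n x - g x))\<^sup>2)) \<longlonglongrightarrow> sqrt 0"
      by (intro tendsto_real_sqrt) simp
    then show ?thesis
      by (simp add: nrm_def)
  qed
  have osc: "(\<lambda>n. nrm (\<lambda>x. s n x - (LINT x|Q. s n x))) \<longlonglongrightarrow> 0"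
  proof -
    have "(\<lambda>n. LINT x|Q. sg' (e n) (r x) * (r x)\<^sup>2 / e n) \<longlonglongrightarrow> (LINT x|(Q :: (real ^ 'n) measure). 0)"
    proof (rule integral_dominated_convergence[where w = "\<lambda>_. 1"])
      show "AE x in Q. (\<lambda>n. sg' (e n) (r x) * (r x)\<^sup>2 / e n) \<longlonglongrightarrow> 0"
        by (intro AE_I2 sg_tendsto e)
      show "AE x in Q. norm (sg' (e n) (r x) * (r x)\<^sup>2 / e n) \<le> 1" for n
        by (intro AE_I2 sg'_scaled_norm e)
      show "(\<lambda>x. sg' (e n) (r x) * (r x)\<^sup>2 / e n) \<in> borel_measurable Q" for n
        unfolding sg'_def using L2pD(4)[OF r_L2p] by measurable
    qed simp_all
    then have "(\<lambda>n. 2 * C / (1 - \<rho>) * (LINT x|Q. sg' (e n) (r x) * (r x)\<^sup>2 / e n)) \<longlonglongrightarrow> 2 * C / (1 - \<rho>) * 0"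
      by (intro tendsto_mult_left) simp
    then have lim: "(\<lambda>n. sqrt (2 * C / (1 - \<rho>) * (LINT x|Q. sg' (e n) (r x) * (r x)\<^sup>2 / e n))) \<longlonglongrightarrow> sqrt (2 * C / (1 - \<rho>) * 0)"
      by (rule tendsto_real_sqrt)
    show ?thesis
    proof (rule Lim_null_comparison[OF _ lim[unfolded mult_zero_right real_sqrt_zero]], intro always_eventually allI)
      fix n
      have "(nrm (\<lambda>x. s n x - (LINT x|Q. s n x)))\<^sup>2 \<le> 2 * C / (1 - \<rho>) * (LINT x|Q. sg' (e n) (r x) * (r x)\<^sup>2 / e n)"
        using poincare[OF sH[of n]] energy_bound[OF e(2)[of n]] unfolding s_def by (rule order_trans)
      then have "sqrt ((nrm (\<lambda>x. s n x - (LINT x|Q. s n x)))\<^sup>2) \<le> sqrt (2 * C / (1 - \<rho>) * (LINT x|Q. sg' (e n) (r x) * (r x)\<^sup>2 / e n))"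
        by (rule real_sqrt_le_mono)
      then show "norm (nrm (\<lambda>x. s n x - (LINT x|Q. s n x))) \<le> sqrt (2 * C / (1 - \<rho>) * (LINT x|Q. sg' (e n) (r x) * (r x)\<^sup>2 / e n))"
        by simp
    qed
  qed
  have mean: "\<bar>(LINT x|Q. s n x) - c\<bar> \<le> nrm (\<lambda>x. s n x - g x)" for n
  proof -
    have "(LINT x|Q. s n x) - c = (LINT x|Q. (s n x - g x))"
      using L2p_integrable[OF sL] L2p_integrable[OF gL] by (simp add: c_def)
    also have "\<bar>\<dots>\<bar> \<le> (LINT x|Q. norm (s n x - g x))"
      using integral_norm_bound[of Q "\<lambda>x. s n x - g x"] by simp
    also have "\<dots> \<le> nrm (\<lambda>x. s n x - g x)"
      by (rule integral_norm_le_nrm[OF L2p_diff[OF sL gL]])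
    finally show ?thesis .
  qed
  have nc: "nrm (\<lambda>x. a - b) = \<bar>a - b\<bar>" for a b :: real
    by (simp add: nrm_def)
  have "nrm (\<lambda>x. g x - c) \<le> nrm (\<lambda>x. s n x - g x) + nrm (\<lambda>x. s n x - (LINT x|Q. s n x)) + nrm (\<lambda>x. s n x - g x)" for n
  proof -
    have "nrm (\<lambda>x. g x - c) \<le> nrm (\<lambda>x. g x - s n x) + nrm (\<lambda>x. s n x - c)"
      by (rule nrm_triangle_diff[OF gL sL L2p_const])
    moreover have "nrm (\<lambda>x. s n x - c) \<le> nrm (\<lambda>x. s n x - (LINT x|Q. s n x)) + nrm (\<lambda>x :: real ^ 'n. (LINT x|Q. s n x) - c)"
      by (rule nrm_triangle_diff[OF sL L2p_const L2p_const])
    ultimately show ?thesis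
      using mean[of n] nrm_minus_commute[of g "s n"] unfolding nc by linarith
  qed
  moreover have "(\<lambda>n. nrm (\<lambda>x. s n x - g x) + nrm (\<lambda>x. s n x - (LINT x|Q. s n x)) + nrm (\<lambda>x. s n x - g x)) \<longlonglongrightarrow> 0 + 0 + 0"
    by (intro tendsto_add sg osc)
  ultimately have "nrm (\<lambda>x. g x - c) \<le> 0 + 0 + 0"
    by (intro LIMSEQ_le_const) auto
  then have "nrm (\<lambda>x. g x - c) = 0"
    using nrm_nonneg[of "\<lambda>x. g x - c"] by linarith
  then have const: "AE x in lebesgue. sgn (r x) = c"
    using nrm_eq_0_iff[OF L2p_diff[OF gL L2p_const]] by (simp add: g_def)
  show ?thesis
  proof (cases "c > 0")
    case True
    from const show ?thesis
      by eventually_elim (use True in \<open>auto simp: sgn_real_def split: if_splits\<close>)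
  next
    case False
    have "AE x in Q. r x \<le> 0"
      using AE_lebesgue_Q[OF const] by eventually_elim (use False in \<open>auto simp: sgn_real_def split: if_splits\<close>)
    then have "(LINT x|Q. r x) \<le> 0"
      using integral_nonneg_AE[of "\<lambda>x. - r x" Q] by simp
    with r_mean show ?thesis
      by simp
  qed
qed

end

subsection \<open>Lipschitz approximation of the coefficients\<close>

lemma norm_ek_diff: "cmod (ek k x - ek k y) \<le> 2 * pi * norm k * norm (x - y)"
proof -
  have "ek k x = ek k (x - y) * ek k y"
    using ek_shift[of k "x - y" y] by simp
  then have "ek k x - ek k y = (cis (2 * pi * (k \<bullet> (x - y))) - 1) * ek k y"
    by (simp add: ek_def left_diff_distrib)
  then have "cmod (ek k x - ek k y) = cmod (cis (2 * pi * (k \<bullet> (x - y))) - 1)"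
    by (simp add: norm_mult)
  also have "\<dots> \<le> \<bar>2 * pi * (k \<bullet> (x - y))\<bar>"
    by (rule norm_cis_minus_1_le)
  also have "\<dots> \<le> 2 * pi * (norm k * norm (x - y))"
    using Cauchy_Schwarz_ineq2[of k "x - y"] by (simp add: abs_mult)
  finally show ?thesis
    by (simp add: mult.assoc)
qed

text \<open>A truncated Fourier series is Lipschitz because each exponential is. Passing to the real
  part keeps this and does not increase the error, since u is real.\<close>

lemma trig_approximation:
  fixes u :: "real ^ 'n \<Rightarrow> real"
  assumes u: "u \<in> L2p" and e: "e > 0"
  obtains p K where "p \<in> L2p" "continuous_on UNIV p" "\<And>x m. m \<in> Zn \<Longrightarrow> p (x + m) = p x"
    "K \<ge> 0" "\<And>x y. \<bar>p x - p y\<bar> \<le> K * norm (x - y)" "nrm (\<lambda>x. u x - p x) \<le> e"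
proof -
  let ?f = "\<lambda>x. complex_of_real (u x)"
  have f: "?f \<in> L2p"
    by (rule L2p_of_real[OF u])
  obtain F where F: "finite F" "F \<subseteq> Zn" "dist (\<Sum>k\<in>F. (cmod (fc ?f k))\<^sup>2) ((nrm ?f)\<^sup>2) \<le> e\<^sup>2"
    using has_sum_finite_approximation[OF parseval[OF f], of "e\<^sup>2"] e by auto
  define q where "q x = (\<Sum>k\<in>F. fc ?f k * ek k x)" for x
  define p where "p x = Re (q x)" for x
  define K where "K = (\<Sum>k\<in>F. cmod (fc ?f k) * (2 * pi * norm k))"
  have q: "q \<in> L2p"
    unfolding q_def[abs_def] by (rule L2p_ek_sum[OF F(2)])
  have cont: "continuous_on UNIV p"
    unfolding p_def q_def by (intro continuous_intros)
  have per: "p (x + m) = p x" if "m \<in> Zn" for x m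
    using F(2) that by (auto simp: p_def q_def ek_shift intro!: arg_cong[of _ _ Re] sum.cong)
  have K: "K \<ge> 0"
    unfolding K_def by (intro sum_nonneg) simp
  have lip: "\<bar>p x - p y\<bar> \<le> K * norm (x - y)" for x y
  proof -
    have "\<bar>p x - p y\<bar> \<le> cmod (q x - q y)"
      using abs_Re_le_cmod[of "q x - q y"] by (simp add: p_def)
    also have "q x - q y = (\<Sum>k\<in>F. fc ?f k * (ek k x - ek k y))"
      by (simp add: q_def right_diff_distrib sum_subtractf)
    also have "cmod \<dots> \<le> (\<Sum>k\<in>F. cmod (fc ?f k) * (2 * pi * norm k * norm (x - y)))"
      by (rule sum_norm_le) (simp add: norm_mult mult_left_mono norm_ek_diff)
    also have "\<dots> = K * norm (x - y)"
      by (simp add: K_def sum_distrib_right mult.assoc)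
    finally show ?thesis .
  qed
  have pL: "p \<in> L2p"
    by (rule L2p_bound(1)[OF q, of _ 1])
      (use cont per in \<open>auto simp: p_def[abs_def] abs_Re_le_cmod intro: continuous_imp_lebesgue periodic_aeI\<close>)
  have "nrm (\<lambda>x. u x - p x) \<le> 1 * nrm (\<lambda>x. ?f x - q x)"
  proof (rule nrm_bound[OF L2p_diff[OF f q]])
    show "(\<lambda>x. u x - p x) \<in> borel_measurable lebesgue" "periodic_ae (\<lambda>x. u x - p x)"
      using L2pD[OF L2p_diff[OF u pL]] by auto
    show "AE x in lebesgue. norm (u x - p x) \<le> 1 * norm (?f x - q x)"
      using abs_Re_le_cmod[of "?f _ - q _"] by (intro AE_I2) (simp add: p_def)
  qed simp
  also have "1 * nrm (\<lambda>x. ?f x - q x) \<le> e"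
  proof (rule power2_le_imp_le)
    show "(1 * nrm (\<lambda>x. ?f x - q x))\<^sup>2 \<le> e\<^sup>2"
      using F(3) unfolding q_def mult_1 nrm_minus_projection[OF F(1,2) f] dist_real_def by linarith
  qed (use e in simp)
  finally show thesis
    using that[OF pL cont per K lip] by blast
qed

lemma norm_coeff_le: "norm v \<le> (\<Sum>i\<in>UNIV. \<Sum>j\<in>UNIV. \<bar>fst v $ i $ j\<bar>) + (\<Sum>i\<in>UNIV. \<bar>snd v $ i\<bar>)" for v :: "('n :: finite) coeff"
proof -
  have "norm v \<le> norm (fst v) + norm (snd v)"
    using norm_Pair_le[of "fst v" "snd v"] by simp
  also have "norm (fst v) \<le> (\<Sum>i\<in>UNIV. norm (fst v $ i))"
    unfolding norm_vec_def[of "fst v"] by (rule L2_set_le_sum) simp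
  also have "\<dots> \<le> (\<Sum>i\<in>UNIV. \<Sum>j\<in>UNIV. \<bar>fst v $ i $ j\<bar>)"
    by (intro sum_mono norm_le_l1_cart)
  also have "norm (snd v) \<le> (\<Sum>i\<in>UNIV. \<bar>snd v $ i\<bar>)"
    by (rule norm_le_l1_cart)
  finally show ?thesis
    by simp
qed

context cordes
begin

lemma component_L2p: "(\<lambda>x. fst (w x) $ i $ j) \<in> L2p" "(\<lambda>x. snd (w x) $ i) \<in> L2p"
  using w_mult_L2p[OF L2p_const[of 1]] by simp_all

text \<open>The nearest-point map of the ball around \<open>w0\<close> preserves the Cordes bound and is
  non-expansive, so it turns trigonometric approximations into admissible ones.\<close>

lemma lipschitz_approximation:
  assumes e: "e > 0"
  obtains v K where "cordes v \<rho>" "\<And>x y. norm (v x - v y) \<le> K * norm (x - y)"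
    "nrm (\<lambda>x. norm (w x - v x)) \<le> e" "(\<lambda>x. norm (w x - v x)) \<in> L2p"
proof -
  define n where "n = real CARD('n)"
  have n: "n > 0"
    by (simp add: n_def)
  \<comment> \<open>There are n^2 matrix entries and n drift entries, each approximated up to
    d.\<close>
  define d where "d = e / (n * n + n)"
  have d: "d > 0"
    using e n by (simp add: d_def add_pos_pos)
  define good where "good u p K \<longleftrightarrow> p \<in> L2p \<and> continuous_on UNIV p \<and> (\<forall>x m. m \<in> Zn \<longrightarrow> p (x + m) = p x) \<and> K \<ge> 0 \<and>
      (\<forall>x y. \<bar>p x - p y\<bar> \<le> K * norm (x - y)) \<and> nrm (\<lambda>x. u x - p x) \<le> d" for u p :: "real ^ 'n \<Rightarrow> real" and K
  have ex: "\<exists>p K. good u p K" if "u \<in> L2p" for u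
    unfolding good_def by (rule trig_approximation[OF that d]) blast
  have "\<forall>i j. \<exists>p K. good (\<lambda>x. fst (w x) $ i $ j) p K"
    using ex[OF component_L2p(1)] by blast
  then obtain p K where "\<And>i j. good (\<lambda>x. fst (w x) $ i $ j) (p i j) (K i j)"
    by metis
  then have p: "p i j \<in> L2p" "continuous_on UNIV (p i j)" "m \<in> Zn \<Longrightarrow> p i j (x + m) = p i j x"
    "K i j \<ge> 0" "\<bar>p i j x - p i j y\<bar> \<le> K i j * norm (x - y)" "nrm (\<lambda>x. fst (w x) $ i $ j - p i j x) \<le> d" for i j x y m
    unfolding good_def by blast+
  have "\<forall>i. \<exists>p K. good (\<lambda>x. snd (w x) $ i) p K"
    using ex[OF component_L2p(2)] by blast
  then obtain q K' where "\<And>i. good (\<lambda>x. snd (w x) $ i) (q i) (K' i)"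
    by metis
  then have q: "q i \<in> L2p" "continuous_on UNIV (q i)" "m \<in> Zn \<Longrightarrow> q i (x + m) = q i x"
    "K' i \<ge> 0" "\<bar>q i x - q i y\<bar> \<le> K' i * norm (x - y)" "nrm (\<lambda>x. snd (w x) $ i - q i x) \<le> d" for i x y m
    unfolding good_def by blast+
  define P :: "real ^ 'n \<Rightarrow> 'n coeff" where "P x = ((\<chi> i j. p i j x), (\<chi> i. q i x))" for x
  define S where "S = cball (w0 :: 'n coeff) \<rho>"
  have S: "convex S" "closed S" "S \<noteq> {}"
    using rho by (auto simp: S_def)
  define v where "v x = closest_point S (P x)" for x
  define L where "L = (\<Sum>i\<in>UNIV. \<Sum>j\<in>UNIV. K i j) + (\<Sum>i\<in>UNIV. K' i)"
  have Plip: "norm (P x - P y) \<le> L * norm (x - y)" for x y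
  proof -
    have "norm (P x - P y) \<le> (\<Sum>i\<in>UNIV. \<Sum>j\<in>UNIV. \<bar>p i j x - p i j y\<bar>) + (\<Sum>i\<in>UNIV. \<bar>q i x - q i y\<bar>)"
      using norm_coeff_le[of "P x - P y"] by (simp add: P_def)
    also have "\<dots> \<le> (\<Sum>i\<in>UNIV. \<Sum>j\<in>UNIV. K i j * norm (x - y)) + (\<Sum>i\<in>UNIV. K' i * norm (x - y))"
      by (intro add_mono sum_mono p(5) q(5))
    also have "\<dots> = L * norm (x - y)"
      by (simp add: L_def distrib_right sum_distrib_right)
    finally show ?thesis .
  qed
  have vlip: "norm (v x - v y) \<le> L * norm (x - y)" for x y
    using closest_point_lipschitz[OF S, of "P x" "P y"] Plip[of x y] by (simp add: v_def dist_norm)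
  have "continuous_on UNIV P"
    unfolding P_def by (intro continuous_intros p(2) q(2))
  then have "continuous_on UNIV v"
    unfolding v_def using continuous_on_compose2[OF continuous_on_closest_point[OF S, of UNIV]] by auto
  then have vm: "v \<in> borel_measurable lebesgue"
    by (rule continuous_imp_lebesgue)
  have vper: "periodic_ae v"
    by (intro periodic_aeI AE_I2) (simp add: v_def P_def p(3) q(3))
  have vnear: "norm (v x - w0) \<le> \<rho>" for x
    using closest_point_in_set[OF S(2,3), of "P x"] by (simp add: S_def v_def dist_norm norm_minus_commute)
  have cv: "cordes v \<rho>"
    by standard (use vm vper vnear rho in auto)
  define D where "D x = (\<Sum>i\<in>UNIV. \<Sum>j\<in>UNIV. norm (fst (w x) $ i $ j - p i j x)) + (\<Sum>i\<in>UNIV. norm (snd (w x) $ i - q i x))" for x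
  have nL: "(\<lambda>x. norm (f x)) \<in> L2p" if "f \<in> L2p" for f :: "real ^ 'n \<Rightarrow> real"
    using that by (auto simp: L2p_def intro: periodic_ae_comp)
  have nn: "nrm (\<lambda>x. norm (f x)) = nrm f" for f :: "real ^ 'n \<Rightarrow> real"
    by (simp add: nrm_def)
  have comp: "(\<lambda>x. norm (fst (w x) $ i $ j - p i j x)) \<in> L2p" "(\<lambda>x. norm (snd (w x) $ i - q i x)) \<in> L2p" for i j
    by (intro nL L2p_diff component_L2p p(1) q(1))+
  have DL: "D \<in> L2p"
    unfolding D_def[abs_def] by (intro L2p_add L2p_sum comp)
  have Dn: "nrm D \<le> e"
  proof -
    have "nrm D \<le> nrm (\<lambda>x. \<Sum>i\<in>UNIV. \<Sum>j\<in>UNIV. norm (fst (w x) $ i $ j - p i j x)) + nrm (\<lambda>x. \<Sum>i\<in>UNIV. norm (snd (w x) $ i - q i x))"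
      unfolding D_def[abs_def] by (intro nrm_triangle L2p_sum comp)
    also have "nrm (\<lambda>x. \<Sum>i\<in>UNIV. \<Sum>j\<in>UNIV. norm (fst (w x) $ i $ j - p i j x)) \<le> (\<Sum>i\<in>(UNIV::'n set). nrm (\<lambda>x. \<Sum>j\<in>UNIV. norm (fst (w x) $ i $ j - p i j x)))"
      by (intro nrm_sum L2p_sum comp)
    also have "\<dots> \<le> (\<Sum>i\<in>(UNIV::'n set). \<Sum>j\<in>(UNIV::'n set). nrm (\<lambda>x. norm (fst (w x) $ i $ j - p i j x)))"
      by (intro sum_mono nrm_sum comp)
    also have "\<dots> \<le> (\<Sum>i\<in>(UNIV::'n set). \<Sum>j\<in>(UNIV::'n set). d)"
      unfolding nn by (intro sum_mono p(6))
    also have "nrm (\<lambda>x. \<Sum>i\<in>UNIV. norm (snd (w x) $ i - q i x)) \<le> (\<Sum>i\<in>(UNIV::'n set). nrm (\<lambda>x. norm (snd (w x) $ i - q i x)))"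
      by (intro nrm_sum comp)
    also have "\<dots> \<le> (\<Sum>i\<in>(UNIV::'n set). d)"
      unfolding nn by (intro sum_mono q(6))
    finally have "nrm D \<le> (n * n + n) * d"
      by (simp add: n_def algebra_simps)
    also have "\<dots> = e"
      using n add_pos_pos[OF mult_pos_pos[OF n n] n] by (simp add: d_def)
    finally show ?thesis .
  qed
  have wv: "AE x in lebesgue. norm (w x - v x) \<le> D x"
    using w_near
  proof eventually_elim
    case (elim x)
    \<comment> \<open>\<open>w x\<close> lies in the ball and is its own nearest point, so
      projecting \<open>P x\<close> does not increase the distance to \<open>w x\<close>.\<close>
    then have "closest_point S (w x) = w x"
      by (intro closest_point_self) (simp add: S_def dist_norm norm_minus_commute)
    then have "norm (w x - v x) \<le> norm (w x - P x)"
      using closest_point_lipschitz[OF S, of "w x" "P x"] by (simp add: v_def dist_norm)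
    also have "\<dots> \<le> D x"
      using norm_coeff_le[of "w x - P x"] by (simp add: P_def D_def)
    finally show ?case .
  qed
  have meas: "(\<lambda>x. norm (w x - v x)) \<in> borel_measurable lebesgue" "periodic_ae (\<lambda>x. norm (w x - v x))"
    using w_meas vm w_per vper by (auto intro: periodic_ae_comp2)
  have ae: "AE x in lebesgue. norm (norm (w x - v x)) \<le> 1 * norm (D x)"
    using wv by eventually_elim simp
  have wvL: "(\<lambda>x. norm (w x - v x)) \<in> L2p"
    by (rule L2p_bound(1)[OF DL meas ae])
  have "nrm (\<lambda>x. norm (w x - v x)) \<le> 1 * nrm D"
    by (rule nrm_bound[OF DL meas ae]) simp
  with Dn have "nrm (\<lambda>x. norm (w x - v x)) \<le> e"
    by linarith
  then show thesis
    by (rule that[OF cv vlip _ wvL])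
qed

text \<open>L2 closeness of the coefficients alone does not make the error weighted by r small.
  Errors of norm at most 2^-n give convergence almost everywhere, and the bound 2 \<rho> |r| then
  allows dominated convergence.\<close>

theorem inv_density_nonneg:
  assumes r: "inv_density w r"
  shows "AE x in lebesgue. 0 \<le> r x"
proof -
  note rL = inv_densityD(1)[OF r]
  define good where "good n v K \<longleftrightarrow> cordes v \<rho> \<and> (\<forall>x y. norm (v x - v y) \<le> K * norm (x - y)) \<and>
    nrm (\<lambda>x. norm (w x - v x)) \<le> (1/2) ^ n \<and> (\<lambda>x. norm (w x - v x)) \<in> L2p" for n :: nat and v K
  have "\<exists>v K. good n v K" for n
  proof (rule lipschitz_approximation[of "(1/2) ^ n"])
    fix v K
    assume "cordes v \<rho>" "\<And>x y. norm (v x - v y) \<le> K * norm (x - y)"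
      "nrm (\<lambda>x. norm (w x - v x)) \<le> (1/2) ^ n" "(\<lambda>x. norm (w x - v x)) \<in> L2p"
    then have "good n v K"
      by (simp add: good_def)
    then show ?thesis
      by blast
  qed simp
  then obtain v K where "\<And>n. good n (v n) (K n)"
    by metis
  then have v: "cordes (v n) \<rho>" "norm (v n x - v n y) \<le> K n * norm (x - y)"
    "nrm (\<lambda>x. norm (w x - v n x)) \<le> (1/2) ^ n" "(\<lambda>x. norm (w x - v n x)) \<in> L2p" for n x y
    unfolding good_def by blast+
  obtain s where s: "\<And>n. inv_density (v n) (s n)"
    using choice[of "\<lambda>n s. inv_density (v n) s"] cordes.inv_density_exists[OF v(1)] by blast
  have sL: "s n \<in> L2p" for n
    by (rule inv_densityD(1)[OF s])
  have pos: "AE x in lebesgue. 0 \<le> s n x" for n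
    by (rule lipschitz_cordes.density_nonneg[of "v n" \<rho> "K n"])
      (intro lipschitz_cordes.intro lipschitz_cordes_axioms.intro v s)
  have vb: "AE x in lebesgue. norm (v n x - w x) \<le> 2 * \<rho>" for n
    using w_near cordes.w_near[OF v(1)[of n]]
  proof eventually_elim
    case (elim x)
    then show ?case
      using norm_triangle_ineq4[of "v n x - w0" "w x - w0"] by simp
  qed
  have dL: "(\<lambda>x. norm (v n x - w x) * r x) \<in> L2p" for n
    by (rule diff_bounded_mult_L2p[OF cordes.w_meas[OF v(1)] cordes.w_per[OF v(1)] w_meas w_per vb rL])
  have "(\<lambda>n. nrm (\<lambda>x. norm (v n x - w x) * r x)) \<longlonglongrightarrow> 0"
  proof -
    have "AE x in Q. summable (\<lambda>n. norm (norm (w x - v n x)))"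
    proof (rule summable_nrm_AE_convergent[OF v(4)])
      have "summable (\<lambda>j. (1/2::real) ^ j)"
        by (rule summable_geometric) simp
      then show "summable (\<lambda>n. nrm (\<lambda>x. norm (w x - v n x)))"
        by (rule summable_comparison_test') (simp add: v(3))
    qed
    then have ae: "AE x in Q. (\<lambda>n. norm (v n x - w x)) \<longlonglongrightarrow> 0"
    proof eventually_elim
      case (elim x)
      from summable_LIMSEQ_zero[OF elim] show ?case
        by (simp add: norm_minus_commute)
    qed
    have "(\<lambda>n. LINT x|Q. (norm (norm (v n x - w x) * r x))\<^sup>2) \<longlonglongrightarrow> (LINT x|(Q :: (real ^ 'n) measure). 0)"
    proof (rule integral_dominated_convergence[where w = "\<lambda>x. (2 * \<rho>)\<^sup>2 * (norm (r x))\<^sup>2"])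
      show "integrable Q (\<lambda>x. (2 * \<rho>)\<^sup>2 * (norm (r x))\<^sup>2)"
        using L2pD(3)[OF rL] by simp
      show "AE x in Q. (\<lambda>n. (norm (norm (v n x - w x) * r x))\<^sup>2) \<longlonglongrightarrow> 0"
        using ae
      proof eventually_elim
        case (elim x)
        then have "(\<lambda>n. (norm (norm (v n x - w x) * r x))\<^sup>2) \<longlonglongrightarrow> (norm (0 * r x))\<^sup>2"
          by (intro tendsto_intros)
        then show ?case by simp
      qed
      show "AE x in Q. norm ((norm (norm (v n x - w x) * r x))\<^sup>2) \<le> (2 * \<rho>)\<^sup>2 * (norm (r x))\<^sup>2" for n
        using AE_lebesgue_Q[OF vb[of n]]
      proof eventually_elim
        case (elim x)
        then have "(norm (v n x - w x))\<^sup>2 \<le> (2 * \<rho>)\<^sup>2"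
          by (intro power_mono) auto
        then show ?case
          by (simp add: abs_mult power_mult_distrib mult_right_mono)
      qed
    qed (use L2pD(4)[OF dL] in measurable)
    then have "(\<lambda>n. sqrt (LINT x|Q. (norm (norm (v n x - w x) * r x))\<^sup>2)) \<longlonglongrightarrow> sqrt 0"
      by (intro tendsto_real_sqrt) simp
    then show ?thesis
      by (simp add: nrm_def)
  qed
  then have lim: "(\<lambda>n. 2 / (1 - \<kappa>) * nrm (\<lambda>x. norm (v n x - w x) * r x)) \<longlonglongrightarrow> 0"
    using tendsto_mult_left[of _ 0 sequentially "2 / (1 - \<kappa>)"] by simp
  \<comment> \<open>The negative part of r up to sign: as \<open>s n\<close> is nonnegative, its
    modulus is at most |s n - r| pointwise, hence small in norm.\<close>
  define m where "m x = min 0 (r x)" for x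
  have mL: "m \<in> L2p"
    using L2pD[OF rL] by (intro L2p_bound(1)[OF rL, of _ 1]) (auto simp: m_def[abs_def] intro: periodic_ae_comp)
  have "nrm m \<le> 2 / (1 - \<kappa>) * nrm (\<lambda>x. norm (v n x - w x) * r x)" for n
  proof -
    have "nrm m \<le> 1 * nrm (\<lambda>x. s n x - r x)"
    proof (rule nrm_bound[OF L2p_diff[OF sL rL] L2pD(1)[OF mL] L2pD(2)[OF mL]])
      show "AE x in lebesgue. norm (m x) \<le> 1 * norm (s n x - r x)"
        using pos[of n] by eventually_elim (auto simp: m_def)
    qed simp
    also have "\<dots> \<le> 2 / (1 - \<kappa>) * nrm (\<lambda>x. norm (v n x - w x) * r x)"
      \<comment> \<open>Stability is used in the direction that puts the fixed weight r on the
        coefficient error. Its constant does not depend on n, because all approximations share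
        \<rho>.\<close>
      using cordes.stability[OF v(1) cordes_axioms s r, of n] kappa(2) by (simp add: field_simps)
    finally show ?thesis .
  qed
  then have "nrm m \<le> 0"
    by (intro LIMSEQ_le_const[OF lim]) auto
  then have "AE x in lebesgue. m x = 0"
    using nrm_eq_0_iff[OF mL] nrm_nonneg[of m] by simp
  then show ?thesis
    by eventually_elim (auto simp: m_def min_def split: if_splits)
qed

end

subsection \<open>The Cordes condition\<close>

lemma mop_cong:
  assumes "\<And>k. k \<in> Zn \<Longrightarrow> m k * rc f k = m k * rc g k"
  shows "mop m f = mop m g"
proof -
  have "(\<lambda>h. h \<in> L2p \<and> (\<forall>k\<in>Zn. rc h k = m k * rc f k)) = (\<lambda>h. h \<in> L2p \<and> (\<forall>k\<in>Zn. rc h k = m k * rc g k))"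
    by (intro ext conj_cong refl ball_cong) (simp only: assms)
  then show ?thesis
    unfolding mop_def by (simp only:)
qed

text \<open>Equal coefficients make every multiplier operator choose the same function, so T acts on
  classes modulo null sets.\<close>

lemma Tw_cong_AE:
  assumes "AE x in lebesgue. f x = g x" "f \<in> L2p" "g \<in> L2p"
  shows "Tw w f = Tw w g"
proof -
  have "rc f k = rc g k" for k
    by (intro rc_cong_AE assms L2pD)
  then have "mop m f = mop m g" for m
    by (intro mop_cong) simp
  then show ?thesis
    by (simp add: Tw_def DD_def fun_eq_iff)
qed

text \<open>All symbols in \<open>DD\<close> vanish at 0, the only frequency at which subtracting a
  constant changes a coefficient.\<close>

lemma Tw_minus_const:
  assumes "f \<in> L2p"
  shows "Tw w (\<lambda>x. f x - c) = Tw w f"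
proof -
  have "rc (\<lambda>x. f x - c) k = rc f k" if "k \<in> Zn" "k \<noteq> 0" for k
    using that by (simp add: rc_diff[OF assms L2p_const] rc_const)
  then have "m k * rc (\<lambda>x. f x - c) k = m k * rc f k" if "m 0 = 0" "k \<in> Zn" for m k
    using that by (cases "k = 0") auto
  then have "mop m (\<lambda>x. f x - c) = mop m f" if "m 0 = 0" for m
    using that by (intro mop_cong)
  then have "mop (Rm i j) (\<lambda>x. f x - c) = mop (Rm i j) f" "mop (Sm i) (\<lambda>x. f x - c) = mop (Sm i) f" for i j
    by (simp_all add: Rm_def Sm_def)
  then show ?thesis
    by (simp add: Tw_def DD_def fun_eq_iff)
qed

text \<open>The bridge from the Sobolev formulation to T: derivatives are rewritten as multipliers
  of the Laplacian, the coefficients are untouched.\<close>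

lemma nondiv_op_eq_Tw:
  fixes A :: "real ^ 'n \<Rightarrow> real ^ 'n ^ 'n"
  assumes \<phi>: "\<phi> \<in> H_per 2"
  shows "AE x in lebesgue. nondiv_op A b \<phi> x = Tw (\<lambda>x. (A x, b x)) (weak_laplacian \<phi>) x"
proof -
  have "AE x in lebesgue. \<forall>i\<in>UNIV. \<forall>j\<in>UNIV. weak_pderiv i (weak_pderiv j \<phi>) x = mop (Rm i j) (weak_laplacian \<phi>) x"
    by (intro AE_finite_allI H_per_2_via_laplacian[OF \<phi>]) auto
  moreover have "AE x in lebesgue. \<forall>i\<in>UNIV. weak_pderiv i \<phi> x = mop (Sm i) (weak_laplacian \<phi>) x"
    by (intro AE_finite_allI H_per_2_via_laplacian[OF \<phi>]) auto
  ultimately show ?thesis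
  proof eventually_elim
    case (elim x)
    then have "weak_hess \<phi> x = (\<chi> i j. mop (Rm i j) (weak_laplacian \<phi>) x)"
      "weak_grad \<phi> x = (\<chi> i. mop (Sm i) (weak_laplacian \<phi>) x)"
      by (simp_all add: weak_hess_def weak_grad_def)
    then show ?case
      by (simp add: nondiv_op_def Tw_def DD_def inner_prod_def)
  qed
qed

section \<open>The variational problem and very weak solutions in terms of T\<close>

locale cordes_pair = cordes "\<lambda>x. (A x, b x)" \<rho>
  for A :: "real ^ 'n \<Rightarrow> real ^ 'n ^ 'n" and b :: "real ^ 'n \<Rightarrow> real ^ 'n" and \<rho> :: real
begin

abbreviation w :: "real ^ 'n \<Rightarrow> 'n coeff" where "w \<equiv> \<lambda>x. (A x, b x)"

lemma nondiv_op_measurable: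
  assumes \<phi>: "\<phi> \<in> H_per 2"
  shows "nondiv_op A b \<phi> \<in> borel_measurable lebesgue"
proof (rule borel_measurable_cong_AE_lebesgue[OF L2pD(1)[OF Tw_L2p[OF weak_laplacian_L2p(1)[OF \<phi>]]]])
  show "AE x in lebesgue. Tw w (weak_laplacian \<phi>) x = nondiv_op A b \<phi> x"
    using nondiv_op_eq_Tw[OF \<phi>, of A b] by eventually_elim simp
qed

lemma integral_nondiv_op:
  assumes u: "u \<in> L2p" and \<phi>: "\<phi> \<in> H_per 2"
  shows "(LINT x|Q. u x * nondiv_op A b \<phi> x) = (LINT x|Q. u x * Tw w (weak_laplacian \<phi>) x)"
proof (rule integral_cong_AE)
  show "(\<lambda>x. u x * nondiv_op A b \<phi> x) \<in> borel_measurable Q" "(\<lambda>x. u x * Tw w (weak_laplacian \<phi>) x) \<in> borel_measurable Q"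
    using L2pD(1)[OF u] L2pD(1)[OF Tw_L2p[OF weak_laplacian_L2p(1)[OF \<phi>]]] nondiv_op_measurable[OF \<phi>]
    by (auto intro!: measurable_Q)
  show "AE x in Q. u x * nondiv_op A b \<phi> x = u x * Tw w (weak_laplacian \<phi>) x"
    using AE_lebesgue_Q[OF nondiv_op_eq_Tw[OF \<phi>, of A b]] by eventually_elim simp
qed

text \<open>By solvability of Poisson's equation the Laplacians exhaust \<open>L0\<close>, but only
  up to null sets; hence the invariance asked of P. The solution can be taken with mean zero, so
  both Sobolev spaces give the same condition.\<close>

lemma all_H_per_iff:
  assumes P: "\<And>f g. f \<in> L2p \<Longrightarrow> g \<in> L2p \<Longrightarrow> (AE x in lebesgue. f x = g x) \<Longrightarrow> P f \<Longrightarrow> P g"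
  shows "(\<forall>\<phi>\<in>H_per 2. P (weak_laplacian \<phi>)) \<longleftrightarrow> (\<forall>g\<in>L0. P g)"
    "(\<forall>\<phi>\<in>H_per0 2. P (weak_laplacian \<phi>)) \<longleftrightarrow> (\<forall>g\<in>L0. P g)"
proof -
  have sub: "H_per0 2 \<subseteq> H_per 2"
    by (auto simp: H_per0_def)
  have 1: "P g" if H: "\<forall>\<phi>\<in>H_per0 2. P (weak_laplacian \<phi>)" and g: "g \<in> L0" for g
  proof (rule P)
    show "P (weak_laplacian (mop Gm g))"
      using H poisson(1)[OF g] by blast
    show "weak_laplacian (mop Gm g) \<in> L2p"
      using poisson(1)[OF g] sub by (intro weak_laplacian_L2p) auto
  qed (use poisson(2)[OF g] L0D(1)[OF g] in auto)
  have 2: "P (weak_laplacian \<phi>)" if "\<forall>g\<in>L0. P g" "\<phi> \<in> H_per 2" for \<phi>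
    using that weak_laplacian_L0 by blast
  show "(\<forall>\<phi>\<in>H_per 2. P (weak_laplacian \<phi>)) \<longleftrightarrow> (\<forall>g\<in>L0. P g)"
    "(\<forall>\<phi>\<in>H_per0 2. P (weak_laplacian \<phi>)) \<longleftrightarrow> (\<forall>g\<in>L0. P g)"
    using 1 2 sub by blast+
qed

lemma psi_solutions_iff:
  "\<psi> \<in> psi_solutions A b c \<longleftrightarrow> \<psi> \<in> H_per0 2 \<and>
     (\<forall>g\<in>L0. (LINT x|Q. weak_laplacian \<psi> x * Tw w g x) = c * (LINT x|Q. Tw w g x))"
proof -
  have "form_B1 A b \<psi> \<phi> = (LINT x|Q. weak_laplacian \<psi> x * Tw w (weak_laplacian \<phi>) x)"
    "(LINT x:cellY|lebesgue. nondiv_op A b \<phi> x) = (LINT x|Q. Tw w (weak_laplacian \<phi>) x)"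
    if "\<psi> \<in> H_per0 2" "\<phi> \<in> H_per0 2" for \<phi>
  proof -
    have H: "\<psi> \<in> H_per 2" "\<phi> \<in> H_per 2"
      using that by (auto simp: H_per0_def)
    show "form_B1 A b \<psi> \<phi> = (LINT x|Q. weak_laplacian \<psi> x * Tw w (weak_laplacian \<phi>) x)"
      unfolding form_B1_def set_lebesgue_integral_Q by (rule integral_nondiv_op[OF weak_laplacian_L2p(1)[OF H(1)] H(2)])
    show "(LINT x:cellY|lebesgue. nondiv_op A b \<phi> x) = (LINT x|Q. Tw w (weak_laplacian \<phi>) x)"
      unfolding set_lebesgue_integral_Q using integral_nondiv_op[OF L2p_const[of 1] H(2)] by simp
  qed
  moreover have "(\<forall>\<phi>\<in>H_per0 2. (LINT x|Q. weak_laplacian \<psi> x * Tw w (weak_laplacian \<phi>) x) = c * (LINT x|Q. Tw w (weak_laplacian \<phi>) x))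
    \<longleftrightarrow> (\<forall>g\<in>L0. (LINT x|Q. weak_laplacian \<psi> x * Tw w g x) = c * (LINT x|Q. Tw w g x))"
    by (rule all_H_per_iff(2)) (simp add: Tw_cong_AE[of _ _ w])
  ultimately show ?thesis
    unfolding psi_solutions_def by auto
qed

lemma very_weak_solutions_iff:
  "u \<in> very_weak_solutions A b \<longleftrightarrow> u \<in> L2p \<and> (\<forall>g\<in>L0. (LINT x|Q. u x * Tw w g x) = 0)"
proof -
  have "(\<forall>\<phi>\<in>H_per 2. (LINT x|Q. u x * Tw w (weak_laplacian \<phi>) x) = 0) \<longleftrightarrow> (\<forall>g\<in>L0. (LINT x|Q. u x * Tw w g x) = 0)"
    by (rule all_H_per_iff(1)) (simp add: Tw_cong_AE[of _ _ w])
  then show ?thesis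
    by (auto simp: very_weak_solutions_def L2_per_eq set_lebesgue_integral_Q integral_nondiv_op)
qed

lemma psi_solution_exists: "\<exists>\<psi>. \<psi> \<in> psi_solutions A b c"
proof -
  obtain f where f: "f \<in> L0" "\<And>g. g \<in> L2p \<Longrightarrow> (LINT x|Q. f x * Tw w g x) = c * (LINT x|Q. Tw w g x)"
    using Tw_solvable by blast
  note p = poisson[OF f(1)]
  have L: "weak_laplacian (mop Gm f) \<in> L2p"
    using p(1) by (intro weak_laplacian_L2p) (auto simp: H_per0_def)
  have "(LINT x|Q. weak_laplacian (mop Gm f) x * Tw w g x) = (LINT x|Q. f x * Tw w g x)" if "g \<in> L0" for g
  proof (rule integral_cong_AE)
    note T = Tw_L2p[OF L0D(1)[OF that]]
    show "(\<lambda>x. weak_laplacian (mop Gm f) x * Tw w g x) \<in> borel_measurable Q" "(\<lambda>x. f x * Tw w g x) \<in> borel_measurable Q"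
      by (intro measurable_Q L2p_mult_integrable(2) L T L0D(1)[OF f(1)])+
    show "AE x in Q. weak_laplacian (mop Gm f) x * Tw w g x = f x * Tw w g x"
      using AE_lebesgue_Q[OF p(2)] by eventually_elim simp
  qed
  then have "mop Gm f \<in> psi_solutions A b c"
    unfolding psi_solutions_iff using p(1) f(2) L0D(1) by auto
  then show ?thesis
    by blast
qed

text \<open>Comparison with c times a solution for 1 yields the scaling and, through it, uniqueness
  for every c. The difference of the Laplacians is orthogonal to the values of T on
  \<open>L0\<close>, hence 0 by coercivity.\<close>

lemma psi_solution_unique:
  assumes \<psi>: "\<psi> \<in> psi_solutions A b c" and \<psi>1: "\<psi>1 \<in> psi_solutions A b 1"
  shows "AE x in lebesgue. \<psi> x = c * \<psi>1 x"
proof -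
  have H: "\<psi> \<in> H_per0 2" "\<psi>1 \<in> H_per0 2"
    using assms by (auto simp: psi_solutions_iff)
  have L: "weak_laplacian \<psi> \<in> L0" "weak_laplacian \<psi>1 \<in> L0"
    using H by (auto simp: H_per0_def intro: weak_laplacian_L0)
  have cL: "(\<lambda>x. c * weak_laplacian \<psi>1 x) \<in> L0"
    using L0D[OF L(2)] by (intro L0I L2p_cmult) (simp_all add: rc_cmult)
  have "AE x in lebesgue. weak_laplacian \<psi> x - c * weak_laplacian \<psi>1 x = 0"
  proof (rule Tw_orthogonal_imp_0[OF L0_diff[OF L(1) cL]])
    fix g :: "real ^ 'n \<Rightarrow> real" assume g: "g \<in> L0"
    note T = Tw_L2p[OF L0D(1)[OF g]]
    have i: "integrable Q (\<lambda>x. weak_laplacian \<psi> x * Tw w g x)" "integrable Q (\<lambda>x. weak_laplacian \<psi>1 x * Tw w g x)"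
      by (intro L2p_mult_integrable L0D(1)[OF L(1)] L0D(1)[OF L(2)] T)+
    have "(LINT x|Q. (weak_laplacian \<psi> x - c * weak_laplacian \<psi>1 x) * Tw w g x)
      = (LINT x|Q. weak_laplacian \<psi> x * Tw w g x) - c * (LINT x|Q. weak_laplacian \<psi>1 x * Tw w g x)"
      using i by (simp add: left_diff_distrib mult.assoc)
    then show "(LINT x|Q. (weak_laplacian \<psi> x - c * weak_laplacian \<psi>1 x) * Tw w g x) = 0"
      using assms g by (simp add: psi_solutions_iff)
  qed
  then have "AE x in lebesgue. weak_laplacian \<psi> x = c * weak_laplacian \<psi>1 x"
    by eventually_elim simp
  then show ?thesis
    by (rule weak_laplacian_inject[OF H])
qed

text \<open>The equation with c = 1 says that 1 - Delta psi is orthogonal to T on \<open>L0\<close>.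
  General test functions are reduced to this case by subtracting their mean, which T does not
  see.\<close>

lemma inv_density_psi:
  assumes \<psi>: "\<psi> \<in> psi_solutions A b 1"
  shows "inv_density w (\<lambda>x. 1 - weak_laplacian \<psi> x)"
  unfolding inv_density_def
proof (intro conjI ballI)
  have L: "weak_laplacian \<psi> \<in> L0"
    using \<psi> by (auto simp: psi_solutions_iff H_per0_def intro: weak_laplacian_L0)
  show "(\<lambda>x. 1 - weak_laplacian \<psi> x) \<in> L2p"
    by (intro L2p_diff L2p_const L0D(1)[OF L])
  show "(LINT x|Q. 1 - weak_laplacian \<psi> x) = 1"
    using L2p_integrable[OF L0D(1)[OF L]] L0D(3)[OF L] by simp
  fix g :: "real ^ 'n \<Rightarrow> real" assume g: "g \<in> L2p"
  define g' where "g' = (\<lambda>x. g x - (LINT x|Q. g x))"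
  have g': "g' \<in> L0"
    unfolding g'_def L0_def using g L2p_integrable[OF g] by (simp add: L2p_diff)
  have Tg: "Tw w g' = Tw w g"
    unfolding g'_def by (rule Tw_minus_const[OF g])
  have i: "integrable Q (\<lambda>x. weak_laplacian \<psi> x * Tw w g x)" "integrable Q (Tw w g)"
    by (intro L2p_mult_integrable L0D(1)[OF L] Tw_L2p g L2p_integrable)+
  show "(LINT x|Q. (1 - weak_laplacian \<psi> x) * Tw w g x) = 0"
  proof -
    have "(LINT x|Q. weak_laplacian \<psi> x * Tw w g' x) = 1 * (LINT x|Q. Tw w g' x)"
      using \<psi> g' unfolding psi_solutions_iff by blast
    with i show ?thesis
      by (simp add: left_diff_distrib Tg)
  qed
qed

text \<open>The multiple of r with the same mean is subtracted; the difference has mean zero and is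
  orthogonal to T on \<open>L0\<close>, so coercivity makes it vanish.\<close>

lemma very_weak_solution_unique:
  assumes u: "u \<in> very_weak_solutions A b" and r: "inv_density w r"
  shows "AE x in lebesgue. u x = (LINT x|Q. u x) * r x"
proof -
  note rD = inv_densityD[OF r]
  have uL: "u \<in> L2p"
    using u by (simp add: very_weak_solutions_iff)
  let ?c = "LINT x|Q. u x"
  have L: "(\<lambda>x. u x - ?c * r x) \<in> L0"
    unfolding L0_def using uL rD L2p_integrable[OF uL] L2p_integrable[OF rD(1)]
    by (auto intro!: L2p_diff L2p_cmult)
  have "AE x in lebesgue. u x - ?c * r x = 0"
  proof (rule Tw_orthogonal_imp_0[OF L])
    fix g :: "real ^ 'n \<Rightarrow> real" assume g: "g \<in> L0"
    have i: "integrable Q (\<lambda>x. u x * Tw w g x)" "integrable Q (\<lambda>x. r x * Tw w g x)"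
      by (intro L2p_mult_integrable uL rD(1) Tw_L2p L0D(1)[OF g])+
    have "(LINT x|Q. (u x - ?c * r x) * Tw w g x) = (LINT x|Q. u x * Tw w g x) - ?c * (LINT x|Q. r x * Tw w g x)"
      using i by (simp add: left_diff_distrib mult.assoc)
    also have "\<dots> = 0"
      using u g rD(3)[OF L0D(1)[OF g]] by (simp add: very_weak_solutions_iff)
    finally show "(LINT x|Q. (u x - ?c * r x) * Tw w g x) = 0" .
  qed
  then show ?thesis
    by eventually_elim simp
qed

end

section \<open>Pointwise consequences of ellipticity and of the Cordes condition\<close>

lemma trace_eq_inner_mat: "trace M = M \<bullet> mat 1" for M :: "real ^ 'n ^ 'n"
  by (simp add: trace_def inner_vec_def mat_def if_distrib[of "\<lambda>a. _ * a"] cong: if_cong)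

lemma elliptic_diagonal:
  fixes M :: "real ^ 'n ^ 'n"
  assumes "\<forall>\<xi>. l * (\<xi> \<bullet> \<xi>) \<le> \<xi> \<bullet> (M *v \<xi>)"
  shows "l \<le> M $ i $ i"
proof -
  have "axis i 1 \<bullet> (M *v axis i 1) = M $ i $ i"
    by (simp add: inner_axis' matrix_vector_mult_basis column_def)
  with assms[rule_format, of "axis i 1"] show ?thesis
    by (simp add: inner_axis_axis)
qed

lemma elliptic_trace:
  fixes M :: "real ^ 'n ^ 'n"
  assumes "\<forall>\<xi>. l * (\<xi> \<bullet> \<xi>) \<le> \<xi> \<bullet> (M *v \<xi>)"
  shows "real CARD('n) * l \<le> trace M"
proof -
  have "(\<Sum>i\<in>(UNIV :: 'n set). l) \<le> (\<Sum>i\<in>UNIV. M $ i $ i)"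
    by (intro sum_mono elliptic_diagonal assms)
  then show ?thesis
    by (simp add: trace_def)
qed

text \<open>The renormalisation \<open>\<gamma>\<close> minimises \<open>|\<gamma> M - I|\<^sup>2 + |\<gamma> v|\<^sup>2\<close>, and the Cordes condition says that
  the minimum is at most \<open>1 - \<delta>\<close>.\<close>

lemma cordes_condition_near:
  fixes M :: "real ^ 'n ^ 'n" and v :: "real ^ 'n"
  assumes g: "g = trace M / ((norm M)\<^sup>2 + (norm v)\<^sup>2)" and tr: "trace M > 0"
    and cordes: "((norm M)\<^sup>2 + (norm v)\<^sup>2) / (trace M)\<^sup>2 \<le> 1 / (real CARD('n) - 1 + \<delta>)" and \<delta>: "\<delta> > 0"
  shows "(norm ((g *\<^sub>R M, g *\<^sub>R v) - w0))\<^sup>2 \<le> 1 - \<delta>"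
proof -
  define D where "D = (norm M)\<^sup>2 + (norm v)\<^sup>2"
  define n where "n = real CARD('n)"
  have n: "n \<ge> 1"
    unfolding n_def using zero_less_card_finite[where 'a = 'n] by linarith
  have "M \<noteq> 0"
    using tr by (auto simp: trace_def)
  then have D: "D > 0"
    unfolding D_def by (intro add_pos_nonneg) auto
  have mat: "(mat 1 :: real ^ 'n ^ 'n) \<bullet> mat 1 = n"
    using trace_eq_inner_mat[of "mat 1 :: real ^ 'n ^ 'n"] by (simp add: trace_def mat_def n_def)
  have "(norm ((g *\<^sub>R M, g *\<^sub>R v) - w0))\<^sup>2 = g\<^sup>2 * D - 2 * g * trace M + n"
  proof -
    have "(norm ((g *\<^sub>R M, g *\<^sub>R v) - w0))\<^sup>2 = (norm (g *\<^sub>R M - mat 1))\<^sup>2 + (norm (g *\<^sub>R v))\<^sup>2"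
      by (simp add: w0_def norm_Pair)
    also have "(norm (g *\<^sub>R M - mat 1))\<^sup>2 = g\<^sup>2 * (norm M)\<^sup>2 - 2 * g * trace M + n"
      unfolding power2_norm_eq_inner inner_diff_left inner_diff_right inner_scaleR_left inner_scaleR_right
        inner_commute[of "mat 1" M] mat trace_eq_inner_mat by (simp add: power2_eq_square algebra_simps)
    finally show ?thesis
      by (simp add: D_def power_mult_distrib distrib_left)
  qed
  \<comment> \<open>The value of the quadratic polynomial at its minimiser; the Cordes condition
    bounds the subtracted quotient below by n - 1 + \<delta>.\<close>
  also have "\<dots> = n - (trace M)\<^sup>2 / D"
    using D by (simp add: g flip: D_def) (simp add: power2_eq_square field_simps)
  also have "\<dots> \<le> 1 - \<delta>"
  proof -
    have "D / (trace M)\<^sup>2 \<le> 1 / (n - 1 + \<delta>)"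
      using cordes by (simp add: D_def n_def)
    then have "D * (n - 1 + \<delta>) \<le> (trace M)\<^sup>2"
      using tr n \<delta> by (simp add: field_simps)
    then have "n - 1 + \<delta> \<le> (trace M)\<^sup>2 / D"
      using D by (simp add: pos_le_divide_eq mult.commute)
    then show ?thesis
      by simp
  qed
  finally show ?thesis .
qed

text \<open>n / (n + pi^2) increases with n, so the worst case is n = 1. There 1 - \<delta> is below
  pi^2 / (1 + pi^2), and the product is below (4 pi^2 + 1) / (4 pi^2 + 4).\<close>

lemma cordes_constant:
  fixes n :: real
  assumes n: "n \<ge> 1" and \<delta>: "n / (n + pi\<^sup>2) < \<delta>"
  shows "(1 - \<delta>) * (1 + 1 / (4 * pi\<^sup>2)) < 1"
proof -
  have p: "pi\<^sup>2 > 0"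
    by simp
  have "1 / (1 + pi\<^sup>2) \<le> n / (n + pi\<^sup>2)"
    using n p by (simp add: divide_simps add_pos_pos) (simp add: algebra_simps)
  then have "1 - \<delta> < 1 - 1 / (1 + pi\<^sup>2)"
    using \<delta> by linarith
  then have "(1 - \<delta>) * (1 + 1 / (4 * pi\<^sup>2)) < (1 - 1 / (1 + pi\<^sup>2)) * (1 + 1 / (4 * pi\<^sup>2))"
    by (intro mult_strict_right_mono) (auto intro: add_pos_nonneg)
  also have "\<dots> = (4 * pi\<^sup>2 + 1) / (4 * (1 + pi\<^sup>2))"
  proof -
    have "(1 - 1 / (1 + q)) * (1 + 1 / (4 * q)) = (4 * q + 1) / (4 * (1 + q))" if "q > 0" for q :: real
    proof -
      have "1 - 1 / (1 + q) = q / (1 + q)" "1 + 1 / (4 * q) = (4 * q + 1) / (4 * q)"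
        using that by (simp_all add: field_simps)
      then show ?thesis
        using that by simp
    qed
    then show ?thesis
      using p by blast
  qed
  also have "\<dots> \<le> 1"
    using p by (subst divide_le_eq_1_pos) (auto intro: add_pos_pos)
  finally show ?thesis .
qed

lemma trace_measurable:
  "A \<in> borel_measurable M \<Longrightarrow> (\<lambda>x. trace (A x)) \<in> borel_measurable M" for A :: "'a \<Rightarrow> real ^ 'n ^ 'n"
  unfolding trace_eq_inner_mat by (intro borel_measurable_inner borel_measurable_const)

theorem theorem2p3:
  fixes A At :: "real ^ 'n \<Rightarrow> real ^ 'n ^ 'n"
    and b bt :: "real ^ 'n \<Rightarrow> real ^ 'n"
    and \<gamma> :: "real ^ 'n \<Rightarrow> real"
  assumes "(A, b) \<in> setting_B"
    and "\<gamma> = (\<lambda>x. trace (A x) / ((norm (A x))\<^sup>2 + (norm (b x))\<^sup>2))"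
    and "At = (\<lambda>x. \<gamma> x *\<^sub>R A x)"
    and "bt = (\<lambda>x. \<gamma> x *\<^sub>R b x)"
  shows
    "(\<forall>c. \<exists>\<psi>\<in>psi_solutions At bt c.
        \<forall>\<psi>'\<in>psi_solutions At bt c. AE x in lebesgue. \<psi>' x = \<psi> x) \<and>
     (\<forall>\<psi>\<^sub>1\<in>psi_solutions At bt 1.
        (\<forall>c. \<forall>\<psi>\<^sub>c\<in>psi_solutions At bt c. AE x in lebesgue. \<psi>\<^sub>c x = c * \<psi>\<^sub>1 x) \<and>
        (let r = (\<lambda>x. 1 - weak_laplacian \<psi>\<^sub>1 x) in
          r \<in> very_weak_solutions At bt \<and> (LINT x:cellY|lebesgue. r x) = 1 \<and>
          (\<forall>v\<in>very_weak_solutions At bt. (LINT x:cellY|lebesgue. v x) = 1 \<longrightarrow>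
             (AE x in lebesgue. v x = r x)) \<and>
          (AE x in lebesgue. r x \<ge> 0) \<and>
          very_weak_solutions A b = {u. \<exists>c. AE x in lebesgue. u x = c * \<gamma> x * r x}))"
proof -
  have A: "A \<in> borel_measurable lebesgue" "periodic_ae A" and b: "b \<in> borel_measurable lebesgue" "periodic_ae b"
    using assms(1) by (auto simp: setting_B_def Linf_per_def)
  obtain CA Cb where CA: "AE x in lebesgue. norm (A x) \<le> CA" and Cb: "AE x in lebesgue. norm (b x) \<le> Cb"
    using assms(1) by (auto simp: setting_B_def Linf_per_def)
  obtain l L where l: "l > 0" and ell: "AE x in lebesgue. \<forall>\<xi>.
        l * (\<xi> \<bullet> \<xi>) \<le> \<xi> \<bullet> (A x *v \<xi>) \<and> \<xi> \<bullet> (A x *v \<xi>) \<le> L * (\<xi> \<bullet> \<xi>)"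
    using assms(1) by (auto simp: setting_B_def)
  obtain \<delta> where \<delta>: "real CARD('n) / (real CARD('n) + pi\<^sup>2) < \<delta>" "\<delta> \<le> 1"
    and cord: "AE x in lebesgue. ((norm (A x))\<^sup>2 + (norm (b x))\<^sup>2) / (trace (A x))\<^sup>2 \<le> 1 / (real CARD('n) - 1 + \<delta>)"
    using assms(1) by (auto simp: setting_B_def)
  have n1: "real CARD('n) \<ge> 1"
    using zero_less_card_finite[where 'a = 'n] by linarith
  then have "0 < real CARD('n) / (real CARD('n) + pi\<^sup>2)"
    by (intro divide_pos_pos add_pos_nonneg) auto
  then have \<delta>0: "\<delta> > 0"
    using \<delta>(1) by linarith
  have diag: "AE x in lebesgue. \<forall>i. l \<le> A x $ i $ i"
    using ell by eventually_elim (auto intro: elliptic_diagonal)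
  have tr: "AE x in lebesgue. l \<le> trace (A x)"
    using ell
  proof eventually_elim
    case (elim x)
    then have "real CARD('n) * l \<le> trace (A x)"
      by (intro elliptic_trace) auto
    moreover have "1 * l \<le> real CARD('n) * l"
      using n1 l by (intro mult_right_mono) auto
    ultimately show ?case by simp
  qed
  have \<gamma>m: "\<gamma> \<in> borel_measurable lebesgue"
    unfolding assms(2) using A(1) b(1) trace_measurable[OF A(1)] by measurable
  have \<gamma>p: "periodic_ae \<gamma>"
    unfolding assms(2) using periodic_ae_comp2[OF A(2) b(2), of "\<lambda>M v. trace M / ((norm M)\<^sup>2 + (norm v)\<^sup>2)"] .
  have near: "AE x in lebesgue. norm ((At x, bt x) - w0) \<le> sqrt (1 - \<delta>)"
    using tr cord
  proof eventually_elim
    case (elim x)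
    have "(norm ((\<gamma> x *\<^sub>R A x, \<gamma> x *\<^sub>R b x) - w0))\<^sup>2 \<le> 1 - \<delta>"
      by (rule cordes_condition_near[OF _ _ elim(2) \<delta>0]) (use elim(1) l in \<open>auto simp: assms(2)\<close>)
    then show ?case
      unfolding assms(3,4) by (rule real_le_rsqrt)
  qed
  interpret cordes_pair At bt "sqrt (1 - \<delta>)"
  proof (intro cordes_pair.intro cordes.intro)
    show "(\<lambda>x. (At x, bt x)) \<in> borel_measurable lebesgue"
      unfolding assms(3,4) using \<gamma>m A(1) b(1) by (intro borel_measurable_Pair borel_measurable_scaleR)
    show "periodic_ae (\<lambda>x. (At x, bt x))"
      unfolding assms(3,4) by (intro periodic_ae_comp2[of _ _ Pair] periodic_ae_comp2[of _ _ "(*\<^sub>R)"] \<gamma>p A b)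
    show "(sqrt (1 - \<delta>))\<^sup>2 * (1 + 1 / (4 * pi\<^sup>2)) < 1"
      using cordes_constant[OF n1 \<delta>(1)] \<delta>(2) by simp
  qed (use near \<delta>(2) in auto)
  \<comment> \<open>The coefficients are bounded and the trace is at least l, so 1/\<gamma> is
    bounded; this keeps u / \<gamma> square-integrable.\<close>
  have \<gamma>_pos: "AE x in lebesgue. \<gamma> x > 0 \<and> \<bar>1 / \<gamma> x\<bar> \<le> (CA\<^sup>2 + Cb\<^sup>2) / l"
    using tr CA Cb
  proof eventually_elim
    case (elim x)
    define D where "D = (norm (A x))\<^sup>2 + (norm (b x))\<^sup>2"
    have t: "trace (A x) > 0"
      using elim(1) l by linarith
    then have "A x \<noteq> 0"
      by (auto simp: trace_def)
    then have D: "D > 0"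
      unfolding D_def by (intro add_pos_nonneg) auto
    have g: "\<gamma> x = trace (A x) / D"
      by (simp add: assms(2) D_def)
    have "D \<le> CA\<^sup>2 + Cb\<^sup>2"
      unfolding D_def using elim(2,3) by (intro add_mono power_mono) auto
    then have "D / trace (A x) \<le> (CA\<^sup>2 + Cb\<^sup>2) / l"
      using elim(1) l D t by (intro frac_le) auto
    with D t show ?case
      by (simp add: g)
  qed
  \<comment> \<open>One diagonal entry suffices: \<open>At\<close> stays close to the identity, so
    its entries are bounded, while the corresponding entry of A is at least l. Here
    \<open>undefined\<close> stands for an arbitrary index.\<close>
  have \<gamma>_bd: "AE x in lebesgue. \<bar>\<gamma> x\<bar> \<le> (norm (w0 :: 'n coeff) + sqrt (1 - \<delta>)) / l"
    using \<gamma>_pos diag w_components(5)[of undefined undefined]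
  proof eventually_elim
    case (elim x)
    have "\<gamma> x * l \<le> \<gamma> x * A x $ undefined $ undefined"
      using elim by (intro mult_left_mono) auto
    also have "\<dots> \<le> norm (w0 :: 'n coeff) + sqrt (1 - \<delta>)"
      using elim(3) by (simp add: assms(3) abs_le_iff)
    finally show ?case
      using elim(1) l by (simp add: pos_le_divide_eq)
  qed
  have op: "nondiv_op At bt \<phi> x = \<gamma> x * nondiv_op A b \<phi> x" for \<phi> x
    by (simp add: nondiv_op_def assms(3,4) distrib_left)
  \<comment> \<open>Division by \<gamma> turns solutions for (A, b) into solutions for the
    renormalised pair, where uniqueness up to a factor is known; multiplication by \<gamma> goes
    back.\<close>
  have vws: "very_weak_solutions A b = {u. \<exists>c. AE x in lebesgue. u x = c * \<gamma> x * r x}" if r: "inv_density w r" for r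
  proof (intro equalityI subsetI)
    fix u assume u: "u \<in> very_weak_solutions A b"
    define v where "v x = (1 / \<gamma> x) * u x" for x
    have uL: "u \<in> L2p" and u0: "\<And>\<phi>. \<phi> \<in> H_per 2 \<Longrightarrow> (LINT x:cellY|lebesgue. u x * nondiv_op A b \<phi> x) = 0"
      using u by (auto simp: very_weak_solutions_def L2_per_eq)
    have vL: "v \<in> L2p"
      unfolding v_def
    proof (rule L2p_mult_bounded[OF uL])
      show "(\<lambda>x. 1 / \<gamma> x) \<in> borel_measurable lebesgue"
        using \<gamma>m by measurable
      show "periodic_ae (\<lambda>x. 1 / \<gamma> x)"
        by (rule periodic_ae_comp[OF \<gamma>p])
      show "AE x in lebesgue. \<bar>1 / \<gamma> x\<bar> \<le> (CA\<^sup>2 + Cb\<^sup>2) / l"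
        using \<gamma>_pos by eventually_elim blast
    qed
    have uv: "AE x in lebesgue. u x = \<gamma> x * v x"
      using \<gamma>_pos by eventually_elim (simp add: v_def)
    have "v \<in> very_weak_solutions At bt"
      unfolding very_weak_solutions_def
    proof (intro CollectI conjI ballI)
      show "v \<in> L2_per"
        using vL by (simp add: L2_per_eq)
      fix \<phi> :: "real ^ 'n \<Rightarrow> real" assume \<phi>: "\<phi> \<in> H_per 2"
      have e: "AE x in lebesgue. indicator cellY x *\<^sub>R (v x * nondiv_op At bt \<phi> x) = indicator cellY x *\<^sub>R (u x * nondiv_op A b \<phi> x)"
        using uv by eventually_elim (simp add: op)
      have m: "(\<lambda>x. indicator cellY x *\<^sub>R (v x * nondiv_op At bt \<phi> x)) \<in> borel_measurable lebesgue"
        by (intro borel_measurable_scaleR borel_measurable_indicator cellY_sets borel_measurable_times L2pD(1)[OF vL] nondiv_op_measurable[OF \<phi>])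
      have "(LINT x:cellY|lebesgue. v x * nondiv_op At bt \<phi> x) = (LINT x:cellY|lebesgue. u x * nondiv_op A b \<phi> x)"
        unfolding set_lebesgue_integral_def
        by (rule integral_cong_AE[OF m borel_measurable_cong_AE_lebesgue[OF m e] e])
      then show "(LINT x:cellY|lebesgue. v x * nondiv_op At bt \<phi> x) = 0"
        using u0[OF \<phi>] by simp
    qed
    from very_weak_solution_unique[OF this r]
    have "AE x in lebesgue. v x = (LINT x|Q. v x) * r x" .
    then have "AE x in lebesgue. u x = (LINT x|Q. v x) * \<gamma> x * r x"
      using uv by eventually_elim simp
    then show "u \<in> {u. \<exists>c. AE x in lebesgue. u x = c * \<gamma> x * r x}"
      by blast
  next
    fix u assume "u \<in> {u. \<exists>c. AE x in lebesgue. u x = c * \<gamma> x * r x}"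
    then obtain c where c: "AE x in lebesgue. u x = c * \<gamma> x * r x"
      by blast
    note rD = inv_densityD[OF r]
    have "(\<lambda>x. c * (\<gamma> x * r x)) \<in> L2p"
      by (intro L2p_cmult L2p_mult_bounded[OF rD(1) \<gamma>m \<gamma>p \<gamma>_bd])
    then have uL: "u \<in> L2p"
      by (rule L2p_cong_AE) (use c in eventually_elim, simp)
    show "u \<in> very_weak_solutions A b"
      unfolding very_weak_solutions_def
    proof (intro CollectI conjI ballI)
      show "u \<in> L2_per"
        using uL by (simp add: L2_per_eq)
      fix \<phi> :: "real ^ 'n \<Rightarrow> real" assume \<phi>: "\<phi> \<in> H_per 2"
      have e: "AE x in lebesgue. indicator cellY x *\<^sub>R (c * (r x * nondiv_op At bt \<phi> x)) = indicator cellY x *\<^sub>R (u x * nondiv_op A b \<phi> x)"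
        using c by eventually_elim (simp add: op)
      have m: "(\<lambda>x. indicator cellY x *\<^sub>R (c * (r x * nondiv_op At bt \<phi> x))) \<in> borel_measurable lebesgue"
        by (intro borel_measurable_scaleR borel_measurable_indicator cellY_sets borel_measurable_times borel_measurable_const
            L2pD(1)[OF rD(1)] nondiv_op_measurable[OF \<phi>])
      have "(LINT x:cellY|lebesgue. u x * nondiv_op A b \<phi> x) = (LINT x:cellY|lebesgue. c * (r x * nondiv_op At bt \<phi> x))"
        unfolding set_lebesgue_integral_def
        by (rule integral_cong_AE[OF m borel_measurable_cong_AE_lebesgue[OF m e] e, symmetric])
      also have "\<dots> = c * (LINT x|Q. r x * Tw w (weak_laplacian \<phi>) x)"
        by (simp add: set_lebesgue_integral_Q integral_nondiv_op[OF rD(1) \<phi>])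
      also have "\<dots> = 0"
        using rD(3)[OF weak_laplacian_L2p(1)[OF \<phi>]] by simp
      finally show "(LINT x:cellY|lebesgue. u x * nondiv_op A b \<phi> x) = 0" .
    qed
  qed
  show ?thesis
    unfolding Let_def
  proof (intro conjI allI ballI impI)
    fix c
    obtain \<psi> \<psi>1 where \<psi>: "\<psi> \<in> psi_solutions At bt c" and \<psi>1: "\<psi>1 \<in> psi_solutions At bt 1"
      using psi_solution_exists by blast
    \<comment> \<open>Both solutions equal c times one and the same solution for 1.\<close>
    have "AE x in lebesgue. \<psi>' x = \<psi> x" if "\<psi>' \<in> psi_solutions At bt c" for \<psi>'
      using psi_solution_unique[OF \<psi> \<psi>1] psi_solution_unique[OF that \<psi>1] by eventually_elim simp
    with \<psi> show "\<exists>\<psi>\<in>psi_solutions At bt c. \<forall>\<psi>'\<in>psi_solutions At bt c. AE x in lebesgue. \<psi>' x = \<psi> x"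
      by blast
  next
    fix \<psi>1 c \<psi>c
    assume "\<psi>1 \<in> psi_solutions At bt 1" "\<psi>c \<in> psi_solutions At bt c"
    then show "AE x in lebesgue. \<psi>c x = c * \<psi>1 x"
      by (intro psi_solution_unique)
  next
    fix \<psi>1 assume "\<psi>1 \<in> psi_solutions At bt 1"
    then have r: "inv_density w (\<lambda>x. 1 - weak_laplacian \<psi>1 x)"
      by (rule inv_density_psi)
    note rD = inv_densityD[OF r]
    show "(\<lambda>x. 1 - weak_laplacian \<psi>1 x) \<in> very_weak_solutions At bt"
      unfolding very_weak_solutions_iff using rD(1,3) L0D(1) by blast
    show "(LINT x:cellY|lebesgue. 1 - weak_laplacian \<psi>1 x) = 1"
      unfolding set_lebesgue_integral_Q by (rule rD(2))
    show "AE x in lebesgue. 0 \<le> 1 - weak_laplacian \<psi>1 x"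
      by (rule inv_density_nonneg[OF r])
    show "very_weak_solutions A b = {u. \<exists>c. AE x in lebesgue. u x = c * \<gamma> x * (1 - weak_laplacian \<psi>1 x)}"
      by (rule vws[OF r])
    fix v assume "v \<in> very_weak_solutions At bt" "(LINT x:cellY|lebesgue. v x) = 1"
    then show "AE x in lebesgue. v x = 1 - weak_laplacian \<psi>1 x"
      using very_weak_solution_unique[OF _ r, of v] by (simp add: set_lebesgue_integral_Q)
  qed
qed

end
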